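(* Let $d\ge 1$. For any $\mu\ge 0$ there exist constants $c_1,c_2,c_3,c_4>0$ such that for all $x,y\in\mathbb{B}^d$ and all $t>0$ $$ \frac{c_1\exp\{-\frac{d_{\mathbb{B}}(x,y)^2}{c_2t}\}}{\big[V_{\mathbb{B}}(x,\sqrt t)\,V_{\mathbb{B}}(y,\sqrt t)\big]^{1/2}} \le e^{t\mathcal{D}_\mu}(x,y) \le \frac{c_3\exp\{-\frac{d_{\mathbb{B}}(x,y)^2}{c_4t}\}}{\big[V_{\mathbb{B}}(x,\sqrt t)\,V_{\mathbb{B}}(y,\sqrt t)\big]^{1/2}}. $$
   Context: $\langle x,y\rangle$ is the Euclidean inner product on $\mathbb{R}^d$, $\|x\|=\sqrt{\langle x,x\rangle}$, and $\mathbb{B}^d=\{x\in\mathbb{R}^d:\|x\|<1\}$. All functions are real-valued. Measure: $d\nu_\mu(x)=w_\mu(x)\,dx$ with $w_\mu(x)=(1-\|x\|^2)^{\mu-1/2}$ on $\mathbb{B}^d$, $\mu\ge 0$. Distance: $d_{\mathbb{B}}(x,y)=\arccos\big(\langle x,y\rangle+\sqrt{1-\|x\|^2}\sqrt{1-\|y\|^2}\big)$. Balls and volumes: $B_{\mathbb{B}}(x,r)=\{y\in\mathbb{B}^d:d_{\mathbb{B}}(x,y)<r\}$ and $V_{\mathbb{B}}(x,r)=\nu_\mu(B_{\mathbb{B}}(x,r))$. Operator: $$\mathcal{D}_\mu=\sum_{i=1}^d(1-x_i^2)\partial_i^2-2\sum_{1\le i<j\le d}x_ix_j\partial_i\partial_j-(d+2\mu)\sum_{i=1}^d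 x_i\partial_i .$$ For $n\ge 1$, $\mathcal{V}_n(w_\mu)$ is the space of algebraic polynomials of degree $n$ in $d$ variables that are orthogonal in $L^2(\mathbb{B}^d,w_\mu)$ to all polynomials of lower degree (together with $0$), and $\mathcal{V}_0(w_\mu)$ is the space of constants. These are eigenspaces of $\mathcal{D}_\mu$: $\mathcal{D}_\mu P=-n(n+d+2\mu-1)P$ for $P\in\mathcal{V}_n(w_\mu)$. Let $P_n(w_\mu;x,y)$ be the kernel (with respect to the measure $\nu_\mu$) of the orthogonal projector of $L^2(\mathbb{B}^d,w_\mu)$ onto $\mathcal{V}_n(w_\mu)$, i.e. $P_n(w_\mu;x,y)=\sum_j P_{nj}(x)P_{nj}(y)$ for any orthonormal basis $\{P_{nj}\}_j$ of $\mathcal{V}_n(w_\mu)$. Heat kernel: the semigroup $e^{t\mathcal{D}_\mu}$, $t>0$, generated by $\mathcal{D}_\mu$ has kernel $$e^{t\mathcal{D}_\mu}(x,y)=\sum_{n=0}^\infty e^{-tn(n+2\lambda)}P_n(w_\mu;x,y),\qquad \lambda=\mu+\tfrac{d-1}{2}.$$ The constants $c_1,\dots,c_4$ may depend on $d$ and $\mu$, but not on $x,y,t$. *)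

theory Defs
  imports "HOL-Analysis.Analysis"
begin

text \<open>The space \<open>\<real>\<^sup>d\<close> is \<^typ>\<open>real ^ 'n\<close> with \<open>d = CARD('n)\<close>, and the open unit ball is \<open>ball 0 1\<close>.\<close>

definition ball_weight :: "real \<Rightarrow> real ^ 'n \<Rightarrow> real" where
  "ball_weight \<mu> x = (1 - (norm x)\<^sup>2) powr (\<mu> - 1/2)"

text \<open>A measure on all of \<^typ>\<open>real ^ 'n\<close> that vanishes off the open unit ball; finite for \<open>\<mu> > -1/2\<close>.\<close>

definition ball_measure :: "real \<Rightarrow> (real ^ 'n) measure" where
  "ball_measure \<mu> = density lborel (\<lambda>x. ennreal (indicator (ball 0 1) x * ball_weight \<mu> x))"

definition ball_dist :: "real ^ 'n \<Rightarrow> real ^ 'n \<Rightarrow> real" where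
  "ball_dist x y = arccos (x \<bullet> y + sqrt (1 - (norm x)\<^sup>2) * sqrt (1 - (norm y)\<^sup>2))"

definition dist_ball :: "real ^ 'n \<Rightarrow> real \<Rightarrow> (real ^ 'n) set" where
  "dist_ball x r = {y \<in> ball 0 1. ball_dist x y < r}"

definition ball_volume :: "real \<Rightarrow> real ^ 'n \<Rightarrow> real \<Rightarrow> real" where
  "ball_volume \<mu> x r = measure (ball_measure \<mu>) (dist_ball x r)"

definition weighted_inner :: "real \<Rightarrow> (real ^ 'n \<Rightarrow> real) \<Rightarrow> (real ^ 'n \<Rightarrow> real) \<Rightarrow> real" where
  "weighted_inner \<mu> f g = (LINT x|ball_measure \<mu>. f x * g x)"

text \<open>Polynomials in \<open>d\<close> variables of total degree at most \<open>n\<close>, as functions on \<open>\<real>\<^sup>d\<close>;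
  a multi-index is a function \<open>'n \<Rightarrow> nat\<close>.\<close>

definition polys_le :: "nat \<Rightarrow> (real ^ 'n \<Rightarrow> real) set" where
  "polys_le n = {P. \<exists>c :: ('n \<Rightarrow> nat) \<Rightarrow> real.
     P = (\<lambda>x. \<Sum>\<alpha> | (\<Sum>i\<in>UNIV. \<alpha> i) \<le> n. c \<alpha> * (\<Prod>i\<in>UNIV. (x $ i) ^ \<alpha> i))}"

definition orth_polys :: "real \<Rightarrow> nat \<Rightarrow> (real ^ 'n \<Rightarrow> real) set" where
  "orth_polys \<mu> n =
     (if n = 0 then range (\<lambda>c x. c)
      else insert (\<lambda>x. 0)
        {P \<in> polys_le n - polys_le (n - 1). \<forall>Q\<in>polys_le (n - 1). weighted_inner \<mu> P Q = 0})"

definition orthonormal_basis ::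
    "real \<Rightarrow> (real ^ 'n \<Rightarrow> real) set \<Rightarrow> (real ^ 'n \<Rightarrow> real) set \<Rightarrow> bool" where
  "orthonormal_basis \<mu> V B \<longleftrightarrow>
     finite B \<and> B \<subseteq> V \<and>
     (\<forall>P\<in>B. \<forall>Q\<in>B. weighted_inner \<mu> P Q = (if P = Q then 1 else 0)) \<and>
     (\<forall>P\<in>V. \<exists>c. P = (\<lambda>x. \<Sum>Q\<in>B. c Q * Q x))"

text \<open>The kernel of the orthogonal projector onto the \<open>n\<close>-th space of orthogonal polynomials.
  The sum does not depend on the orthonormal basis chosen.\<close>

definition proj_kernel :: "real \<Rightarrow> nat \<Rightarrow> real ^ 'n \<Rightarrow> real ^ 'n \<Rightarrow> real" where
  "proj_kernel \<mu> n x y =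
     (\<Sum>P\<in>(SOME B. orthonormal_basis \<mu> (orth_polys \<mu> n) B). P x * P y)"

text \<open>The kernel of the semigroup \<open>exp (t D)\<close> generated by
  \<open>D = (\<Sum>i. (1 - x\<^sub>i\<^sup>2) \<partial>\<^sub>i\<^sup>2) - 2 (\<Sum>i<j. x\<^sub>i x\<^sub>j \<partial>\<^sub>i \<partial>\<^sub>j) - (d + 2 \<mu>) (\<Sum>i. x\<^sub>i \<partial>\<^sub>i)\<close>,
  given pointwise by its spectral expansion: \<open>D\<close> acts on \<^term>\<open>orth_polys \<mu> n\<close> as multiplication
  by \<open>- n (n + 2 l)\<close>, where \<open>l = \<mu> + (d - 1) / 2\<close>.\<close>

definition heat_kernel :: "real \<Rightarrow> real \<Rightarrow> real ^ 'n \<Rightarrow> real ^ 'n \<Rightarrow> real" where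
  "heat_kernel \<mu> t x y =
     (let l = \<mu> + (real CARD('n) - 1) / 2
      in \<Sum>n. exp (- t * real n * (real n + 2 * l)) * proj_kernel \<mu> n x y)"

end

theory Submission
  imports Defs "HOL-Real_Asymp.Real_Asymp" "HOL-Computational_Algebra.Polynomial"
begin

text \<open>The kernel of \<open>exp (t D)\<close> is compared with a heat flow in one variable, for which explicit
  functions of Gaussian type are super- and subsolutions. Write \<open>m = l + 1/2\<close>,
  \<open>\<rho> x = sqrt (1 - |x|\<^sup>2)\<close> (\<open>bdepth\<close>), and \<open>d x y\<close> for the distance.

  Reduction to one variable. A function \<open>f\<close> on \<open>[-1, 1]\<close> has a zonal lift to the ball: the average
  of \<open>f (x \<bullet> y + u * \<rho> x * \<rho> y)\<close> over \<open>u\<close> with probability density proportional to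
  \<open>(1 - u\<^sup>2) powr (\<mu> - 1)\<close>, and over \<open>u = 1\<close> and \<open>u = -1\<close> if \<open>\<mu> = 0\<close>. Applied in \<open>x\<close> to the lift
  of a polynomial \<open>f\<close>, the operator \<open>D\<close> becomes the Gegenbauer operator
  \<open>L f = (1 - z\<^sup>2) f'' - (2 l + 1) z f'\<close> (\<open>ball_op_zonal_poly\<close>). The lift preserves inequalities,
  so bounds for the flow of \<open>L\<close> carry over to the ball.

  Bounds in one variable. The flow of \<open>L\<close> starts from the polynomial \<open>((1 + z) / 2) ^ k\<close>, which
  concentrates at \<open>z = 1\<close>. A minimum principle compares it with a supersolution built on
  \<open>exp (- (1 - z) / (2 s))\<close> (\<open>heat_flow_upper\<close>), and with a subsolution that is elementary in the
  variable \<open>sqrt ((1 + z) / 2)\<close> (\<open>heat_flow_lower\<close>). When these are lifted, the average of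
  \<open>exp (- b (1 - u))\<close> over \<open>u\<close> is comparable to \<open>(1 + b) powr (-\<mu>)\<close> (\<open>gegenbauer_laplace_upper\<close>,
  \<open>gegenbauer_laplace_lower\<close>). For small \<open>t\<close> the lifted flow thus lies, up to terms that vanish as
  \<open>k\<close> grows, between multiples of
  \<open>t powr (-m) * (1 + \<rho> x * \<rho> y / t) powr (-\<mu>) * exp (- c * (1 - cos (d x y)) / t)\<close>, with a
  constant \<open>c\<close> for each side.

  Identification of the limit. Divided by their mass, the lifts of \<open>((1 + z) / 2) ^ k\<close> form an
  approximate identity on the ball, so the spectral coefficients of the lifted flow converge to
  those of the heat kernel. The uniform bound on the flow, by Parseval's identity, also bounds the
  projection kernels (\<open>proj_kernel_bound\<close>) and thereby dominates the series. Hence the flows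
  converge to the heat kernel (\<open>flow_tendsto\<close>), which inherits the bounds and has total mass one.

  Volumes. They are read off from the kernel. Its lower bound near \<open>x\<close> and its mass bound the
  volume of the ball from above. Its upper bound shows that half of the mass lies in a ball of
  radius a multiple of \<open>sqrt t\<close>, which bounds the volume from below. For \<open>t \<le> 1\<close> the volume of the
  ball of radius \<open>sqrt t\<close> turns out to be of order
  \<open>t powr (CARD('n) / 2) * (sqrt t + \<rho> x) powr (2 * \<mu>)\<close> (\<open>volume_upper\<close>, \<open>volume_lower\<close>).

  Conclusion. \<open>1 - cos (d x y)\<close> is comparable to \<open>(d x y)\<^sup>2\<close>, and \<open>t + \<rho> x * \<rho> y\<close> to
  \<open>(sqrt t + \<rho> x) * (sqrt t + \<rho> y)\<close> up to a factor \<open>1 + (1 - cos (d x y)) / t\<close>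
  (\<open>depth_comparison\<close>), which the Gaussian absorbs; this gives the theorem for \<open>t \<le> 1\<close>. For
  \<open>t \<ge> 1\<close> the minimum principle keeps the kernel between the positive constants that bound it at
  \<open>t = 1\<close> (\<open>heat_kernel_long_time\<close>), and the volumes and the Gaussian factor lie between positive
  constants as well.\<close>

section \<open>Integration by parts for the Jacobi weight\<close>

text \<open>The exponent is shifted so that the measure is finite for \<open>a > 0\<close>. Two instances occur
  below: the measure of the theorem on \<open>real ^ 'n\<close>, where \<open>a = \<mu> + 1/2\<close>, and Gegenbauer weights on
  the real line, where \<open>a\<close> is \<open>\<mu>\<close> or \<open>l + 1/2\<close>.\<close>

definition jacobi_measure :: "real \<Rightarrow> 'a::euclidean_space measure" where
  "jacobi_measure a = density lborel (\<lambda>x. ennreal (indicator (ball 0 1) x * (1 - (norm x)\<^sup>2) powr (a - 1)))"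

lemma ball_in_sets_borel [measurable]: "ball (x::'a::metric_space) r \<in> sets borel"
  by simp

lemma continuous_bounded_on_cball:
  fixes f :: "'a::euclidean_space \<Rightarrow> real"
  assumes "continuous_on UNIV f"
  obtains B where "\<And>x. norm x \<le> r \<Longrightarrow> \<bar>f x\<bar> \<le> B"
proof -
  have "compact (f ` cball 0 r)"
    using assms by (intro compact_continuous_image) (auto intro: continuous_on_subset)
  then obtain B where "\<And>y. y \<in> f ` cball 0 r \<Longrightarrow> norm y \<le> B" by (meson compact_imp_bounded bounded_iff)
  then show thesis by (intro that[of B]) auto
qed

lemma powr_max_Lipschitz:
  fixes a \<epsilon> :: real
  assumes "0 < a" "0 < \<epsilon>" "\<epsilon> < 1"
  obtains L where "L \<ge> 0"
    "\<And>s t. s \<le> 1 \<Longrightarrow> t \<le> 1 \<Longrightarrow> \<bar>max s \<epsilon> powr a - max t \<epsilon> powr a\<bar> \<le> L * \<bar>s - t\<bar>"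
proof -
  define L where "L = a * max 1 (\<epsilon> powr (a - 1))"
  have d: "\<bar>s powr a - t powr a\<bar> \<le> L * \<bar>s - t\<bar>" if "s \<in> {\<epsilon>..1}" "t \<in> {\<epsilon>..1}" for s t
  proof -
    have "norm (s powr a - t powr a) \<le> L * norm (s - t)"
    proof (rule field_differentiable_bound[of "{\<epsilon>..1}" "\<lambda>x. x powr a" "\<lambda>x. a * x powr (a - 1)"])
      fix z assume z: "z \<in> {\<epsilon>..1}"
      show "((\<lambda>x. x powr a) has_field_derivative a * z powr (a - 1)) (at z within {\<epsilon>..1})"
        using z assms by (intro has_field_derivative_at_within[OF has_real_derivative_powr]) auto
      have "z powr (a - 1) \<le> max 1 (\<epsilon> powr (a - 1))"
      proof (cases "a \<ge> 1")
        case True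
        then have "z powr (a - 1) \<le> 1 powr (a - 1)"
          using z assms by (intro powr_mono2) auto
        then show ?thesis by simp
      next
        case False
        then have "z powr (a - 1) \<le> \<epsilon> powr (a - 1)"
          using z assms by (intro powr_mono2') auto
        then show ?thesis by simp
      qed
      then show "norm (a * z powr (a - 1)) \<le> L"
        using assms by (simp add: L_def mult_left_mono)
    qed (use that in auto)
    then show ?thesis by simp
  qed
  show thesis
  proof
    show "L \<ge> 0" using assms by (simp add: L_def)
    fix s t :: real assume "s \<le> 1" "t \<le> 1"
    then have "\<bar>max s \<epsilon> powr a - max t \<epsilon> powr a\<bar> \<le> L * \<bar>max s \<epsilon> - max t \<epsilon>\<bar>"
      using assms by (intro d) auto
    also have "\<dots> \<le> L * \<bar>s - t\<bar>"
      using \<open>L \<ge> 0\<close> by (intro mult_left_mono) auto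
    finally show "\<bar>max s \<epsilon> powr a - max t \<epsilon> powr a\<bar> \<le> L * \<bar>s - t\<bar>" .
  qed
qed

lemma lborel_integral_translate:
  fixes W :: "'a::euclidean_space \<Rightarrow> real"
  assumes "W \<in> borel_measurable borel"
  shows "(\<integral>x. W (x + v) \<partial>lborel) = (\<integral>x. W x \<partial>lborel)"
proof -
  have "(\<integral>x. W x \<partial>lborel) = (\<integral>x. W x \<partial>(distr lborel borel ((+) v)))"
    by (simp add: lborel_distr_plus)
  also have "\<dots> = (\<integral>x. W (v + x) \<partial>lborel)"
    using assms by (subst integral_distr) auto
  finally show ?thesis by (simp add: add.commute)
qed

text \<open>By translation invariance every difference quotient of \<open>W\<close> in the direction \<open>e\<close> has integral
  zero. The Lipschitz bound dominates these quotients, so the integral of their limit vanishes as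
  well. Differentiability almost everywhere suffices, which leaves room for the kink of the
  truncated weight in the next lemma.\<close>

lemma integral_directional_derivative_zero:
  fixes W :: "'a::euclidean_space \<Rightarrow> real"
  assumes W: "W \<in> borel_measurable borel"
    and supp: "\<And>x. norm x \<ge> R \<Longrightarrow> W x = 0"
    and lip: "\<And>x h. 0 < h \<Longrightarrow> h \<le> 1 \<Longrightarrow> norm x \<le> R + 1 \<Longrightarrow> \<bar>W (x + h *\<^sub>R e) - W x\<bar> \<le> M * h"
    and e: "norm e = 1"
    and bd: "\<And>x. \<bar>W x\<bar> \<le> B"
    and der: "AE x in lborel. ((\<lambda>h. W (x + h *\<^sub>R e)) has_real_derivative W' x) (at 0)"
    and W': "W' \<in> borel_measurable borel"
  shows "(\<integral>x. W' x \<partial>lborel) = 0"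
proof -
  define S where "S j x = (W (x + (1 / Suc j) *\<^sub>R e) - W x) * Suc j" for j :: nat and x
  have intc: "integrable lborel (\<lambda>x::'a. B * indicator (cball 0 R) x :: real)" for B R
    using emeasure_bounded_finite[OF bounded_cball, of "0::'a" R] by (intro integrable_mult_right integrable_real_indicator) auto
  have intW: "integrable lborel W"
  proof (rule Bochner_Integration.integrable_bound[OF intc[of B R]])
    show "AE x in lborel. norm (W x) \<le> norm (B * indicator (cball 0 R) x)"
    proof (intro AE_I2)
      fix x show "norm (W x) \<le> norm (B * indicator (cball 0 R) x)"
        using supp[of x] bd[of x] by (cases "norm x \<le> R") (auto simp: indicator_def)
    qed
  qed (use W in simp)
  have intS: "(\<integral>x. S j x \<partial>lborel) = 0" for j
  proof -
    define v where "v = (1 / Suc j) *\<^sub>R e"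
    have 1: "integrable lborel (\<lambda>x. W (x + v))"
    proof -
      have "integrable (distr lborel borel ((+) v)) W" using intW by (simp add: lborel_distr_plus)
      then have "integrable lborel (\<lambda>x. W (v + x))"
        using W by (subst (asm) integrable_distr_eq) auto
      then show ?thesis by (simp add: add.commute)
    qed
    have "(\<integral>x. S j x \<partial>lborel) = (\<integral>x. (W (x + v) - W x) \<partial>lborel) * Suc j"
      unfolding S_def v_def by simp
    also have "(\<integral>x. (W (x + v) - W x) \<partial>lborel) = 0"
      using 1 intW lborel_integral_translate[OF W, of v] by simp
    finally show ?thesis by simp
  qed
  have "(\<lambda>j. \<integral>x. S j x \<partial>lborel) \<longlonglongrightarrow> (\<integral>x. W' x \<partial>lborel)"
  proof (rule integral_dominated_convergence[where w = "\<lambda>x. \<bar>M\<bar> * indicator (cball 0 (R+1)) x"])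
    show "AE x in lborel. (\<lambda>j. S j x) \<longlonglongrightarrow> W' x"
      using der
    proof eventually_elim
      case (elim x)
      then have *: "((\<lambda>h. (W (x + h *\<^sub>R e) - W x) / h) \<longlongrightarrow> W' x) (at 0)"
        by (simp add: DERIV_def)
      have "filterlim (\<lambda>j. 1 / real (Suc j)) (at 0) sequentially"
        using LIMSEQ_inverse_real_of_nat by (intro filterlim_atI) (auto simp: inverse_eq_divide)
      from filterlim_compose[OF * this]
      show ?case by (simp add: S_def field_simps)
    qed
    show "AE x in lborel. norm (S j x) \<le> \<bar>M\<bar> * indicator (cball 0 (R+1)) x" for j
    proof (rule AE_I2)
      fix x
      show "norm (S j x) \<le> \<bar>M\<bar> * indicator (cball 0 (R+1)) x"
      proof (cases "norm x \<le> R + 1")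
        case True
        have "\<bar>W (x + (1 / Suc j) *\<^sub>R e) - W x\<bar> \<le> M * (1 / Suc j)"
          using True by (intro lip) auto
        then have "\<bar>S j x\<bar> \<le> M * (1 / Suc j) * Suc j"
          unfolding S_def abs_mult abs_of_nat by (rule mult_right_mono) simp
        also have "\<dots> = M" by simp
        also have "\<dots> \<le> \<bar>M\<bar>" by simp
        finally show ?thesis using True by simp
      next
        case False
        have "norm x \<le> norm (x + (1 / Suc j) *\<^sub>R e) + norm ((1 / Suc j) *\<^sub>R e)"
          by (metis add_diff_cancel_right' norm_triangle_ineq4)
        also have "norm ((1 / Suc j) *\<^sub>R e) \<le> 1" using e by simp
        finally show ?thesis using False supp[of x] supp[of "x + (1 / Suc j) *\<^sub>R e"]
          by (simp add: S_def)
      qed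
    qed
    show "S j \<in> borel_measurable lborel" for j
      using W unfolding S_def by measurable
    show "W' \<in> borel_measurable lborel" using W' by simp
    show "integrable lborel (\<lambda>x::'a. \<bar>M\<bar> * indicator (cball 0 (R+1)) x :: real)" by (rule intc)
  qed
  then show ?thesis using intS by (simp add: LIMSEQ_const_iff)
qed

text \<open>For \<open>a < 1\<close> the function \<open>(1 - |x|\<^sup>2)\<^sup>a\<close> is not Lipschitz at the unit sphere. Its truncation
  at height \<open>\<epsilon>\<close>, lowered by \<open>\<epsilon>\<^sup>a\<close>, is Lipschitz, vanishes outside the ball, and has a kink only on
  the null set \<open>|x|\<^sup>2 = 1 - \<epsilon>\<close>. The formula says that the directional derivative of its product
  with \<open>F\<close> has integral zero.\<close>

lemma integral_by_parts_truncated: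
  fixes F :: "'a::euclidean_space \<Rightarrow> real"
  assumes a: "0 < a" and \<epsilon>: "0 < \<epsilon>" "\<epsilon> < 1" and e: "norm e = 1"
    and F: "\<And>x. (F has_derivative F' x) (at x)"
    and F': "continuous_on UNIV (\<lambda>x. F' x e)"
  shows "integrable lborel (\<lambda>x. (max (1 - (norm x)\<^sup>2) \<epsilon> powr a - \<epsilon> powr a) * F' x e)" (is "integrable _ ?L")
    and "integrable lborel (\<lambda>x. if 1 - (norm x)\<^sup>2 > \<epsilon> then 2 * a * (1 - (norm x)\<^sup>2) powr (a - 1) * (x \<bullet> e) * F x else 0)"
      (is "integrable _ ?R")
    and "(\<integral>x. (max (1 - (norm x)\<^sup>2) \<epsilon> powr a - \<epsilon> powr a) * F' x e \<partial>lborel)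
      = (\<integral>x. (if 1 - (norm x)\<^sup>2 > \<epsilon> then 2 * a * (1 - (norm x)\<^sup>2) powr (a - 1) * (x \<bullet> e) * F x else 0) \<partial>lborel)"
proof -
  define r where "r x = 1 - (norm x)\<^sup>2" for x :: 'a
  define \<phi> where "\<phi> x = max (r x) \<epsilon> powr a - \<epsilon> powr a" for x
  define W where "W x = \<phi> x * F x" for x
  define W' where "W' x = \<phi> x * F' x e - (if r x > \<epsilon> then 2 * a * r x powr (a - 1) * (x \<bullet> e) * F x else 0)" for x
  have Fc: "continuous_on UNIV F"
    using F by (meson continuous_at_imp_continuous_on has_derivative_continuous)
  have [measurable]: "F \<in> borel_measurable borel" "(\<lambda>x. F' x e) \<in> borel_measurable borel"
    using Fc F' by (auto intro: borel_measurable_continuous_onI)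
  have [measurable]: "r \<in> borel_measurable borel" unfolding r_def by measurable
  have [measurable]: "\<phi> \<in> borel_measurable borel" unfolding \<phi>_def by measurable
  obtain BF where BF: "\<And>x. norm x \<le> 3 \<Longrightarrow> \<bar>F x\<bar> \<le> BF"
    using continuous_bounded_on_cball[OF Fc] by blast
  obtain BF' where BF': "\<And>x. norm x \<le> 3 \<Longrightarrow> \<bar>F' x e\<bar> \<le> BF'"
    using continuous_bounded_on_cball[OF F'] by blast
  have BF0: "0 \<le> BF" using BF[of 0] by auto
  have BF'0: "0 \<le> BF'" using BF'[of 0] by auto
  obtain L where L: "L \<ge> 0" "\<And>s t. s \<le> 1 \<Longrightarrow> t \<le> 1 \<Longrightarrow> \<bar>max s \<epsilon> powr a - max t \<epsilon> powr a\<bar> \<le> L * \<bar>s - t\<bar>"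
    using powr_max_Lipschitz[OF a \<epsilon>] by metis
  have r1: "r x \<le> 1" for x by (simp add: r_def)
  have \<phi>0: "\<phi> x = 0" if "norm x \<ge> 1" for x
  proof -
    have "r x \<le> \<epsilon>" using that \<epsilon> one_le_power[of "norm x" 2] unfolding r_def by linarith
    then show ?thesis by (simp add: \<phi>_def max_absorb2)
  qed
  have \<phi>b: "0 \<le> \<phi> x" "\<phi> x \<le> 1" for x
  proof -
    show "0 \<le> \<phi> x" using a \<epsilon> by (simp add: \<phi>_def powr_mono2)
    have "max (r x) \<epsilon> powr a \<le> 1 powr a" using a \<epsilon> r1[of x] by (intro powr_mono2) auto
    also have "\<dots> = 1" by simp
    finally show "\<phi> x \<le> 1" using powr_ge_zero[of \<epsilon> a] unfolding \<phi>_def by linarith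
  qed
  have rh: "r (x + h *\<^sub>R e) = r x - 2 * h * (x \<bullet> e) - h\<^sup>2" for x h
  proof -
    have "e \<bullet> e = 1" using e by (simp add: norm_eq_1)
    then show ?thesis unfolding r_def power2_norm_eq_inner
      by (simp add: inner_add inner_commute power2_eq_square algebra_simps)
  qed
  have dF: "((\<lambda>h. F (x + h *\<^sub>R e)) has_real_derivative F' (x + h *\<^sub>R e) e) (at h)" for x h
  proof -
    have "(F has_derivative F' (x + h *\<^sub>R e)) (at (x + h *\<^sub>R e))" by (rule F)
    then have "((\<lambda>h. F (x + h *\<^sub>R e)) has_derivative (\<lambda>k. F' (x + h *\<^sub>R e) (k *\<^sub>R e))) (at h)"
      by (rule has_derivative_compose[rotated]) (auto intro!: derivative_eq_intros)
    moreover have "F' (x + h *\<^sub>R e) (k *\<^sub>R e) = F' (x + h *\<^sub>R e) e * k" for k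
      using F[THEN has_derivative_linear, THEN linear_cmul] by (simp add: mult.commute)
    ultimately show ?thesis by (simp add: has_field_derivative_def)
  qed
  have lip\<phi>: "\<bar>\<phi> (x + h *\<^sub>R e) - \<phi> x\<bar> \<le> 5 * L * h" if "norm x \<le> 2" "0 < h" "h \<le> 1" for x h
  proof -
    have "\<bar>x \<bullet> e\<bar> \<le> norm x * norm e" by (rule Cauchy_Schwarz_ineq2)
    then have xe: "\<bar>x \<bullet> e\<bar> \<le> 2" using e that by simp
    have "\<bar>\<phi> (x + h *\<^sub>R e) - \<phi> x\<bar> \<le> L * \<bar>r (x + h *\<^sub>R e) - r x\<bar>"
      using L(2)[OF r1 r1, of "x + h *\<^sub>R e" x] by (simp add: \<phi>_def)
    also have "\<bar>r (x + h *\<^sub>R e) - r x\<bar> = h * \<bar>2 * (x \<bullet> e) + h\<bar>"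
    proof -
      have "r (x + h *\<^sub>R e) - r x = - (h * (2 * (x \<bullet> e) + h))" by (simp add: rh power2_eq_square algebra_simps)
      then show ?thesis using that by (simp add: abs_mult)
    qed
    also have "L * \<dots> \<le> L * (h * 5)"
      using that xe L by (intro mult_left_mono) auto
    finally show ?thesis by (simp add: mult_ac)
  qed
  have lipF: "\<bar>F (x + h *\<^sub>R e) - F x\<bar> \<le> BF' * h" if "norm x \<le> 2" "0 < h" "h \<le> 1" for x h
  proof -
    have "norm (F (x + h *\<^sub>R e) - F (x + 0 *\<^sub>R e)) \<le> BF' * norm (h - 0)"
    proof (rule field_differentiable_bound[of "{0..h}" "\<lambda>h. F (x + h *\<^sub>R e)" "\<lambda>h. F' (x + h *\<^sub>R e) e"])
      fix z assume z: "z \<in> {0..h}"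
      show "((\<lambda>h. F (x + h *\<^sub>R e)) has_field_derivative F' (x + z *\<^sub>R e) e) (at z within {0..h})"
        using dF by (rule has_field_derivative_at_within)
      have "norm (x + z *\<^sub>R e) \<le> norm x + norm (z *\<^sub>R e)" by (rule norm_triangle_ineq)
      then show "norm (F' (x + z *\<^sub>R e) e) \<le> BF'" using z that e by (auto intro!: BF')
    qed (use that in auto)
    then show ?thesis using that by simp
  qed
  have lipW: "\<bar>W (x + h *\<^sub>R e) - W x\<bar> \<le> (5 * L * BF + BF') * h" if "0 < h" "h \<le> 1" "norm x \<le> 1 + 1" for x h
  proof -
    have nx: "norm (x + h *\<^sub>R e) \<le> 3" using norm_triangle_ineq[of x "h *\<^sub>R e"] that e by simp
    have "W (x + h *\<^sub>R e) - W x = (\<phi> (x + h *\<^sub>R e) - \<phi> x) * F (x + h *\<^sub>R e) + \<phi> x * (F (x + h *\<^sub>R e) - F x)"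
      by (simp add: W_def algebra_simps)
    also have "\<bar>\<dots>\<bar> \<le> \<bar>\<phi> (x + h *\<^sub>R e) - \<phi> x\<bar> * \<bar>F (x + h *\<^sub>R e)\<bar> + \<bar>\<phi> x\<bar> * \<bar>F (x + h *\<^sub>R e) - F x\<bar>"
      by (metis abs_mult abs_triangle_ineq)
    also have "\<dots> \<le> (5 * L * h) * BF + 1 * (BF' * h)"
      using that nx \<phi>b[of x] lip\<phi>[of x h] lipF[of x h] BF[of "x + h *\<^sub>R e"] BF0 BF'0 L
      by (intro add_mono mult_mono) auto
    finally show ?thesis by (simp add: algebra_simps)
  qed
  have "{x. r x = \<epsilon>} \<subseteq> sphere 0 (sqrt (1 - \<epsilon>))"
    using \<epsilon> by (auto simp: r_def)
  then have "negligible {x. r x = \<epsilon>}"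
    using negligible_sphere negligible_subset by blast
  then have "{x. r x = \<epsilon>} \<in> null_sets lborel"
    by (auto simp: negligible_iff_null_sets null_sets_completion_iff)
  then have AEr: "AE x in lborel. r x \<noteq> \<epsilon>"
    by (rule AE_I') auto
  have zero: "(\<integral>x. W' x \<partial>lborel) = 0"
  proof (rule integral_directional_derivative_zero[where W = W and R = 1 and e = e and M = "5 * L * BF + BF'" and B = BF])
    show "W \<in> borel_measurable borel" unfolding W_def by measurable
    show "W' \<in> borel_measurable borel" unfolding W'_def by measurable
    show "\<And>x. 1 \<le> norm x \<Longrightarrow> W x = 0" using \<phi>0 by (simp add: W_def)
    show "\<bar>W x\<bar> \<le> BF" for x
    proof (cases "norm x \<ge> 1")
      case True then show ?thesis using \<phi>0 BF0 by (simp add: W_def)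
    next
      case False
      have "\<bar>W x\<bar> \<le> 1 * BF" unfolding W_def abs_mult
        using False \<phi>b[of x] BF[of x] by (intro mult_mono) auto
      then show ?thesis by simp
    qed
    show "AE x in lborel. ((\<lambda>h. W (x + h *\<^sub>R e)) has_real_derivative W' x) (at 0)"
      using AEr
    proof eventually_elim
      case (elim x)
      have dF0: "((\<lambda>h. F (x + h *\<^sub>R e)) has_real_derivative F' x e) (at 0)"
        using dF[of x 0] by simp
      have dr: "((\<lambda>h. r (x + h *\<^sub>R e)) has_real_derivative - 2 * (x \<bullet> e)) (at 0)"
        unfolding rh by (auto intro!: derivative_eq_intros)
      have rc: "isCont (\<lambda>h. r (x + h *\<^sub>R e)) 0"
        using dr by (rule DERIV_isCont)
      then have rn: "((\<lambda>h. r (x + h *\<^sub>R e)) \<longlongrightarrow> r x) (nhds 0)"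
        using tendsto_at_iff_tendsto_nhds[of "\<lambda>h. r (x + h *\<^sub>R e)" 0] by (simp add: isCont_def)
      show ?case
      proof (cases "r x > \<epsilon>")
        case True
        have "\<forall>\<^sub>F h in nhds 0. r (x + h *\<^sub>R e) > \<epsilon>"
          by (rule order_tendstoD(1)[OF rn True])
        then have ev: "\<forall>\<^sub>F h in nhds 0. (r (x + h *\<^sub>R e) powr a - \<epsilon> powr a) * F (x + h *\<^sub>R e) = W (x + h *\<^sub>R e)"
          by eventually_elim (simp add: W_def \<phi>_def)
        have "((\<lambda>h. r (x + h *\<^sub>R e) powr a) has_real_derivative (a * r x powr (a - 1)) * (- 2 * (x \<bullet> e))) (at 0)"
          using DERIV_fun_powr[OF dr, of a] True \<epsilon> by simp
        then have "((\<lambda>h. (r (x + h *\<^sub>R e) powr a - \<epsilon> powr a) * F (x + h *\<^sub>R e)) has_real_derivative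
            ((a * r x powr (a - 1)) * (- 2 * (x \<bullet> e)) - 0) * F (x + 0 *\<^sub>R e) + F' x e * (r (x + 0 *\<^sub>R e) powr a - \<epsilon> powr a)) (at 0)"
          by (intro DERIV_mult DERIV_diff DERIV_const dF0)
        moreover have "((a * r x powr (a - 1)) * (- 2 * (x \<bullet> e)) - 0) * F (x + 0 *\<^sub>R e) + F' x e * (r (x + 0 *\<^sub>R e) powr a - \<epsilon> powr a) = W' x"
          using True by (simp add: W'_def \<phi>_def algebra_simps)
        ultimately show ?thesis using DERIV_cong_ev[OF refl ev refl] by simp
      next
        case False
        then have lt: "r x < \<epsilon>" using elim by simp
        have "\<forall>\<^sub>F h in nhds 0. r (x + h *\<^sub>R e) < \<epsilon>"
          by (rule order_tendstoD(2)[OF rn lt])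
        then have ev: "\<forall>\<^sub>F h in nhds 0. 0 = W (x + h *\<^sub>R e)"
          by eventually_elim (simp add: W_def \<phi>_def)
        have "W' x = 0" using lt by (simp add: W'_def \<phi>_def)
        then show ?thesis using iffD1[OF DERIV_cong_ev[OF refl ev refl] DERIV_const] by simp
      qed
    qed
  qed (use lipW e in auto)
  have intc: "integrable lborel (\<lambda>x::'a. B * indicator (cball 0 1) x :: real)" for B
    using emeasure_bounded_finite[OF bounded_cball, of "0::'a" 1] by (intro integrable_mult_right integrable_real_indicator) auto
  have iL: "integrable lborel (\<lambda>x. \<phi> x * F' x e)"
  proof (rule Bochner_Integration.integrable_bound[OF intc[of BF']])
    show "AE x in lborel. norm (\<phi> x * F' x e) \<le> norm (BF' * indicator (cball 0 1) x)"
    proof (intro AE_I2)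
      fix x show "norm (\<phi> x * F' x e) \<le> norm (BF' * indicator (cball 0 1) x)"
      proof (cases "norm x \<le> 1")
        case True
        have "\<bar>\<phi> x * F' x e\<bar> \<le> 1 * BF'" unfolding abs_mult
          using True \<phi>b[of x] BF'[of x] by (intro mult_mono) auto
        then show ?thesis using True BF'0 by simp
      qed (simp add: \<phi>0)
    qed
  qed measurable
  have iR: "integrable lborel (\<lambda>x. if r x > \<epsilon> then 2 * a * r x powr (a - 1) * (x \<bullet> e) * F x else 0)"
  proof (rule Bochner_Integration.integrable_bound[OF intc[of "2 * a * max 1 (\<epsilon> powr (a-1)) * BF"]])
    show "AE x in lborel. norm (if r x > \<epsilon> then 2 * a * r x powr (a - 1) * (x \<bullet> e) * F x else 0)
        \<le> norm (2 * a * max 1 (\<epsilon> powr (a-1)) * BF * indicator (cball 0 1) x)"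
    proof (intro AE_I2)
      fix x show "norm (if r x > \<epsilon> then 2 * a * r x powr (a - 1) * (x \<bullet> e) * F x else 0)
        \<le> norm (2 * a * max 1 (\<epsilon> powr (a-1)) * BF * indicator (cball 0 1) x)"
      proof (cases "r x > \<epsilon>")
        case True
        then have "(norm x)\<^sup>2 \<le> 1\<^sup>2" using \<epsilon> by (simp add: r_def)
        then have n1: "norm x \<le> 1" using power2_le_imp_le zero_le_one by blast
        have "\<bar>x \<bullet> e\<bar> \<le> norm x * norm e" by (rule Cauchy_Schwarz_ineq2)
        then have xe: "\<bar>x \<bullet> e\<bar> \<le> 1" using e n1 by simp
        have "r x powr (a - 1) \<le> max 1 (\<epsilon> powr (a - 1))"
        proof (cases "a \<ge> 1")
          case True
          then have "r x powr (a - 1) \<le> 1 powr (a - 1)"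
            using \<open>r x > \<epsilon>\<close> r1[of x] \<epsilon> by (intro powr_mono2) auto
          then show ?thesis by simp
        next
          case False
          then have "r x powr (a - 1) \<le> \<epsilon> powr (a - 1)"
            using \<open>r x > \<epsilon>\<close> \<epsilon> by (intro powr_mono2') auto
          then show ?thesis by simp
        qed
        then have "\<bar>2 * a * r x powr (a - 1) * (x \<bullet> e) * F x\<bar> \<le> 2 * a * max 1 (\<epsilon> powr (a-1)) * 1 * BF"
          unfolding abs_mult using a xe n1 BF[of x] by (intro mult_mono) auto
        then show ?thesis using True n1 a BF0 by (simp add: abs_mult)
      qed auto
    qed
  qed measurable
  show "integrable lborel ?L" using iL unfolding \<phi>_def r_def .
  show "integrable lborel ?R" using iR unfolding r_def .
  show "(\<integral>x. ?L x \<partial>lborel) = (\<integral>x. ?R x \<partial>lborel)"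
    using zero iL iR unfolding W'_def unfolding \<phi>_def r_def by simp
qed

lemma has_derivative_inner_self:
  fixes e :: "'a::euclidean_space"
  shows "((\<lambda>x. x \<bullet> e) has_derivative (\<lambda>h. h \<bullet> e)) (at x)"
  by (intro bounded_linear_imp_has_derivative bounded_linear_inner_left)

text \<open>Truncated integration by parts with \<open>F x = x \<bullet> e\<close>, summed over an orthonormal basis, bounds
  the integral of \<open>2 a (1 - |x|\<^sup>2) powr (a - 1) |x|\<^sup>2\<close> over \<open>1 - |x|\<^sup>2 > \<epsilon>\<close> by the dimension times
  the volume of the ball. The bound does not depend on \<open>\<epsilon>\<close>, so monotone convergence gives
  integrability of this function, which controls the weight wherever \<open>|x|\<^sup>2 \<ge> 1/2\<close>.\<close>

lemma integrable_jacobi_weight: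
  assumes a: "0 < a"
  shows "integrable lborel (\<lambda>x::'a::euclidean_space. indicator (ball 0 1) x * (1 - (norm x)\<^sup>2) powr (a - 1))"
proof -
  define r where "r x = 1 - (norm x)\<^sup>2" for x :: 'a
  have [measurable]: "r \<in> borel_measurable borel" unfolding r_def by measurable
  define vol where "vol = measure lborel (ball (0::'a) 1)"
  define G where "G \<epsilon> x = (if r x > \<epsilon> then 2 * a * r x powr (a - 1) * (norm x)\<^sup>2 else 0)" for \<epsilon> x
  have rb: "norm x < 1" if "r x > 0" for x
    using that power2_less_imp_less[of "norm x" 1] by (simp add: r_def)
  have rb': "r x > 0" if "norm x < 1" for x
    using that by (simp add: r_def power_less_one_iff abs_square_less_1)
  have ib: "integrable lborel (\<lambda>x::'a. B * indicator (ball 0 1) x :: real)" for B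
    using emeasure_bounded_finite[OF bounded_ball, of "0::'a" 1] by (intro integrable_mult_right integrable_real_indicator) auto
  have key: "integrable lborel (G \<epsilon>) \<and> (\<integral>x. G \<epsilon> x \<partial>lborel) \<le> DIM('a) * vol" if \<epsilon>: "0 < \<epsilon>" "\<epsilon> < 1" for \<epsilon>
  proof -
    define R where "R e x = (if 1 - (norm x)\<^sup>2 > \<epsilon> then 2 * a * (1 - (norm x)\<^sup>2) powr (a - 1) * (x \<bullet> e) * (x \<bullet> e) else 0)" for e x :: 'a
    have c: "continuous_on UNIV (\<lambda>x::'a. e \<bullet> e)" for e :: 'a by simp
    have e: "e \<in> Basis \<Longrightarrow> norm e = 1" for e :: 'a by simp
    note ibp = integral_by_parts_truncated[OF a \<epsilon> e has_derivative_inner_self c]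
    have G: "G \<epsilon> = (\<lambda>x. \<Sum>e\<in>Basis. R e x)"
    proof
      fix x :: 'a
      have "(\<Sum>e\<in>Basis. (x \<bullet> e) * (x \<bullet> e)) = (norm x)\<^sup>2"
        unfolding power2_norm_eq_inner by (rule euclidean_inner[symmetric])
      then have "(\<Sum>e\<in>Basis. 2 * a * (1 - (norm x)\<^sup>2) powr (a - 1) * (x \<bullet> e) * (x \<bullet> e)) = 2 * a * (1 - (norm x)\<^sup>2) powr (a - 1) * (norm x)\<^sup>2"
        by (simp only: sum_distrib_left[symmetric] mult.assoc)
      then show "G \<epsilon> x = (\<Sum>e\<in>Basis. R e x)"
        by (simp add: G_def R_def r_def)
    qed
    have iR: "integrable lborel (R e)" if "e \<in> Basis" for e
      using ibp(2)[OF that] unfolding R_def by simp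
    have 1: "(\<integral>x. R e x \<partial>lborel) \<le> vol" if eB: "e \<in> Basis" for e
    proof -
      have "(\<integral>x. R e x \<partial>lborel) = (\<integral>x. (max (1 - (norm (x::'a))\<^sup>2) \<epsilon> powr a - \<epsilon> powr a) * (e \<bullet> e) \<partial>lborel)"
        unfolding R_def using ibp(3)[OF eB] by (rule sym)
      also have "\<dots> \<le> (\<integral>x. 1 * indicator (ball 0 1) (x::'a) \<partial>lborel)"
      proof (rule Bochner_Integration.integral_mono)
        show "integrable lborel (\<lambda>x::'a. (max (1 - (norm x)\<^sup>2) \<epsilon> powr a - \<epsilon> powr a) * (e \<bullet> e))"
          by (rule ibp(1)[OF eB])
        fix x :: 'a
        have "max (1 - (norm x)\<^sup>2) \<epsilon> powr a \<le> 1 powr a"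
          using a \<epsilon> by (intro powr_mono2) auto
        also have "\<dots> = 1" by simp
        finally have 2: "max (1 - (norm x)\<^sup>2) \<epsilon> powr a - \<epsilon> powr a \<le> 1"
          using powr_ge_zero[of \<epsilon> a] by linarith
        show "(max (1 - (norm x)\<^sup>2) \<epsilon> powr a - \<epsilon> powr a) * (e \<bullet> e) \<le> 1 * indicator (ball 0 1) x"
        proof (cases "norm x < 1")
          case True
          then show ?thesis using 2 eB by (simp add: inner_Basis)
        next
          case False
          then have "r x \<le> 0" using rb by force
          then have "max (1 - (norm x)\<^sup>2) \<epsilon> = \<epsilon>" using \<epsilon> by (simp add: r_def)
          then show ?thesis using False by simp
        qed
      qed (use ib[of 1] in simp)
      also have "\<dots> = vol" by (simp add: vol_def)
      finally show ?thesis .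
    qed
    have "(\<integral>x. G \<epsilon> x \<partial>lborel) = (\<Sum>e\<in>Basis. \<integral>x. R e x \<partial>lborel)"
      unfolding G using iR by (rule Bochner_Integration.integral_sum)
    also have "\<dots> \<le> DIM('a) * vol"
      using 1 by (rule sum_bounded_above)
    finally show ?thesis unfolding G using iR by auto
  qed
  define \<epsilon> where "\<epsilon> j = 1 / (real j + 2)" for j
  have \<epsilon>: "0 < \<epsilon> j" "\<epsilon> j < 1" for j by (auto simp: \<epsilon>_def)
  have iH: "integrable lborel (\<lambda>x. if r x > 0 then 2 * a * r x powr (a - 1) * (norm x)\<^sup>2 else 0)"
  proof -
    define H where "H x = (if r x > 0 then 2 * a * r x powr (a - 1) * (norm x)\<^sup>2 else 0)" for x
    have "(\<lambda>j. \<integral>\<^sup>+x. ennreal (G (\<epsilon> j) x) \<partial>lborel) \<longlonglongrightarrow> (\<integral>\<^sup>+x. ennreal (H x) \<partial>lborel)"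
    proof (rule nn_integral_LIMSEQ)
      show "incseq (\<lambda>j x. ennreal (G (\<epsilon> j) x))"
      proof (intro incseq_SucI le_funI ennreal_leI)
        fix j x
        have "\<epsilon> (Suc j) \<le> \<epsilon> j" by (simp add: \<epsilon>_def field_simps)
        then show "G (\<epsilon> j) x \<le> G (\<epsilon> (Suc j)) x"
          using a by (auto simp: G_def)
      qed
      fix x
      show "(\<lambda>j. ennreal (G (\<epsilon> j) x)) \<longlonglongrightarrow> ennreal (H x)"
      proof (rule tendsto_ennrealI, cases "r x > 0")
        case True
        have "\<epsilon> \<longlonglongrightarrow> 0" unfolding \<epsilon>_def by real_asymp
        then have "\<forall>\<^sub>F j in sequentially. \<epsilon> j < r x" using True by (rule order_tendstoD(2))
        then have "\<forall>\<^sub>F j in sequentially. G (\<epsilon> j) x = H x"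
          by (rule eventually_mono) (use True in \<open>simp add: G_def H_def\<close>)
        then show "(\<lambda>j. G (\<epsilon> j) x) \<longlonglongrightarrow> H x" by (rule tendsto_eventually)
      next
        case False
        then have "G (\<epsilon> j) x = H x" for j
          using \<epsilon>(1)[of j] by (simp add: G_def H_def)
        then show "(\<lambda>j. G (\<epsilon> j) x) \<longlonglongrightarrow> H x" by simp
      qed
    qed (simp add: G_def)
    moreover have "(\<integral>\<^sup>+x. ennreal (G (\<epsilon> j) x) \<partial>lborel) \<le> ennreal (DIM('a) * vol)" for j
    proof -
      have "(\<integral>\<^sup>+x. ennreal (G (\<epsilon> j) x) \<partial>lborel) = ennreal (\<integral>x. G (\<epsilon> j) x \<partial>lborel)"
        using key[OF \<epsilon>] a by (intro nn_integral_eq_integral AE_I2) (auto, simp add: G_def)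
      then show ?thesis using key[OF \<epsilon>] by (simp add: ennreal_leI)
    qed
    ultimately have "(\<integral>\<^sup>+x. ennreal (H x) \<partial>lborel) \<le> ennreal (DIM('a) * vol)"
      by (intro LIMSEQ_le_const2) auto
    then have "(\<integral>\<^sup>+x. ennreal (H x) \<partial>lborel) < \<infinity>" by (simp add: order_le_less_trans)
    moreover have "H \<in> borel_measurable lborel" unfolding H_def by measurable
    moreover have "H x \<ge> 0" for x using a by (simp add: H_def)
    ultimately have "integrable lborel H" by (intro integrableI_nonneg) auto
    then show ?thesis unfolding H_def .
  qed
  show ?thesis
  proof (rule Bochner_Integration.integrable_bound)
    \<comment> \<open>The first summand dominates the weight on \<open>|x|\<^sup>2 \<ge> 1/2\<close>, the second one on \<open>|x|\<^sup>2 < 1/2\<close>.\<close>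
    show "integrable lborel (\<lambda>x. (if r x > 0 then 2 * a * r x powr (a - 1) * (norm x)\<^sup>2 else 0) * (1 / a) + (max 1 ((1/2) powr (a - 1))) * indicator (ball 0 1) x)"
      by (intro Bochner_Integration.integrable_add integrable_mult_left iH ib)
    show "AE x::'a in lborel. norm (indicator (ball 0 1) x * (1 - (norm x)\<^sup>2) powr (a - 1))
       \<le> norm ((if r x > 0 then 2 * a * r x powr (a - 1) * (norm x)\<^sup>2 else 0) * (1 / a) + (max 1 ((1/2) powr (a - 1))) * indicator (ball 0 1) x)"
    proof (intro AE_I2)
      fix x :: 'a
      show "norm (indicator (ball 0 1) x * (1 - (norm x)\<^sup>2) powr (a - 1))
       \<le> norm ((if r x > 0 then 2 * a * r x powr (a - 1) * (norm x)\<^sup>2 else 0) * (1 / a) + (max 1 ((1/2) powr (a - 1))) * indicator (ball 0 1) x)"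
      proof (cases "norm x < 1")
        case True
        then have r0: "r x > 0" by (rule rb')
        have "r x powr (a - 1) \<le> 2 * r x powr (a - 1) * (norm x)\<^sup>2 + max 1 ((1/2) powr (a - 1))"
        proof (cases "(norm x)\<^sup>2 \<ge> 1/2")
          case True
          have "r x powr (a - 1) * 1 \<le> r x powr (a - 1) * (2 * (norm x)\<^sup>2)"
            using True by (intro mult_left_mono) auto
          then show ?thesis by (simp add: mult_ac)
        next
          case False
          then have r2: "r x \<ge> 1/2" "r x \<le> 1" by (auto simp: r_def)
          have "r x powr (a - 1) \<le> max 1 ((1/2) powr (a - 1))"
          proof (cases "a \<ge> 1")
            case True
            then have "r x powr (a - 1) \<le> 1 powr (a - 1)" using r2 by (intro powr_mono2) auto
            then show ?thesis by simp
          next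
            case False
            then have "r x powr (a - 1) \<le> (1/2) powr (a - 1)" using r2 by (intro powr_mono2') auto
            then show ?thesis by simp
          qed
          then show ?thesis by (simp add: add_increasing)
        qed
        then show ?thesis using True r0 a by (simp add: r_def[symmetric])
      qed (simp add: rb)
    qed
  qed measurable
qed

lemma finite_measure_jacobi:
  assumes "0 < a" shows "finite_measure (jacobi_measure a)"
proof
  have "emeasure (jacobi_measure a) (space (jacobi_measure a :: 'a measure)) =
     (\<integral>\<^sup>+x. ennreal (indicator (ball 0 1) (x::'a) * (1 - (norm x)\<^sup>2) powr (a - 1)) \<partial>lborel)"
    unfolding jacobi_measure_def by (subst emeasure_density) auto
  also have "\<dots> = ennreal (\<integral>x. indicator (ball 0 1) (x::'a) * (1 - (norm x)\<^sup>2) powr (a - 1) \<partial>lborel)"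
    by (intro nn_integral_eq_integral integrable_jacobi_weight assms) auto
  finally show "emeasure (jacobi_measure a) (space (jacobi_measure a :: 'a measure)) \<noteq> \<infinity>" by simp
qed

lemma AE_jacobi_ball: "AE x in jacobi_measure a. norm x < 1"
  unfolding jacobi_measure_def by (subst AE_density) (auto simp: indicator_def)

lemma sets_jacobi [measurable_cong, simp]: "sets (jacobi_measure a) = sets borel"
  by (simp add: jacobi_measure_def)

lemma space_jacobi [simp]: "space (jacobi_measure a) = UNIV"
  by (simp add: jacobi_measure_def)

lemma integrable_jacobi_continuous:
  fixes f :: "'a::euclidean_space \<Rightarrow> real"
  assumes a: "0 < a" and f: "continuous_on UNIV f"
  shows "integrable (jacobi_measure a) f"
proof -
  interpret finite_measure "jacobi_measure a :: 'a measure" by (rule finite_measure_jacobi[OF a])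
  obtain B where B: "\<And>x. norm x \<le> 1 \<Longrightarrow> \<bar>f x\<bar> \<le> B"
    using continuous_bounded_on_cball[OF f] by blast
  show ?thesis
  proof (rule integrable_const_bound[where B = B])
    show "AE x in jacobi_measure a. norm (f x) \<le> B"
      using AE_jacobi_ball[of a] by eventually_elim (simp add: B)
    show "f \<in> borel_measurable (jacobi_measure a)"
      using borel_measurable_continuous_onI[OF f] by (simp add: measurable_cong_sets[OF sets_jacobi refl])
  qed
qed

lemma jacobi_integral_eq:
  fixes f :: "'a::euclidean_space \<Rightarrow> real"
  assumes "f \<in> borel_measurable borel"
  shows "(\<integral>x. f x \<partial>jacobi_measure a) = (\<integral>x. (indicator (ball 0 1) x * (1 - (norm x)\<^sup>2) powr (a - 1)) * f x \<partial>lborel)"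
  unfolding jacobi_measure_def using assms by (subst integral_density) (auto simp: indicator_def)

lemma integrable_jacobi_weight_mult:
  fixes f :: "'a::euclidean_space \<Rightarrow> real"
  assumes a: "0 < a" and f: "continuous_on UNIV f"
  shows "integrable lborel (\<lambda>x. (indicator (ball 0 1) x * (1 - (norm x)\<^sup>2) powr (a - 1)) * f x)"
  using integrable_jacobi_continuous[OF a f] borel_measurable_continuous_onI[OF f]
  unfolding jacobi_measure_def by (subst (asm) integrable_density) auto

text \<open>The limit \<open>\<epsilon> \<rightarrow> 0\<close> of the truncated formula. On both sides the integrand for the weight
  without truncation is a dominating function.\<close>

lemma jacobi_integral_by_parts:
  fixes F :: "'a::euclidean_space \<Rightarrow> real"
  assumes a: "0 < a" and e: "norm e = 1"
    and F: "\<And>x. (F has_derivative F' x) (at x)"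
    and F': "continuous_on UNIV (\<lambda>x. F' x e)"
  shows "(\<integral>x. (1 - (norm x)\<^sup>2) * F' x e \<partial>jacobi_measure a) = 2 * a * (\<integral>x. (x \<bullet> e) * F x \<partial>jacobi_measure a)"
proof -
  define r where "r x = 1 - (norm x)\<^sup>2" for x :: 'a
  have [measurable]: "r \<in> borel_measurable borel" unfolding r_def by measurable
  have rb: "norm x < 1" if "r x > 0" for x
    using that power2_less_imp_less[of "norm x" 1] by (simp add: r_def)
  have rb': "r x > 0" if "norm x < 1" for x
    using that by (simp add: r_def power_less_one_iff abs_square_less_1)
  have Fc: "continuous_on UNIV F"
    using F by (meson continuous_at_imp_continuous_on has_derivative_continuous)
  have [measurable]: "F \<in> borel_measurable borel" "(\<lambda>x. F' x e) \<in> borel_measurable borel"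
    using Fc F' by (auto intro: borel_measurable_continuous_onI)
  define w where "w x = indicator (ball 0 1) x * r x powr (a - 1)" for x
  have [measurable]: "w \<in> borel_measurable borel" unfolding w_def by measurable
  have iw: "integrable lborel (\<lambda>x. w x * f x)" if "continuous_on UNIV f" for f :: "'a \<Rightarrow> real"
    unfolding w_def r_def using a that by (rule integrable_jacobi_weight_mult)
  define \<epsilon> where "\<epsilon> j = 1 / (real j + 2)" for j
  have \<epsilon>: "0 < \<epsilon> j" "\<epsilon> j < 1" for j by (auto simp: \<epsilon>_def)
  have \<epsilon>l: "\<epsilon> \<longlonglongrightarrow> 0" unfolding \<epsilon>_def by real_asymp
  define L where "L j x = (max (r x) (\<epsilon> j) powr a - \<epsilon> j powr a) * F' x e" for j x
  define R where "R j x = (if r x > \<epsilon> j then 2 * a * r x powr (a - 1) * (x \<bullet> e) * F x else 0)" for j x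
  have eq: "(\<integral>x. L j x \<partial>lborel) = (\<integral>x. R j x \<partial>lborel)" for j
    using integral_by_parts_truncated(3)[OF a \<epsilon> e F F'] unfolding L_def R_def r_def .
  have "(\<lambda>j. \<integral>x. R j x \<partial>lborel) \<longlonglongrightarrow> (\<integral>x. w x * (2 * a * ((x \<bullet> e) * F x)) \<partial>lborel)"
  proof (rule integral_dominated_convergence)
    show "integrable lborel (\<lambda>x. norm (w x * (2 * a * ((x \<bullet> e) * F x))))"
      by (intro integrable_norm iw continuous_intros Fc)
    show "AE x in lborel. (\<lambda>j. R j x) \<longlonglongrightarrow> w x * (2 * a * ((x \<bullet> e) * F x))"
    proof (rule AE_I2)
      fix x
      show "(\<lambda>j. R j x) \<longlonglongrightarrow> w x * (2 * a * ((x \<bullet> e) * F x))"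
      proof (cases "r x > 0")
        case True
        then have "\<forall>\<^sub>F j in sequentially. \<epsilon> j < r x" using \<epsilon>l by (rule order_tendstoD(2)[rotated])
        then have "\<forall>\<^sub>F j in sequentially. R j x = w x * (2 * a * ((x \<bullet> e) * F x))"
          by (rule eventually_mono) (use rb[OF True] True in \<open>simp add: R_def w_def\<close>)
        then show ?thesis by (rule tendsto_eventually)
      next
        case False
        then have "R j x = w x * (2 * a * ((x \<bullet> e) * F x))" for j
          using \<epsilon>(1)[of j] rb'[of x] by (auto simp: R_def w_def indicator_def)
        then show ?thesis by simp
      qed
    qed
    show "AE x in lborel. norm (R j x) \<le> norm (w x * (2 * a * ((x \<bullet> e) * F x)))" for j
      using \<epsilon>(1)[of j] rb by (intro AE_I2) (auto simp: R_def w_def abs_mult indicator_def)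
    show "(\<lambda>x. w x * (2 * a * ((x \<bullet> e) * F x))) \<in> borel_measurable lborel" by measurable
    show "R j \<in> borel_measurable lborel" for j unfolding R_def by measurable
  qed
  moreover have "(\<lambda>j. \<integral>x. L j x \<partial>lborel) \<longlonglongrightarrow> (\<integral>x. w x * (r x * F' x e) \<partial>lborel)"
  proof (rule integral_dominated_convergence)
    have wr: "w x * r x = (if r x > 0 then r x powr a else 0)" for x
      using rb[of x] rb'[of x] powr_mult_base[of "r x" "a - 1"] by (auto simp: w_def mult.commute indicator_def)
    show "integrable lborel (\<lambda>x. norm (w x * (r x * F' x e)))"
      unfolding r_def by (intro integrable_norm iw continuous_intros F')
    show "AE x in lborel. (\<lambda>j. L j x) \<longlonglongrightarrow> w x * (r x * F' x e)"
    proof (rule AE_I2)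
      fix x
      have "(\<lambda>j. L j x) \<longlonglongrightarrow> (max (r x) 0 powr a - 0) * F' x e"
        unfolding L_def using a \<epsilon> \<epsilon>l
        by (intro tendsto_intros tendsto_max tendsto_zero_powrI always_eventually) (auto intro!: tendsto_powr2 tendsto_max always_eventually simp: less_imp_le max.coboundedI2)
      also have "(max (r x) 0 powr a - 0) * F' x e = w x * (r x * F' x e)"
        using wr[of x] a by (simp add: mult.assoc[symmetric] max_def)
      finally show "(\<lambda>j. L j x) \<longlonglongrightarrow> w x * (r x * F' x e)" .
    qed
    show "AE x in lborel. norm (L j x) \<le> norm (w x * (r x * F' x e))" for j
    proof (rule AE_I2)
      fix x
      have "\<bar>max (r x) (\<epsilon> j) powr a - \<epsilon> j powr a\<bar> \<le> \<bar>w x * r x\<bar>"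
      proof (cases "r x > \<epsilon> j")
        case True
        then have "\<epsilon> j powr a \<le> r x powr a" using \<epsilon>(1)[of j] a by (intro powr_mono2) auto
        then show ?thesis using True \<epsilon>(1)[of j] by (simp add: wr max_absorb1)
      qed (simp add: max_absorb2)
      then have "\<bar>max (r x) (\<epsilon> j) powr a - \<epsilon> j powr a\<bar> * \<bar>F' x e\<bar> \<le> \<bar>w x * r x\<bar> * \<bar>F' x e\<bar>"
        by (rule mult_right_mono) simp
      then show "norm (L j x) \<le> norm (w x * (r x * F' x e))"
        by (simp add: L_def abs_mult mult.assoc)
    qed
    show "(\<lambda>x. w x * (r x * F' x e)) \<in> borel_measurable lborel" by measurable
    show "L j \<in> borel_measurable lborel" for j unfolding L_def by measurable
  qed
  ultimately have "(\<integral>x. w x * (r x * F' x e) \<partial>lborel) = (\<integral>x. w x * (2 * a * ((x \<bullet> e) * F x)) \<partial>lborel)"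
    unfolding eq by (rule LIMSEQ_unique[rotated])
  moreover have "(\<integral>x. r x * F' x e \<partial>jacobi_measure a) = (\<integral>x. w x * (r x * F' x e) \<partial>lborel)"
    unfolding w_def r_def by (rule jacobi_integral_eq) measurable
  moreover have "(\<integral>x. 2 * a * ((x \<bullet> e) * F x) \<partial>jacobi_measure a) = (\<integral>x. w x * (2 * a * ((x \<bullet> e) * F x)) \<partial>lborel)"
    unfolding w_def r_def by (rule jacobi_integral_eq) measurable
  ultimately show ?thesis by (simp add: r_def)
qed

section \<open>Polynomial functions and their partial derivatives\<close>

lemma finite_multi_indices: "finite {\<alpha> :: 'n::finite \<Rightarrow> nat. (\<Sum>i\<in>UNIV. \<alpha> i) \<le> n}"
proof (rule finite_subset)
  show "{\<alpha> :: 'n \<Rightarrow> nat. (\<Sum>i\<in>UNIV. \<alpha> i) \<le> n} \<subseteq> PiE UNIV (\<lambda>_. {..n})"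
  proof
    fix \<alpha> :: "'n \<Rightarrow> nat" assume "\<alpha> \<in> {\<alpha>. (\<Sum>i\<in>UNIV. \<alpha> i) \<le> n}"
    then have "(\<Sum>i\<in>UNIV. \<alpha> i) \<le> n" by simp
    moreover have "\<alpha> i \<le> (\<Sum>i\<in>UNIV. \<alpha> i)" for i by (rule member_le_sum) auto
    ultimately show "\<alpha> \<in> PiE UNIV (\<lambda>_. {..n})" by (auto intro: order_trans)
  qed
qed (simp add: finite_PiE)

lemma polys_leI:
  "P = (\<lambda>x. \<Sum>\<alpha> | (\<Sum>i\<in>UNIV. \<alpha> i) \<le> n. c \<alpha> * (\<Prod>i\<in>UNIV. (x $ i) ^ \<alpha> i)) \<Longrightarrow> P \<in> polys_le n"
  unfolding polys_le_def by blast

lemma polys_leE: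
  assumes "P \<in> polys_le n"
  obtains c where "P = (\<lambda>x. \<Sum>\<alpha> | (\<Sum>i\<in>UNIV. \<alpha> i) \<le> n. c \<alpha> * (\<Prod>i\<in>UNIV. (x $ i) ^ \<alpha> i))"
  using assms unfolding polys_le_def by blast

lemma polys_le_monomial:
  fixes \<alpha> :: "'n::finite \<Rightarrow> nat"
  assumes "(\<Sum>i\<in>UNIV. \<alpha> i) \<le> n"
  shows "(\<lambda>x. c * (\<Prod>i\<in>UNIV. (x $ i) ^ \<alpha> i)) \<in> polys_le n"
proof (rule polys_leI[where c = "\<lambda>\<beta>. if \<beta> = \<alpha> then c else 0"])
  show "(\<lambda>x. c * (\<Prod>i\<in>UNIV. (x $ i) ^ \<alpha> i)) =
    (\<lambda>x. \<Sum>\<beta> | (\<Sum>i\<in>UNIV. \<beta> i) \<le> n. (if \<beta> = \<alpha> then c else 0) * (\<Prod>i\<in>UNIV. (x $ i) ^ \<beta> i))"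
  proof
    fix x :: "real^'n"
    have "(\<Sum>\<beta> | (\<Sum>i\<in>UNIV. \<beta> i) \<le> n. (if \<beta> = \<alpha> then c else 0) * (\<Prod>i\<in>UNIV. (x $ i) ^ \<beta> i))
      = (\<Sum>\<beta> | (\<Sum>i\<in>UNIV. \<beta> i) \<le> n. if \<beta> = \<alpha> then c * (\<Prod>i\<in>UNIV. (x $ i) ^ \<alpha> i) else 0)"
      by (intro sum.cong) auto
    also have "\<dots> = c * (\<Prod>i\<in>UNIV. (x $ i) ^ \<alpha> i)"
      using assms by (simp add: finite_multi_indices)
    finally show "c * (\<Prod>i\<in>UNIV. (x $ i) ^ \<alpha> i) =
      (\<Sum>\<beta> | (\<Sum>i\<in>UNIV. \<beta> i) \<le> n. (if \<beta> = \<alpha> then c else 0) * (\<Prod>i\<in>UNIV. (x $ i) ^ \<beta> i))" by simp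
  qed
qed

lemma polys_le_add: "P \<in> polys_le n \<Longrightarrow> Q \<in> polys_le n \<Longrightarrow> (\<lambda>x. P x + Q x) \<in> polys_le n"
proof (elim polys_leE)
  fix c e assume "P = (\<lambda>x. \<Sum>\<alpha> | (\<Sum>i\<in>UNIV. \<alpha> i) \<le> n. c \<alpha> * (\<Prod>i\<in>UNIV. (x $ i) ^ \<alpha> i))"
    "Q = (\<lambda>x. \<Sum>\<alpha> | (\<Sum>i\<in>UNIV. \<alpha> i) \<le> n. e \<alpha> * (\<Prod>i\<in>UNIV. (x $ i) ^ \<alpha> i))"
  then show ?thesis
    by (intro polys_leI[where c = "\<lambda>\<alpha>. c \<alpha> + e \<alpha>"]) (simp add: sum.distrib distrib_right)
qed

lemma polys_le_cmult: "P \<in> polys_le n \<Longrightarrow> (\<lambda>x. a * P x) \<in> polys_le n"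
proof (elim polys_leE)
  fix c assume "P = (\<lambda>x. \<Sum>\<alpha> | (\<Sum>i\<in>UNIV. \<alpha> i) \<le> n. c \<alpha> * (\<Prod>i\<in>UNIV. (x $ i) ^ \<alpha> i))"
  then show ?thesis
    by (intro polys_leI[where c = "\<lambda>\<alpha>. a * c \<alpha>"]) (simp add: sum_distrib_left mult.assoc)
qed

lemma polys_le_const [simp]: "(\<lambda>x::real^'n. c) \<in> polys_le n"
  using polys_le_monomial[of "\<lambda>_::'n. 0" n c] by simp

lemma polys_le_sum: "(\<And>a. a \<in> A \<Longrightarrow> P a \<in> polys_le n) \<Longrightarrow> (\<lambda>x. \<Sum>a\<in>A. P a x) \<in> polys_le n"
  by (induction A rule: infinite_finite_induct) (auto intro: polys_le_add)

lemma polys_le_diff: "P \<in> polys_le n \<Longrightarrow> Q \<in> polys_le n \<Longrightarrow> (\<lambda>x. P x - Q x) \<in> polys_le n"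
  using polys_le_add[OF _ polys_le_cmult[of Q n "-1"]] by fastforce

lemma polys_le_mono:
  assumes "P \<in> polys_le n" "n \<le> m" shows "P \<in> polys_le m"
proof -
  obtain c where "P = (\<lambda>x. \<Sum>\<alpha> | (\<Sum>i\<in>UNIV. \<alpha> i) \<le> n. c \<alpha> * (\<Prod>i\<in>UNIV. (x $ i) ^ \<alpha> i))"
    using assms(1) by (rule polys_leE)
  then show ?thesis using assms(2) by (auto intro!: polys_le_sum polys_le_monomial)
qed

lemma polys_le_0: "polys_le 0 = range (\<lambda>c (x::real^'n). c)"
proof -
  have "{\<alpha> :: 'n \<Rightarrow> nat. (\<Sum>i\<in>UNIV. \<alpha> i) \<le> 0} = {\<lambda>_. 0}" by auto
  then show ?thesis unfolding polys_le_def by auto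
qed

lemma prod_power_fun_upd_Suc:
  fixes x :: "real^'n"
  shows "(\<Prod>k\<in>UNIV. (x $ k) ^ (\<alpha>(i := Suc (\<alpha> i))) k) = x $ i * (\<Prod>k\<in>UNIV. (x $ k) ^ \<alpha> k)"
proof -
  have "(\<Prod>k\<in>UNIV. (x $ k) ^ (\<alpha>(i := Suc (\<alpha> i))) k) = (\<Prod>k\<in>UNIV. (if k = i then x $ k else 1) * (x $ k) ^ \<alpha> k)"
    by (intro prod.cong) auto
  then show ?thesis by (simp add: prod.distrib)
qed

lemma sum_fun_upd_Suc:
  fixes \<alpha> :: "'n::finite \<Rightarrow> nat"
  shows "(\<Sum>k\<in>UNIV. (\<alpha>(i := Suc (\<alpha> i))) k) = Suc (\<Sum>k\<in>UNIV. \<alpha> k)"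
proof -
  have "(\<Sum>k\<in>UNIV. (\<alpha>(i := Suc (\<alpha> i))) k) = (\<Sum>k\<in>UNIV. (if k = i then 1 else 0) + \<alpha> k)"
    by (intro sum.cong) auto
  then show ?thesis by (simp add: sum.distrib)
qed

lemma polys_le_coord_mult:
  assumes "P \<in> polys_le n" shows "(\<lambda>x. x $ i * P x) \<in> polys_le (Suc n)"
proof -
  obtain c where "P = (\<lambda>x. \<Sum>\<alpha> | (\<Sum>i\<in>UNIV. \<alpha> i) \<le> n. c \<alpha> * (\<Prod>i\<in>UNIV. (x $ i) ^ \<alpha> i))"
    using assms(1) by (rule polys_leE)
  then have "(\<lambda>x. x $ i * P x) = (\<lambda>x. \<Sum>\<alpha> | (\<Sum>i\<in>UNIV. \<alpha> i) \<le> n. c \<alpha> * (\<Prod>k\<in>UNIV. (x $ k) ^ (\<alpha>(i := Suc (\<alpha> i))) k))"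
    unfolding prod_power_fun_upd_Suc by (simp add: sum_distrib_left mult_ac)
  also have "\<dots> \<in> polys_le (Suc n)"
    by (intro polys_le_sum polys_le_monomial) (simp only: sum_fun_upd_Suc mem_Collect_eq Suc_le_mono)
  finally show ?thesis .
qed

text \<open>A polynomial of degree at most \<open>n\<close> is built from constants by sums and by multiplication by
  a coordinate, each multiplication raising the degree bound by one. Later proofs about
  polynomials use this induction in place of multi-indices.\<close>

lemma polys_le_induct [consumes 1, case_names const add coord Suc]:
  fixes P :: "real^'n \<Rightarrow> real"
  assumes P: "P \<in> polys_le n"
    and const: "\<And>c. R 0 (\<lambda>x::real^'n. c)"
    and add: "\<And>n P Q. P \<in> polys_le n \<Longrightarrow> Q \<in> polys_le n \<Longrightarrow> R n P \<Longrightarrow> R n Q \<Longrightarrow> R n (\<lambda>x. P x + Q x)"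
    and coord: "\<And>n P i. P \<in> polys_le n \<Longrightarrow> R n P \<Longrightarrow> R (Suc n) (\<lambda>x. x $ i * P x)"
    and Suc: "\<And>n P. P \<in> polys_le n \<Longrightarrow> R n P \<Longrightarrow> R (Suc n) P"
  shows "R n P"
proof -
  have up: "R (n + k) P" if "P \<in> polys_le n" "R n P" for n k P
    by (induction k) (use that polys_le_mono[OF that(1)] in \<open>auto intro: Suc\<close>)
  have mono: "R k (\<lambda>x. c * (\<Prod>i\<in>UNIV. (x $ i) ^ \<alpha> i))" if "(\<Sum>i\<in>UNIV. \<alpha> i) = k" for k c and \<alpha> :: "'n \<Rightarrow> nat"
    using that
  proof (induction k arbitrary: \<alpha>)
    case 0
    then have "\<alpha> = (\<lambda>_. 0)" by auto
    then show ?case using const[of c] by simp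
  next
    case (Suc k)
    then obtain i where "\<alpha> i \<noteq> 0" by fastforce
    define \<beta> where "\<beta> = \<alpha>(i := \<alpha> i - 1)"
    have \<alpha>: "\<alpha> = \<beta>(i := Suc (\<beta> i))" using \<open>\<alpha> i \<noteq> 0\<close> by (auto simp: \<beta>_def)
    have \<beta>: "(\<Sum>i\<in>UNIV. \<beta> i) = k" using Suc.prems sum_fun_upd_Suc[of \<beta> i] \<alpha> by simp
    have "R (Suc k) (\<lambda>x. x $ i * (c * (\<Prod>i\<in>UNIV. (x $ i) ^ \<beta> i)))"
      using \<beta> by (intro coord Suc.IH polys_le_monomial) auto
    moreover have "c * (\<Prod>i\<in>UNIV. (x $ i) ^ \<alpha> i) = x $ i * (c * (\<Prod>i\<in>UNIV. (x $ i) ^ \<beta> i))" for x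
      by (subst \<alpha>, subst prod_power_fun_upd_Suc) simp
    ultimately show ?case by presburger
  qed
  obtain c where c: "P = (\<lambda>x. \<Sum>\<alpha> | (\<Sum>i\<in>UNIV. \<alpha> i) \<le> n. c \<alpha> * (\<Prod>i\<in>UNIV. (x $ i) ^ \<alpha> i))"
    using P by (rule polys_leE)
  have "R n (\<lambda>x. \<Sum>\<alpha>\<in>A. c \<alpha> * (\<Prod>i\<in>UNIV. (x $ i) ^ \<alpha> i))"
    if "finite A" "A \<subseteq> {\<alpha>. (\<Sum>i\<in>UNIV. \<alpha> i) \<le> n}" for A
    using that
  proof (induction A)
    case empty
    then show ?case using up[OF _ const, of 0 n] by simp
  next
    case (insert \<alpha> A)
    have "R n (\<lambda>x. c \<alpha> * (\<Prod>i\<in>UNIV. (x $ i) ^ \<alpha> i))"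
    proof -
      have "R ((\<Sum>i\<in>UNIV. \<alpha> i) + (n - (\<Sum>i\<in>UNIV. \<alpha> i))) (\<lambda>x. c \<alpha> * (\<Prod>i\<in>UNIV. (x $ i) ^ \<alpha> i))"
        by (rule up[OF polys_le_monomial mono[OF refl]]) simp
      then show ?thesis using insert.prems by simp
    qed
    moreover have "(\<lambda>x. \<Sum>\<alpha>\<in>A. c \<alpha> * (\<Prod>i\<in>UNIV. (x $ i) ^ \<alpha> i)) \<in> polys_le n"
      using insert.prems by (intro polys_le_sum polys_le_monomial) auto
    ultimately have "R n (\<lambda>x. c \<alpha> * (\<Prod>i\<in>UNIV. (x $ i) ^ \<alpha> i) + (\<Sum>\<alpha>\<in>A. c \<alpha> * (\<Prod>i\<in>UNIV. (x $ i) ^ \<alpha> i)))"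
      using insert by (intro add polys_le_monomial) auto
    then show ?case using insert.hyps by simp
  qed
  from this[OF finite_multi_indices subset_refl] show ?thesis unfolding c .
qed

lemma polys_le_mult:
  assumes "P \<in> polys_le n" "Q \<in> polys_le m" shows "(\<lambda>x. P x * Q x) \<in> polys_le (n + m)"
  using assms(1)
proof (induction rule: polys_le_induct)
  case (const c)
  then show ?case using polys_le_cmult[OF assms(2)] by simp
next
  case (add n P1 P2)
  then show ?case using polys_le_add by (simp add: distrib_right)
next
  case (coord n P1 i)
  then show ?case using polys_le_coord_mult[of "\<lambda>x. P1 x * Q x" "n + m" i] by (simp add: mult.assoc)
next
  case (Suc n P1)
  then show ?case using polys_le_mono by fastforce
qed

lemma polys_le_coord: "(\<lambda>x. x $ i) \<in> polys_le 1"
  using polys_le_coord_mult[OF polys_le_const[of 1 0], of i] by simp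

lemma polys_le_inner: "(\<lambda>x::real^'n. x \<bullet> y) \<in> polys_le 1"
  unfolding inner_vec_def inner_real_def using polys_le_cmult[OF polys_le_coord]
  by (intro polys_le_sum) (subst mult.commute, blast)

lemma polys_le_norm_sq: "(\<lambda>x::real^'n. (norm x)\<^sup>2) \<in> polys_le 2"
  unfolding power2_norm_eq_inner inner_vec_def using polys_le_mult[OF polys_le_coord polys_le_coord]
  by (auto intro!: polys_le_sum simp: numeral_2_eq_2)

lemma polys_le_power: "P \<in> polys_le n \<Longrightarrow> (\<lambda>x. P x ^ k) \<in> polys_le (k * n)"
  by (induction k) (auto intro: polys_le_mult)

lemma polys_le_differentiable: "P \<in> polys_le n \<Longrightarrow> P differentiable (at x)"
  by (induction rule: polys_le_induct)
    (simp_all add: differentiable_add differentiable_mult bounded_linear_imp_differentiable[OF bounded_linear_vec_nth])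

lemma polys_le_continuous: "P \<in> polys_le n \<Longrightarrow> continuous_on A P"
  by (meson continuous_at_imp_continuous_on differentiable_imp_continuous_within polys_le_differentiable)

definition polys :: "(real ^ 'n \<Rightarrow> real) set" where "polys = (\<Union>n. polys_le n)"

lemma polysI: "P \<in> polys_le n \<Longrightarrow> P \<in> polys" by (auto simp: polys_def)

lemma polys2E:
  assumes "P \<in> polys" "Q \<in> polys"
  obtains n where "P \<in> polys_le n" "Q \<in> polys_le n"
proof -
  obtain n m where "P \<in> polys_le n" "Q \<in> polys_le m" using assms by (auto simp: polys_def)
  then show thesis using that[of "max n m"] polys_le_mono[of P n] polys_le_mono[of Q m] by simp
qed

lemma polys_const [simp, intro]: "(\<lambda>x. c) \<in> polys" by (rule polysI[OF polys_le_const])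
lemma polys_coord [simp, intro]: "(\<lambda>x. x $ i) \<in> polys" by (rule polysI[OF polys_le_coord])
lemma polys_inner [simp, intro]: "(\<lambda>x. x \<bullet> y) \<in> polys" by (rule polysI[OF polys_le_inner])
lemma polys_norm_sq [simp, intro]: "(\<lambda>x. (norm x)\<^sup>2) \<in> polys" by (rule polysI[OF polys_le_norm_sq])
lemma polys_add [simp, intro]: "P \<in> polys \<Longrightarrow> Q \<in> polys \<Longrightarrow> (\<lambda>x. P x + Q x) \<in> polys"
  by (rule polys2E[of P Q]) (auto intro: polysI polys_le_add)
lemma polys_diff [simp, intro]: "P \<in> polys \<Longrightarrow> Q \<in> polys \<Longrightarrow> (\<lambda>x. P x - Q x) \<in> polys"
  by (rule polys2E[of P Q]) (auto intro: polysI polys_le_diff)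
lemma polys_mult [simp, intro]: "P \<in> polys \<Longrightarrow> Q \<in> polys \<Longrightarrow> (\<lambda>x. P x * Q x) \<in> polys"
  by (rule polys2E[of P Q]) (auto intro: polysI polys_le_mult)
lemma polys_power [simp, intro]: "P \<in> polys \<Longrightarrow> (\<lambda>x. P x ^ k) \<in> polys"
  by (induction k) auto
lemma polys_sum [simp, intro]: "(\<And>a. a \<in> A \<Longrightarrow> P a \<in> polys) \<Longrightarrow> (\<lambda>x. \<Sum>a\<in>A. P a x) \<in> polys"
  by (induction A rule: infinite_finite_induct) auto
lemma polys_uminus [simp, intro]: "P \<in> polys \<Longrightarrow> (\<lambda>x. - P x) \<in> polys"
  using polys_diff[OF polys_const[of 0], of P] by simp

lemma polys_differentiable: "P \<in> polys \<Longrightarrow> P differentiable (at x)"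
  by (auto simp: polys_def intro: polys_le_differentiable)
lemma polys_continuous: "P \<in> polys \<Longrightarrow> continuous_on A P"
  by (auto simp: polys_def intro: polys_le_continuous)

definition pderiv_at :: "'n \<Rightarrow> (real ^ 'n \<Rightarrow> real) \<Rightarrow> real ^ 'n \<Rightarrow> real" where
  "pderiv_at i P x = frechet_derivative P (at x) (axis i 1)"

lemma pderiv_at_eq: "(P has_derivative P') (at x) \<Longrightarrow> pderiv_at i P x = P' (axis i 1)"
  unfolding pderiv_at_def by (simp flip: frechet_derivative_at)

lemma pderiv_at_const [simp]: "pderiv_at i (\<lambda>x. c) = (\<lambda>x. 0)"
  by (rule ext, rule pderiv_at_eq) simp

lemma pderiv_at_coord: "pderiv_at i (\<lambda>x::real^'n. x $ j) = (\<lambda>x. if i = j then 1 else 0)"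
proof
  fix x :: "real^'n"
  have "((\<lambda>x. x $ j) has_derivative (\<lambda>x. x $ j)) (at x)"
    by (rule bounded_linear_imp_has_derivative[OF bounded_linear_vec_nth])
  then show "pderiv_at i (\<lambda>x. x $ j) x = (if i = j then 1 else 0)"
    using pderiv_at_eq[of "\<lambda>x. x $ j" "\<lambda>x. x $ j" x i] by (simp add: axis_def)
qed

context
  fixes P Q :: "real ^ 'n \<Rightarrow> real"
  assumes PQ: "P \<in> polys" "Q \<in> polys"
begin

lemma pderiv_at_add: "pderiv_at i (\<lambda>x. P x + Q x) = (\<lambda>x. pderiv_at i P x + pderiv_at i Q x)"
proof
  fix x
  have "(P has_derivative frechet_derivative P (at x)) (at x)" "(Q has_derivative frechet_derivative Q (at x)) (at x)"
    using PQ polys_differentiable by (auto simp: frechet_derivative_works)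
  from has_derivative_add[OF this] show "pderiv_at i (\<lambda>x. P x + Q x) x = pderiv_at i P x + pderiv_at i Q x"
    by (subst pderiv_at_eq) (auto simp: pderiv_at_def)
qed

lemma pderiv_at_diff: "pderiv_at i (\<lambda>x. P x - Q x) = (\<lambda>x. pderiv_at i P x - pderiv_at i Q x)"
proof
  fix x
  have "(P has_derivative frechet_derivative P (at x)) (at x)" "(Q has_derivative frechet_derivative Q (at x)) (at x)"
    using PQ polys_differentiable by (auto simp: frechet_derivative_works)
  from has_derivative_diff[OF this] show "pderiv_at i (\<lambda>x. P x - Q x) x = pderiv_at i P x - pderiv_at i Q x"
    by (subst pderiv_at_eq) (auto simp: pderiv_at_def)
qed

lemma pderiv_at_mult: "pderiv_at i (\<lambda>x. P x * Q x) = (\<lambda>x. P x * pderiv_at i Q x + Q x * pderiv_at i P x)"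
proof
  fix x
  have "(P has_derivative frechet_derivative P (at x)) (at x)" "(Q has_derivative frechet_derivative Q (at x)) (at x)"
    using PQ polys_differentiable by (auto simp: frechet_derivative_works)
  from has_derivative_mult[OF this] show "pderiv_at i (\<lambda>x. P x * Q x) x = P x * pderiv_at i Q x + Q x * pderiv_at i P x"
    by (subst pderiv_at_eq) (auto simp: pderiv_at_def mult.commute)
qed

end

lemma pderiv_at_cmult: "P \<in> polys \<Longrightarrow> pderiv_at i (\<lambda>x. c * P x) = (\<lambda>x. c * pderiv_at i P x)"
  using pderiv_at_mult[of "\<lambda>x. c" P i] by auto

lemma pderiv_at_coord_mult:
  "P \<in> polys \<Longrightarrow> pderiv_at i (\<lambda>x. x $ j * P x) = (\<lambda>x. x $ j * pderiv_at i P x + (if i = j then P x else 0))"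
  by (subst pderiv_at_mult) (auto simp: pderiv_at_coord)

lemma polys_le_pderiv: "P \<in> polys_le n \<Longrightarrow> pderiv_at i P \<in> polys_le n"
proof (induction rule: polys_le_induct)
  case (add n P Q)
  then show ?case by (simp add: pderiv_at_add polysI polys_le_add)
next
  case (coord n P j)
  have "(\<lambda>x. if i = j then P x else 0) \<in> polys_le (Suc n)"
    using coord(1) polys_le_mono[of P n "Suc n"] by (cases "i = j") auto
  then show ?case using coord by (simp add: pderiv_at_coord_mult polysI polys_le_add polys_le_coord_mult)
qed (auto intro: polys_le_mono)

lemma polys_pderiv [simp, intro]: "P \<in> polys \<Longrightarrow> pderiv_at i P \<in> polys"
  by (auto simp: polys_def intro: polys_le_pderiv)

lemma polys_has_derivative:
  "P \<in> polys \<Longrightarrow> (P has_derivative (\<lambda>h. \<Sum>i\<in>UNIV. h $ i * pderiv_at i P x)) (at x)"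
proof -
  assume "P \<in> polys"
  then have D: "(P has_derivative frechet_derivative P (at x)) (at x)"
    using polys_differentiable by (auto simp: frechet_derivative_works)
  then have lin: "linear (frechet_derivative P (at x))" by (rule has_derivative_linear)
  have "frechet_derivative P (at x) h = (\<Sum>i\<in>UNIV. h $ i * pderiv_at i P x)" for h
  proof -
    have "frechet_derivative P (at x) (\<Sum>i\<in>UNIV. h $ i *\<^sub>R axis i 1) = (\<Sum>i\<in>UNIV. h $ i * pderiv_at i P x)"
      using lin by (simp add: linear_sum linear_cmul pderiv_at_def)
    then show ?thesis using basis_expansion[of h] by (simp add: scalar_mult_eq_scaleR)
  qed
  then have "frechet_derivative P (at x) = (\<lambda>h. \<Sum>i\<in>UNIV. h $ i * pderiv_at i P x)" by (rule ext)
  with D show ?thesis by simp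
qed

lemma pderiv_at_commute:
  assumes "P \<in> polys" shows "pderiv_at i (pderiv_at j P) = pderiv_at j (pderiv_at i P)"
proof -
  obtain n where "P \<in> polys_le n" using assms by (auto simp: polys_def)
  then show ?thesis
  proof (induction rule: polys_le_induct)
    case (add n P Q)
    then show ?case by (simp add: pderiv_at_add polysI)
  next
    case (coord n P k)
    have *: "pderiv_at a (\<lambda>x. if b then P x else 0) = (\<lambda>x. if b then pderiv_at a P x else 0)" for a b
      by auto
    have P: "P \<in> polys" "(\<lambda>x. if b then P x else 0) \<in> polys" for b
      using coord(1) by (cases b; simp add: polysI)+
    show ?case using P coord(2)
      by (simp add: pderiv_at_coord_mult pderiv_at_add * fun_eq_iff)
  qed auto
qed

section \<open>The differential operator on the ball\<close>

text \<open>The operator \<open>D\<close>: the double sum runs over all ordered pairs, so its diagonal supplies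
  \<open>- x\<^sub>i\<^sup>2 \<partial>\<^sub>i\<^sup>2\<close> and each mixed derivative is counted twice.\<close>

definition ball_op :: "real \<Rightarrow> (real^'n \<Rightarrow> real) \<Rightarrow> real^'n \<Rightarrow> real" where
  "ball_op \<mu> P x = (\<Sum>i\<in>UNIV. pderiv_at i (pderiv_at i P) x)
     - (\<Sum>i\<in>UNIV. \<Sum>j\<in>UNIV. x $ i * x $ j * pderiv_at i (pderiv_at j P) x)
     - (real CARD('n) + 2 * \<mu>) * (\<Sum>i\<in>UNIV. x $ i * pderiv_at i P x)"

text \<open>The symmetric bilinear form by which \<open>D\<close> fails to be a derivation: \<open>ball_op_mult\<close> shows that
  it is half of \<open>D (P Q) - P D Q - Q D P\<close>.\<close>

definition carre_du_champ :: "(real^'n \<Rightarrow> real) \<Rightarrow> (real^'n \<Rightarrow> real) \<Rightarrow> real^'n \<Rightarrow> real" where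
  "carre_du_champ P Q x = (\<Sum>i\<in>UNIV. pderiv_at i P x * pderiv_at i Q x)
     - (\<Sum>i\<in>UNIV. x $ i * pderiv_at i P x) * (\<Sum>i\<in>UNIV. x $ i * pderiv_at i Q x)"

lemma polys_ball_op [simp, intro]: "P \<in> polys \<Longrightarrow> ball_op \<mu> P \<in> polys"
  unfolding ball_op_def by (intro polys_diff polys_sum polys_mult polys_pderiv polys_coord polys_const)

lemma polys_carre [simp, intro]: "P \<in> polys \<Longrightarrow> Q \<in> polys \<Longrightarrow> carre_du_champ P Q \<in> polys"
  unfolding carre_du_champ_def by (intro polys_diff polys_sum polys_mult polys_pderiv polys_coord polys_const)

lemma ball_op_const [simp]: "ball_op \<mu> (\<lambda>x. c) = (\<lambda>x. 0)"
  by (simp add: ball_op_def fun_eq_iff)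

lemma ball_op_add: "P \<in> polys \<Longrightarrow> Q \<in> polys \<Longrightarrow> ball_op \<mu> (\<lambda>x. P x + Q x) = (\<lambda>x. ball_op \<mu> P x + ball_op \<mu> Q x)"
  by (simp add: ball_op_def fun_eq_iff pderiv_at_add sum.distrib algebra_simps)

lemma carre_commute: "carre_du_champ P Q = carre_du_champ Q P"
  by (simp add: carre_du_champ_def fun_eq_iff mult.commute)

lemma ball_op_mult:
  fixes P Q :: "real^'n \<Rightarrow> real"
  assumes P: "P \<in> polys" and Q: "Q \<in> polys"
  shows "ball_op \<mu> (\<lambda>x. P x * Q x) = (\<lambda>x. P x * ball_op \<mu> Q x + Q x * ball_op \<mu> P x + 2 * carre_du_champ P Q x)"
proof
  fix x :: "real^'n"
  define p q where "p i = pderiv_at i P x" and "q i = pderiv_at i Q x" for i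
  define pp qq where "pp i j = pderiv_at i (pderiv_at j P) x" and "qq i j = pderiv_at i (pderiv_at j Q) x" for i j
  have 1: "pderiv_at i (\<lambda>x. P x * Q x) x = P x * q i + Q x * p i" for i
    using P Q by (simp add: pderiv_at_mult p_def q_def)
  have 2: "pderiv_at i (pderiv_at j (\<lambda>x. P x * Q x)) x = P x * qq i j + Q x * pp i j + (p i * q j + p j * q i)" for i j
    using P Q by (simp add: pderiv_at_mult pderiv_at_add p_def q_def pp_def qq_def algebra_simps)
  have s1: "(\<Sum>i\<in>UNIV. \<Sum>j\<in>UNIV. x $ i * x $ j * (p i * q j)) = (\<Sum>i\<in>UNIV. x $ i * p i) * (\<Sum>i\<in>UNIV. x $ i * q i)"
    by (simp add: sum_product mult_ac)
  have s2: "(\<Sum>i\<in>UNIV. \<Sum>j\<in>UNIV. x $ i * x $ j * (p j * q i)) = (\<Sum>i\<in>UNIV. x $ i * p i) * (\<Sum>i\<in>UNIV. x $ i * q i)"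
    by (subst sum.swap) (simp add: sum_product mult_ac)
  have "(\<Sum>i\<in>UNIV. \<Sum>j\<in>UNIV. x $ i * x $ j * (P x * qq i j + Q x * pp i j + (p i * q j + p j * q i)))
     = P x * (\<Sum>i\<in>UNIV. \<Sum>j\<in>UNIV. x $ i * x $ j * qq i j) + Q x * (\<Sum>i\<in>UNIV. \<Sum>j\<in>UNIV. x $ i * x $ j * pp i j)
      + ((\<Sum>i\<in>UNIV. \<Sum>j\<in>UNIV. x $ i * x $ j * (p i * q j)) + (\<Sum>i\<in>UNIV. \<Sum>j\<in>UNIV. x $ i * x $ j * (p j * q i)))"
    by (simp add: sum.distrib sum_distrib_left algebra_simps)
  note A = this[unfolded s1 s2]
  have B: "(\<Sum>i\<in>UNIV. P x * qq i i + Q x * pp i i + (p i * q i + p i * q i)) =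
     P x * (\<Sum>i\<in>UNIV. qq i i) + Q x * (\<Sum>i\<in>UNIV. pp i i) + 2 * (\<Sum>i\<in>UNIV. p i * q i)"
    by (simp add: sum.distrib sum_distrib_left algebra_simps)
  have C: "(\<Sum>i\<in>UNIV. x $ i * (P x * q i + Q x * p i)) = P x * (\<Sum>i\<in>UNIV. x $ i * q i) + Q x * (\<Sum>i\<in>UNIV. x $ i * p i)"
    by (simp add: sum.distrib sum_distrib_left algebra_simps)
  have D: "ball_op \<mu> (\<lambda>x. P x * Q x) x = (\<Sum>i\<in>UNIV. P x * qq i i + Q x * pp i i + (p i * q i + p i * q i))
     - (\<Sum>i\<in>UNIV. \<Sum>j\<in>UNIV. x $ i * x $ j * (P x * qq i j + Q x * pp i j + (p i * q j + p j * q i)))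
     - (real CARD('n) + 2 * \<mu>) * (\<Sum>i\<in>UNIV. x $ i * (P x * q i + Q x * p i))"
    unfolding ball_op_def 1 2 ..
  show "ball_op \<mu> (\<lambda>x. P x * Q x) x = P x * ball_op \<mu> Q x + Q x * ball_op \<mu> P x + 2 * carre_du_champ P Q x"
    unfolding D unfolding A B C unfolding ball_op_def carre_du_champ_def p_def[symmetric] q_def[symmetric] pp_def[symmetric] qq_def[symmetric]
    by (simp add: algebra_simps)
qed

lemma ball_op_cmult: "P \<in> polys \<Longrightarrow> ball_op \<mu> (\<lambda>x. c * P x) = (\<lambda>x. c * ball_op \<mu> P x)"
  by (subst ball_op_mult) (auto simp: carre_du_champ_def fun_eq_iff)

lemma ball_op_sum: "(\<And>a. a \<in> A \<Longrightarrow> P a \<in> polys) \<Longrightarrow> ball_op \<mu> (\<lambda>x. \<Sum>a\<in>A. P a x) = (\<lambda>x. \<Sum>a\<in>A. ball_op \<mu> (P a) x)"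
  by (induction A rule: infinite_finite_induct) (auto simp: ball_op_add)

lemma carre_mult:
  assumes "P \<in> polys" "Q \<in> polys"
  shows "carre_du_champ (\<lambda>x. P x * Q x) R = (\<lambda>x. P x * carre_du_champ Q R x + Q x * carre_du_champ P R x)"
proof -
  have "(\<Sum>i\<in>UNIV. (P x * pderiv_at i Q x + Q x * pderiv_at i P x) * pderiv_at i R x)
     = P x * (\<Sum>i\<in>UNIV. pderiv_at i Q x * pderiv_at i R x) + Q x * (\<Sum>i\<in>UNIV. pderiv_at i P x * pderiv_at i R x)"
    "(\<Sum>i\<in>UNIV. x $ i * (P x * pderiv_at i Q x + Q x * pderiv_at i P x))
     = P x * (\<Sum>i\<in>UNIV. x $ i * pderiv_at i Q x) + Q x * (\<Sum>i\<in>UNIV. x $ i * pderiv_at i P x)" for x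
    by (simp_all add: sum.distrib sum_distrib_left algebra_simps)
  then show ?thesis using assms
    unfolding carre_du_champ_def by (simp add: pderiv_at_mult fun_eq_iff algebra_simps)
qed

lemma ball_op_coord: "ball_op \<mu> (\<lambda>x::real^'n. x $ i) = (\<lambda>x. - (real CARD('n) + 2 * \<mu>) * x $ i)"
proof -
  have *: "pderiv_at j (\<lambda>x::real^'n. if k then 1 else 0) = (\<lambda>x. 0)" for j k by auto
  have "(\<Sum>j\<in>UNIV. x $ j * (if j = i then 1 else 0)) = x $ i" for x :: "real^'n"
    by (simp add: if_distrib cong: if_cong)
  then show ?thesis by (simp add: ball_op_def pderiv_at_coord * fun_eq_iff algebra_simps)
qed

lemma carre_coord: "carre_du_champ (\<lambda>x::real^'n. x $ i) Q x = pderiv_at i Q x - x $ i * (\<Sum>j\<in>UNIV. x $ j * pderiv_at j Q x)"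
  by (simp add: carre_du_champ_def pderiv_at_coord if_distrib if_distribR cong: if_cong)

text \<open>Polynomials of degree less than \<open>n\<close>. The case \<open>n = 0\<close> is separate because truncated
  subtraction would make constants polynomials of degree less than zero.\<close>

definition polys_lt :: "nat \<Rightarrow> (real^'n \<Rightarrow> real) set" where
  "polys_lt n = (if n = 0 then {\<lambda>x. 0} else polys_le (n - 1))"

lemma polys_lt_Suc [simp]: "polys_lt (Suc n) = polys_le n" by (simp add: polys_lt_def)

lemma polys_lt_add: "P \<in> polys_lt n \<Longrightarrow> Q \<in> polys_lt n \<Longrightarrow> (\<lambda>x. P x + Q x) \<in> polys_lt n"
  by (auto simp: polys_lt_def intro: polys_le_add split: if_splits)

lemma polys_lt_coord_mult: "P \<in> polys_lt n \<Longrightarrow> (\<lambda>x. x $ i * P x) \<in> polys_le n"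
  using polys_le_coord_mult[of P "n - 1" i] by (auto simp: polys_lt_def split: if_splits)

lemma polys_lt_le: "P \<in> polys_lt n \<Longrightarrow> P \<in> polys_le n"
  by (auto simp: polys_lt_def intro: polys_le_mono split: if_splits)

text \<open>Euler's identity for the homogeneous part of top degree.\<close>

lemma euler_mod_lower:
  fixes P :: "real^'n \<Rightarrow> real"
  assumes "P \<in> polys_le n"
  shows "(\<lambda>x. (\<Sum>i\<in>UNIV. x $ i * pderiv_at i P x) - n * P x) \<in> polys_lt n"
  using assms
proof (induction rule: polys_le_induct)
  case (add n P Q)
  have "(\<lambda>x. (\<Sum>i\<in>UNIV. x $ i * pderiv_at i (\<lambda>x. P x + Q x) x) - n * (P x + Q x)) =
     (\<lambda>x. ((\<Sum>i\<in>UNIV. x $ i * pderiv_at i P x) - n * P x) + ((\<Sum>i\<in>UNIV. x $ i * pderiv_at i Q x) - n * Q x))"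
    using add(1,2) by (simp add: polysI pderiv_at_add sum.distrib algebra_simps)
  then show ?case using polys_lt_add[OF add(3,4)] by simp
next
  case (coord n P j)
  have "(\<lambda>x. (\<Sum>i\<in>UNIV. x $ i * pderiv_at i (\<lambda>x. x $ j * P x) x) - Suc n * (x $ j * P x)) =
     (\<lambda>x. x $ j * ((\<Sum>i\<in>UNIV. x $ i * pderiv_at i P x) - n * P x))"
    proof
    fix x :: "real^'n"
    have "(\<Sum>i\<in>UNIV. x $ i * (x $ j * pderiv_at i P x + (if i = j then P x else 0)))
      = (\<Sum>i\<in>UNIV. x $ i * (x $ j * pderiv_at i P x)) + (\<Sum>i\<in>UNIV. x $ i * (if i = j then P x else 0))"
      by (simp only: distrib_left sum.distrib)
    also have "(\<Sum>i\<in>UNIV. x $ i * (if i = j then P x else 0)) = x $ j * P x"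
      by (simp add: if_distrib cong: if_cong)
    also have "(\<Sum>i\<in>UNIV. x $ i * (x $ j * pderiv_at i P x)) = x $ j * (\<Sum>i\<in>UNIV. x $ i * pderiv_at i P x)"
      by (simp add: sum_distrib_left mult_ac)
    finally show "(\<Sum>i\<in>UNIV. x $ i * pderiv_at i (\<lambda>x. x $ j * P x) x) - Suc n * (x $ j * P x)
      = x $ j * ((\<Sum>i\<in>UNIV. x $ i * pderiv_at i P x) - n * P x)"
      using coord(1) unfolding pderiv_at_coord_mult[OF polysI[OF coord(1)]] by (simp only: distrib_right of_nat_Suc) (simp add: algebra_simps)
  qed
  then show ?case using polys_lt_coord_mult[OF coord(2)] by simp
next
  case (Suc n P)
  have "(\<lambda>x. (\<Sum>i\<in>UNIV. x $ i * pderiv_at i P x) - Suc n * P x) =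
     (\<lambda>x. ((\<Sum>i\<in>UNIV. x $ i * pderiv_at i P x) - n * P x) - P x)"
    by (simp add: algebra_simps)
  then show ?case using polys_le_diff[OF polys_lt_le[OF Suc(2)] Suc(1)] by simp
qed (simp add: polys_lt_def)

definition eigval :: "real \<Rightarrow> nat \<Rightarrow> real" where "eigval l n = real n * (real n + 2 * l)"

text \<open>\<open>D\<close> is triangular with respect to the degree. On a homogeneous polynomial of degree \<open>n\<close> its
  part that preserves the degree is \<open>- E (E - 1) - (d + 2 \<mu>) E\<close> with the Euler field \<open>E\<close>, which
  acts as multiplication by \<open>- n (n + d - 1 + 2 \<mu>) = - n (n + 2 l)\<close>.\<close>

lemma ball_op_mod_lower:
  fixes P :: "real^'n \<Rightarrow> real"
  assumes "P \<in> polys_le n" and l: "l = \<mu> + (real CARD('n) - 1) / 2"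
  shows "(\<lambda>x. ball_op \<mu> P x + eigval l n * P x) \<in> polys_lt n"
  using assms(1)
proof (induction rule: polys_le_induct)
  case (const c)
  then show ?case by (simp add: polys_lt_def eigval_def)
next
  case (add n P Q)
  have "(\<lambda>x. ball_op \<mu> (\<lambda>x. P x + Q x) x + eigval l n * (P x + Q x)) =
    (\<lambda>x. (ball_op \<mu> P x + eigval l n * P x) + (ball_op \<mu> Q x + eigval l n * Q x))"
    using add(1,2) by (simp add: polysI ball_op_add algebra_simps)
  then show ?case using polys_lt_add[OF add(3,4)] by simp
next
  case (coord n P j)
  have P: "P \<in> polys" using coord(1) by (rule polysI)
  have ev: "eigval l (Suc n) = eigval l n + (2 * real n + (real CARD('n) + 2 * \<mu>))"
    unfolding eigval_def l by (simp add: field_simps)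
  have "(\<lambda>x. ball_op \<mu> (\<lambda>x. x $ j * P x) x + eigval l (Suc n) * (x $ j * P x)) =
    (\<lambda>x. x $ j * (ball_op \<mu> P x + eigval l n * P x) + 2 * pderiv_at j P x
        - 2 * (x $ j * ((\<Sum>i\<in>UNIV. x $ i * pderiv_at i P x) - n * P x)))"
    using P unfolding ev by (simp add: ball_op_mult ball_op_coord carre_coord fun_eq_iff) (simp add: algebra_simps)
  moreover have "\<dots> \<in> polys_le n"
    by (intro polys_le_add polys_le_diff polys_lt_coord_mult[OF coord(2)] polys_le_cmult polys_le_pderiv
        polys_lt_coord_mult[OF euler_mod_lower] coord(1))
  ultimately show ?case by simp
next
  case (Suc n P)
  have "(\<lambda>x. ball_op \<mu> P x + eigval l (Suc n) * P x) =
     (\<lambda>x. (ball_op \<mu> P x + eigval l n * P x) + (eigval l (Suc n) - eigval l n) * P x)"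
    by (simp add: algebra_simps)
  then show ?case using polys_le_add[OF polys_lt_le[OF Suc(2)] polys_le_cmult[OF Suc(1)]] by simp
qed

section \<open>Symmetry of the operator\<close>

lemma ball_measure_eq_jacobi: "ball_measure \<mu> = jacobi_measure (\<mu> + 1/2)"
  unfolding ball_measure_def jacobi_measure_def ball_weight_def by simp

definition ball_mean :: "real \<Rightarrow> (real^'n \<Rightarrow> real) \<Rightarrow> real" where
  "ball_mean \<mu> P = (\<integral>x. P x \<partial>ball_measure \<mu>)"

context
  fixes \<mu> :: real
  assumes mu: "\<mu> \<ge> 0"
begin

lemma integrable_ball_polys: "P \<in> polys \<Longrightarrow> integrable (ball_measure \<mu>) P"
  unfolding ball_measure_eq_jacobi using mu by (intro integrable_jacobi_continuous polys_continuous) auto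

lemma ball_mean_add: "P \<in> polys \<Longrightarrow> Q \<in> polys \<Longrightarrow> ball_mean \<mu> (\<lambda>x. P x + Q x) = ball_mean \<mu> P + ball_mean \<mu> Q"
  unfolding ball_mean_def by (simp add: integrable_ball_polys)
lemma ball_mean_diff: "P \<in> polys \<Longrightarrow> Q \<in> polys \<Longrightarrow> ball_mean \<mu> (\<lambda>x. P x - Q x) = ball_mean \<mu> P - ball_mean \<mu> Q"
  unfolding ball_mean_def by (simp add: integrable_ball_polys)
lemma ball_mean_cmult: "ball_mean \<mu> (\<lambda>x. c * P x) = c * ball_mean \<mu> P"
  unfolding ball_mean_def by simp
lemma ball_mean_sum: "(\<And>a. a \<in> A \<Longrightarrow> P a \<in> polys) \<Longrightarrow> ball_mean \<mu> (\<lambda>x. \<Sum>a\<in>A. P a x) = (\<Sum>a\<in>A. ball_mean \<mu> (P a))"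
  unfolding ball_mean_def by (intro Bochner_Integration.integral_sum integrable_ball_polys)

lemma ball_mean_by_parts:
  assumes F: "F \<in> polys"
  shows "ball_mean \<mu> (\<lambda>x. (1 - (norm x)\<^sup>2) * pderiv_at i F x) = (2 * \<mu> + 1) * ball_mean \<mu> (\<lambda>x. x $ i * F x)"
proof -
  have "(\<integral>x. (1 - (norm x)\<^sup>2) * (\<Sum>j\<in>UNIV. axis i 1 $ j * pderiv_at j F x) \<partial>jacobi_measure (\<mu> + 1/2))
     = 2 * (\<mu> + 1/2) * (\<integral>x. (x \<bullet> axis i 1) * F x \<partial>jacobi_measure (\<mu> + 1/2))"
    using mu F by (intro jacobi_integral_by_parts[OF _ _ polys_has_derivative] polys_continuous) auto
  moreover have "(\<Sum>j\<in>UNIV. axis i 1 $ j * pderiv_at j F x) = pderiv_at i F x" for x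
    by (simp add: axis_def if_distrib[of "\<lambda>z. z * _"] cong: if_cong)
  ultimately show ?thesis unfolding ball_mean_def ball_measure_eq_jacobi by (simp add: inner_axis algebra_simps)
qed

text \<open>Rotations preserve the measure, so the angular field \<open>x\<^sub>j \<partial>\<^sub>i - x\<^sub>i \<partial>\<^sub>j\<close> has mean zero on
  functions. Here this comes from integrating by parts \<open>\<partial>\<^sub>i F\<close> in the direction \<open>j\<close> and \<open>\<partial>\<^sub>j F\<close> in
  the direction \<open>i\<close>, since the mixed derivatives agree.\<close>

lemma ball_mean_rotation:
  assumes F: "F \<in> polys"
  shows "ball_mean \<mu> (\<lambda>x. x $ j * pderiv_at i F x) = ball_mean \<mu> (\<lambda>x. x $ i * pderiv_at j F x)"
  using ball_mean_by_parts[of "pderiv_at i F" j] ball_mean_by_parts[of "pderiv_at j F" i] F mu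
  by (simp add: pderiv_at_commute[of F i j])

text \<open>With the Euler field \<open>E\<close>, the operator has the divergence form
  \<open>D P = (\<Sum>j. (\<partial>\<^sub>j - x\<^sub>j E - (d + 2 \<mu>) x\<^sub>j) (\<partial>\<^sub>j P))\<close>, and every summand has mean zero for the
  weight. The terms \<open>x\<^sub>j x\<^sub>i \<partial>\<^sub>i G\<close> are turned by \<open>ball_mean_rotation\<close> into \<open>x\<^sub>i\<^sup>2 \<partial>\<^sub>j G\<close>, after
  which one integration by parts in the direction \<open>j\<close> remains.\<close>

lemma ball_mean_divergence:
  fixes G :: "real^'n \<Rightarrow> real"
  assumes G: "G \<in> polys"
  shows "ball_mean \<mu> (\<lambda>x. pderiv_at j G x - x $ j * (\<Sum>i\<in>UNIV. x $ i * pderiv_at i G x) - (real CARD('n) + 2 * \<mu>) * (x $ j * G x)) = 0"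
proof -
  have 1: "ball_mean \<mu> (\<lambda>x. x $ j * (x $ i * pderiv_at i G x)) =
     ball_mean \<mu> (\<lambda>x. (x $ i * x $ i) * pderiv_at j G x) + (if i = j then ball_mean \<mu> (\<lambda>x. x $ j * G x) else 0) - ball_mean \<mu> (\<lambda>x. x $ j * G x)" for i
  proof -
    have iG: "(\<lambda>x. x $ i * G x) \<in> polys" using G by auto
    have "ball_mean \<mu> (\<lambda>x. x $ j * (x $ i * pderiv_at i G x + G x)) =
        ball_mean \<mu> (\<lambda>x. x $ i * (x $ i * pderiv_at j G x + (if j = i then G x else 0)))"
      using ball_mean_rotation[OF iG, of j i] G by (simp add: pderiv_at_coord_mult)
    moreover have "ball_mean \<mu> (\<lambda>x. x $ j * (x $ i * pderiv_at i G x + G x)) =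
        ball_mean \<mu> (\<lambda>x. x $ j * (x $ i * pderiv_at i G x)) + ball_mean \<mu> (\<lambda>x. x $ j * G x)"
      using G by (subst ball_mean_add[symmetric]) (auto simp: algebra_simps)
    moreover have "ball_mean \<mu> (\<lambda>x. x $ i * (x $ i * pderiv_at j G x + (if j = i then G x else 0))) =
        ball_mean \<mu> (\<lambda>x. (x $ i * x $ i) * pderiv_at j G x) + (if i = j then ball_mean \<mu> (\<lambda>x. x $ j * G x) else 0)"
      using G by (cases "i = j") (auto simp: ball_mean_add[symmetric] algebra_simps)
    ultimately show ?thesis by simp
  qed
  have n2: "(\<Sum>i\<in>UNIV. x $ i * x $ i) = (norm x)\<^sup>2" for x :: "real^'n"
    by (simp add: power2_norm_eq_inner inner_vec_def)
  have "ball_mean \<mu> (\<lambda>x. x $ j * (\<Sum>i\<in>UNIV. x $ i * pderiv_at i G x)) = (\<Sum>i\<in>UNIV. ball_mean \<mu> (\<lambda>x. x $ j * (x $ i * pderiv_at i G x)))"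
    unfolding sum_distrib_left using G by (intro ball_mean_sum) auto
  also have "\<dots> = (\<Sum>i\<in>UNIV. ball_mean \<mu> (\<lambda>x. (x $ i * x $ i) * pderiv_at j G x)) + ball_mean \<mu> (\<lambda>x. x $ j * G x)
      - real CARD('n) * ball_mean \<mu> (\<lambda>x. x $ j * G x)"
    unfolding 1 by (simp add: sum.distrib sum_subtractf)
  also have "(\<Sum>i\<in>UNIV. ball_mean \<mu> (\<lambda>x. (x $ i * x $ i) * pderiv_at j G x)) = ball_mean \<mu> (\<lambda>x. (norm x)\<^sup>2 * pderiv_at j G x)"
    using G by (subst ball_mean_sum[symmetric]) (auto simp: sum_distrib_right[symmetric] n2)
  finally have 2: "ball_mean \<mu> (\<lambda>x. x $ j * (\<Sum>i\<in>UNIV. x $ i * pderiv_at i G x)) = 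
    ball_mean \<mu> (\<lambda>x. (norm x)\<^sup>2 * pderiv_at j G x) + (1 - real CARD('n)) * ball_mean \<mu> (\<lambda>x. x $ j * G x)"
    by (simp add: algebra_simps)
  have 3: "ball_mean \<mu> (\<lambda>x. pderiv_at j G x) - ball_mean \<mu> (\<lambda>x. (norm x)\<^sup>2 * pderiv_at j G x) = (2 * \<mu> + 1) * ball_mean \<mu> (\<lambda>x. x $ j * G x)"
    using ball_mean_by_parts[OF G, of j] G by (subst ball_mean_diff[symmetric]) (auto simp: algebra_simps)
  have "ball_mean \<mu> (\<lambda>x. pderiv_at j G x - x $ j * (\<Sum>i\<in>UNIV. x $ i * pderiv_at i G x) - (real CARD('n) + 2 * \<mu>) * (x $ j * G x)) =
    ball_mean \<mu> (\<lambda>x. pderiv_at j G x) - ball_mean \<mu> (\<lambda>x. x $ j * (\<Sum>i\<in>UNIV. x $ i * pderiv_at i G x)) - (real CARD('n) + 2 * \<mu>) * ball_mean \<mu> (\<lambda>x. x $ j * G x)"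
    using G by (simp add: ball_mean_diff ball_mean_cmult)
  also have "\<dots> = 0" using 2 3 by (simp add: algebra_simps)
  finally show ?thesis .
qed

text \<open>Apply \<open>ball_mean_divergence\<close> to \<open>G = Q \<partial>\<^sub>j P\<close> and sum over \<open>j\<close>: the derivatives that fall on
  \<open>Q\<close> add up to the bilinear form. Symmetry of \<open>D\<close> follows because that form is symmetric.\<close>

lemma ball_op_carre:
  fixes P Q :: "real^'n \<Rightarrow> real"
  assumes P: "P \<in> polys" and Q: "Q \<in> polys"
  shows "ball_mean \<mu> (\<lambda>x. Q x * ball_op \<mu> P x) = - ball_mean \<mu> (carre_du_champ P Q)"
proof -
  define T where "T j x = pderiv_at j (\<lambda>x. Q x * pderiv_at j P x) x - x $ j * (\<Sum>i\<in>UNIV. x $ i * pderiv_at i (\<lambda>x. Q x * pderiv_at j P x) x)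
     - (real CARD('n) + 2 * \<mu>) * (x $ j * (Q x * pderiv_at j P x))" for j x
  have "(\<lambda>x. Q x * ball_op \<mu> P x + carre_du_champ P Q x) = (\<lambda>x. \<Sum>j\<in>UNIV. T j x)"
  proof
    fix x
    define p q where "p i = pderiv_at i P x" and "q i = pderiv_at i Q x" for i
    define pp where "pp i j = pderiv_at i (pderiv_at j P) x" for i j
    have T: "T j x = (Q x * pp j j + p j * q j) - (\<Sum>i\<in>UNIV. Q x * (x $ i * x $ j * pp i j) + (x $ j * p j) * (x $ i * q i)) - (real CARD('n) + 2 * \<mu>) * (Q x * (x $ j * p j))" for j
      using P Q unfolding T_def by (simp add: pderiv_at_mult p_def q_def pp_def sum_distrib_left algebra_simps)
    have "(\<Sum>j\<in>UNIV. T j x) = (Q x * (\<Sum>j\<in>UNIV. pp j j) + (\<Sum>j\<in>UNIV. p j * q j))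
       - (Q x * (\<Sum>j\<in>UNIV. \<Sum>i\<in>UNIV. x $ i * x $ j * pp i j) + (\<Sum>j\<in>UNIV. x $ j * p j) * (\<Sum>i\<in>UNIV. x $ i * q i))
       - (real CARD('n) + 2 * \<mu>) * (Q x * (\<Sum>j\<in>UNIV. x $ j * p j))"
      unfolding T sum_product by (simp add: sum.distrib sum_subtractf sum_distrib_left)
    moreover have "(\<Sum>j\<in>UNIV. \<Sum>i\<in>UNIV. x $ i * x $ j * pp i j) = (\<Sum>i\<in>UNIV. \<Sum>j\<in>UNIV. x $ i * x $ j * pp i j)"
      by (rule sum.swap)
    ultimately show "Q x * ball_op \<mu> P x + carre_du_champ P Q x = (\<Sum>j\<in>UNIV. T j x)"
      unfolding ball_op_def carre_du_champ_def p_def[symmetric] q_def[symmetric] pp_def[symmetric]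
      by (simp add: algebra_simps)
  qed
  moreover have "ball_mean \<mu> (\<lambda>x. \<Sum>j\<in>UNIV. T j x) = (\<Sum>j\<in>UNIV. ball_mean \<mu> (T j))"
    using P Q by (intro ball_mean_sum) (auto simp: T_def)
  moreover have "ball_mean \<mu> (T j) = 0" for j
    unfolding T_def using P Q by (intro ball_mean_divergence) auto
  ultimately have "ball_mean \<mu> (\<lambda>x. Q x * ball_op \<mu> P x + carre_du_champ P Q x) = 0" by simp
  then show ?thesis using P Q by (subst (asm) ball_mean_add) auto
qed

lemma ball_op_symmetric:
  "P \<in> polys \<Longrightarrow> Q \<in> polys \<Longrightarrow> ball_mean \<mu> (\<lambda>x. ball_op \<mu> P x * Q x) = ball_mean \<mu> (\<lambda>x. P x * ball_op \<mu> Q x)"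
  using ball_op_carre[of P Q] ball_op_carre[of Q P] by (simp add: carre_commute mult.commute)

end

section \<open>Orthogonal polynomials and projection kernels\<close>

lemma polys_ray:
  assumes "P \<in> polys" shows "\<exists>p :: real poly. \<forall>t. P (t *\<^sub>R x) = poly p t"
proof -
  obtain n where "P \<in> polys_le n" using assms by (auto simp: polys_def)
  then show ?thesis
  proof (induction rule: polys_le_induct)
    case (const c)
    show ?case by (rule exI[of _ "[:c:]"]) simp
  next
    case (add n P Q)
    then obtain p q where "\<forall>t. P (t *\<^sub>R x) = poly p t" "\<forall>t. Q (t *\<^sub>R x) = poly q t" by blast
    then show ?case by (intro exI[of _ "p + q"]) simp
  next
    case (coord n P i)
    then obtain p where "\<forall>t. P (t *\<^sub>R x) = poly p t" by blast
    then show ?case by (intro exI[of _ "[:0, x $ i:] * p"]) simp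
  qed
qed

text \<open>On each line through the origin \<open>P\<close> is a polynomial in one variable that vanishes on an
  interval.\<close>

lemma polys_eq_0_if_ball:
  assumes P: "P \<in> polys" and 0: "\<And>x. norm x < 1 \<Longrightarrow> P x = 0"
  shows "P = (\<lambda>x. 0)"
proof
  fix x
  obtain p where p: "\<And>t. P (t *\<^sub>R x) = poly p t" using polys_ray[OF P] by blast
  define \<delta> where "\<delta> = 1 / (norm x + 1)"
  have \<delta>: "\<delta> > 0" by (simp add: \<delta>_def add_nonneg_pos)
  have "{0<..<\<delta>} \<subseteq> {t. poly p t = 0}"
  proof
    fix t assume t: "t \<in> {0<..<\<delta>}"
    have "norm (t *\<^sub>R x) \<le> t * (norm x + 1)" using t by (simp add: algebra_simps)
    also have "\<dots> < \<delta> * (norm x + 1)" using t by (intro mult_strict_right_mono) (auto simp: add_nonneg_pos)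
    also have "\<dots> = 1" proof -
      have "norm x + 1 \<noteq> 0" using norm_ge_zero[of x] by linarith
      then show ?thesis by (simp add: \<delta>_def)
    qed
    finally have "P (t *\<^sub>R x) = 0" by (rule 0)
    then show "t \<in> {t. poly p t = 0}" by (simp add: p)
  qed
  moreover have "infinite {0<..<\<delta>}" using \<delta> by (simp add: infinite_Ioo)
  ultimately have "p = 0" using poly_roots_finite[of p] finite_subset by blast
  then show "P x = 0" using p[of 1] by simp
qed

lemma weighted_inner_eq: "weighted_inner \<mu> P Q = ball_mean \<mu> (\<lambda>x. P x * Q x)"
  by (simp add: weighted_inner_def ball_mean_def)

lemma weighted_inner_commute: "weighted_inner \<mu> P Q = weighted_inner \<mu> Q P"
  by (simp add: weighted_inner_eq mult.commute)

definition lin_closed :: "('a \<Rightarrow> real) set \<Rightarrow> bool" where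
  "lin_closed V \<longleftrightarrow> (\<lambda>x. 0) \<in> V \<and> (\<forall>P\<in>V. \<forall>Q\<in>V. (\<lambda>x. P x + Q x) \<in> V) \<and> (\<forall>P\<in>V. \<forall>c. (\<lambda>x. c * P x) \<in> V)"

lemma lin_closed_add: "lin_closed V \<Longrightarrow> P \<in> V \<Longrightarrow> Q \<in> V \<Longrightarrow> (\<lambda>x. P x + Q x) \<in> V"
  by (simp add: lin_closed_def)
lemma lin_closed_cmult: "lin_closed V \<Longrightarrow> P \<in> V \<Longrightarrow> (\<lambda>x. c * P x) \<in> V"
  by (simp add: lin_closed_def)

lemma lin_closed_sum:
  assumes "lin_closed V" "\<And>a. a \<in> A \<Longrightarrow> P a \<in> V" shows "(\<lambda>x. \<Sum>a\<in>A. c a * P a x) \<in> V"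
  using assms(2) by (induction A rule: infinite_finite_induct) (use assms(1) in \<open>auto simp: lin_closed_def\<close>)

lemma lin_closed_polys_le: "lin_closed (polys_le n)"
  by (auto simp: lin_closed_def intro: polys_le_add polys_le_cmult)

text \<open>The linear span for finite \<open>B\<close>, in the shape in which \<open>orthonormal_basis\<close> speaks of linear
  combinations.\<close>

definition lin_span :: "('a \<Rightarrow> real) set \<Rightarrow> ('a \<Rightarrow> real) set" where
  "lin_span B = {P. \<exists>c. P = (\<lambda>x. \<Sum>Q\<in>B. c Q * Q x)}"

lemma lin_spanI: "P = (\<lambda>x. \<Sum>Q\<in>B. c Q * Q x) \<Longrightarrow> P \<in> lin_span B" by (auto simp: lin_span_def)

lemma lin_closed_span: "lin_closed (lin_span B)"
  unfolding lin_closed_def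
proof (intro conjI ballI allI)
  show "(\<lambda>x. 0) \<in> lin_span B" by (rule lin_spanI[where c = "\<lambda>_. 0"]) simp
  fix P assume "P \<in> lin_span B"
  then obtain p where p: "P = (\<lambda>x. \<Sum>Q\<in>B. p Q * Q x)" by (auto simp: lin_span_def)
  show "(\<lambda>x. c * P x) \<in> lin_span B" for c
    unfolding p by (rule lin_spanI[where c = "\<lambda>Q. c * p Q"]) (simp add: sum_distrib_left mult.assoc)
  fix R assume "R \<in> lin_span B"
  then obtain r where r: "R = (\<lambda>x. \<Sum>Q\<in>B. r Q * Q x)" by (auto simp: lin_span_def)
  show "(\<lambda>x. P x + R x) \<in> lin_span B"
    unfolding p r by (rule lin_spanI[where c = "\<lambda>Q. p Q + r Q"]) (simp add: sum.distrib distrib_right)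
qed

lemma lin_span_superset: "finite B \<Longrightarrow> P \<in> B \<Longrightarrow> P \<in> lin_span B"
proof (rule lin_spanI[where c = "\<lambda>Q. if Q = P then 1 else 0"], rule ext)
  fix x assume "finite B" "P \<in> B"
  then have "P x = (\<Sum>Q\<in>B. if Q = P then P x else 0)" by simp
  also have "\<dots> = (\<Sum>Q\<in>B. (if Q = P then 1 else 0) * Q x)" by (intro sum.cong) auto
  finally show "P x = (\<Sum>Q\<in>B. (if Q = P then 1 else 0) * Q x)" .
qed

lemma lin_span_mono: "finite B' \<Longrightarrow> B \<subseteq> B' \<Longrightarrow> P \<in> lin_span B \<Longrightarrow> P \<in> lin_span B'"
proof -
  assume *: "finite B'" "B \<subseteq> B'" "P \<in> lin_span B"
  then obtain p where p: "P = (\<lambda>x. \<Sum>Q\<in>B. p Q * Q x)" by (auto simp: lin_span_def)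
  show ?thesis unfolding p
    using * by (intro lin_closed_sum lin_closed_span lin_span_superset) auto
qed

context
  fixes \<mu> :: real
  assumes mu: "\<mu> \<ge> 0"
begin

text \<open>The weight is positive on the open ball, and a continuous function that vanishes almost
  everywhere on an open set vanishes on all of it.\<close>

lemma weighted_inner_definite:
  assumes P: "P \<in> polys" and 0: "weighted_inner \<mu> P P = 0"
  shows "P = (\<lambda>x. 0)"
proof (rule polys_eq_0_if_ball[OF P])
  have "integrable (ball_measure \<mu>) (\<lambda>x. P x * P x)" using P by (intro integrable_ball_polys mu) auto
  then have "AE x in ball_measure \<mu>. P x * P x = 0"
    using 0 by (intro integral_nonneg_eq_0_iff_AE[THEN iffD1]) (auto simp: weighted_inner_def)
  then have "AE x in lborel. 0 < ennreal (indicator (ball 0 1) x * ball_weight \<mu> x) \<longrightarrow> P x = 0"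
    unfolding ball_measure_def by (subst (asm) AE_density) (auto simp: ball_weight_def)
  then have "AE x in lborel. \<not> (x \<in> ball 0 1 \<and> P x \<noteq> 0)"
  proof eventually_elim
    case (elim x)
    have "x \<in> ball 0 1 \<Longrightarrow> ball_weight \<mu> x > 0"
      using power_strict_mono[of "norm x" 1 2] by (simp add: ball_weight_def)
    with elim show ?case by auto
  qed
  then have "{x. x \<in> ball 0 1 \<and> P x \<noteq> 0} \<in> null_sets lborel"
  proof -
    have [measurable]: "P \<in> borel_measurable borel"
      using polys_continuous[OF P, of UNIV] by (rule borel_measurable_continuous_onI)
    have "{x. x \<in> ball 0 1 \<and> P x \<noteq> 0} \<in> sets borel" by measurable
    then have "{x. x \<in> ball 0 1 \<and> P x \<noteq> 0} \<in> sets lborel" by simp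
    then show ?thesis
      using \<open>AE x in lborel. \<not> (x \<in> ball 0 1 \<and> P x \<noteq> 0)\<close> by (subst AE_iff_null_sets) auto
  qed
  then have "negligible {x. x \<in> ball 0 1 \<and> P x \<noteq> 0}"
    by (simp add: negligible_iff_null_sets null_sets_completionI)
  moreover have "open {x. x \<in> ball 0 1 \<and> P x \<noteq> 0}"
  proof -
    have "open {x. P x \<noteq> 0}"
      using open_vimage[OF open_Compl[OF closed_singleton[of 0]] polys_continuous[OF P, of UNIV]]
      by (simp add: vimage_def)
    then have "open (ball 0 1 \<inter> {x. P x \<noteq> 0})" by (intro open_Int open_ball)
    then show ?thesis by (simp add: Int_def)
  qed
  ultimately have "{x. x \<in> ball 0 1 \<and> P x \<noteq> 0} = {}" using open_not_negligible by blast
  then show "P x = 0" if "norm x < 1" for x using that by auto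
qed

lemma weighted_inner_add_left: "P \<in> polys \<Longrightarrow> Q \<in> polys \<Longrightarrow> R \<in> polys \<Longrightarrow>
    weighted_inner \<mu> (\<lambda>x. P x + Q x) R = weighted_inner \<mu> P R + weighted_inner \<mu> Q R"
  unfolding weighted_inner_eq by (subst ball_mean_add[OF mu, symmetric]) (auto simp: distrib_right)

lemma weighted_inner_cmult_left: "weighted_inner \<mu> (\<lambda>x. c * P x) R = c * weighted_inner \<mu> P R"
  unfolding weighted_inner_eq by (simp add: ball_mean_cmult[OF mu, symmetric] mult.assoc)

lemma weighted_inner_sum_left: "(\<And>a. a \<in> A \<Longrightarrow> P a \<in> polys) \<Longrightarrow> R \<in> polys \<Longrightarrow>
    weighted_inner \<mu> (\<lambda>x. \<Sum>a\<in>A. c a * P a x) R = (\<Sum>a\<in>A. c a * weighted_inner \<mu> (P a) R)"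
  unfolding weighted_inner_eq
  by (simp add: sum_distrib_right ball_mean_sum[OF mu] ball_mean_cmult[OF mu, symmetric] mult.assoc)

lemma weighted_inner_diff_left: "P \<in> polys \<Longrightarrow> Q \<in> polys \<Longrightarrow> R \<in> polys \<Longrightarrow>
    weighted_inner \<mu> (\<lambda>x. P x - Q x) R = weighted_inner \<mu> P R - weighted_inner \<mu> Q R"
  unfolding weighted_inner_eq by (subst ball_mean_diff[OF mu, symmetric]) (auto simp: left_diff_distrib)

definition orthonormal :: "(real^'n \<Rightarrow> real) set \<Rightarrow> bool" where
  "orthonormal B \<longleftrightarrow> (\<forall>P\<in>B. \<forall>Q\<in>B. weighted_inner \<mu> P Q = (if P = Q then 1 else 0))"

definition proj_onto :: "(real^'n \<Rightarrow> real) set \<Rightarrow> (real^'n \<Rightarrow> real) \<Rightarrow> real^'n \<Rightarrow> real" where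
  "proj_onto B P x = (\<Sum>Q\<in>B. weighted_inner \<mu> P Q * Q x)"

lemma orth_proj:
  assumes B: "finite B" "B \<subseteq> polys" "orthonormal B" and P: "P \<in> polys" and Q: "Q \<in> B"
  shows "weighted_inner \<mu> (\<lambda>x. P x - proj_onto B P x) Q = 0"
proof -
  have "weighted_inner \<mu> (\<lambda>x. P x - proj_onto B P x) Q = weighted_inner \<mu> P Q - weighted_inner \<mu> (proj_onto B P) Q"
    unfolding proj_onto_def using B P Q by (intro weighted_inner_diff_left polys_sum polys_mult polys_const) auto
  also have "weighted_inner \<mu> (proj_onto B P) Q = (\<Sum>R\<in>B. weighted_inner \<mu> P R * weighted_inner \<mu> R Q)"
    unfolding proj_onto_def using B Q by (intro weighted_inner_sum_left) auto
  also have "\<dots> = (\<Sum>R\<in>B. if R = Q then weighted_inner \<mu> P R else 0)"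
    using B Q unfolding orthonormal_def by (intro sum.cong) auto
  also have "\<dots> = weighted_inner \<mu> P Q" using B(1) Q by simp
  finally show ?thesis by simp
qed

text \<open>The space \<open>V\<close> is carried along because the family obtained has to consist of elements of the
  space that it spans.\<close>

lemma gram_schmidt:
  fixes S :: "(real^'n \<Rightarrow> real) set"
  assumes "finite S" "S \<subseteq> V" "S \<subseteq> polys" "lin_closed V"
  shows "\<exists>B. finite B \<and> B \<subseteq> V \<and> B \<subseteq> polys \<and> orthonormal B \<and> S \<subseteq> lin_span B"
  using assms(1-3)
proof (induction S)
  case empty
  show ?case by (rule exI[of _ "{}"]) (simp add: orthonormal_def)
next
  case (insert P S)
  then obtain B where B: "finite B" "B \<subseteq> V" "B \<subseteq> polys" "orthonormal B" "S \<subseteq> lin_span B" by auto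
  have P: "P \<in> V" "P \<in> polys" using insert.prems by auto
  have proj: "proj_onto B P \<in> V" "proj_onto B P \<in> polys" "proj_onto B P \<in> lin_span B"
    unfolding proj_onto_def using B assms(4)
    by (auto intro!: lin_closed_sum lin_spanI polys_sum polys_mult polys_const)
  define r where "r x = P x - proj_onto B P x" for x
  have r: "r \<in> polys" unfolding r_def using P proj by auto
  have "(\<lambda>x. P x + (-1) * proj_onto B P x) \<in> V" using assms(4) P proj by (intro lin_closed_add lin_closed_cmult)
  then have rV: "r \<in> V" by (simp add: r_def[abs_def])
  have ro: "weighted_inner \<mu> r Q = 0" if "Q \<in> B" for Q
    unfolding r_def using B P that by (intro orth_proj) auto
  show ?case
  proof (cases "r = (\<lambda>x. 0)")
    case True
    then have "P = proj_onto B P" by (auto simp: r_def fun_eq_iff)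
    then have "P \<in> lin_span B" using proj by simp
    then show ?thesis using B by auto
  next
    case False
    have rr: "weighted_inner \<mu> r r > 0"
    proof -
      have "weighted_inner \<mu> r r \<ge> 0" unfolding weighted_inner_def by (intro integral_nonneg_AE) auto
      moreover have "weighted_inner \<mu> r r \<noteq> 0" using weighted_inner_definite[OF r] False by auto
      ultimately show ?thesis by simp
    qed
    define k where "k = 1 / sqrt (weighted_inner \<mu> r r)"
    have k: "k > 0" "k * k * weighted_inner \<mu> r r = 1" using rr by (auto simp: k_def)
    define e where "e x = k * r x" for x
    have e: "e \<in> polys" "e \<in> V" unfolding e_def using r rV assms(4) by (auto simp: lin_closed_def)
    have eo: "weighted_inner \<mu> e Q = 0" if "Q \<in> B" for Q
      unfolding e_def weighted_inner_cmult_left using ro[OF that] by simp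
    have ee: "weighted_inner \<mu> e e = 1"
      unfolding e_def weighted_inner_cmult_left
      by (subst weighted_inner_commute, unfold weighted_inner_cmult_left) (use k in \<open>simp add: mult.assoc\<close>)
    have eB: "e \<notin> B" using eo[of e] ee by auto
    have on: "orthonormal (insert e B)"
      unfolding orthonormal_def
    proof (intro ballI)
      fix P Q assume PQ: "P \<in> insert e B" "Q \<in> insert e B"
      have oe: "weighted_inner \<mu> R e = 0" if "R \<in> B" for R
        using eo[OF that] by (simp add: weighted_inner_commute)
      have BB: "weighted_inner \<mu> P Q = (if P = Q then 1 else 0)" if "P \<in> B" "Q \<in> B"
        using B(4) that unfolding orthonormal_def by blast
      show "weighted_inner \<mu> P Q = (if P = Q then 1 else 0)"
        using PQ eB by (elim insertE) (simp_all only: ee eo oe BB, simp_all, auto)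
    qed
    have "P \<in> lin_span (insert e B)"
    proof -
      have "e \<in> lin_span (insert e B)" "proj_onto B P \<in> lin_span (insert e B)"
        using B(1) proj(3) by (auto intro: lin_span_superset lin_span_mono)
      then have "(\<lambda>x. (1 / k) * e x + proj_onto B P x) \<in> lin_span (insert e B)"
        by (intro lin_closed_add lin_closed_cmult lin_closed_span)
      moreover have "(\<lambda>x. (1 / k) * e x + proj_onto B P x) = P" using k(1) by (auto simp: e_def r_def)
      ultimately show ?thesis by simp
    qed
    moreover have "S \<subseteq> lin_span (insert e B)" using B(1,5) by (auto intro: lin_span_mono)
    ultimately have "insert P S \<subseteq> lin_span (insert e B)" by simp
    moreover have "finite (insert e B)" "insert e B \<subseteq> V" "insert e B \<subseteq> polys" using B e by simp_all
    ultimately show ?thesis using on by blast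
  qed
qed

lemma orthonormal_basis_of_span:
  fixes S :: "(real^'n \<Rightarrow> real) set"
  assumes "finite S" "S \<subseteq> V" "V \<subseteq> polys" "lin_closed V" "V \<subseteq> lin_span S"
  shows "\<exists>B. orthonormal_basis \<mu> V B"
proof -
  obtain B where B: "finite B" "B \<subseteq> V" "B \<subseteq> polys" "orthonormal B" "S \<subseteq> lin_span B"
    using gram_schmidt[of S V] assms by blast
  have "P \<in> lin_span B" if P: "P \<in> V" for P
  proof -
    obtain c where c: "P = (\<lambda>x. \<Sum>Q\<in>S. c Q * Q x)" using P assms(5) by (auto simp: lin_span_def)
    show ?thesis unfolding c using B(5) by (intro lin_closed_sum lin_closed_span) auto
  qed
  then show ?thesis using B unfolding orthonormal_basis_def orthonormal_def lin_span_def by blast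
qed

definition monomials :: "nat \<Rightarrow> (real^'n \<Rightarrow> real) set" where
  "monomials n = (\<lambda>\<alpha> x. \<Prod>i\<in>UNIV. (x $ i) ^ \<alpha> i) ` {\<alpha>. (\<Sum>i\<in>UNIV. \<alpha> i) \<le> n}"

lemma finite_monomials: "finite (monomials n)"
  unfolding monomials_def by (intro finite_imageI finite_multi_indices)

lemma monomials_subset: "monomials n \<subseteq> polys_le n"
  unfolding monomials_def using polys_le_monomial[of _ n 1] by auto

lemma polys_le_subset_span: "polys_le n \<subseteq> lin_span (monomials n)"
proof
  fix P :: "real^'n \<Rightarrow> real" assume "P \<in> polys_le n"
  then obtain c where c: "P = (\<lambda>x. \<Sum>\<alpha> | (\<Sum>i\<in>UNIV. \<alpha> i) \<le> n. c \<alpha> * (\<Prod>i\<in>UNIV. (x $ i) ^ \<alpha> i))" by (rule polys_leE)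
  show "P \<in> lin_span (monomials n)" unfolding c
    by (intro lin_closed_sum lin_closed_span lin_span_superset finite_monomials) (auto simp: monomials_def)
qed

lemma polys_lt_basis: "\<exists>B. orthonormal_basis \<mu> (polys_lt n) B"
proof (cases n)
  case 0
  then show ?thesis by (intro exI[of _ "{}"]) (auto simp: orthonormal_basis_def polys_lt_def)
next
  case (Suc m)
  then show ?thesis
    using orthonormal_basis_of_span[OF finite_monomials monomials_subset subsetI[OF polysI] lin_closed_polys_le polys_le_subset_span]
    by simp
qed

text \<open>The exceptional elements in the definition of \<open>orth_polys\<close> fit a uniform description: a
  polynomial of degree less than \<open>n\<close> that is orthogonal to all such polynomials is orthogonal to
  itself, hence zero.\<close>

lemma orth_polys_eq: "orth_polys \<mu> n = {P \<in> polys_le n. \<forall>Q\<in>polys_lt n. weighted_inner \<mu> P Q = 0}"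
proof (cases n)
  case 0
  then show ?thesis by (auto simp: orth_polys_def polys_le_0 polys_lt_def weighted_inner_eq ball_mean_def)
next
  case (Suc m)
  have "P = (\<lambda>x. 0)" if "P \<in> polys_le m" "\<forall>Q\<in>polys_le m. weighted_inner \<mu> P Q = 0" for P :: "real^'a \<Rightarrow> real"
    using that weighted_inner_definite[of P] polysI by blast
  moreover have "weighted_inner \<mu> (\<lambda>x. 0) Q = 0" for Q :: "real^'a \<Rightarrow> real" by (simp add: weighted_inner_def)
  ultimately show ?thesis using Suc by (auto simp: orth_polys_def)
qed

lemma orth_polys_polys: "P \<in> orth_polys \<mu> n \<Longrightarrow> P \<in> polys"
  by (auto simp: orth_polys_eq intro: polysI)

lemma polys_lt_polys: "P \<in> polys_lt n \<Longrightarrow> P \<in> polys"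
  using polys_lt_le polysI by blast

lemma lin_closed_orth_polys: "lin_closed (orth_polys \<mu> n)"
  unfolding lin_closed_def
proof (intro conjI ballI allI)
  show "(\<lambda>x. 0) \<in> orth_polys \<mu> n" by (simp add: orth_polys_eq weighted_inner_def)
  fix P :: "real^'a \<Rightarrow> real" assume P: "P \<in> orth_polys \<mu> n"
  then show "(\<lambda>x. c * P x) \<in> orth_polys \<mu> n" for c
    by (simp add: orth_polys_eq polys_le_cmult weighted_inner_cmult_left)
  fix Q :: "real^'a \<Rightarrow> real" assume Q: "Q \<in> orth_polys \<mu> n"
  show "(\<lambda>x. P x + Q x) \<in> orth_polys \<mu> n"
    using P Q orth_polys_polys[OF P] orth_polys_polys[OF Q]
    by (simp add: orth_polys_eq polys_le_add weighted_inner_add_left polys_lt_polys)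
qed

text \<open>Ensures that the choice in \<open>proj_kernel\<close> picks an orthonormal basis. The monomials of degree
  at most \<open>n\<close>, minus their projections to the polynomials of lower degree, span the space.\<close>

lemma orth_polys_basis: "\<exists>B. orthonormal_basis \<mu> (orth_polys \<mu> n :: (real^'n \<Rightarrow> real) set) B"
proof -
  obtain B :: "(real^'n \<Rightarrow> real) set" where "orthonormal_basis \<mu> (polys_lt n) B" using polys_lt_basis by blast
  then have B: "finite B" "B \<subseteq> polys_lt n" "orthonormal B" "polys_lt n \<subseteq> lin_span B"
    unfolding orthonormal_basis_def orthonormal_def lin_span_def by blast+
  have Bp: "B \<subseteq> polys" using B(2) polys_lt_polys by blast
  define S where "S = (\<lambda>P x. P x - proj_onto B P x) ` monomials n"
  have le: "(\<lambda>x. P x - proj_onto B P x) \<in> polys_le n" if "P \<in> polys_le n" for P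
    unfolding proj_onto_def using B(2) polys_lt_le that
    by (intro polys_le_diff polys_le_sum polys_le_cmult) auto
  have "S \<subseteq> orth_polys \<mu> n"
  proof
    fix R assume "R \<in> S"
    then obtain P where P: "P \<in> monomials n" and R: "R = (\<lambda>x. P x - proj_onto B P x)" by (auto simp: S_def)
    have P': "P \<in> polys_le n" using P monomials_subset by blast
    have "weighted_inner \<mu> R Q = 0" if Q: "Q \<in> polys_lt n" for Q
    proof -
      obtain c where c: "Q = (\<lambda>x. \<Sum>b\<in>B. c b * b x)" using Q B(4) by (auto simp: lin_span_def)
      have "weighted_inner \<mu> Q R = (\<Sum>b\<in>B. c b * weighted_inner \<mu> b R)"
        unfolding c using Bp le[OF P'] by (intro weighted_inner_sum_left) (auto simp: R intro: polysI)
      also have "\<dots> = 0"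
        using orth_proj[OF B(1) Bp B(3) polysI[OF P']] by (intro sum.neutral) (simp add: R weighted_inner_commute)
      finally show ?thesis by (simp add: weighted_inner_commute)
    qed
    then show "R \<in> orth_polys \<mu> n" unfolding orth_polys_eq using le[OF P'] by (simp add: R)
  qed
  moreover have "orth_polys \<mu> n \<subseteq> lin_span S"
  proof
    fix P :: "real^'n \<Rightarrow> real" assume P: "P \<in> orth_polys \<mu> n"
    then have P': "P \<in> polys_le n" "\<And>Q. Q \<in> polys_lt n \<Longrightarrow> weighted_inner \<mu> P Q = 0" by (auto simp: orth_polys_eq)
    obtain c where c: "P = (\<lambda>x. \<Sum>Q\<in>monomials n. c Q * Q x)" using P'(1) polys_le_subset_span by (auto simp: lin_span_def)
    have mp: "\<And>Q. Q \<in> monomials n \<Longrightarrow> Q \<in> polys" using monomials_subset polysI by blast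
    have "(\<Sum>Q\<in>monomials n. c Q * proj_onto B Q x) = (\<Sum>b\<in>B. weighted_inner \<mu> P b * b x)" for x
    proof -
      have "weighted_inner \<mu> P b = (\<Sum>Q\<in>monomials n. c Q * weighted_inner \<mu> Q b)" if "b \<in> B" for b
        unfolding c using Bp mp that by (intro weighted_inner_sum_left) auto
      then show ?thesis
        unfolding proj_onto_def by (simp add: sum_distrib_left sum_distrib_right mult.assoc) (rule sum.swap)
    qed
    also have "(\<Sum>b\<in>B. weighted_inner \<mu> P b * b x) = 0" for x
      using P'(2) B(2) by (intro sum.neutral) auto
    finally have "P = (\<lambda>x. \<Sum>Q\<in>monomials n. c Q * (Q x - proj_onto B Q x))"
      by (subst c) (simp add: algebra_simps sum_subtractf)
    moreover have "(\<lambda>x. \<Sum>Q\<in>monomials n. c Q * (Q x - proj_onto B Q x)) \<in> lin_span S"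
      using finite_monomials by (intro lin_closed_sum lin_closed_span lin_span_superset) (auto simp: S_def)
    ultimately show "P \<in> lin_span S" by simp
  qed
  moreover have "finite S" unfolding S_def by (intro finite_imageI finite_monomials)
  ultimately show ?thesis
    using lin_closed_orth_polys orth_polys_polys by (intro orthonormal_basis_of_span[of S]) auto
qed

definition orth_basis :: "nat \<Rightarrow> (real^'n \<Rightarrow> real) set" where
  "orth_basis n = (SOME B. orthonormal_basis \<mu> (orth_polys \<mu> n) B)"

lemma orth_basis: "orthonormal_basis \<mu> (orth_polys \<mu> n) (orth_basis n)"
  unfolding orth_basis_def using orth_polys_basis by (rule someI_ex)

lemma proj_kernel_eq: "proj_kernel \<mu> n x y = (\<Sum>P\<in>orth_basis n. P x * P y)"
  by (simp add: proj_kernel_def orth_basis_def)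

lemma finite_orth_basis [simp]: "finite (orth_basis n)"
  by (rule conjunct1[OF orth_basis[unfolded orthonormal_basis_def]])

lemma orth_basis_orth_polys: "P \<in> orth_basis n \<Longrightarrow> P \<in> orth_polys \<mu> n"
  using orth_basis[of n] by (auto simp: orthonormal_basis_def)

lemma orth_basis_polys [simp]: "P \<in> orth_basis n \<Longrightarrow> P \<in> polys"
  using orth_basis_orth_polys orth_polys_polys by blast

lemma orth_basis_inner: "P \<in> orth_basis n \<Longrightarrow> Q \<in> orth_basis n \<Longrightarrow> weighted_inner \<mu> P Q = (if P = Q then 1 else 0)"
  using orth_basis[of n] by (auto simp: orthonormal_basis_def)

lemma orth_polys_orthogonal:
  assumes "P \<in> orth_polys \<mu> n" "Q \<in> orth_polys \<mu> m" "n \<noteq> m"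
  shows "weighted_inner \<mu> P Q = 0"
proof -
  have *: "weighted_inner \<mu> P Q = 0" if "P \<in> orth_polys \<mu> n" "Q \<in> orth_polys \<mu> m" "m < n" for n m P Q
  proof -
    have "Q \<in> polys_lt n" using that polys_le_mono[of Q m "n - 1"] by (auto simp: orth_polys_eq polys_lt_def)
    then show ?thesis using that by (auto simp: orth_polys_eq)
  qed
  show ?thesis
  proof (cases "m < n")
    case True then show ?thesis using * assms by blast
  next
    case False
    then have "weighted_inner \<mu> Q P = 0" using * assms by force
    then show ?thesis by (simp add: weighted_inner_commute)
  qed
qed

lemma orth_basis_expansion:
  assumes P: "P \<in> orth_polys \<mu> n"
  shows "P x = (\<Sum>Q\<in>orth_basis n. weighted_inner \<mu> P Q * Q x)"
proof -
  obtain c where c: "P = (\<lambda>x. \<Sum>Q\<in>orth_basis n. c Q * Q x)"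
    using P orth_basis[of n] unfolding orthonormal_basis_def by blast
  have "weighted_inner \<mu> P R = c R" if R: "R \<in> orth_basis n" for R
  proof -
    have "weighted_inner \<mu> P R = (\<Sum>Q\<in>orth_basis n. c Q * weighted_inner \<mu> Q R)"
      unfolding c using R by (intro weighted_inner_sum_left) auto
    also have "\<dots> = (\<Sum>Q\<in>orth_basis n. if Q = R then c Q else 0)"
      using R by (intro sum.cong) (auto simp: orth_basis_inner)
    finally show ?thesis using R by simp
  qed
  then have "(\<Sum>Q\<in>orth_basis n. weighted_inner \<mu> P Q * Q x) = (\<Sum>Q\<in>orth_basis n. c Q * Q x)"
    by (intro sum.cong) auto
  then show ?thesis using fun_cong[OF c, of x] by simp
qed

text \<open>Let \<open>Q\<close> have degree at most \<open>k < n\<close>. By symmetry of \<open>D\<close>, the number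
  \<open>eigval l k - eigval l n\<close> times the inner product of \<open>P\<close> and \<open>Q\<close> is the inner product of \<open>P\<close>
  with \<open>D Q + eigval l k Q\<close>, a polynomial of degree less than \<open>k\<close>. As the eigenvalues are
  distinct, induction on \<open>k\<close> shows that \<open>P\<close> is orthogonal to all polynomials of lower degree.\<close>

lemma eigenfunction_in_orth_polys:
  fixes P :: "real^'n \<Rightarrow> real"
  assumes P: "P \<in> polys_le n" and l: "l = \<mu> + (real CARD('n) - 1) / 2"
    and eig: "ball_op \<mu> P = (\<lambda>x. - eigval l n * P x)"
  shows "P \<in> orth_polys \<mu> n"
proof -
  have Pp: "P \<in> polys" using P by (rule polysI)
  have l0: "l \<ge> 0"
  proof -
    have "real CARD('n) \<ge> 1" using zero_less_card_finite[where ?'a = 'n] by linarith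
    then show ?thesis using mu unfolding l by simp
  qed
  have ev: "eigval l k < eigval l n" if "k < n" for k
    unfolding eigval_def using that l0 by (intro mult_strict_mono) auto
  have main: "weighted_inner \<mu> P Q = 0" if "k < n" "Q \<in> polys_le k" for k Q
    using that
  proof (induction k arbitrary: Q rule: less_induct)
    case (less k)
    have Q: "Q \<in> polys" using less.prems polysI by blast
    define R where "R x = ball_op \<mu> Q x + eigval l k * Q x" for x
    have R: "R \<in> polys_lt k" unfolding R_def using ball_op_mod_lower[OF less.prems(2) l] .
    have "weighted_inner \<mu> P R = 0"
    proof (cases k)
      case 0
      then have "R = (\<lambda>x. 0)" using R by (simp add: polys_lt_def)
      then show ?thesis by (simp add: weighted_inner_def)
    next
      case (Suc m)
      then show ?thesis using less.IH[of m R] less.prems R by simp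
    qed
    moreover have "weighted_inner \<mu> P R = weighted_inner \<mu> (ball_op \<mu> Q) P + eigval l k * weighted_inner \<mu> P Q"
      unfolding weighted_inner_commute[of \<mu> P] R_def
      using Q Pp by (subst weighted_inner_add_left) (auto simp: weighted_inner_cmult_left)
    moreover have "weighted_inner \<mu> (ball_op \<mu> Q) P = - eigval l n * weighted_inner \<mu> P Q"
      using ball_op_symmetric[OF mu Q Pp] unfolding eig weighted_inner_eq
      by (simp add: ball_mean_cmult[OF mu, symmetric] mult_ac)
    ultimately have "(eigval l k - eigval l n) * weighted_inner \<mu> P Q = 0" by (simp add: algebra_simps)
    then show ?case using ev[OF less.prems(1)] by simp
  qed
  show ?thesis unfolding orth_polys_eq
  proof (intro CollectI conjI ballI P)
    fix Q :: "real^'n \<Rightarrow> real" assume Q: "Q \<in> polys_lt n"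
    show "weighted_inner \<mu> P Q = 0"
    proof (cases n)
      case 0
      then show ?thesis using Q by (simp add: polys_lt_def weighted_inner_def)
    next
      case (Suc m)
      then show ?thesis using main[of m Q] Q by simp
    qed
  qed
qed

end

section \<open>Gegenbauer means of exponentials\<close>

text \<open>The mean for the probability density proportional to \<open>(1 - u\<^sup>2) powr (a - 1)\<close> on \<open>(-1, 1)\<close>.
  For \<open>a \<rightarrow> 0\<close> these measures converge to the mean of the point masses at \<open>1\<close> and \<open>-1\<close>, which is
  taken as the value at \<open>a = 0\<close>.\<close>

definition gegenbauer_mean :: "real \<Rightarrow> (real \<Rightarrow> real) \<Rightarrow> real" where
  "gegenbauer_mean a f = (if a = 0 then (f 1 + f (-1)) / 2
     else (\<integral>u. f u \<partial>jacobi_measure a) / measure (jacobi_measure a) (UNIV :: real set))"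

lemma jacobi_mass_pos:
  assumes "0 < a" shows "measure (jacobi_measure a) (UNIV :: real set) > 0"
proof (rule ccontr)
  interpret finite_measure "jacobi_measure a :: real measure" by (rule finite_measure_jacobi[OF assms])
  assume "\<not> ?thesis"
  then have "measure (jacobi_measure a) (UNIV :: real set) = 0" by (simp add: zero_less_measure_iff)
  then have "UNIV \<in> null_sets (jacobi_measure a :: real measure)"
    by (intro null_setsI) (simp_all add: emeasure_eq_measure)
  then have "AE x in jacobi_measure a. (x::real) \<noteq> x"
    by (intro AE_I'[where N = UNIV]) auto
  then have "AE x in lborel. 0 < ennreal (indicator (ball 0 1) (x::real) * (1 - (norm x)\<^sup>2) powr (a - 1)) \<longrightarrow> False"
    unfolding jacobi_measure_def by (subst (asm) AE_density) auto
  then have "AE x in lborel. (x::real) \<notin> ball 0 1"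
  proof (rule eventually_mono)
    fix x :: real
    assume elim: "0 < ennreal (indicator (ball 0 1) x * (1 - (norm x)\<^sup>2) powr (a - 1)) \<longrightarrow> False"
    show "x \<notin> ball 0 1"
    proof
      assume "x \<in> ball 0 1"
      moreover from this have "(norm x)\<^sup>2 < 1" using power_strict_mono[of "norm x" 1 2] by simp
      ultimately show False using elim by (simp add: ennreal_zero_less_mult_iff)
    qed
  qed
  then have "ball (0::real) 1 \<in> null_sets lborel" by (subst AE_iff_null_sets) auto
  then show False by (simp add: null_sets_def ball_eq_greaterThanLessThan)
qed

lemma continuous_real_poly: "continuous_on A (poly p :: real \<Rightarrow> real)"
  by (intro continuous_intros)

context
  fixes a :: real
  assumes a: "a \<ge> 0"
begin

lemma integrable_gegenbauer: "a > 0 \<Longrightarrow> continuous_on UNIV f \<Longrightarrow> integrable (jacobi_measure a) (f :: real \<Rightarrow> real)"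
  by (rule integrable_jacobi_continuous)

lemma gegenbauer_mean_add:
  assumes "continuous_on UNIV f" "continuous_on UNIV g"
  shows "gegenbauer_mean a (\<lambda>u. f u + g u) = gegenbauer_mean a f + gegenbauer_mean a g"
  using a assms integrable_gegenbauer[of f] integrable_gegenbauer[of g]
  by (simp add: gegenbauer_mean_def add_divide_distrib)

lemma gegenbauer_mean_cmult: "gegenbauer_mean a (\<lambda>u. c * f u) = c * gegenbauer_mean a f"
  by (simp add: gegenbauer_mean_def algebra_simps)

lemma gegenbauer_mean_sum:
  assumes "\<And>i. i \<in> I \<Longrightarrow> continuous_on UNIV (f i)"
  shows "gegenbauer_mean a (\<lambda>u. \<Sum>i\<in>I. f i u) = (\<Sum>i\<in>I. gegenbauer_mean a (f i))"
  using assms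
proof (induction I rule: infinite_finite_induct)
  case (insert i I)
  then show ?case by (simp add: gegenbauer_mean_add continuous_on_sum)
qed (simp_all add: gegenbauer_mean_def)

lemma gegenbauer_mean_const [simp]: "gegenbauer_mean a (\<lambda>u. c) = c"
  using a jacobi_mass_pos[of a] by (cases "a = 0") (auto simp: gegenbauer_mean_def)

lemma gegenbauer_mean_mono:
  assumes "continuous_on UNIV f" "continuous_on UNIV g" "\<And>u. \<bar>u\<bar> \<le> 1 \<Longrightarrow> f u \<le> g u"
  shows "gegenbauer_mean a f \<le> gegenbauer_mean a g"
proof (cases "a = 0")
  case True
  then show ?thesis using assms(3)[of 1] assms(3)[of "-1"] by (simp add: gegenbauer_mean_def)
next
  case False
  then have a0: "a > 0" using a by simp
  have "(\<integral>u. f u \<partial>jacobi_measure a) \<le> (\<integral>u. g u \<partial>jacobi_measure a)"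
    using a0 assms AE_jacobi_ball[of a]
    by (intro integral_mono_AE integrable_gegenbauer) (auto elim!: eventually_mono)
  then show ?thesis using False jacobi_mass_pos[OF a0] by (simp add: gegenbauer_mean_def divide_right_mono)
qed

text \<open>Integration by parts on the interval. For \<open>a = 0\<close> both sides are zero because \<open>1 - u\<^sup>2\<close>
  vanishes at \<open>1\<close> and \<open>-1\<close>.\<close>

lemma gegenbauer_mean_by_parts:
  "gegenbauer_mean a (\<lambda>u. (1 - u\<^sup>2) * poly (pderiv p) u) = 2 * a * gegenbauer_mean a (\<lambda>u. u * poly p u)"
proof (cases "a = 0")
  case False
  then have a0: "a > 0" using a by simp
  have "(\<integral>u. (1 - (norm u)\<^sup>2) * (poly (pderiv p) u * 1) \<partial>jacobi_measure a) = 2 * a * (\<integral>u. (u \<bullet> 1) * poly p u \<partial>jacobi_measure a)"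
  proof (rule jacobi_integral_by_parts[OF a0, where F' = "\<lambda>u h. poly (pderiv p) u * h"])
    show "(poly p has_derivative (\<lambda>h. poly (pderiv p) u * h)) (at u)" for u
      using poly_DERIV[of p u] by (simp add: has_field_derivative_def)
  qed (auto intro!: continuous_intros)
  then show ?thesis using False by (simp add: gegenbauer_mean_def)
qed (simp add: gegenbauer_mean_def)

definition moment :: "nat \<Rightarrow> real" where "moment n = gegenbauer_mean a (\<lambda>u. u ^ n)"

lemma moment_0: "moment 0 = 1"
  by (simp add: moment_def)

lemma moment_Suc_Suc: "moment (Suc (Suc n)) * (real n + 1 + 2 * a) = moment n * (real n + 1)"
proof -
  define p :: "real poly" where "p = monom 1 (Suc n)"
  have 1: "(\<lambda>u::real. (1 - u\<^sup>2) * poly (pderiv p) u) = (\<lambda>u. (real n + 1) * u ^ n + (- (real n + 1)) * u ^ Suc (Suc n))"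
    by (simp add: p_def pderiv_monom poly_monom fun_eq_iff power2_eq_square algebra_simps)
  have 2: "(\<lambda>u::real. u * poly p u) = (\<lambda>u. u ^ Suc (Suc n))"
    by (simp add: p_def poly_monom)
  have "gegenbauer_mean a (\<lambda>u. (real n + 1) * u ^ n + (- (real n + 1)) * u ^ Suc (Suc n))
     = (real n + 1) * moment n + (- (real n + 1)) * moment (Suc (Suc n))"
    unfolding moment_def gegenbauer_mean_cmult[symmetric] by (intro gegenbauer_mean_add continuous_intros)
  then have "(real n + 1) * moment n + (- (real n + 1)) * moment (Suc (Suc n)) = 2 * a * moment (Suc (Suc n))"
    using gegenbauer_mean_by_parts[of p] unfolding 1 2 by (simp add: moment_def)
  then show ?thesis by (simp add: algebra_simps)
qed

lemma moment_odd: "odd n \<Longrightarrow> moment n = 0"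
proof (induction n rule: less_induct)
  case (less n)
  show ?case
  proof (cases "n = 1")
    case True
    have "2 * a * moment 1 = 0" using gegenbauer_mean_by_parts[of 1] by (simp add: moment_def)
    moreover have "a = 0 \<Longrightarrow> moment 1 = 0" unfolding moment_def gegenbauer_mean_def by simp
    ultimately show ?thesis using True by auto
  next
    case False
    then obtain m where m: "n = Suc (Suc m)" using less.prems by (metis One_nat_def even_zero not0_implies_Suc)
    then have "moment m = 0" using less by auto
    then have "moment n * (real m + 1 + 2 * a) = 0" using moment_Suc_Suc[of m] m by simp
    then show ?thesis using a by auto
  qed
qed

end

lemma has_bochner_integral_of_has_integral:
  fixes f :: "real \<Rightarrow> real"
  assumes "(f has_integral I) S" "\<And>x. x \<in> S \<Longrightarrow> 0 \<le> f x" "f \<in> borel_measurable borel" "S \<in> sets borel" "0 \<le> I"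
  shows "has_bochner_integral lborel (\<lambda>x. indicator S x * f x) I"
proof (rule has_bochner_integral_nn_integral)
  show "(\<lambda>x. indicator S x * f x) \<in> borel_measurable lborel" using assms(3,4) by measurable
  show "AE x in lborel. 0 \<le> indicator S x * f x" using assms(2) by (auto simp: indicator_def)
  show "integral\<^sup>N lborel (\<lambda>x. ennreal (indicator S x * f x)) = ennreal I"
    using nn_integral_has_integral_lebesgue[OF assms(2,1)] .
qed fact

lemma one_plus_powr_le_exp:
  fixes b x :: real assumes "b \<ge> 1" "x \<ge> 0" shows "(1 + x) powr b \<le> b powr b * exp x"
proof -
  have "1 + x \<le> b * (1 + x / b)" using assms by (simp add: algebra_simps)
  also have "\<dots> \<le> b * exp (x / b)" using assms by (intro mult_left_mono) auto
  finally have "(1 + x) powr b \<le> (b * exp (x / b)) powr b" using assms by (intro powr_mono2) auto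
  also have "\<dots> = b powr b * exp x" using assms by (simp add: powr_mult exp_powr_real)
  finally show ?thesis .
qed

lemma exp_minus_le:
  fixes b x :: real assumes "b \<ge> 1" "x \<ge> 0" shows "exp (- x) \<le> b powr b * (1 + x) powr (- b)"
proof -
  have "exp (- x) * (1 + x) powr b \<le> b powr b * (exp (- x) * exp x)"
    using one_plus_powr_le_exp[OF assms] by (simp add: mult_left_mono mult.left_commute)
  then show ?thesis using assms by (simp add: exp_minus powr_minus field_simps)
qed

lemma jacobi_weight_near_1:
  fixes a u :: real assumes "0 \<le> u" "u < 1"
  shows "(1 - u\<^sup>2) powr (a - 1) \<le> max 1 (2 powr (a - 1)) * (1 - u) powr (a - 1)"
    and "min 1 (2 powr (a - 1)) * (1 - u) powr (a - 1) \<le> (1 - u\<^sup>2) powr (a - 1)"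
proof -
  have eq: "(1 - u\<^sup>2) powr (a - 1) = (1 + u) powr (a - 1) * (1 - u) powr (a - 1)"
    using assms by (subst powr_mult[symmetric]) (auto simp: power2_eq_square algebra_simps)
  have "min 1 (2 powr (a - 1)) \<le> (1 + u) powr (a - 1) \<and> (1 + u) powr (a - 1) \<le> max 1 (2 powr (a - 1))"
  proof (cases "a \<ge> 1")
    case True
    then have "(1 + u) powr (a - 1) \<le> 2 powr (a - 1)" "1 powr (a - 1) \<le> (1 + u) powr (a - 1)"
      using assms by (intro powr_mono2; simp)+
    then show ?thesis by auto
  next
    case False
    then have "2 powr (a - 1) \<le> (1 + u) powr (a - 1)" "(1 + u) powr (a - 1) \<le> 1 powr (a - 1)"
      using assms by (intro powr_mono2'; simp)+
    then show ?thesis by auto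
  qed
  then show "(1 - u\<^sup>2) powr (a - 1) \<le> max 1 (2 powr (a - 1)) * (1 - u) powr (a - 1)"
    "min 1 (2 powr (a - 1)) * (1 - u) powr (a - 1) \<le> (1 - u\<^sup>2) powr (a - 1)"
    unfolding eq by (auto intro: mult_right_mono)
qed

text \<open>The mass of the weight within distance \<open>1 / s\<close> of \<open>u = 1\<close> is of order \<open>s powr (-a)\<close>. To
  avoid incomplete gamma functions the exponential is first weakened to the power \<open>- (a + 1)\<close> of
  \<open>1 + s (1 - u)\<close>: then \<open>((1 - u) / (1 + s (1 - u))) powr a\<close> is an explicit antiderivative, up to
  a factor, near \<open>u = 1\<close>. The function \<open>f\<close> in the statement allows both exponentials and powers of
  \<open>(1 + u) / 2\<close>.\<close>

lemma gegenbauer_laplace_upper: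
  assumes a: "a \<ge> 0"
  shows "\<exists>C>0. \<forall>s\<ge>0. \<forall>f. continuous_on UNIV f \<and> (\<forall>u. \<bar>u\<bar> \<le> 1 \<longrightarrow> f u \<le> exp (- s * (1 - u)))
     \<longrightarrow> gegenbauer_mean a f \<le> C * (1 + s) powr (- a)"
proof (cases "a = 0")
  case True
  have "gegenbauer_mean a f \<le> 1 * (1 + s) powr (- a)" if "s \<ge> 0" "\<forall>u. \<bar>u\<bar> \<le> 1 \<longrightarrow> f u \<le> exp (- s * (1 - u))" for s f
  proof -
    have "exp (- s * (1 - (- 1))) \<le> 1" using that by simp
    moreover have "f 1 \<le> exp (- s * (1 - 1))" "f (- 1) \<le> exp (- s * (1 - (- 1)))" using that(2)[rule_format, of 1] that(2)[rule_format, of "-1"] by simp_all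
    ultimately have "f (- 1) \<le> 1" "f 1 \<le> 1" by (auto intro: order_trans)
    then show ?thesis using True that(1) by (simp add: gegenbauer_mean_def)
  qed
  then show ?thesis by (intro exI[of _ 1]) auto
next
  case False
  then have a0: "a > 0" using a by simp
  define T where "T = measure (jacobi_measure a) (UNIV :: real set)"
  have T: "T > 0" unfolding T_def by (rule jacobi_mass_pos[OF a0])
  \<comment> \<open>The exponent for which the majorant below has an elementary antiderivative.\<close>
  define b where "b = a + 1"
  define K where "K = b powr b * (max 1 (2 powr (a - 1)) / a + T)"
  have K: "K > 0" unfolding K_def using a0 T by (intro mult_pos_pos add_pos_pos divide_pos_pos) (auto simp: b_def)
  have "gegenbauer_mean a f \<le> (K / T) * (1 + s) powr (- a)"
    if s: "s \<ge> 0" and f: "continuous_on UNIV f" "\<forall>u. \<bar>u\<bar> \<le> 1 \<longrightarrow> f u \<le> exp (- s * (1 - u))" for s f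
  proof -
    define w where "w u = indicator (ball 0 1) u * (1 - (norm u)\<^sup>2) powr (a - 1)" for u :: real
    have [measurable]: "w \<in> borel_measurable borel" unfolding w_def by measurable
    have w0: "w u \<ge> 0" for u by (simp add: w_def)
    \<comment> \<open>The weight near \<open>u = 1\<close> times the power that replaces the exponential.\<close>
    define g where "g u = (1 - u) powr (a - 1) * (1 + s * (1 - u)) powr (- b)" for u
    have [measurable]: "g \<in> borel_measurable borel" unfolding g_def by measurable
    have iw: "integrable lborel w" unfolding w_def by (rule integrable_jacobi_weight[OF a0])
    have Tw: "(\<integral>u. w u \<partial>lborel) = T"
    proof -
      interpret finite_measure "jacobi_measure a :: real measure" by (rule finite_measure_jacobi[OF a0])
      have "T = (\<integral>u. 1 \<partial>(jacobi_measure a :: real measure))" by (simp add: T_def)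
      also have "\<dots> = (\<integral>u. w u * 1 \<partial>lborel)" unfolding w_def by (rule jacobi_integral_eq) simp
      finally show ?thesis by simp
    qed
    have I: "(g has_integral (1 / a * (1 + s) powr (- a))) {0..1}"
    proof -
      define G where "G u = - (1 / a) * ((1 - u) / (1 + s * (1 - u))) powr a" for u
      have "(g has_integral (G 1 - G 0)) {0..1}"
      proof (rule fundamental_theorem_of_calculus_interior)
        show "continuous_on {0..1} G" unfolding G_def using a0 s
          by (intro continuous_intros continuous_on_powr') (auto simp: add_nonneg_eq_0_iff)
        fix u :: real assume u: "u \<in> {0<..<1}"
        define v where "v = 1 + s * (1 - u)"
        have v: "v > 0" unfolding v_def using s u by (intro add_pos_nonneg) auto
        have 1: "((\<lambda>u. (1 - u) / (1 + s * (1 - u))) has_real_derivative (- 1 / v\<^sup>2)) (at u)"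
          using v unfolding v_def by (auto intro!: derivative_eq_intros simp: power2_eq_square)
        have "(G has_real_derivative (- (1 / a)) * (a * ((1 - u) / v) powr (a - 1) * (- 1 / v\<^sup>2))) (at u)"
          unfolding G_def using DERIV_cmult[OF DERIV_fun_powr[OF 1, of a], of "- (1 / a)"] u v by (simp add: v_def)
        moreover have "(- (1 / a)) * (a * ((1 - u) / v) powr (a - 1) * (- 1 / v\<^sup>2)) = g u"
        proof -
          have "- b = - (a - 1) + - 2" by (simp add: b_def)
          then have "v powr (- b) = v powr (- (a - 1)) * v powr (- 2)" by (simp only: powr_add)
          also have "v powr (- 2) = 1 / v\<^sup>2" using v by (simp add: powr_minus_divide powr_numeral)
          also have "v powr (- (a - 1)) = 1 / v powr (a - 1)" by (rule powr_minus_divide)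
          finally show ?thesis using a0 v u unfolding g_def v_def[symmetric]
            by (simp add: powr_divide)
        qed
        ultimately show "(G has_vector_derivative g u) (at u)"
          by (simp add: has_real_derivative_iff_has_vector_derivative)
      qed simp
      moreover have "G 1 - G 0 = 1 / a * (1 + s) powr (- a)"
        using a0 s by (simp add: G_def powr_divide powr_minus field_simps)
      ultimately show ?thesis by simp
    qed
    have hb: "has_bochner_integral lborel (\<lambda>u. indicator {0..1} u * g u) (1 / a * (1 + s) powr (- a))"
    proof (rule has_bochner_integral_of_has_integral[OF I])
      show "0 \<le> g x" if "x \<in> {0..1}" for x by (simp add: g_def)
    qed (use a0 in auto)
    have bound: "w u * f u \<le> b powr b * (max 1 (2 powr (a - 1)) * (indicator {0..1} u * g u) + (1 + s) powr (- a) * w u)" for u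
    proof (cases "\<bar>u\<bar> < 1")
      case False
      then have "w u = 0" by (simp add: w_def)
      then show ?thesis by (simp add: g_def)
    next
      case True
      have "f u \<le> exp (- (s * (1 - u)))" using f(2)[rule_format, of u] True by simp
      also have "\<dots> \<le> b powr b * (1 + s * (1 - u)) powr (- b)"
        using True s a0 by (intro exp_minus_le) (auto simp: b_def)
      finally have fb: "f u \<le> b powr b * (1 + s * (1 - u)) powr (- b)" .
      have wu: "w u = (1 - u\<^sup>2) powr (a - 1)" using True by (simp add: w_def)
      have "w u * f u \<le> w u * (b powr b * (1 + s * (1 - u)) powr (- b))"
        using fb w0 by (rule mult_left_mono)
      also have "\<dots> = b powr b * (w u * (1 + s * (1 - u)) powr (- b))" by simp
      also have "\<dots> \<le> b powr b * (max 1 (2 powr (a - 1)) * (indicator {0..1} u * g u) + (1 + s) powr (- a) * w u)"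
      proof (intro mult_left_mono)
        show "w u * (1 + s * (1 - u)) powr (- b) \<le> max 1 (2 powr (a - 1)) * (indicator {0..1} u * g u) + (1 + s) powr (- a) * w u"
        proof (cases "u \<ge> 0")
          case u0: True
          have "w u * (1 + s * (1 - u)) powr (- b) \<le> (max 1 (2 powr (a - 1)) * (1 - u) powr (a - 1)) * (1 + s * (1 - u)) powr (- b)"
            unfolding wu using jacobi_weight_near_1(1)[of u a] True u0 by (intro mult_right_mono) auto
          also have "\<dots> = max 1 (2 powr (a - 1)) * (indicator {0..1} u * g u)" using u0 True by (simp add: g_def)
          also have "\<dots> \<le> \<dots> + (1 + s) powr (- a) * w u" using w0 by simp
          finally show ?thesis .
        next
          case u0: False
          have "(1 + s * (1 - u)) powr (- b) \<le> (1 + s) powr (- b)"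
            using s u0 a0 mult_left_mono[of 1 "1 - u" s] by (intro powr_mono2') (auto simp: b_def)
          also have "\<dots> \<le> (1 + s) powr (- a)" using s by (intro powr_mono) (auto simp: b_def)
          finally have "w u * (1 + s * (1 - u)) powr (- b) \<le> w u * (1 + s) powr (- a)" using w0 by (rule mult_left_mono)
          then show ?thesis using u0 by (simp add: mult.commute)
        qed
      qed simp
      finally show ?thesis .
    qed
    have fm: "f \<in> borel_measurable borel" using f(1) by (rule borel_measurable_continuous_onI)
    have iwf: "integrable lborel (\<lambda>u. w u * f u)"
      unfolding w_def using a0 f(1) by (rule integrable_jacobi_weight_mult)
    have ig: "integrable lborel (\<lambda>u. indicator {0..1} u * g u)" "(\<integral>u. indicator {0..1} u * g u \<partial>lborel) = 1 / a * (1 + s) powr (- a)"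
      using hb by (auto simp: has_bochner_integral_iff)
    have "(\<integral>u. f u \<partial>jacobi_measure a) = (\<integral>u. w u * f u \<partial>lborel)"
      unfolding w_def using fm by (rule jacobi_integral_eq)
    also have "\<dots> \<le> (\<integral>u. b powr b * (max 1 (2 powr (a - 1)) * (indicator {0..1} u * g u) + (1 + s) powr (- a) * w u) \<partial>lborel)"
      using ig iw iwf bound
      by (intro Bochner_Integration.integral_mono integrable_mult_right Bochner_Integration.integrable_add) auto
    also have "\<dots> = b powr b * (max 1 (2 powr (a - 1)) * (1 / a * (1 + s) powr (- a)) + (1 + s) powr (- a) * T)"
      using ig iw Tw by simp
    also have "\<dots> = K * (1 + s) powr (- a)" by (simp add: K_def algebra_simps)
    finally show ?thesis using False T unfolding gegenbauer_mean_def T_def[symmetric]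
      by (simp add: divide_right_mono)
  qed
  then show ?thesis using K T by (intro exI[of _ "K / T"]) auto
qed

text \<open>For \<open>1 - u \<le> 1 / (1 + s)\<close> the exponential is at least \<open>exp (-1)\<close>, and the weight of this
  interval is of order \<open>(1 + s) powr (-a)\<close>.\<close>

lemma gegenbauer_laplace_lower:
  assumes a: "a \<ge> 0"
  shows "\<exists>c>0. \<forall>s\<ge>0. \<forall>f. continuous_on UNIV f \<and> (\<forall>u. \<bar>u\<bar> \<le> 1 \<longrightarrow> 0 \<le> f u) \<and> (\<forall>u. 0 \<le> u \<and> u \<le> 1 \<longrightarrow> exp (- s * (1 - u)) \<le> f u)
     \<longrightarrow> c * (1 + s) powr (- a) \<le> gegenbauer_mean a f"
proof (cases "a = 0")
  case True
  have "(1/2) * (1 + s) powr (- a) \<le> gegenbauer_mean a f"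
    if "s \<ge> 0" "\<forall>u. \<bar>u\<bar> \<le> 1 \<longrightarrow> 0 \<le> f u" "\<forall>u. 0 \<le> u \<and> u \<le> 1 \<longrightarrow> exp (- s * (1 - u)) \<le> f u" for s f
  proof -
    have "1 \<le> f 1" using that(3)[rule_format, of 1] by simp
    moreover have "0 \<le> f (-1)" using that(2) by simp
    ultimately show ?thesis using True that(1) by (simp add: gegenbauer_mean_def)
  qed
  then show ?thesis by (intro exI[of _ "1/2"]) auto
next
  case False
  then have a0: "a > 0" using a by simp
  define T where "T = measure (jacobi_measure a) (UNIV :: real set)"
  have T: "T > 0" unfolding T_def by (rule jacobi_mass_pos[OF a0])
  define K where "K = exp (-1) * (min 1 (2 powr (a - 1)) / a)"
  have K: "K > 0" unfolding K_def using a0 by auto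
  have "(K / T) * (1 + s) powr (- a) \<le> gegenbauer_mean a f"
    if s: "s \<ge> 0" and f: "continuous_on UNIV f" "\<forall>u. \<bar>u\<bar> \<le> 1 \<longrightarrow> 0 \<le> f u" "\<forall>u. 0 \<le> u \<and> u \<le> 1 \<longrightarrow> exp (- s * (1 - u)) \<le> f u" for s f
  proof -
    define w where "w u = indicator (ball 0 1) u * (1 - (norm u)\<^sup>2) powr (a - 1)" for u :: real
    have [measurable]: "w \<in> borel_measurable borel" unfolding w_def by measurable
    have w0: "w u \<ge> 0" for u by (simp add: w_def)
    define h where "h = 1 / (1 + s)"
    have h: "0 < h" "h \<le> 1" "s * h \<le> 1" using s by (auto simp: h_def field_simps)
    have I: "((\<lambda>u. (1 - u) powr (a - 1)) has_integral (1 / a * h powr a)) {1-h..1}"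
    proof -
      define G where "G u = - (1 / a) * (1 - u) powr a" for u :: real
      have "((\<lambda>u. (1 - u) powr (a - 1)) has_integral (G 1 - G (1 - h))) {1-h..1}"
      proof (rule fundamental_theorem_of_calculus_interior)
        show "continuous_on {1-h..1} G" unfolding G_def using a0
          by (intro continuous_intros continuous_on_powr') auto
        fix u :: real assume u: "u \<in> {1-h<..<1}"
        have 1: "((\<lambda>u::real. 1 - u) has_real_derivative - 1) (at u)"
          by (auto intro!: derivative_eq_intros)
        have "(G has_real_derivative (- (1 / a)) * (a * (1 - u) powr (a - 1) * (- 1))) (at u)"
          unfolding G_def using DERIV_cmult[OF DERIV_fun_powr[OF 1, of a], of "- (1 / a)"] u by simp
        then show "(G has_vector_derivative (1 - u) powr (a - 1)) (at u)"
          using a0 by (simp add: has_real_derivative_iff_has_vector_derivative)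
      qed (use h in simp)
      then show ?thesis using a0 by (simp add: G_def)
    qed
    have hb: "has_bochner_integral lborel (\<lambda>u. indicator {1-h..1} u * (1 - u) powr (a - 1)) (1 / a * h powr a)"
      using I a0 by (rule_tac has_bochner_integral_of_has_integral) auto
    then have ig: "integrable lborel (\<lambda>u. indicator {1-h..1} u * (1 - u) powr (a - 1))"
        "(\<integral>u. indicator {1-h..1} u * (1 - u) powr (a - 1) \<partial>lborel) = 1 / a * h powr a"
      by (auto simp: has_bochner_integral_iff)
    have bound: "exp (-1) * (min 1 (2 powr (a - 1)) * (indicator {1-h..1} u * (1 - u) powr (a - 1))) \<le> w u * f u" for u
    proof (cases "\<bar>u\<bar> < 1")
      case False
      then have "u = 1 \<or> u \<notin> {1-h..1}" using h by auto
      then show ?thesis using False by (auto simp: w_def)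
    next
      case True
      show ?thesis
      proof (cases "u \<in> {1-h..1}")
        case u: True
        then have u0: "u \<ge> 0" using h by simp
        have "s * (1 - u) \<le> s * h" using u s by (intro mult_left_mono) auto
        then have "exp (- 1) \<le> exp (- s * (1 - u))" using h by simp
        also have "\<dots> \<le> f u" using f(3)[rule_format, of u] u u0 by simp
        finally have "exp (- 1) \<le> f u" .
        moreover have "min 1 (2 powr (a - 1)) * (1 - u) powr (a - 1) \<le> w u"
          using jacobi_weight_near_1(2)[of u a] True u0 by (simp add: w_def)
        ultimately have "exp (-1) * (min 1 (2 powr (a - 1)) * (1 - u) powr (a - 1)) \<le> f u * w u"
          by (intro mult_mono) (auto intro: order_trans[of 0 "exp (-1)"])
        then show ?thesis using u by (simp add: mult.commute)
      next
        case u: False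
        then show ?thesis using w0[of u] f(2) True by simp
      qed
    qed
    have fm: "f \<in> borel_measurable borel" using f(1) by (rule borel_measurable_continuous_onI)
    have iwf: "integrable lborel (\<lambda>u. w u * f u)"
      unfolding w_def using a0 f(1) by (rule integrable_jacobi_weight_mult)
    have "K * (1 + s) powr (- a) = (\<integral>u. exp (-1) * (min 1 (2 powr (a - 1)) * (indicator {1-h..1} u * (1 - u) powr (a - 1))) \<partial>lborel)"
    proof -
      have "h powr a = (1 + s) powr (- a)" using s by (simp add: h_def powr_divide powr_minus_divide)
      then show ?thesis by (simp only: integral_mult_right_zero ig(2) K_def) simp
    qed
    also have "\<dots> \<le> (\<integral>u. w u * f u \<partial>lborel)"
      using ig iwf bound by (intro Bochner_Integration.integral_mono integrable_mult_right) auto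
    also have "\<dots> = (\<integral>u. f u \<partial>jacobi_measure a)"
      unfolding w_def using fm by (rule jacobi_integral_eq[symmetric])
    finally show ?thesis using False T unfolding gegenbauer_mean_def T_def[symmetric]
      by (simp add: divide_right_mono)
  qed
  then show ?thesis using K T by (intro exI[of _ "K / T"]) auto
qed

section \<open>Zonal functions\<close>

lemma carre_power:
  assumes "P \<in> polys"
  shows "carre_du_champ (\<lambda>x. P x ^ n) R x = n * P x ^ (n - 1) * carre_du_champ P R x"
proof (induction n)
  case 0
  show ?case by (simp add: carre_du_champ_def)
next
  case (Suc n)
  have "carre_du_champ (\<lambda>x. P x ^ Suc n) R x = P x * carre_du_champ (\<lambda>x. P x ^ n) R x + P x ^ n * carre_du_champ P R x"
    using assms by (simp add: carre_mult)
  also have "P x * carre_du_champ (\<lambda>x. P x ^ n) R x = n * P x ^ n * carre_du_champ P R x"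
    unfolding Suc by (cases n) (auto simp: algebra_simps)
  finally show ?case by (simp add: algebra_simps)
qed

lemma ball_op_power:
  assumes "P \<in> polys"
  shows "ball_op \<mu> (\<lambda>x. P x ^ n) x = n * P x ^ (n - 1) * ball_op \<mu> P x + n * (real n - 1) * P x ^ (n - 2) * carre_du_champ P P x"
proof (induction n)
  case (Suc n)
  have "ball_op \<mu> (\<lambda>x. P x ^ Suc n) x = P x * ball_op \<mu> (\<lambda>x. P x ^ n) x + P x ^ n * ball_op \<mu> P x + 2 * (n * P x ^ (n - 1) * carre_du_champ P P x)"
    using assms carre_power[OF assms, of n P x] by (simp add: ball_op_mult carre_commute[of P "\<lambda>x. P x ^ n"])
  also have "P x * ball_op \<mu> (\<lambda>x. P x ^ n) x = n * P x ^ n * ball_op \<mu> P x + n * (real n - 1) * P x ^ (n - 1) * carre_du_champ P P x"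
    unfolding Suc
  proof (cases n)
    case (Suc m)
    then show "P x * (n * P x ^ (n - 1) * ball_op \<mu> P x + n * (real n - 1) * P x ^ (n - 2) * carre_du_champ P P x) =
      n * P x ^ n * ball_op \<mu> P x + n * (real n - 1) * P x ^ (n - 1) * carre_du_champ P P x"
      by (cases m) (auto simp: algebra_simps)
  qed simp
  finally show ?case by (simp add: algebra_simps)
qed simp

lemma pderiv_at_inner: "pderiv_at i (\<lambda>x::real^'n. x \<bullet> y) = (\<lambda>x. y $ i)"
proof
  fix x :: "real^'n"
  have "((\<lambda>x. x \<bullet> y) has_derivative (\<lambda>h. h \<bullet> y)) (at x)"
    by (rule bounded_linear_imp_has_derivative[OF bounded_linear_inner_left])
  then show "pderiv_at i (\<lambda>x. x \<bullet> y) x = y $ i"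
    using pderiv_at_eq[of _ _ x i] by (simp add: inner_axis')
qed

lemma pderiv_at_norm_sq: "pderiv_at i (\<lambda>x::real^'n. (norm x)\<^sup>2) = (\<lambda>x. 2 * x $ i)"
proof
  fix x :: "real^'n"
  have "((\<lambda>x. x \<bullet> x) has_derivative (\<lambda>h. x \<bullet> h + h \<bullet> x)) (at x)"
    by (intro has_derivative_inner has_derivative_ident)
  from pderiv_at_eq[OF this, of i] show "pderiv_at i (\<lambda>x. (norm x)\<^sup>2) x = 2 * x $ i"
    unfolding power2_norm_eq_inner by (simp add: inner_axis inner_axis')
qed

text \<open>The square of \<open>sqrt (1 - |x|\<^sup>2) * sqrt (1 - |y|\<^sup>2)\<close>, which is a polynomial while the product
  of the roots is not.\<close>

definition zonal_q :: "real^'n \<Rightarrow> real^'n \<Rightarrow> real" where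
  "zonal_q x y = (1 - (norm x)\<^sup>2) * (1 - (norm y)\<^sup>2)"

lemma zonal_q_polys [simp, intro]: "(\<lambda>x. zonal_q x y) \<in> polys"
  unfolding zonal_q_def by (intro polys_mult polys_diff polys_const polys_norm_sq)

lemma pderiv_at_zonal_q:
  fixes y :: "real^'n"
  shows "pderiv_at i (\<lambda>x. zonal_q x y) = (\<lambda>x. (- 2 * (1 - (norm y)\<^sup>2)) * x $ i)"
proof -
  have "pderiv_at i (\<lambda>x::real^'n. 1 - (norm x)\<^sup>2) = (\<lambda>x. 0 - 2 * x $ i)"
    by (subst pderiv_at_diff) (auto simp: pderiv_at_norm_sq)
  then have "pderiv_at i (\<lambda>x. (1 - (norm x)\<^sup>2) * (1 - (norm y)\<^sup>2)) = (\<lambda>x. (1 - (norm x)\<^sup>2) * 0 + (1 - (norm y)\<^sup>2) * (0 - 2 * x $ i))"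
    by (subst pderiv_at_mult) auto
  then show ?thesis unfolding zonal_q_def by (simp add: fun_eq_iff algebra_simps)
qed

lemma sum_coord_inner: "(\<Sum>i\<in>UNIV. x $ i * y $ i) = x \<bullet> (y :: real^'n)"
  by (simp add: inner_vec_def)

lemma sum_coord_norm: "(\<Sum>i\<in>UNIV. x $ i * x $ i) = (norm (x :: real^'n))\<^sup>2"
  by (simp add: power2_norm_eq_inner inner_vec_def)

lemma zonal_s_facts:
  fixes x y :: "real^'n"
  shows "ball_op \<mu> (\<lambda>x. x \<bullet> y) x = - (real CARD('n) + 2 * \<mu>) * (x \<bullet> y)"
    and "carre_du_champ (\<lambda>x. x \<bullet> y) (\<lambda>x. x \<bullet> y) x = (norm y)\<^sup>2 - (x \<bullet> y)\<^sup>2"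
  by (simp_all add: ball_op_def carre_du_champ_def pderiv_at_inner sum_coord_inner power2_norm_eq_inner power2_eq_square[of "x \<bullet> y"] algebra_simps)

text \<open>With \<open>x \<bullet> y\<close> and \<open>zonal_q\<close> as new variables, \<open>D\<close> and its bilinear form close up: only
  polynomials in these two variables appear, with coefficients that depend on \<open>y\<close> through
  \<open>1 - |y|\<^sup>2\<close>.\<close>

lemma zonal_q_facts:
  fixes x y :: "real^'n"
  defines "\<sigma> \<equiv> 1 - (norm y)\<^sup>2"
  shows "ball_op \<mu> (\<lambda>x. zonal_q x y) x = \<sigma> * (2 + 4 * \<mu>) - zonal_q x y * (2 + 2 * real CARD('n) + 4 * \<mu>)" (is ?A)
    and "carre_du_champ (\<lambda>x. zonal_q x y) (\<lambda>x. zonal_q x y) x = 4 * zonal_q x y * (\<sigma> - zonal_q x y)" (is ?B)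
    and "carre_du_champ (\<lambda>x. x \<bullet> y) (\<lambda>x. zonal_q x y) x = - 2 * (x \<bullet> y) * zonal_q x y" (is ?C)
proof -
  have pd2: "pderiv_at i (\<lambda>x::real^'n. c * x $ j) = (\<lambda>x. c * (if i = j then 1 else 0))" for c i j
    by (subst pderiv_at_cmult) (auto simp: pderiv_at_coord)
  have xx: "(\<Sum>i\<in>UNIV. x $ i * (c * x $ i)) = c * (norm x)\<^sup>2" for c
    by (simp add: sum_coord_norm[symmetric] sum_distrib_left mult_ac)
  have xxd: "(\<Sum>i\<in>UNIV. \<Sum>j\<in>UNIV. x $ i * x $ j * (c * (if i = j then 1 else 0))) = c * (norm x)\<^sup>2" for c
  proof -
    have "(\<Sum>j\<in>UNIV. x $ i * x $ j * (c * (if i = j then 1 else 0))) = x $ i * (c * x $ i)" for i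
      by (simp add: if_distrib mult_ac cong: if_cong)
    then show ?thesis by (simp add: xx)
  qed
  show ?A unfolding ball_op_def pderiv_at_zonal_q pd2 xx xxd unfolding \<sigma>_def zonal_q_def
    by (simp add: algebra_simps)
  have cc: "(\<Sum>i\<in>UNIV. (c * x $ i) * (c * x $ i)) = c * (c * (norm x)\<^sup>2)" for c
    by (simp add: sum_coord_norm[symmetric] sum_distrib_left mult_ac)
  show ?B unfolding carre_du_champ_def pderiv_at_zonal_q cc xx unfolding \<sigma>_def zonal_q_def
    by (simp add: algebra_simps power2_eq_square)
  have yc: "(\<Sum>i\<in>UNIV. y $ i * (c * x $ i)) = c * (x \<bullet> y)" for c
    by (simp add: sum_coord_inner[symmetric] sum_distrib_left mult_ac)
  show ?C unfolding carre_du_champ_def pderiv_at_zonal_q pderiv_at_inner xx yc sum_coord_inner unfolding zonal_q_def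
    by (simp add: algebra_simps power2_eq_square)
qed

text \<open>The result is sorted by \<open>\<sigma> = 1 - |y|\<^sup>2\<close>. The part free of \<open>\<sigma>\<close> is what the one-dimensional
  operator produces; the part with the factor \<open>\<sigma>\<close> cancels when the terms are summed with the
  coefficients of \<open>zonal_monom\<close>.\<close>

lemma ball_op_zonal_term:
  fixes x y :: "real^'n"
  assumes l: "l = \<mu> + (real CARD('n) - 1) / 2"
  defines "\<sigma> \<equiv> 1 - (norm y)\<^sup>2"
  shows "ball_op \<mu> (\<lambda>x. (x \<bullet> y) ^ a * zonal_q x y ^ b) x =
    - eigval l (a + 2 * b) * ((x \<bullet> y) ^ a * zonal_q x y ^ b)
    + real a * (real a - 1) * (x \<bullet> y) ^ (a - 2) * zonal_q x y ^ b
    + \<sigma> * (2 * real b * (2 * real b - 1 + 2 * \<mu>) * (x \<bullet> y) ^ a * zonal_q x y ^ (b - 1)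
        - real a * (real a - 1) * (x \<bullet> y) ^ (a - 2) * zonal_q x y ^ b)"
proof -
  define d where "d = real CARD('n)"
  define s q where "s = x \<bullet> y" and "q = zonal_q x y"
  \<comment> \<open>First and second derivatives of the two powers; the identities \<open>h1\<close> to \<open>h4\<close> cover the small
    exponents, where subtraction of naturals is truncated.\<close>
  define A1 A2 B1 B2 where "A1 = real a * s ^ (a - 1)" and "A2 = real a * (real a - 1) * s ^ (a - 2)"
    and "B1 = real b * q ^ (b - 1)" and "B2 = real b * (real b - 1) * q ^ (b - 2)"
  have h1: "A1 * s = a * s ^ a" by (cases a) (auto simp: A1_def)
  have h2: "A2 * s\<^sup>2 = a * (real a - 1) * s ^ a"
  proof -
    consider "a = 0" | "a = 1" | m where "a = Suc (Suc m)" by (metis One_nat_def not0_implies_Suc)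
    then show ?thesis by cases (auto simp: A2_def power2_eq_square algebra_simps)
  qed
  have h3: "B1 * q = b * q ^ b" by (cases b) (auto simp: B1_def)
  have h4: "B2 * q = (real b - 1) * B1"
  proof -
    consider "b = 0" | "b = 1" | m where "b = Suc (Suc m)" by (metis One_nat_def not0_implies_Suc)
    then show ?thesis by cases (auto simp: B2_def B1_def algebra_simps)
  qed
  have "carre_du_champ (\<lambda>x. (x \<bullet> y) ^ a) (\<lambda>x. zonal_q x y ^ b) x = A1 * carre_du_champ (\<lambda>x. x \<bullet> y) (\<lambda>x. zonal_q x y ^ b) x"
    by (simp add: carre_power A1_def s_def)
  also have "carre_du_champ (\<lambda>x. x \<bullet> y) (\<lambda>x. zonal_q x y ^ b) x = B1 * (- 2 * s * q)"
  proof -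
    have "carre_du_champ (\<lambda>x. x \<bullet> y) (\<lambda>x. zonal_q x y ^ b) x = carre_du_champ (\<lambda>x. zonal_q x y ^ b) (\<lambda>x. x \<bullet> y) x"
      by (rule fun_cong[OF carre_commute])
    also have "\<dots> = b * zonal_q x y ^ (b - 1) * carre_du_champ (\<lambda>x. zonal_q x y) (\<lambda>x. x \<bullet> y) x"
      by (rule carre_power) auto
    also have "carre_du_champ (\<lambda>x. zonal_q x y) (\<lambda>x. x \<bullet> y) x = - 2 * s * q"
      unfolding fun_cong[OF carre_commute[of "\<lambda>x. zonal_q x y"]] zonal_q_facts s_def q_def ..
    finally show ?thesis by (simp add: B1_def q_def)
  qed
  finally have c: "carre_du_champ (\<lambda>x. (x \<bullet> y) ^ a) (\<lambda>x. zonal_q x y ^ b) x = A1 * (B1 * (- 2 * s * q))" .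
  have "ball_op \<mu> (\<lambda>x. (x \<bullet> y) ^ a * zonal_q x y ^ b) x =
     s ^ a * (B1 * (\<sigma> * (2 + 4 * \<mu>) - q * (2 + 2 * d + 4 * \<mu>)) + B2 * (4 * q * (\<sigma> - q)))
     + q ^ b * (A1 * (- (d + 2 * \<mu>) * s) + A2 * ((1 - \<sigma>) - s\<^sup>2)) + 2 * (A1 * (B1 * (- 2 * s * q)))"
    using c by (simp add: ball_op_mult ball_op_power zonal_s_facts zonal_q_facts A1_def A2_def B1_def B2_def s_def q_def d_def \<sigma>_def)
  also have "\<dots> = s ^ a * B1 * \<sigma> * (2 + 4 * \<mu>) - s ^ a * (B1 * q) * (2 + 2 * d + 4 * \<mu>) + 4 * s ^ a * (B2 * q) * \<sigma> - 4 * s ^ a * (B2 * q) * q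
     - (d + 2 * \<mu>) * q ^ b * (A1 * s) + q ^ b * A2 * (1 - \<sigma>) - q ^ b * (A2 * s\<^sup>2) - 4 * (A1 * s) * (B1 * q)"
    by (simp add: algebra_simps)
  also have "4 * s ^ a * (B2 * q) * q = 4 * s ^ a * (real b - 1) * (B1 * q)" unfolding h4 by simp
  also have "s ^ a * B1 * \<sigma> * (2 + 4 * \<mu>) - s ^ a * (B1 * q) * (2 + 2 * d + 4 * \<mu>) + 4 * s ^ a * (B2 * q) * \<sigma> - 4 * s ^ a * (real b - 1) * (B1 * q)
     - (d + 2 * \<mu>) * q ^ b * (A1 * s) + q ^ b * A2 * (1 - \<sigma>) - q ^ b * (A2 * s\<^sup>2) - 4 * (A1 * s) * (B1 * q) =
    - eigval l (a + 2 * b) * (s ^ a * q ^ b) + A2 * q ^ b + \<sigma> * (2 * (2 * real b - 1 + 2 * \<mu>) * s ^ a * B1 - A2 * q ^ b)"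
    unfolding h1 h2 h3 h4 eigval_def l d_def[symmetric] by (simp add: field_simps)
  finally show ?thesis unfolding A2_def B1_def s_def q_def by (simp add: mult_ac)
qed

text \<open>The mean over \<open>u\<close> of the \<open>N\<close>-th power of \<open>x \<bullet> y + u * sqrt (1 - |x|\<^sup>2) * sqrt (1 - |y|\<^sup>2)\<close>,
  expanded by the binomial theorem: odd moments vanish, and for even \<open>j\<close> the \<open>j\<close>-th power of the
  product of roots is a power of \<open>zonal_q\<close>.\<close>

definition zonal_monom :: "real \<Rightarrow> nat \<Rightarrow> real^'n \<Rightarrow> real^'n \<Rightarrow> real" where
  "zonal_monom \<mu> N x y = (\<Sum>j\<le>N. real (N choose j) * moment \<mu> j * ((x \<bullet> y) ^ (N - j) * zonal_q x y ^ (j div 2)))"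

lemma zonal_q_commute: "zonal_q x y = zonal_q y x" by (simp add: zonal_q_def mult.commute)

lemma zonal_monom_commute: "zonal_monom \<mu> N x y = zonal_monom \<mu> N y x"
  by (simp add: zonal_monom_def inner_commute[of x y] zonal_q_commute[of x y])

lemma zonal_q_polys_le: "(\<lambda>x. zonal_q x y) \<in> polys_le 2"
proof -
  have "(\<lambda>x. zonal_q x y) = (\<lambda>x. (1 - (norm y)\<^sup>2) * (1 - (norm x)\<^sup>2))" by (simp add: zonal_q_def mult.commute)
  then show ?thesis by (simp add: polys_le_cmult polys_le_diff polys_le_norm_sq)
qed

lemma zonal_monom_polys_le: "(\<lambda>x. zonal_monom \<mu> N x y) \<in> polys_le N"
  unfolding zonal_monom_def
proof (intro polys_le_sum polys_le_cmult)
  fix j assume "j \<in> {..N}"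
  have "(\<lambda>x. (x \<bullet> y) ^ (N - j) * zonal_q x y ^ (j div 2)) \<in> polys_le ((N - j) * 1 + (j div 2) * 2)"
    by (intro polys_le_mult polys_le_power polys_le_inner zonal_q_polys_le)
  then show "(\<lambda>x. (x \<bullet> y) ^ (N - j) * zonal_q x y ^ (j div 2)) \<in> polys_le N"
    using \<open>j \<in> {..N}\<close> by (elim polys_le_mono) auto
qed

lemma binomial_two_steps_comp:
  assumes "j \<le> M"
  shows "real (Suc (Suc M) choose j) * (real (Suc (Suc M) - j) * (real (Suc (Suc M) - j) - 1)) = real (Suc (Suc M)) * real (Suc M) * real (M choose j)"
proof -
  have "(Suc (Suc M) - j) * (Suc (Suc M) choose j) = Suc (Suc M) * (Suc M choose j)"
    using binomial_absorb_comp[of "Suc (Suc M)" j] by simp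
  moreover have "(Suc M - j) * (Suc M choose j) = Suc M * (M choose j)"
    using binomial_absorb_comp[of "Suc M" j] by simp
  ultimately have "(Suc M - j) * ((Suc (Suc M) - j) * (Suc (Suc M) choose j)) = Suc (Suc M) * (Suc M * (M choose j))"
    by (metis mult.left_commute)
  then have "real ((Suc M - j) * ((Suc (Suc M) - j) * (Suc (Suc M) choose j))) = real (Suc (Suc M) * (Suc M * (M choose j)))"
    by (simp only:)
  moreover have "real (Suc (Suc M) - j) - 1 = real (Suc M - j)" using assms by (simp add: of_nat_diff Suc_diff_le)
  ultimately show ?thesis by (simp only: of_nat_mult) (simp add: mult_ac)
qed

lemma binomial_two_steps:
  "real (Suc (Suc M) choose Suc (Suc i)) * (real (Suc (Suc i)) * real (Suc i)) = real (Suc (Suc M)) * real (Suc M) * real (M choose i)"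
proof -
  have "Suc (Suc i) * (Suc (Suc M) choose Suc (Suc i)) = Suc (Suc M) * (Suc M choose Suc i)"
    by (rule Suc_times_binomial)
  moreover have "Suc i * (Suc M choose Suc i) = Suc M * (M choose i)" by (rule Suc_times_binomial)
  ultimately have "Suc i * (Suc (Suc i) * (Suc (Suc M) choose Suc (Suc i))) = Suc (Suc M) * (Suc M * (M choose i))"
    by (metis mult.left_commute)
  then have "real (Suc i * (Suc (Suc i) * (Suc (Suc M) choose Suc (Suc i)))) = real (Suc (Suc M) * (Suc M * (M choose i)))"
    by (simp only:)
  then show ?thesis by (simp only: of_nat_mult) (simp add: mult_ac)
qed

text \<open>The Gegenbauer operator maps \<open>z ^ N\<close> to \<open>- N (N + 2 l) z ^ N + N (N - 1) z ^ (N - 2)\<close>, and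
  \<open>D\<close> acts in the same way on the lifted powers. The recursion \<open>moment_Suc_Suc\<close> of the moments is
  exactly what makes the terms with \<open>\<sigma>\<close> cancel.\<close>

lemma ball_op_zonal_monom:
  fixes x y :: "real^'n"
  assumes mu: "\<mu> \<ge> 0" and l: "l = \<mu> + (real CARD('n) - 1) / 2"
  shows "ball_op \<mu> (\<lambda>x. zonal_monom \<mu> N x y) x =
     - eigval l N * zonal_monom \<mu> N x y + real N * (real N - 1) * zonal_monom \<mu> (N - 2) x y"
proof -
  define s q \<sigma> where "s = x \<bullet> y" and "q = zonal_q x y" and "\<sigma> = 1 - (norm y)\<^sup>2"
  define c where "c j = real (N choose j) * moment \<mu> j" for j
  \<comment> \<open>\<open>X\<close> collects the second derivatives of the powers of \<open>x \<bullet> y\<close>, and \<open>Y\<close> the derivatives of the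
    powers of \<open>zonal_q\<close>.\<close>
  define X where "X = (\<Sum>j\<le>N. c j * (real (N - j) * (real (N - j) - 1) * s ^ (N - j - 2) * q ^ (j div 2)))"
  define Y where "Y = (\<Sum>j\<le>N. c j * (real j * (real j - 1 + 2 * \<mu>) * s ^ (N - j) * q ^ (j div 2 - 1)))"
  have odd: "c j = 0" if "odd j" for j using moment_odd[OF mu that] by (simp add: c_def)
  have "ball_op \<mu> (\<lambda>x. zonal_monom \<mu> N x y) x = (\<Sum>j\<le>N. c j * ball_op \<mu> (\<lambda>x. (x \<bullet> y) ^ (N - j) * zonal_q x y ^ (j div 2)) x)"
    unfolding zonal_monom_def c_def by (subst ball_op_sum) (auto simp: ball_op_cmult)
  also have "\<dots> = (\<Sum>j\<le>N. - eigval l N * (c j * (s ^ (N - j) * q ^ (j div 2)))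
      + c j * (real (N - j) * (real (N - j) - 1) * s ^ (N - j - 2) * q ^ (j div 2))
      + \<sigma> * (c j * (real j * (real j - 1 + 2 * \<mu>) * s ^ (N - j) * q ^ (j div 2 - 1))
         - c j * (real (N - j) * (real (N - j) - 1) * s ^ (N - j - 2) * q ^ (j div 2))))"
  proof (rule sum.cong[OF refl])
    fix j assume j: "j \<in> {..N}"
    show "c j * ball_op \<mu> (\<lambda>x. (x \<bullet> y) ^ (N - j) * zonal_q x y ^ (j div 2)) x = - eigval l N * (c j * (s ^ (N - j) * q ^ (j div 2)))
      + c j * (real (N - j) * (real (N - j) - 1) * s ^ (N - j - 2) * q ^ (j div 2))
      + \<sigma> * (c j * (real j * (real j - 1 + 2 * \<mu>) * s ^ (N - j) * q ^ (j div 2 - 1))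
         - c j * (real (N - j) * (real (N - j) - 1) * s ^ (N - j - 2) * q ^ (j div 2)))"
    proof (cases "odd j")
      case True
      then show ?thesis by (simp add: odd)
    next
      case False
      then obtain b where b: "j = 2 * b" by (auto elim: evenE)
      then have "(N - j) + 2 * (j div 2) = N" using j by simp
      then show ?thesis
        unfolding ball_op_zonal_term[OF l] s_def[symmetric] q_def[symmetric] \<sigma>_def[symmetric]
        using b by (simp add: algebra_simps)
    qed
  qed
  \<comment> \<open>It remains to see that \<open>X = Y\<close>; both equal the lift of \<open>N (N - 1) z ^ (N - 2)\<close>.\<close>
  also have "\<dots> = - eigval l N * zonal_monom \<mu> N x y + X + \<sigma> * (Y - X)"
    unfolding X_def Y_def zonal_monom_def c_def s_def[symmetric] q_def[symmetric]
    by (simp only: sum.distrib sum_subtractf sum_distrib_left[symmetric])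
  finally have main: "ball_op \<mu> (\<lambda>x. zonal_monom \<mu> N x y) x = - eigval l N * zonal_monom \<mu> N x y + X + \<sigma> * (Y - X)" .
  have XY: "X = real N * (real N - 1) * zonal_monom \<mu> (N - 2) x y \<and> Y = real N * (real N - 1) * zonal_monom \<mu> (N - 2) x y"
  proof -
    consider "N = 0" | "N = 1" | M where "N = Suc (Suc M)" by (metis One_nat_def not0_implies_Suc)
    then show ?thesis
    proof cases
      case 1
      then show ?thesis by (simp add: X_def Y_def)
    next
      case 2
      then show ?thesis by (simp add: X_def Y_def odd)
    next
      case (3 M)
      have "X = (\<Sum>j\<le>M. c j * (real (N - j) * (real (N - j) - 1) * s ^ (N - j - 2) * q ^ (j div 2)))"
        unfolding X_def 3 by simp
      also have "\<dots> = (\<Sum>j\<le>M. real N * (real N - 1) * (real (M choose j) * moment \<mu> j * (s ^ (M - j) * q ^ (j div 2))))"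
      proof (rule sum.cong[OF refl])
        fix j assume j: "j \<in> {..M}"
        have "c j * (real (N - j) * (real (N - j) - 1) * s ^ (N - j - 2) * q ^ (j div 2)) =
          (real (Suc (Suc M) choose j) * (real (Suc (Suc M) - j) * (real (Suc (Suc M) - j) - 1))) * (moment \<mu> j * (s ^ (N - j - 2) * q ^ (j div 2)))"
          unfolding c_def 3 by (simp add: mult_ac)
        also have "(real (Suc (Suc M) choose j) * (real (Suc (Suc M) - j) * (real (Suc (Suc M) - j) - 1))) = real N * (real N - 1) * real (M choose j)"
          using binomial_two_steps_comp[of j M] j 3 by simp
        finally have "c j * (real (N - j) * (real (N - j) - 1) * s ^ (N - j - 2) * q ^ (j div 2)) =
            real N * (real N - 1) * real (M choose j) * (moment \<mu> j * (s ^ (N - j - 2) * q ^ (j div 2)))" .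
        moreover have "N - j - 2 = M - j" using 3 by simp
        ultimately show "c j * (real (N - j) * (real (N - j) - 1) * s ^ (N - j - 2) * q ^ (j div 2)) = real N * (real N - 1) * (real (M choose j) * moment \<mu> j * (s ^ (M - j) * q ^ (j div 2)))"
          by (simp only: mult.assoc)
      qed
      also have "\<dots> = real N * (real N - 1) * zonal_monom \<mu> (N - 2) x y"
        unfolding zonal_monom_def 3 s_def[symmetric] q_def[symmetric] by (simp add: sum_distrib_left)
      finally have X: "X = real N * (real N - 1) * zonal_monom \<mu> (N - 2) x y" .
      have "Y = (\<Sum>i\<le>M. c (Suc (Suc i)) * (real (Suc (Suc i)) * (real (Suc (Suc i)) - 1 + 2 * \<mu>) * s ^ (N - Suc (Suc i)) * q ^ (Suc (Suc i) div 2 - 1)))"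
        unfolding Y_def 3 sum.atMost_Suc_shift by (simp add: odd)
      also have "\<dots> = (\<Sum>i\<le>M. real N * (real N - 1) * (real (M choose i) * moment \<mu> i * (s ^ (M - i) * q ^ (i div 2))))"
      proof (rule sum.cong[OF refl])
        fix i assume i: "i \<in> {..M}"
        have "c (Suc (Suc i)) * (real (Suc (Suc i)) * (real (Suc (Suc i)) - 1 + 2 * \<mu>)) =
          real (Suc (Suc M) choose Suc (Suc i)) * real (Suc (Suc i)) * (moment \<mu> (Suc (Suc i)) * (real i + 1 + 2 * \<mu>))"
          unfolding c_def 3 by (simp add: mult_ac)
        also have "\<dots> = (real (Suc (Suc M) choose Suc (Suc i)) * (real (Suc (Suc i)) * real (Suc i))) * moment \<mu> i"
          unfolding moment_Suc_Suc[OF mu] by (simp add: mult_ac)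
        also have "\<dots> = real N * (real N - 1) * (real (M choose i) * moment \<mu> i)"
          unfolding binomial_two_steps using 3 by simp
        finally have *: "c (Suc (Suc i)) * (real (Suc (Suc i)) * (real (Suc (Suc i)) - 1 + 2 * \<mu>)) = real N * (real N - 1) * (real (M choose i) * moment \<mu> i)" .
        have "c (Suc (Suc i)) * (real (Suc (Suc i)) * (real (Suc (Suc i)) - 1 + 2 * \<mu>) * s ^ (N - Suc (Suc i)) * q ^ (Suc (Suc i) div 2 - 1))
          = (c (Suc (Suc i)) * (real (Suc (Suc i)) * (real (Suc (Suc i)) - 1 + 2 * \<mu>))) * (s ^ (N - Suc (Suc i)) * q ^ (Suc (Suc i) div 2 - 1))"
          by (simp only: mult.assoc)
        also have "\<dots> = real N * (real N - 1) * (real (M choose i) * moment \<mu> i * (s ^ (M - i) * q ^ (i div 2)))"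
          unfolding * using 3 by (simp add: mult.assoc)
        finally show "c (Suc (Suc i)) * (real (Suc (Suc i)) * (real (Suc (Suc i)) - 1 + 2 * \<mu>) * s ^ (N - Suc (Suc i)) * q ^ (Suc (Suc i) div 2 - 1))
          = real N * (real N - 1) * (real (M choose i) * moment \<mu> i * (s ^ (M - i) * q ^ (i div 2)))" .
      qed
      also have "\<dots> = real N * (real N - 1) * zonal_monom \<mu> (N - 2) x y"
        unfolding zonal_monom_def 3 s_def[symmetric] q_def[symmetric] by (simp add: sum_distrib_left)
      finally show ?thesis using X by simp
    qed
  qed
  show ?thesis unfolding main using XY by simp
qed

lemma zonal_monom_polys [simp, intro]: "(\<lambda>x. zonal_monom \<mu> N x y) \<in> polys"
  by (rule polysI[OF zonal_monom_polys_le])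

definition zonal_poly :: "real \<Rightarrow> real poly \<Rightarrow> real^'n \<Rightarrow> real^'n \<Rightarrow> real" where
  "zonal_poly \<mu> p x y = (\<Sum>N\<le>degree p. coeff p N * zonal_monom \<mu> N x y)"

text \<open>The operator \<open>L p = (1 - z\<^sup>2) p'' - (2 l + 1) z p'\<close> on polynomials.\<close>

definition gegenbauer_op :: "real \<Rightarrow> real poly \<Rightarrow> real poly" where
  "gegenbauer_op l p = pderiv (pderiv p) - monom 1 2 * pderiv (pderiv p) - smult (2 * l + 1) (monom 1 1 * pderiv p)"

lemma coeff_gegenbauer_op:
  "coeff (gegenbauer_op l p) k = (real k + 2) * (real k + 1) * coeff p (k + 2) - eigval l k * coeff p k"
proof -
  have "coeff (monom 1 2 * pderiv (pderiv p)) k = real k * (real k - 1) * coeff p k"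
  proof -
    consider "k = 0" | "k = 1" | m where "k = Suc (Suc m)" by (metis One_nat_def not0_implies_Suc)
    then show ?thesis by cases (auto simp: coeff_monom_mult coeff_pderiv)
  qed
  moreover have "coeff (monom 1 1 * pderiv p) k = real k * coeff p k"
    by (cases k) (auto simp: coeff_monom_mult coeff_pderiv)
  moreover have "coeff (pderiv (pderiv p)) k = (real k + 2) * (real k + 1) * coeff p (k + 2)"
    by (simp add: coeff_pderiv algebra_simps)
  ultimately show ?thesis unfolding gegenbauer_op_def eigval_def by (simp add: algebra_simps)
qed

lemma zonal_poly_bound:
  assumes "degree p \<le> n" shows "zonal_poly \<mu> p x y = (\<Sum>N\<le>n. coeff p N * zonal_monom \<mu> N x y)"
  unfolding zonal_poly_def by (rule sum.mono_neutral_left) (use assms in \<open>auto simp: coeff_eq_0\<close>)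

lemma degree_gegenbauer_op: "degree p \<le> n \<Longrightarrow> degree (gegenbauer_op l p) \<le> n"
  by (rule degree_le) (auto simp: coeff_gegenbauer_op coeff_eq_0)

lemma zonal_poly_add: "zonal_poly \<mu> (p + q) x y = zonal_poly \<mu> p x y + zonal_poly \<mu> q x y"
  using zonal_poly_bound[of p "max (degree p) (degree q)" \<mu> x y] zonal_poly_bound[of q "max (degree p) (degree q)" \<mu> x y]
    zonal_poly_bound[of "p + q" "max (degree p) (degree q)" \<mu> x y] degree_add_le_max[of p q]
  by (simp add: sum.distrib distrib_right)

lemma zonal_poly_0 [simp]: "zonal_poly \<mu> 0 x y = 0" by (simp add: zonal_poly_def)

lemma zonal_poly_smult: "zonal_poly \<mu> (smult c p) x y = c * zonal_poly \<mu> p x y"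
  using zonal_poly_bound[of "smult c p" "degree p" \<mu> x y]
  by (simp add: zonal_poly_def sum_distrib_left mult.assoc)

lemma zonal_poly_sum: "zonal_poly \<mu> (\<Sum>i\<in>I. p i) x y = (\<Sum>i\<in>I. zonal_poly \<mu> (p i) x y)"
  by (induction I rule: infinite_finite_induct) (auto simp: zonal_poly_add)

lemma zonal_poly_commute: "zonal_poly \<mu> p x y = zonal_poly \<mu> p y x"
  by (simp add: zonal_poly_def zonal_monom_commute[of _ _ x y])

lemma zonal_poly_polys_le: "degree p \<le> n \<Longrightarrow> (\<lambda>x. zonal_poly \<mu> p x y) \<in> polys_le n"
  unfolding zonal_poly_def by (intro polys_le_sum polys_le_cmult polys_le_mono[OF zonal_monom_polys_le]) auto

lemma zonal_poly_polys [simp, intro]: "(\<lambda>x. zonal_poly \<mu> p x y) \<in> polys"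
  using zonal_poly_polys_le polysI by blast

text \<open>The intertwining relation between \<open>D\<close> and \<open>L\<close>. If \<open>2 \<mu>\<close> is a positive integer, the ball is a
  projection of the unit sphere of dimension \<open>d + 2 \<mu>\<close>, the lift averages a zonal function of this
  sphere over the fibres, and \<open>D\<close> and \<open>L\<close> are both forms of the Laplacian of the sphere.\<close>

lemma ball_op_zonal_poly:
  fixes x y :: "real^'n"
  assumes mu: "\<mu> \<ge> 0" and l: "l = \<mu> + (real CARD('n) - 1) / 2"
  shows "ball_op \<mu> (\<lambda>x. zonal_poly \<mu> p x y) x = zonal_poly \<mu> (gegenbauer_op l p) x y"
proof -
  define n where "n = degree p + 2"
  have "zonal_poly \<mu> (gegenbauer_op l p) x y = (\<Sum>N\<le>n. coeff (gegenbauer_op l p) N * zonal_monom \<mu> N x y)"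
    by (rule zonal_poly_bound, rule degree_gegenbauer_op) (simp add: n_def)
  also have "\<dots> = (\<Sum>N\<le>n. (real N + 2) * (real N + 1) * coeff p (N + 2) * zonal_monom \<mu> N x y) - (\<Sum>N\<le>n. eigval l N * coeff p N * zonal_monom \<mu> N x y)"
    by (simp add: coeff_gegenbauer_op sum_subtractf left_diff_distrib)
  also have "(\<Sum>N\<le>n. (real N + 2) * (real N + 1) * coeff p (N + 2) * zonal_monom \<mu> N x y) =
     (\<Sum>N\<le>Suc (Suc n). real N * (real N - 1) * coeff p N * zonal_monom \<mu> (N - 2) x y)"
    unfolding sum.atMost_Suc_shift by (simp add: algebra_simps)
  also have "\<dots> = (\<Sum>N\<le>n. real N * (real N - 1) * coeff p N * zonal_monom \<mu> (N - 2) x y)"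
    by (simp add: n_def coeff_eq_0)
  finally have A: "zonal_poly \<mu> (gegenbauer_op l p) x y =
     (\<Sum>N\<le>n. coeff p N * (- eigval l N * zonal_monom \<mu> N x y + real N * (real N - 1) * zonal_monom \<mu> (N - 2) x y))"
    by (simp add: sum_subtractf[symmetric] algebra_simps)
  have "ball_op \<mu> (\<lambda>x. zonal_poly \<mu> p x y) x = ball_op \<mu> (\<lambda>x. \<Sum>N\<le>n. coeff p N * zonal_monom \<mu> N x y) x"
    by (simp add: zonal_poly_bound[of p n] n_def)
  also have "\<dots> = (\<Sum>N\<le>n. coeff p N * ball_op \<mu> (\<lambda>x. zonal_monom \<mu> N x y) x)"
    by (subst ball_op_sum) (auto simp: ball_op_cmult)
  finally show ?thesis unfolding A ball_op_zonal_monom[OF mu l] .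
qed

text \<open>The same lift for arbitrary functions; on the closed ball it agrees with \<open>zonal_poly\<close>. The
  polynomial form is the one on which \<open>D\<close> can act, the integral form shows that the lift preserves
  inequalities.\<close>

definition zonal :: "real \<Rightarrow> (real \<Rightarrow> real) \<Rightarrow> real^'n \<Rightarrow> real^'n \<Rightarrow> real" where
  "zonal \<mu> f x y = gegenbauer_mean \<mu> (\<lambda>u. f (x \<bullet> y + u * (sqrt (1 - (norm x)\<^sup>2) * sqrt (1 - (norm y)\<^sup>2))))"

lemma zonal_poly_eq:
  assumes mu: "\<mu> \<ge> 0" and "norm x \<le> 1" "norm y \<le> 1"
  shows "zonal \<mu> (poly p) x y = zonal_poly \<mu> p x y"
proof -
  define v where "v = sqrt (1 - (norm x)\<^sup>2) * sqrt (1 - (norm y)\<^sup>2)"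
  have v2: "v\<^sup>2 = zonal_q x y"
  proof -
    have "(norm x)\<^sup>2 \<le> 1" "(norm y)\<^sup>2 \<le> 1" using assms by (auto simp: power_le_one)
    then show ?thesis by (simp add: v_def zonal_q_def power_mult_distrib)
  qed
  have "zonal \<mu> (poly p) x y = gegenbauer_mean \<mu> (\<lambda>u. \<Sum>N\<le>degree p. coeff p N * (\<Sum>j\<le>N. real (N choose j) * (x \<bullet> y) ^ (N - j) * v ^ j * u ^ j))"
    unfolding zonal_def v_def[symmetric]
    by (intro arg_cong[where f = "gegenbauer_mean \<mu>"] ext)
      (simp add: poly_altdef add.commute[of "x \<bullet> y"] binomial_ring power_mult_distrib mult_ac)
  also have "\<dots> = (\<Sum>N\<le>degree p. coeff p N * (\<Sum>j\<le>N. real (N choose j) * (x \<bullet> y) ^ (N - j) * v ^ j * moment \<mu> j))"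
    by (simp add: gegenbauer_mean_sum[OF mu] gegenbauer_mean_cmult[OF mu] moment_def[OF mu] continuous_intros)
  also have "\<dots> = (\<Sum>N\<le>degree p. coeff p N * zonal_monom \<mu> N x y)"
  proof -
    have "real (N choose j) * (x \<bullet> y) ^ (N - j) * v ^ j * moment \<mu> j = real (N choose j) * moment \<mu> j * ((x \<bullet> y) ^ (N - j) * zonal_q x y ^ (j div 2))" for N j
    proof (cases "odd j")
      case True
      then show ?thesis using moment_odd[OF mu] by simp
    next
      case False
      then obtain b where "j = 2 * b" by (auto elim: evenE)
      then show ?thesis by (simp add: power_mult v2)
    qed
    then show ?thesis by (simp only: zonal_monom_def)
  qed
  finally show ?thesis by (simp add: zonal_poly_def)
qed

lemma zonal_mono:
  assumes mu: "\<mu> \<ge> 0" and xy: "norm x \<le> 1" "norm y \<le> 1" and c: "continuous_on UNIV f" "continuous_on UNIV g"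
    and le: "\<And>z. \<bar>z\<bar> \<le> 1 \<Longrightarrow> f z \<le> g z"
  shows "zonal \<mu> f x y \<le> zonal \<mu> g x y"
proof -
  define v where "v = sqrt (1 - (norm x)\<^sup>2) * sqrt (1 - (norm y)\<^sup>2)"
  have n: "(norm x)\<^sup>2 \<le> 1" "(norm y)\<^sup>2 \<le> 1" using xy by (auto simp: power_le_one)
  have v0: "v \<ge> 0" unfolding v_def using n by simp
  \<comment> \<open>Keeps the arguments of \<open>f\<close> and \<open>g\<close> in \<open>[-1, 1]\<close>.\<close>
  have "\<bar>x \<bullet> y\<bar> + v \<le> 1"
  proof -
    have "2 * v \<le> (1 - (norm x)\<^sup>2) + (1 - (norm y)\<^sup>2)"
      unfolding v_def using n arith_geo_mean_sqrt[of "1 - (norm x)\<^sup>2" "1 - (norm y)\<^sup>2"] by (simp add: real_sqrt_mult)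
    moreover have "2 * \<bar>x \<bullet> y\<bar> \<le> (norm x)\<^sup>2 + (norm y)\<^sup>2"
      using Cauchy_Schwarz_ineq2[of x y] sum_squares_bound[of "norm x" "norm y"] by simp
    ultimately show ?thesis by simp
  qed
  then have "\<bar>x \<bullet> y + u * v\<bar> \<le> 1" if "\<bar>u\<bar> \<le> 1" for u
  proof -
    have "\<bar>u * v\<bar> \<le> 1 * v" unfolding abs_mult using that v0 by (intro mult_mono) auto
    then show ?thesis using \<open>\<bar>x \<bullet> y\<bar> + v \<le> 1\<close> by linarith
  qed
  then show ?thesis unfolding zonal_def v_def[symmetric]
    by (intro gegenbauer_mean_mono[OF mu] le continuous_on_compose2[OF c(1)] continuous_on_compose2[OF c(2)] continuous_intros) auto
qed

text \<open>\<open>L\<close> is triangular with respect to the degree, with distinct diagonal entries. The polynomial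
  \<open>r = L p + eigval l n p\<close> has degree less than \<open>n\<close> and decomposes by induction. Dividing its part
  of index \<open>j\<close> by \<open>eigval l n - eigval l j\<close> and subtracting from \<open>p\<close> leaves an eigenfunction of
  index \<open>n\<close>.\<close>

lemma gegenbauer_eigen_decomposition:
  assumes l: "l \<ge> 0" and "degree p \<le> n"
  shows "\<exists>e. (\<forall>j. degree (e j) \<le> j \<and> gegenbauer_op l (e j) = smult (- eigval l j) (e j)) \<and> (\<forall>j>n. e j = 0) \<and> p = (\<Sum>j\<le>n. e j)"
  using assms(2)
proof (induction n arbitrary: p rule: less_induct)
  case (less n)
  have ev: "eigval l k < eigval l n" if "k < n" for k
    unfolding eigval_def using that l by (intro mult_strict_mono) auto
  have add: "gegenbauer_op l (p + q) = gegenbauer_op l p + gegenbauer_op l q" for p q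
    by (simp add: gegenbauer_op_def pderiv_add algebra_simps smult_add_right)
  have scale: "gegenbauer_op l (smult c p) = smult c (gegenbauer_op l p)" for c p
    by (simp add: gegenbauer_op_def pderiv_smult smult_diff_right mult.commute)
  have z: "gegenbauer_op l 0 = 0" by (simp add: gegenbauer_op_def)
  have sum: "gegenbauer_op l (\<Sum>i\<in>I. f i) = (\<Sum>i\<in>I. gegenbauer_op l (f i))" for I :: "nat set" and f
    by (induction I rule: infinite_finite_induct) (auto simp: add z)
  define r where "r = gegenbauer_op l p + smult (eigval l n) p"
  have cr: "coeff r k = 0" if "k \<ge> n" for k
    using that less.prems by (cases "k = n") (auto simp: r_def coeff_gegenbauer_op coeff_eq_0)
  show ?case
  proof (cases n)
    case 0
    then have "r = 0" using cr by (intro poly_eqI) simp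
    then have "gegenbauer_op l p = smult (- eigval l n) p" by (simp add: r_def add_eq_0_iff2)
    then show ?thesis using 0 less.prems by (intro exI[of _ "\<lambda>j. if j = 0 then p else 0"]) (auto simp: z)
  next
    case (Suc m)
    have "degree r \<le> m" using cr Suc by (intro degree_le) auto
    then obtain e where e: "\<And>j. degree (e j) \<le> j" "\<And>j. gegenbauer_op l (e j) = smult (- eigval l j) (e j)" "\<And>j. j > m \<Longrightarrow> e j = 0" "r = (\<Sum>j\<le>m. e j)"
      using less.IH[of m r] Suc by auto
    define c where "c j = 1 / (eigval l n - eigval l j)" for j
    define h where "h = p - (\<Sum>j\<le>m. smult (c j) (e j))"
    have p: "p = h + (\<Sum>j\<le>m. smult (c j) (e j))" by (simp add: h_def)
    have "gegenbauer_op l h + smult (eigval l n) h = 0"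
    proof -
      have "r = (gegenbauer_op l h + smult (eigval l n) h) + (\<Sum>j\<le>m. smult (c j * (eigval l n - eigval l j)) (e j))"
      proof -
        have sm: "smult k (\<Sum>j\<le>m. f j) = (\<Sum>j\<le>m. smult k (f j))" for k :: real and f
          by (induction m) (simp_all add: smult_add_right)
        have "r = (gegenbauer_op l h + smult (eigval l n) h)
           + ((\<Sum>j\<le>m. smult (c j) (smult (- eigval l j) (e j))) + (\<Sum>j\<le>m. smult (eigval l n) (smult (c j) (e j))))"
          unfolding r_def by (subst (1 2) p) (simp only: add sum scale e(2) smult_add_right sm ac_simps)
        also have "(\<Sum>j\<le>m. smult (c j) (smult (- eigval l j) (e j))) + (\<Sum>j\<le>m. smult (eigval l n) (smult (c j) (e j)))
           = (\<Sum>j\<le>m. smult (c j * (eigval l n - eigval l j)) (e j))"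
          unfolding sum.distrib[symmetric] smult_smult smult_add_left[symmetric] by (simp add: algebra_simps)
        finally show ?thesis .
      qed
      also have "(\<Sum>j\<le>m. smult (c j * (eigval l n - eigval l j)) (e j)) = (\<Sum>j\<le>m. e j)"
      proof (rule sum.cong[OF refl])
        fix j assume "j \<in> {..m}"
        then have "eigval l n - eigval l j \<noteq> 0" using ev[of j] Suc by auto
        then show "smult (c j * (eigval l n - eigval l j)) (e j) = e j" by (simp add: c_def)
      qed
      finally show ?thesis using e(4) by simp
    qed
    then have hh: "gegenbauer_op l h = smult (- eigval l n) h" by (simp add: add_eq_0_iff2)
    have "degree h \<le> n" unfolding h_def using less.prems e(1) Suc
      by (intro degree_diff_le degree_sum_le) (auto intro: order_trans[OF degree_smult_le] order_trans[OF e(1)])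
    then show ?thesis using hh e(1,2) Suc p
      by (intro exI[of _ "\<lambda>j. if j = n then h else if j \<le> m then smult (c j) (e j) else 0"])
        (auto simp: scale z mult.commute intro: order_trans[OF degree_smult_le])
  qed
qed

section \<open>The parabolic minimum principle\<close>

text \<open>The differential inequality enters through \<open>step\<close>: at points where \<open>v t\<close> is minimal in
  space, the derivative in time is nonnegative. Adding \<open>\<epsilon> t\<close> makes this strict. If \<open>v + \<epsilon> t\<close> had a
  negative minimum, attained at a positive time, its derivative in time there would be positive,
  and an earlier value would be smaller.\<close>

lemma parabolic_minimum_principle:
  fixes v :: "real \<Rightarrow> real \<Rightarrow> real"
  assumes T: "T > 0" and ab: "\<alpha> \<le> \<beta>"
    and cont: "continuous_on ({0..T} \<times> {\<alpha>..\<beta>}) (\<lambda>(t, z). v t z)"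
    and init: "\<And>z. z \<in> {\<alpha>..\<beta>} \<Longrightarrow> 0 \<le> v 0 z"
    and step: "\<And>t z. 0 < t \<Longrightarrow> t \<le> T \<Longrightarrow> z \<in> {\<alpha>..\<beta>} \<Longrightarrow> (\<forall>z'\<in>{\<alpha>..\<beta>}. v t z \<le> v t z') \<Longrightarrow>
      \<exists>d\<ge>0. ((\<lambda>s. v s z) has_real_derivative d) (at t)"
    and t: "t \<in> {0..T}" and z: "z \<in> {\<alpha>..\<beta>}"
  shows "0 \<le> v t z"
proof (rule ccontr)
  assume "\<not> 0 \<le> v t z"
  then have neg: "v t z < 0" by simp
  \<comment> \<open>Small enough for \<open>v + \<epsilon> t\<close> to stay negative at the given point.\<close>
  define \<epsilon> where "\<epsilon> = - v t z / (2 * T)"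
  have \<epsilon>: "\<epsilon> > 0" using neg T by (simp add: \<epsilon>_def divide_neg_pos)
  define w where "w p = (case p of (t, z) \<Rightarrow> v t z + \<epsilon> * t)" for p
  have "continuous_on ({0..T} \<times> {\<alpha>..\<beta>}) (\<lambda>p. (case p of (t, z) \<Rightarrow> v t z) + \<epsilon> * fst p)"
    by (intro continuous_intros cont)
  then have cw: "continuous_on ({0..T} \<times> {\<alpha>..\<beta>}) w"
    by (rule continuous_on_eq) (auto simp: w_def)
  have "compact ({0..T} \<times> {\<alpha>..\<beta>})" by (intro compact_Times compact_Icc)
  moreover have "{0..T} \<times> {\<alpha>..\<beta>} \<noteq> {}" using t z by auto
  ultimately obtain p where p: "p \<in> {0..T} \<times> {\<alpha>..\<beta>}" "\<And>q. q \<in> {0..T} \<times> {\<alpha>..\<beta>} \<Longrightarrow> w p \<le> w q"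
    using continuous_attains_inf[OF _ _ cw] by blast
  obtain t0 z0 where p0: "p = (t0, z0)" by (cases p)
  have t0: "t0 \<in> {0..T}" and z0: "z0 \<in> {\<alpha>..\<beta>}" using p(1) p0 by auto
  have min: "v t0 z0 + \<epsilon> * t0 \<le> v s z' + \<epsilon> * s" if "s \<in> {0..T}" "z' \<in> {\<alpha>..\<beta>}" for s z'
    using p(2)[of "(s, z')"] that by (simp add: w_def p0)
  have "v t z + \<epsilon> * t \<le> v t z + \<epsilon> * T" using t \<epsilon> by simp
  also have "\<dots> = v t z / 2" using T by (simp add: \<epsilon>_def)
  also have "\<dots> < 0" using neg by simp
  finally have "v t0 z0 + \<epsilon> * t0 < 0" using min[OF t z] by linarith
  then have "t0 \<noteq> 0" using init[OF z0] by auto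
  then have t0': "0 < t0" "t0 \<le> T" using t0 by auto
  have "\<forall>z'\<in>{\<alpha>..\<beta>}. v t0 z0 \<le> v t0 z'" using min[OF t0] by auto
  then obtain d where d: "d \<ge> 0" "((\<lambda>s. v s z0) has_real_derivative d) (at t0)"
    using step[OF t0' z0] by blast
  have "((\<lambda>s. v s z0 + \<epsilon> * s) has_real_derivative d + \<epsilon> * 1) (at t0)"
    by (intro DERIV_add d(2) DERIV_cmult DERIV_ident)
  moreover have "0 < d + \<epsilon> * 1" using d \<epsilon> by simp
  ultimately obtain \<delta> where \<delta>: "\<delta> > 0" "\<And>h. 0 < h \<Longrightarrow> h < \<delta> \<Longrightarrow> v (t0 - h) z0 + \<epsilon> * (t0 - h) < v t0 z0 + \<epsilon> * t0"
    using DERIV_pos_inc_left by blast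
  define h where "h = min (\<delta> / 2) t0"
  have "0 < h" "h < \<delta>" "t0 - h \<in> {0..T}" using \<delta>(1) t0' by (auto simp: h_def)
  then show False using \<delta>(2)[of h] min[of "t0 - h" z0] z0 by auto
qed

lemma second_derivative_at_min:
  fixes f f' :: "real \<Rightarrow> real"
  assumes z: "\<alpha> < z" "z < \<beta>"
    and f: "\<And>x. \<alpha> < x \<Longrightarrow> x < \<beta> \<Longrightarrow> (f has_real_derivative f' x) (at x)"
    and f2: "(f' has_real_derivative f2) (at z)"
    and min: "\<And>x. x \<in> {\<alpha>..\<beta>} \<Longrightarrow> f z \<le> f x"
  shows "f' z = 0" "f2 \<ge> 0"
proof -
  show 0: "f' z = 0"
  proof (rule DERIV_local_min[OF f[OF z]])
    show "0 < min (z - \<alpha>) (\<beta> - z)" using z by simp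
    show "\<forall>y. \<bar>z - y\<bar> < min (z - \<alpha>) (\<beta> - z) \<longrightarrow> f z \<le> f y"
      using min by (auto simp: abs_less_iff)
  qed
  show "f2 \<ge> 0"
  proof (rule ccontr)
    assume "\<not> f2 \<ge> 0"
    then obtain \<delta> where \<delta>: "\<delta> > 0" "\<And>h. 0 < h \<Longrightarrow> h < \<delta> \<Longrightarrow> f' (z + h) < f' z"
      using DERIV_neg_dec_right[OF f2] by auto
    define h where "h = min (\<delta> / 2) ((\<beta> - z) / 2)"
    have h: "0 < h" "h < \<delta>" "z + h < \<beta>"
      using \<delta>(1) z min_less_iff_disj[of "\<delta> / 2" "(\<beta> - z) / 2" "\<beta> - z"] by (auto simp: h_def) 
    obtain \<xi> where \<xi>: "z < \<xi>" "\<xi> < z + h" "f (z + h) - f z = (z + h - z) * f' \<xi>"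
      using MVT2[of z "z + h" f f'] h z f by auto
    have "f' \<xi> < 0" using \<delta>(2)[of "\<xi> - z"] \<xi> h 0 by auto
    then have "f (z + h) - f z < 0" unfolding \<xi>(3) using h by (intro mult_pos_neg) auto
    then show False using min[of "z + h"] h z by auto
  qed
qed

lemma derivative_at_min_right:
  fixes f :: "real \<Rightarrow> real"
  assumes "(f has_real_derivative d) (at b)" "a < b" "\<And>x. x \<in> {a..b} \<Longrightarrow> f b \<le> f x"
  shows "d \<le> 0"
proof (rule ccontr)
  assume "\<not> d \<le> 0"
  then obtain \<delta> where \<delta>: "\<delta> > 0" "\<And>h. 0 < h \<Longrightarrow> h < \<delta> \<Longrightarrow> f (b - h) < f b"
    using DERIV_pos_inc_left[OF assms(1)] by auto
  define h where "h = min (\<delta> / 2) (b - a)"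
  have "0 < h" "h < \<delta>" "b - h \<in> {a..b}" using \<delta>(1) assms(2) by (auto simp: h_def)
  then show False using \<delta>(2)[of h] assms(3)[of "b - h"] by auto
qed

lemma derivative_at_min_left:
  fixes f :: "real \<Rightarrow> real"
  assumes "(f has_real_derivative d) (at a)" "a < b" "\<And>x. x \<in> {a..b} \<Longrightarrow> f a \<le> f x"
  shows "d \<ge> 0"
proof (rule ccontr)
  assume "\<not> d \<ge> 0"
  then obtain \<delta> where \<delta>: "\<delta> > 0" "\<And>h. 0 < h \<Longrightarrow> h < \<delta> \<Longrightarrow> f (a + h) < f a"
    using DERIV_neg_dec_right[OF assms(1)] by auto
  define h where "h = min (\<delta> / 2) (b - a)"
  have "0 < h" "h < \<delta>" "a + h \<in> {a..b}" using \<delta>(1) assms(2) by (auto simp: h_def)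
  then show False using \<delta>(2)[of h] assms(3)[of "a + h"] by auto
qed

text \<open>At the end points \<open>1 - z\<^sup>2\<close> vanishes and the first-order term of \<open>L\<close> points into the
  interval; this takes the place of a boundary condition.\<close>

lemma gegenbauer_op_at_min:
  fixes f f' f2 :: "real \<Rightarrow> real"
  assumes l: "l \<ge> 0" and z: "z \<in> {-1..1}"
    and f: "\<And>x. (f has_real_derivative f' x) (at x)" and f2: "\<And>x. (f' has_real_derivative f2 x) (at x)"
    and min: "\<forall>x\<in>{-1..1}. f z \<le> f x"
  shows "(1 - z\<^sup>2) * f2 z - (2 * l + 1) * z * f' z \<ge> 0"
proof -
  consider "z = -1" | "z = 1" | "-1 < z" "z < 1" using z by fastforce
  then show ?thesis
  proof cases
    case 1
    then have "f' z \<ge> 0" using min by (intro derivative_at_min_left[OF f, of z 1]) auto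
    then have "(2 * l + 1) * f' z \<ge> 0" using l by (intro mult_nonneg_nonneg) auto
    then show ?thesis using 1 by (simp add: algebra_simps)
  next
    case 2
    then have "f' z \<le> 0" using min by (intro derivative_at_min_right[OF f, of "-1" z]) auto
    then have "(2 * l + 1) * f' z \<le> 0" using l by (intro mult_nonneg_nonpos) auto
    then show ?thesis using 2 by simp
  next
    case 3
    then have "f' z = 0" "f2 z \<ge> 0" using second_derivative_at_min[OF 3 f f2] min by auto
    moreover have "z\<^sup>2 \<le> 1" using 3 by (simp add: abs_square_le_1)
    ultimately show ?thesis by simp
  qed
qed

section \<open>Barriers for the Gegenbauer heat flow\<close>

context
  fixes l :: real and e :: "nat \<Rightarrow> real poly" and n :: nat
  assumes l: "l \<ge> 0"
    and eig: "\<And>j. gegenbauer_op l (e j) = smult (- eigval l j) (e j)"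
begin

text \<open>The solution of \<open>\<partial>\<^sub>t f = L f\<close> with initial value the sum of the eigenfunctions
  \<open>e 0, \<dots>, e n\<close>.\<close>

definition heat_flow :: "real \<Rightarrow> real \<Rightarrow> real" where
  "heat_flow t z = (\<Sum>j\<le>n. exp (- t * eigval l j) * poly (e j) z)"

definition heat_flow_z :: "real \<Rightarrow> real \<Rightarrow> real" where
  "heat_flow_z t z = (\<Sum>j\<le>n. exp (- t * eigval l j) * poly (pderiv (e j)) z)"

definition heat_flow_zz :: "real \<Rightarrow> real \<Rightarrow> real" where
  "heat_flow_zz t z = (\<Sum>j\<le>n. exp (- t * eigval l j) * poly (pderiv (pderiv (e j))) z)"

text \<open>Defined as \<open>L\<close> applied to the flow; \<open>heat_flow_dt\<close> identifies it with the derivative in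
  time.\<close>

definition heat_flow_t :: "real \<Rightarrow> real \<Rightarrow> real" where
  "heat_flow_t t z = (1 - z\<^sup>2) * heat_flow_zz t z - (2 * l + 1) * z * heat_flow_z t z"

lemma heat_flow_dz: "(heat_flow t has_real_derivative heat_flow_z t z) (at z)"
  unfolding heat_flow_def heat_flow_z_def by (intro DERIV_sum DERIV_cmult poly_DERIV)

lemma heat_flow_dzz: "(heat_flow_z t has_real_derivative heat_flow_zz t z) (at z)"
  unfolding heat_flow_z_def heat_flow_zz_def by (intro DERIV_sum DERIV_cmult poly_DERIV)

lemma heat_flow_dt: "((\<lambda>t. heat_flow t z) has_real_derivative heat_flow_t t z) (at t)"
proof -
  have 1: "poly (gegenbauer_op l p) z = (1 - z\<^sup>2) * poly (pderiv (pderiv p)) z - (2 * l + 1) * z * poly (pderiv p) z" for p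
    by (simp add: gegenbauer_op_def poly_monom algebra_simps)
  have "heat_flow_t t z = (\<Sum>j\<le>n. exp (- t * eigval l j) * poly (gegenbauer_op l (e j)) z)"
    unfolding heat_flow_t_def heat_flow_z_def heat_flow_zz_def 1
    by (simp add: sum_distrib_left sum_subtractf[symmetric] algebra_simps)
  also have "\<dots> = (\<Sum>j\<le>n. (exp (- t * eigval l j) * (- eigval l j)) * poly (e j) z)"
    unfolding eig by (simp add: mult_ac)
  finally have 2: "heat_flow_t t z = (\<Sum>j\<le>n. (exp (- t * eigval l j) * (- eigval l j)) * poly (e j) z)" .
  show ?thesis unfolding heat_flow_def 2
    by (intro DERIV_sum DERIV_cmult_right) (auto intro!: derivative_eq_intros)
qed

lemma continuous_heat_flow: "continuous_on S (\<lambda>(t, z). heat_flow t z)"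
  unfolding heat_flow_def split_def by (intro continuous_intros)

lemma heat_flow_ge_const:
  assumes init: "\<And>z. z \<in> {-1..1} \<Longrightarrow> k \<le> heat_flow t0 z" and t: "t \<ge> t0" and z: "z \<in> {-1..1}"
  shows "k \<le> heat_flow t z"
proof -
  have "0 \<le> heat_flow (t0 + (t - t0)) z - k"
  proof (rule parabolic_minimum_principle[where v = "\<lambda>s z. heat_flow (t0 + s) z - k" and \<alpha> = "-1" and \<beta> = 1 and T = "t - t0 + 1"])
    have "continuous_on ({0..t - t0 + 1} \<times> {-1..1}) ((\<lambda>(t, z). heat_flow t z) \<circ> (\<lambda>(s, z). (t0 + s, z)))"
      by (intro continuous_on_compose continuous_heat_flow) (auto simp: split_def intro!: continuous_intros)
    then show "continuous_on ({0..t - t0 + 1} \<times> {-1..1}) (\<lambda>(s, z). heat_flow (t0 + s) z - k)"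
      by (auto simp: comp_def split_def intro!: continuous_intros)
  next
    fix s z assume s: "0 < s" "s \<le> t - t0 + 1" and z: "z \<in> {-1..1}" and min: "\<forall>z'\<in>{-1..1}. heat_flow (t0 + s) z - k \<le> heat_flow (t0 + s) z' - k"
    have "heat_flow_t (t0 + s) z \<ge> 0" unfolding heat_flow_t_def
      using min by (intro gegenbauer_op_at_min[OF l z heat_flow_dz heat_flow_dzz]) auto
    moreover have "((\<lambda>s. heat_flow (t0 + s) z - k) has_real_derivative heat_flow_t (t0 + s) z * 1 - 0) (at s)"
      by (intro DERIV_diff DERIV_const DERIV_chain2[OF heat_flow_dt]) (auto intro!: derivative_eq_intros)
    ultimately show "\<exists>d\<ge>0. ((\<lambda>s. heat_flow (t0 + s) z - k) has_real_derivative d) (at s)" by auto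
  qed (use assms in auto)
  then show ?thesis by simp
qed

text \<open>The function \<open>h s z = s powr (-m) * exp (m\<^sup>2 s) * exp (- (1 - z) / (2 s))\<close> is a
  supersolution, because \<open>\<partial>\<^sub>s h - L h = h (m - (1 - z) / (2 s))\<^sup>2\<close>. Started at \<open>s = 1 / k\<close>, a
  multiple of it coincides with the bound on the initial value.\<close>

lemma heat_flow_upper:
  assumes k: "k > (0::real)" and init: "\<And>z. z \<in> {-1..1} \<Longrightarrow> heat_flow 0 z \<le> exp (- k * (1 - z) / 2)"
    and t: "t \<ge> 0" and z: "z \<in> {-1..1}"
  defines "m \<equiv> l + 1/2"
  shows "heat_flow t z \<le> k powr (- m) * exp (m\<^sup>2 * t) * (t + 1 / k) powr (- m) * exp (- (1 - z) / (2 * (t + 1 / k)))"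
proof -
  define \<tau> where "\<tau> = 1 / k"
  have \<tau>: "\<tau> > 0" using k by (simp add: \<tau>_def)
  define h where "h s z = exp (m\<^sup>2 * s - m * ln s - (1 - z) / (2 * s))" for s z :: real
  \<comment> \<open>Normalizes the barrier at the initial time \<open>s = \<tau>\<close>.\<close>
  define C where "C = \<tau> powr m * exp (- (m\<^sup>2 * \<tau>))"
  have C: "C > 0" using \<tau> by (simp add: C_def)
  have heq: "h s z = s powr (- m) * exp (m\<^sup>2 * s) * exp (- (1 - z) / (2 * s))" if "s > 0" for s z
    using that by (simp add: h_def powr_def exp_add[symmetric] algebra_simps diff_divide_distrib)
  define v where "v t z = C * h (t + \<tau>) z - heat_flow t z" for t z
  have "0 \<le> v t z"
  proof (rule parabolic_minimum_principle[where v = v and \<alpha> = "-1" and \<beta> = 1 and T = "t + 1"])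
    have "continuous_on ({0..t + 1} \<times> {-1..1}) (\<lambda>p. C * h (fst p + \<tau>) (snd p) - (\<lambda>(t, z). heat_flow t z) p)"
      unfolding h_def using \<tau> by (intro continuous_intros continuous_heat_flow) auto
    then show "continuous_on ({0..t + 1} \<times> {-1..1}) (\<lambda>(t, z). v t z)"
      by (simp add: v_def split_def)
  next
    fix z :: real assume z: "z \<in> {-1..1}"
    have "C * h (0 + \<tau>) z = (\<tau> powr m * \<tau> powr (- m)) * (exp (- (m\<^sup>2 * \<tau>)) * exp (m\<^sup>2 * \<tau>)) * exp (- (1 - z) / (2 * \<tau>))"
      using heq[OF \<tau>] by (simp add: C_def mult_ac)
    also have "\<tau> powr m * \<tau> powr (- m) = 1" using \<tau> by (simp add: powr_add[symmetric])
    also have "exp (- (m\<^sup>2 * \<tau>)) * exp (m\<^sup>2 * \<tau>) = 1" by (simp add: exp_add[symmetric])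
    also have "exp (- (1 - z) / (2 * \<tau>)) = exp (- k * (1 - z) / 2)" using k by (simp add: \<tau>_def field_simps)
    finally show "0 \<le> v 0 z" using init[OF z] by (simp add: v_def)
  next
    fix t z :: real assume t: "0 < t" and z: "z \<in> {-1..1}" and min: "\<forall>z'\<in>{-1..1}. v t z \<le> v t z'"
    define s where "s = t + \<tau>"
    have s: "s > 0" using t \<tau> by (simp add: s_def)
    define hz where "hz z = h s z * (1 / (2 * s))" for z
    define hzz where "hzz z = h s z * (1 / (2 * s)) * (1 / (2 * s))" for z
    define ht where "ht = h s z * (m\<^sup>2 - m / s + (1 - z) / (2 * s\<^sup>2))"
    have dh: "(h s has_real_derivative hz z) (at z)" for z
      unfolding h_def hz_def using s by (auto intro!: derivative_eq_intros simp: field_simps)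
    have dhz: "(hz has_real_derivative hzz z) (at z)" for z
      unfolding hz_def[abs_def] hzz_def by (intro DERIV_cmult_right dh[unfolded hz_def])
    have dht: "((\<lambda>s. h s z) has_real_derivative ht) (at s)"
      unfolding h_def ht_def using s by (auto intro!: derivative_eq_intros simp: field_simps power2_eq_square)
    have "(1 - z\<^sup>2) * (C * hzz z - heat_flow_zz t z) - (2 * l + 1) * z * (C * hz z - heat_flow_z t z) \<ge> 0"
    proof (rule gegenbauer_op_at_min[OF l z, where f = "v t"])
      show "(v t has_real_derivative C * hz x - heat_flow_z t x) (at x)" for x
        unfolding v_def s_def[symmetric] by (intro DERIV_diff DERIV_cmult dh heat_flow_dz)
      show "((\<lambda>x. C * hz x - heat_flow_z t x) has_real_derivative C * hzz x - heat_flow_zz t x) (at x)" for x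
        by (intro DERIV_diff DERIV_cmult dhz heat_flow_dzz)
      show "\<forall>x\<in>{-1..1}. v t z \<le> v t x" by (rule min)
    qed
    then have 1: "heat_flow_t t z \<le> C * ((1 - z\<^sup>2) * hzz z - (2 * l + 1) * z * hz z)"
      unfolding heat_flow_t_def by (simp add: algebra_simps)
    have "ht - ((1 - z\<^sup>2) * hzz z - (2 * l + 1) * z * hz z) = h s z * (m - (1 - z) / (2 * s))\<^sup>2"
      unfolding ht_def hzz_def hz_def m_def using s by (simp add: field_simps power2_eq_square)
    also have "\<dots> \<ge> 0" by (simp add: h_def)
    finally have 2: "(1 - z\<^sup>2) * hzz z - (2 * l + 1) * z * hz z \<le> ht" by simp
    have "0 \<le> C * ht - heat_flow_t t z" using 1 mult_left_mono[OF 2 less_imp_le[OF C]] by linarith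
    moreover have "((\<lambda>t. v t z) has_real_derivative C * (ht * 1) - heat_flow_t t z) (at t)"
      unfolding v_def using dht unfolding s_def
      by (intro DERIV_diff DERIV_cmult heat_flow_dt DERIV_chain2[of "\<lambda>s. h s z"]) (auto intro!: derivative_eq_intros)
    ultimately show "\<exists>d\<ge>0. ((\<lambda>s. v s z) has_real_derivative d) (at t)"
      by (intro exI[of _ "C * (ht * 1) - heat_flow_t t z"]) simp
  qed (use t z in auto)
  then have "heat_flow t z \<le> C * h (t + \<tau>) z" by (simp add: v_def)
  also have "\<dots> = \<tau> powr m * (exp (- (m\<^sup>2 * \<tau>)) * exp (m\<^sup>2 * (t + \<tau>))) * (t + \<tau>) powr (- m) * exp (- (1 - z) / (2 * (t + \<tau>)))"
    using heq[of "t + \<tau>"] t \<tau> by (simp add: C_def mult_ac)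
  also have "exp (- (m\<^sup>2 * \<tau>)) * exp (m\<^sup>2 * (t + \<tau>)) = exp (m\<^sup>2 * t)" by (simp add: exp_add[symmetric] algebra_simps)
  also have "\<tau> powr m = k powr (- m)" using k by (simp add: \<tau>_def powr_divide powr_minus_divide)
  finally show ?thesis by (simp add: \<tau>_def)
qed

text \<open>For \<open>z = cos \<theta>\<close> put \<open>y = cos (\<theta> / 2)\<close>, so that \<open>z = 2 y\<^sup>2 - 1\<close>. The subsolution is
  \<open>s powr (-m) * exp (- 3 s) * exp (- \<phi> y / s)\<close> with \<open>\<phi> y = 4 (1 - y) / (1 + y)\<close>, that is
  \<open>\<phi> y = 4 (tan (\<theta> / 4))\<^sup>2\<close>, which is \<open>\<theta>\<^sup>2 / 4\<close> to leading order.

  In the variable \<open>y\<close> the operator \<open>4 L\<close> becomes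
  \<open>(1 - y\<^sup>2) \<partial>\<^sub>y\<^sup>2 - y \<partial>\<^sub>y - 2 l ((2 y\<^sup>2 - 1) / y) \<partial>\<^sub>y\<close>. It is singular at \<open>y = 0\<close>, the image of
  \<open>z = -1\<close>, where the barrier, seen as a function of \<open>z\<close>, is not smooth. There the barrier has a
  positive slope in \<open>y\<close> while the flow has slope zero, so the difference cannot attain its minimum
  at \<open>y = 0\<close>.

  The slack \<open>\<epsilon>\<close> is for initial values that vanish at \<open>z = -1\<close>, where the barrier is positive.\<close>

lemma heat_flow_lower:
  assumes k: "k > (0::real)"
    and init: "\<And>y. y \<in> {0..1} \<Longrightarrow> exp (- k * (4 * (1 - y) / (1 + y))) - \<epsilon> \<le> heat_flow 0 (2 * y\<^sup>2 - 1)"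
    and t: "t \<ge> 0" and z: "z \<in> {-1..1}"
  defines "m \<equiv> l + 1/2"
  shows "k powr (- m) * exp (- 3 * t) * (t + 1 / k) powr (- m) * exp (- 2 * (1 - z) / (t + 1 / k)) - \<epsilon> \<le> heat_flow t z"
proof -
  define \<tau> where "\<tau> = 1 / k"
  have \<tau>: "\<tau> > 0" using k by (simp add: \<tau>_def)
  define \<phi> where "\<phi> y = 4 * (1 - y) / (1 + y)" for y :: real
  define h where "h s y = exp (- 3 * s - m * ln s - \<phi> y / s)" for s y :: real
  define C where "C = \<tau> powr m * exp (3 * \<tau>)"
  have C: "C > 0" using \<tau> by (simp add: C_def)
  have heq: "h s y = s powr (- m) * exp (- 3 * s) * exp (- \<phi> y / s)" if "s > 0" for s y
    using that by (simp add: h_def powr_def exp_add[symmetric] algebra_simps)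
  define v where "v t y = heat_flow t (2 * y\<^sup>2 - 1) + \<epsilon> - C * h (t + \<tau>) y" for t y
  define y where "y = sqrt ((1 + z) / 2)"
  have y: "y \<in> {0..1}" "2 * y\<^sup>2 - 1 = z" using z by (auto simp: y_def field_simps)
  have "0 \<le> v t y"
  proof (rule parabolic_minimum_principle[where v = v and \<alpha> = 0 and \<beta> = 1 and T = "t + 1"])
    have "continuous_on ({0..t + 1} \<times> {0..1}) ((\<lambda>(t, z). heat_flow t z) \<circ> (\<lambda>(s, y). (s, 2 * y\<^sup>2 - 1)))"
      by (intro continuous_on_compose continuous_heat_flow) (auto simp: split_def intro!: continuous_intros)
    moreover have "continuous_on ({0..t + 1} \<times> {0..1}) (\<lambda>p. \<epsilon> - C * h (fst p + \<tau>) (snd p))"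
      unfolding h_def \<phi>_def using \<tau> by (intro continuous_intros) auto
    ultimately have "continuous_on ({0..t + 1} \<times> {0..1}) (\<lambda>p. ((\<lambda>(t, z). heat_flow t z) \<circ> (\<lambda>(s, y). (s, 2 * y\<^sup>2 - 1))) p + (\<epsilon> - C * h (fst p + \<tau>) (snd p)))"
      by (rule continuous_on_add)
    then show "continuous_on ({0..t + 1} \<times> {0..1}) (\<lambda>(t, y). v t y)"
      by (simp add: v_def split_def comp_def add_diff_eq)
  next
    fix y :: real assume y: "y \<in> {0..1}"
    have "C * h (0 + \<tau>) y = (\<tau> powr m * \<tau> powr (- m)) * (exp (3 * \<tau>) * exp (- 3 * \<tau>)) * exp (- \<phi> y / \<tau>)"
      using heq[OF \<tau>] by (simp add: C_def mult_ac)
    also have "\<tau> powr m * \<tau> powr (- m) = 1" using \<tau> by (simp add: powr_add[symmetric])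
    also have "exp (3 * \<tau>) * exp (- 3 * \<tau>) = 1" by (simp add: exp_add[symmetric])
    also have "exp (- \<phi> y / \<tau>) = exp (- k * (4 * (1 - y) / (1 + y)))" using k by (simp add: \<tau>_def \<phi>_def mult_ac)
    finally show "0 \<le> v 0 y" using init[OF y] by (simp add: v_def)
  next
    fix t y :: real assume t: "0 < t" and y: "y \<in> {0..1}" and min: "\<forall>y'\<in>{0..1}. v t y \<le> v t y'"
    define s where "s = t + \<tau>"
    have s: "s > 0" using t \<tau> by (simp add: s_def)
    define hy where "hy y = h s y * (8 / (s * (1 + y)\<^sup>2))" for y
    define hyy where "hyy y = h s y * (8 / (s * (1 + y)\<^sup>2))\<^sup>2 - h s y * (16 / (s * (1 + y) ^ 3))" for y
    define ht where "ht = h s y * (- 3 - m / s + \<phi> y / s\<^sup>2)"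
    have d\<phi>: "(\<phi> has_real_derivative - (8 / (1 + y)\<^sup>2)) (at y)" if "y > -1" for y
      unfolding \<phi>_def using that by (auto intro!: derivative_eq_intros simp: field_simps power2_eq_square)
    have dh: "(h s has_real_derivative hy y) (at y)" if "y > -1" for y
    proof -
      have "(h s has_real_derivative h s y * (0 - - (8 / (1 + y)\<^sup>2) / s)) (at y)"
        unfolding h_def by (intro DERIV_fun_exp DERIV_diff DERIV_const DERIV_cdivide d\<phi> that)
      then show ?thesis by (simp add: hy_def mult.commute)
    qed
    have dhy: "(hy has_real_derivative hyy y) (at y)" if "y > -1" for y
    proof -
      have 1: "((\<lambda>y. 8 / (s * (1 + y)\<^sup>2)) has_real_derivative - (16 / (s * (1 + y) ^ 3))) (at y)"
      proof -
        have 2: "((\<lambda>v. 8 / (s * v\<^sup>2)) has_real_derivative - (16 / (s * v ^ 3))) (at v)" if "v > 0" for v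
          using that s by (auto intro!: derivative_eq_intros simp: field_simps power2_eq_square power3_eq_cube)
        have "((\<lambda>y. 1 + y) has_real_derivative 1) (at y)" by (auto intro!: derivative_eq_intros)
        from DERIV_chain2[OF 2 this] that show ?thesis by simp
      qed
      have "(hy has_real_derivative hy y * (8 / (s * (1 + y)\<^sup>2)) + - (16 / (s * (1 + y) ^ 3)) * h s y) (at y)"
        unfolding hy_def[abs_def] using DERIV_mult[OF dh[OF that] 1] by (simp add: hy_def)
      moreover have "hy y * (8 / (s * (1 + y)\<^sup>2)) + - (16 / (s * (1 + y) ^ 3)) * h s y = hyy y"
        by (simp add: hyy_def hy_def power2_eq_square[of "8 / (s * (1 + y)\<^sup>2)"] algebra_simps)
      ultimately show ?thesis by simp
    qed
    have dht: "((\<lambda>s. h s y) has_real_derivative ht) (at s)"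
      unfolding h_def ht_def using s by (auto intro!: derivative_eq_intros simp: field_simps power2_eq_square)
    define vy where "vy y = heat_flow_z t (2 * y\<^sup>2 - 1) * (4 * y) - C * hy y" for y
    define vyy where "vyy y = heat_flow_zz t (2 * y\<^sup>2 - 1) * (4 * y) * (4 * y) + heat_flow_z t (2 * y\<^sup>2 - 1) * 4 - C * hyy y" for y
    have dz: "((\<lambda>y. 2 * y\<^sup>2 - 1) has_real_derivative 4 * y) (at y)" for y :: real
      by (auto intro!: derivative_eq_intros)
    have dv: "(v t has_real_derivative vy y) (at y)" if "y > -1" for y
    proof -
      have "(v t has_real_derivative heat_flow_z t (2 * y\<^sup>2 - 1) * (4 * y) + 0 - C * hy y) (at y)"
        unfolding v_def s_def[symmetric]
        by (intro DERIV_diff DERIV_add DERIV_const DERIV_cmult dh that DERIV_chain2[OF heat_flow_dz dz])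
      then show ?thesis by (simp add: vy_def)
    qed
    have dvy: "(vy has_real_derivative vyy y) (at y)" if "y > -1" for y
    proof -
      have "((\<lambda>y. 4 * y) has_real_derivative 4) (at y)" by (auto intro!: derivative_eq_intros)
      from DERIV_mult[OF DERIV_chain2[OF heat_flow_dzz dz] this]
      have "((\<lambda>y. heat_flow_z t (2 * y\<^sup>2 - 1) * (4 * y)) has_real_derivative
         heat_flow_zz t (2 * y\<^sup>2 - 1) * (4 * y) * (4 * y) + heat_flow_z t (2 * y\<^sup>2 - 1) * 4) (at y)"
        by (simp add: mult.commute)
      then show ?thesis unfolding vy_def[abs_def] vyy_def by (intro DERIV_diff DERIV_cmult dhy that)
    qed
    \<comment> \<open>At \<open>y = 0\<close> the slope of the flow is zero, because \<open>z\<close> depends on \<open>y\<close> through \<open>y\<^sup>2\<close>.\<close>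
    have y0: "y \<noteq> 0"
    proof
      assume 0: "y = 0"
      have "vy y \<ge> 0" using min 0 by (intro derivative_at_min_left[OF dv, of y 1]) auto
      moreover have "vy y < 0" unfolding vy_def hy_def 0 using C s by (simp add: h_def)
      ultimately show False by simp
    qed
    then have yp: "0 < y" "y \<le> 1" using y by auto
    have Mv: "(1 - y\<^sup>2) * vyy y - y * vy y - 2 * l * ((2 * y\<^sup>2 - 1) / y) * vy y \<ge> 0"
    proof (cases "y = 1")
      case True
      have "vy y \<le> 0" using min True by (intro derivative_at_min_right[OF dv, of y 0]) auto
      then have "(1 + 2 * l) * vy y \<le> 0" using l by (intro mult_nonneg_nonpos) auto
      then show ?thesis using True by (simp add: algebra_simps)
    next
      case False
      then have "vy y = 0" "vyy y \<ge> 0"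
        using second_derivative_at_min[of 0 y 1 "v t" vy "vyy y"] yp dv dvy min by auto
      moreover have "y\<^sup>2 \<le> 1" using yp by (simp add: power_le_one)
      ultimately show ?thesis by simp
    qed
    define Mh where "Mh = (1 - y\<^sup>2) * hyy y - y * hy y - 2 * l * ((2 * y\<^sup>2 - 1) / y) * hy y"
    have "(1 - y\<^sup>2) * vyy y - y * vy y - 2 * l * ((2 * y\<^sup>2 - 1) / y) * vy y = 4 * heat_flow_t t (2 * y\<^sup>2 - 1) - C * Mh"
      unfolding vyy_def vy_def heat_flow_t_def Mh_def using yp by (simp add: field_simps power2_eq_square)
    then have 1: "C * Mh \<le> 4 * heat_flow_t t (2 * y\<^sup>2 - 1)" using Mv by simp
    have 2: "4 * ht \<le> Mh"
    proof -
      define w where "w = 1 / s"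
      define W where "W = (1 - y) * w"
      have w: "w > 0" using s by (simp add: w_def)
      \<comment> \<open>The quotient of \<open>Mh - 4 * ht\<close> by \<open>4 * h s y\<close>, as a quadratic in \<open>w = 1 / s\<close>. The constant
        term \<open>3\<close> comes from the factor \<open>exp (- 3 s)\<close>.\<close>
      define D where "D = w\<^sup>2 * (4 * (1 - y)\<^sup>2 * ((3 + y) / (1 + y) ^ 3))
         + w * (- ((1 - y) * (y + 7) / (2 * (1 + y)\<^sup>2)) + l * ((1 - y) * (4 + 5 * y - y\<^sup>2) / (y * (1 + y)\<^sup>2))) + 3"
      define v where "v = 1 + y"
      have v: "v > 0" "y = v - 1" using yp by (simp_all add: v_def)
      have i1: "(1 - y\<^sup>2) * (64 / v ^ 4) - 4 * (4 * (1 - y) / v) = 4 * (4 * (1 - y)\<^sup>2 * ((3 + y) / v ^ 3))"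
        unfolding v(2) using v(1) by (simp add: field_simps power2_eq_square power3_eq_cube power4_eq_xxxx)
      have i2: "2 - (1 - y\<^sup>2) * (16 / v ^ 3) - y * (8 / v\<^sup>2) = 4 * - ((1 - y) * (y + 7) / (2 * v\<^sup>2))"
        unfolding v(2) using v(1) by (simp add: field_simps power2_eq_square power3_eq_cube)
      have i3: "4 - 2 * ((2 * y\<^sup>2 - 1) / y) * (8 / v\<^sup>2) = 4 * ((1 - y) * (4 + 5 * y - y\<^sup>2) / (y * v\<^sup>2))"
        using v(1) yp by (simp add: field_simps) (simp add: v_def power2_eq_square algebra_simps)
      have A: "(8 / (s * v\<^sup>2))\<^sup>2 = w\<^sup>2 * (64 / v ^ 4)" "16 / (s * v ^ 3) = w * (16 / v ^ 3)" "8 / (s * v\<^sup>2) = w * (8 / v\<^sup>2)"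
        by (simp_all add: w_def power_divide power_mult_distrib)
      have B: "m / s = w * (l + 1/2)" "\<phi> y / s\<^sup>2 = w\<^sup>2 * (4 * (1 - y) / v)"
        by (simp_all add: w_def m_def \<phi>_def v_def power_divide)
      have "Mh - 4 * ht = h s y * (w\<^sup>2 * ((1 - y\<^sup>2) * (64 / v ^ 4) - 4 * (4 * (1 - y) / v))
          + w * ((2 - (1 - y\<^sup>2) * (16 / v ^ 3) - y * (8 / v\<^sup>2)) + l * (4 - 2 * ((2 * y\<^sup>2 - 1) / y) * (8 / v\<^sup>2))) + 12)"
        unfolding Mh_def ht_def hyy_def hy_def v_def[symmetric] unfolding A(1,2) unfolding A(3) B by (simp add: algebra_simps)
      also have "\<dots> = 4 * (h s y * D)"
        unfolding i1 i2 i3 unfolding D_def v_def by (simp add: algebra_simps)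
      finally have "Mh - 4 * ht = 4 * (h s y * D)" .
      moreover have "D \<ge> 0"
      proof -
        have a1: "1 / 2 \<le> (3 + y) / (1 + y) ^ 3"
        proof -
          have "(1 + y) ^ 3 \<le> 2\<^sup>2 * (1 + y)" unfolding power3_eq_cube power2_eq_square
            using yp by (intro mult_mono) auto
          also have "\<dots> \<le> 2 * (3 + y)" using yp by simp
          finally show ?thesis using yp by (simp add: field_simps)
        qed
        have "(1 - y) * (y + 7) / (2 * (1 + y)\<^sup>2) \<le> (1 - y) * 7 / 2"
        proof -
          have "y + 7 \<le> 7 * (1 + y)\<^sup>2" using yp by (simp add: power2_eq_square algebra_simps)
          then have "(y + 7) / (1 + y)\<^sup>2 \<le> 7" using yp by (simp add: divide_le_eq)
          then have "(1 - y) * ((y + 7) / (1 + y)\<^sup>2) \<le> (1 - y) * 7" using yp by (intro mult_left_mono) auto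
          then show ?thesis by simp
        qed
        moreover have "l * ((1 - y) * (4 + 5 * y - y\<^sup>2) / (y * (1 + y)\<^sup>2)) \<ge> 0"
        proof -
          have "y\<^sup>2 \<le> y" using yp by (simp add: power2_eq_square mult_left_le)
          then show ?thesis using yp l by (intro mult_nonneg_nonneg divide_nonneg_nonneg) auto
        qed
        ultimately have "w * (- ((1 - y) * (y + 7) / (2 * (1 + y)\<^sup>2)) + l * ((1 - y) * (4 + 5 * y - y\<^sup>2) / (y * (1 + y)\<^sup>2))) \<ge> w * (- ((1 - y) * 7 / 2))"
          using w by (intro mult_left_mono) linarith+
        moreover have "w\<^sup>2 * (4 * (1 - y)\<^sup>2 * ((3 + y) / (1 + y) ^ 3)) \<ge> w\<^sup>2 * (4 * (1 - y)\<^sup>2 * (1 / 2))"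
          using a1 by (intro mult_left_mono) auto
        \<comment> \<open>The remaining quadratic has discriminant \<open>49/4 - 24 < 0\<close>.\<close>
        ultimately have "D \<ge> 2 * W\<^sup>2 - (7 / 2) * W + 3"
          unfolding D_def W_def by (simp add: power_mult_distrib mult_ac)
        moreover have "2 * W\<^sup>2 - (7 / 2) * W + 3 = 2 * (W - 7 / 8)\<^sup>2 + 47 / 32"
          by (simp add: power2_eq_square algebra_simps)
        moreover have "(W - 7 / 8)\<^sup>2 \<ge> 0" by simp
        ultimately show ?thesis by linarith
      qed
      moreover have "h s y > 0" by (simp add: h_def)
      ultimately have "0 \<le> 4 * (h s y * D)" by simp
      then show ?thesis using \<open>Mh - 4 * ht = 4 * (h s y * D)\<close> by linarith
    qed
    have "C * (4 * ht) \<le> C * Mh" using 2 C by (intro mult_left_mono) auto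
    then have "0 \<le> heat_flow_t t (2 * y\<^sup>2 - 1) - C * ht" using 1 by linarith
    moreover have "((\<lambda>t. v t y) has_real_derivative heat_flow_t t (2 * y\<^sup>2 - 1) + 0 - C * (ht * 1)) (at t)"
      unfolding v_def using dht unfolding s_def
      by (intro DERIV_diff DERIV_add DERIV_const DERIV_cmult heat_flow_dt DERIV_chain2[of "\<lambda>s. h s y"]) (auto intro!: derivative_eq_intros)
    ultimately show "\<exists>d\<ge>0. ((\<lambda>s. v s y) has_real_derivative d) (at t)"
      by (intro exI[of _ "heat_flow_t t (2 * y\<^sup>2 - 1) + 0 - C * (ht * 1)"]) simp
  qed (use t y in auto)
  then have "C * h (t + \<tau>) y - \<epsilon> \<le> heat_flow t z" using y by (simp add: v_def)
  moreover have "C * h (t + \<tau>) y = \<tau> powr m * (exp (3 * \<tau>) * exp (- 3 * (t + \<tau>))) * (t + \<tau>) powr (- m) * exp (- \<phi> y / (t + \<tau>))"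
    using heq[of "t + \<tau>"] t \<tau> by (simp add: C_def mult_ac)
  moreover have "exp (3 * \<tau>) * exp (- 3 * (t + \<tau>)) = exp (- 3 * t)" by (simp add: exp_add[symmetric] algebra_simps)
  moreover have "\<tau> powr m = k powr (- m)" using k by (simp add: \<tau>_def powr_divide powr_minus_divide)
  moreover have "k powr (- m) * exp (- 3 * t) * (t + \<tau>) powr (- m) * exp (- 2 * (1 - z) / (t + \<tau>))
     \<le> k powr (- m) * exp (- 3 * t) * (t + \<tau>) powr (- m) * exp (- \<phi> y / (t + \<tau>))"
  proof -
    \<comment> \<open>The price for returning from \<open>y\<close> to \<open>z\<close>: a larger constant in the Gaussian.\<close>
    have "\<phi> y \<le> 2 * (1 - z)"
    proof -
      have 1: "2 * (1 - z) = 4 * (1 - y) * (1 + y)" using y(2) by (simp add: power2_eq_square algebra_simps)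
      have "1 * 1 \<le> (1 + y) * (1 + y)" by (rule mult_mono) (use y(1) in auto)
      then have "4 * (1 - y) * 1 \<le> 4 * (1 - y) * ((1 + y) * (1 + y))"
        using y(1) by (intro mult_left_mono) simp_all
      then have "4 * (1 - y) \<le> (4 * (1 - y) * (1 + y)) * (1 + y)" by (simp only: mult.assoc mult_1_right)
      then have "4 * (1 - y) / (1 + y) \<le> 4 * (1 - y) * (1 + y)"
        using y(1) by (subst pos_divide_le_eq) simp_all
      then show ?thesis unfolding 1 \<phi>_def .
    qed
    then have "- 2 * (1 - z) / (t + \<tau>) \<le> - \<phi> y / (t + \<tau>)" using t \<tau> by (intro divide_right_mono) auto
    then show ?thesis by (intro mult_left_mono) auto
  qed
  ultimately show ?thesis by (simp add: \<tau>_def)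
qed

end

section \<open>An approximate identity made of zonal polynomials\<close>

text \<open>\<open>L f\<close> is \<open>(1 - z\<^sup>2) powr (1/2 - l)\<close> times the derivative of \<open>(1 - z\<^sup>2) powr (l + 1/2) * f'\<close>,
  so its mean for the weight \<open>(1 - z\<^sup>2) powr (l - 1/2)\<close> is zero.\<close>

lemma gegenbauer_mean_gegenbauer_op:
  assumes "l \<ge> 0" shows "gegenbauer_mean (l + 1/2) (poly (gegenbauer_op l p)) = 0"
proof -
  define a where "a = l + 1/2"
  have a: "a \<ge> 0" using assms by (simp add: a_def)
  have "poly (gegenbauer_op l p) = (\<lambda>z. (1 - z\<^sup>2) * poly (pderiv (pderiv p)) z + (- (2 * a)) * (z * poly (pderiv p) z))"
    by (simp add: fun_eq_iff gegenbauer_op_def poly_monom a_def algebra_simps)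
  then have "gegenbauer_mean a (poly (gegenbauer_op l p)) =
    gegenbauer_mean a (\<lambda>z. (1 - z\<^sup>2) * poly (pderiv (pderiv p)) z) + (- (2 * a)) * gegenbauer_mean a (\<lambda>z. z * poly (pderiv p) z)"
    by (simp only: gegenbauer_mean_cmult[OF a, symmetric]) (intro gegenbauer_mean_add[OF a] continuous_intros)
  then show ?thesis unfolding a_def[symmetric] using gegenbauer_mean_by_parts[OF a, of "pderiv p"] by simp
qed

text \<open>A polynomial that is nonnegative on \<open>[-1, 1]\<close>, concentrates at \<open>z = 1\<close> and is bounded there
  by \<open>exp (- k (1 - z) / 2)\<close>. As a polynomial it is a finite sum of eigenfunctions of \<open>L\<close>, so the
  flow that starts from it is explicit.\<close>

definition bump :: "nat \<Rightarrow> real poly" where "bump k = [:1/2, 1/2:] ^ k"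

lemma poly_bump: "poly (bump k) z = ((1 + z) / 2) ^ k"
  by (simp add: bump_def poly_power field_simps)

lemma degree_bump: "degree (bump k) \<le> k"
  unfolding bump_def using degree_power_le[of "[:1/2, 1/2::real:]" k] by simp

lemma bump_upper: "z \<in> {-1..1} \<Longrightarrow> ((1 + z) / 2) ^ k \<le> exp (- real k * (1 - z) / 2)"
proof -
  assume z: "z \<in> {-1..1}"
  have "(1 + z) / 2 \<le> exp (- (1 - z) / 2)" using exp_ge_add_one_self[of "- (1 - z) / 2"] by (simp add: field_simps)
  then have "((1 + z) / 2) ^ k \<le> exp (- (1 - z) / 2) ^ k" using z by (intro power_mono) auto
  also have "\<dots> = exp (- real k * (1 - z) / 2)" by (simp add: exp_of_nat_mult[symmetric] algebra_simps)
  finally show ?thesis .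
qed

lemma bump_lower: "0 \<le> z \<Longrightarrow> z \<le> 1 \<Longrightarrow> exp (- real k * (1 - z)) \<le> ((1 + z) / 2) ^ k"
proof -
  assume z: "0 \<le> z" "z \<le> 1"
  have "1 / exp (1 - z) \<le> 1 / (1 + (1 - z))"
    using exp_ge_add_one_self[of "1 - z"] z by (intro divide_left_mono) auto
  also have "\<dots> \<le> (1 + z) / 2"
  proof -
    have "2 \<le> (1 + z) * (2 - z)" using z mult_nonneg_nonneg[of z "1 - z"] by (simp add: algebra_simps)
    then show ?thesis using z by (simp add: field_simps)
  qed
  finally have "exp (- (1 - z)) \<le> (1 + z) / 2" by (simp only: exp_minus inverse_eq_divide)
  then have "exp (- (1 - z)) ^ k \<le> ((1 + z) / 2) ^ k" by (intro power_mono) auto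
  moreover have "exp (- (1 - z)) ^ k = exp (- real k * (1 - z))" by (simp add: exp_of_nat_mult[symmetric] algebra_simps)
  ultimately show ?thesis by (simp only:)
qed

text \<open>The initial inequality of \<open>heat_flow_lower\<close>, with \<open>2 k\<close> in place of \<open>k\<close> because the bump is
  \<open>y\<close> to the power \<open>2 k\<close>. For \<open>y \<ge> 1/2\<close> one has \<open>exp (- \<phi>) \<le> 1 / (1 + \<phi>) \<le> y\<close>; for \<open>y < 1/2\<close> the
  exponent \<open>\<phi>\<close> exceeds \<open>4/3\<close>, and the left-hand side is not positive.\<close>

lemma bump_lower_sqrt:
  assumes y: "y \<in> {0..1}"
  shows "exp (- (2 * real k) * (4 * (1 - y) / (1 + y))) - exp (- 8 * real k / 3) \<le> ((1 + (2 * y\<^sup>2 - 1)) / 2) ^ k"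
proof (cases "y \<ge> 1/2")
  case True
  have "1 / exp (4 * (1 - y) / (1 + y)) \<le> 1 / (1 + 4 * (1 - y) / (1 + y))"
    using exp_ge_add_one_self[of "4 * (1 - y) / (1 + y)"] y True by (intro divide_left_mono) (auto intro!: add_pos_nonneg mult_pos_pos)
  also have "\<dots> \<le> y"
  proof -
    have "(1 - y) * (3 * y - 1) \<ge> 0" using y True by (intro mult_nonneg_nonneg) auto
    then show ?thesis using y True by (simp add: field_simps power2_eq_square)
  qed
  finally have "exp (- (4 * (1 - y) / (1 + y))) \<le> y" by (simp only: exp_minus inverse_eq_divide)
  then have "exp (- (4 * (1 - y) / (1 + y))) ^ (2 * k) \<le> y ^ (2 * k)" by (intro power_mono) auto
  moreover have "exp (- (4 * (1 - y) / (1 + y))) ^ (2 * k) = exp (- (2 * real k) * (4 * (1 - y) / (1 + y)))"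
    by (simp add: exp_of_nat_mult[symmetric])
  moreover have "y ^ (2 * k) = ((1 + (2 * y\<^sup>2 - 1)) / 2) ^ k" by (simp add: power_mult)
  moreover have "exp (- 8 * real k / 3) > 0" by simp
  ultimately show ?thesis by linarith
next
  case False
  have "4 / 3 \<le> 4 * (1 - y) / (1 + y)" using y False by (simp add: field_simps)
  then have "(2 * real k) * (4 / 3) \<le> (2 * real k) * (4 * (1 - y) / (1 + y))" by (intro mult_left_mono) auto
  then have "exp (- (2 * real k) * (4 * (1 - y) / (1 + y))) \<le> exp (- 8 * real k / 3)" by simp
  moreover have "((1 + (2 * y\<^sup>2 - 1)) / 2) ^ k \<ge> 0" by (intro zero_le_power) auto
  ultimately show ?thesis by linarith
qed

text \<open>One minus the cosine of \<open>ball_dist\<close>. The kernel is estimated in terms of this quantity,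
  which involves no inverse trigonometric function; \<open>cos_gap_dist\<close> translates the result.\<close>

definition cos_gap :: "real^'n \<Rightarrow> real^'n \<Rightarrow> real" where
  "cos_gap x y = 1 - (x \<bullet> y + sqrt (1 - (norm x)\<^sup>2) * sqrt (1 - (norm y)\<^sup>2))"

text \<open>The height of the point of the upper unit hemisphere above \<open>x\<close>.\<close>

definition bdepth :: "real^'n \<Rightarrow> real" where "bdepth x = sqrt (1 - (norm x)\<^sup>2)"

lemma bdepth_sq: "norm x \<le> 1 \<Longrightarrow> (bdepth x)\<^sup>2 = 1 - (norm x)\<^sup>2"
  by (simp add: bdepth_def power_le_one)

lemma bdepth_nonneg: "norm x \<le> 1 \<Longrightarrow> bdepth x \<ge> 0"
  by (simp add: bdepth_def power_le_one)

text \<open>Both sides are the squared chord between the points of the hemisphere above \<open>x\<close> and \<open>y\<close>.\<close>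

lemma cos_gap_eq:
  assumes "norm x \<le> 1" "norm y \<le> 1"
  shows "2 * cos_gap x y = (norm (x - y))\<^sup>2 + (bdepth x - bdepth y)\<^sup>2"
proof -
  have "(norm (x - y))\<^sup>2 = (norm x)\<^sup>2 + (norm y)\<^sup>2 - 2 * (x \<bullet> y)"
    by (simp add: power2_norm_eq_inner inner_diff inner_commute)
  moreover have "(bdepth x - bdepth y)\<^sup>2 = (bdepth x)\<^sup>2 + (bdepth y)\<^sup>2 - 2 * (bdepth x * bdepth y)"
    by (simp add: power2_eq_square algebra_simps)
  ultimately show ?thesis using assms by (simp add: bdepth_sq cos_gap_def bdepth_def[symmetric])
qed

lemma cos_gap_bounds:
  assumes "norm x \<le> 1" "norm y \<le> 1"
  shows "0 \<le> cos_gap x y" "cos_gap x y \<le> 2"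
proof -
  show "0 \<le> cos_gap x y"
  proof -
    have "0 \<le> (norm (x - y))\<^sup>2 + (bdepth x - bdepth y)\<^sup>2" by simp
    then show ?thesis using cos_gap_eq[OF assms] by linarith
  qed
  have "\<bar>x \<bullet> y\<bar> \<le> norm x * norm y" by (rule Cauchy_Schwarz_ineq2)
  also have "\<dots> \<le> 1" using assms by (simp add: mult_le_one)
  finally have "x \<bullet> y \<ge> -1" by simp
  moreover have "bdepth x * bdepth y \<ge> 0" using assms bdepth_nonneg by (intro mult_nonneg_nonneg) auto
  ultimately show "cos_gap x y \<le> 2" by (simp add: cos_gap_def bdepth_def)
qed

text \<open>The shapes that the barriers take after lifting to the ball. The time \<open>s\<close> is \<open>t\<close> plus the
  initial time of the barrier, and \<open>s = t\<close> in the limit.\<close>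

abbreviation gauss_super :: "real \<Rightarrow> real \<Rightarrow> real \<Rightarrow> real \<Rightarrow> real \<Rightarrow> real^'n \<Rightarrow> real^'n \<Rightarrow> real" where
  "gauss_super A \<mu> l t s x y \<equiv> A * exp ((l + 1/2)\<^sup>2 * t) * s powr (- (l + 1/2)) * exp (- cos_gap x y / (2 * s))
      * (1 + bdepth x * bdepth y / (2 * s)) powr (- \<mu>)"

abbreviation gauss_sub :: "real \<Rightarrow> real \<Rightarrow> real \<Rightarrow> real \<Rightarrow> real \<Rightarrow> real^'n \<Rightarrow> real^'n \<Rightarrow> real" where
  "gauss_sub A \<mu> l t s x y \<equiv> A * exp (- 3 * t) * s powr (- (l + 1/2)) * exp (- 2 * cos_gap x y / s)
      * (1 + 2 * (bdepth x * bdepth y) / s) powr (- \<mu>)"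

lemma zonal_arg: "x \<bullet> y + u * (sqrt (1 - (norm x)\<^sup>2) * sqrt (1 - (norm y)\<^sup>2)) = 1 - cos_gap x y - bdepth x * bdepth y * (1 - u)"
  by (simp add: cos_gap_def bdepth_def algebra_simps)

text \<open>An exponential in \<open>1 - z\<close> lifts to a product: since \<open>z\<close> differs from \<open>1 - cos_gap x y\<close> by a
  multiple of \<open>1 - u\<close>, the distance separates from the average over \<open>u\<close>.\<close>

lemma zonal_exp:
  assumes mu: "\<mu> \<ge> 0"
  shows "zonal \<mu> (\<lambda>z. exp (- b * (1 - z))) x y =
     exp (- b * cos_gap x y) * gegenbauer_mean \<mu> (\<lambda>u. exp (- (b * (bdepth x * bdepth y)) * (1 - u)))"
  unfolding zonal_def zonal_arg gegenbauer_mean_cmult[OF mu, symmetric]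
  by (simp add: exp_add[symmetric] algebra_simps)

lemma zonal_cmult: "\<mu> \<ge> 0 \<Longrightarrow> zonal \<mu> (\<lambda>z. c * f z) x y = c * zonal \<mu> f x y"
  unfolding zonal_def by (rule gegenbauer_mean_cmult)

lemma zonal_const: "\<mu> \<ge> 0 \<Longrightarrow> zonal \<mu> (\<lambda>z. c) x y = c"
  unfolding zonal_def by simp

lemma zonal_diff_const:
  assumes "\<mu> \<ge> 0" "continuous_on UNIV f" shows "zonal \<mu> (\<lambda>z. f z - c) x y = zonal \<mu> f x y - c"
proof -
  have "continuous_on UNIV (\<lambda>u. f (x \<bullet> y + u * (sqrt (1 - (norm x)\<^sup>2) * sqrt (1 - (norm y)\<^sup>2))))"
    by (intro continuous_on_compose2[OF assms(2)] continuous_intros) auto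
  from gegenbauer_mean_add[OF assms(1) this, of "\<lambda>_. - c"] show ?thesis
    unfolding zonal_def using assms(1) by simp
qed

context
  fixes \<mu> l :: real
  assumes mu: "\<mu> \<ge> 0" and l: "l = \<mu> + (real CARD('n::finite) - 1) / 2"
begin

lemma l_nonneg: "l \<ge> 0"
proof -
  have "real CARD('n) \<ge> 1" using zero_less_card_finite[where ?'a = 'n] by linarith
  then show ?thesis using mu unfolding l by simp
qed

lemma eigval_ge: "eigval l j \<ge> real j"
proof (cases j)
  case (Suc i)
  then have "real j * 1 \<le> real j * (real j + 2 * l)" using l_nonneg by (intro mult_left_mono) auto
  then show ?thesis by (simp add: eigval_def)
qed (simp add: eigval_def)

definition bump_part :: "nat \<Rightarrow> nat \<Rightarrow> real poly" where
  "bump_part k = (SOME e. (\<forall>j. degree (e j) \<le> j \<and> gegenbauer_op l (e j) = smult (- eigval l j) (e j)) \<and> (\<forall>j>k. e j = 0) \<and> bump k = (\<Sum>j\<le>k. e j))"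

lemma bump_part: "degree (bump_part k j) \<le> j" "gegenbauer_op l (bump_part k j) = smult (- eigval l j) (bump_part k j)"
  "j > k \<Longrightarrow> bump_part k j = 0" "bump k = (\<Sum>j\<le>k. bump_part k j)"
  using someI_ex[OF gegenbauer_eigen_decomposition[OF l_nonneg degree_bump[of k]], folded bump_part_def] by blast+

definition bump_mass :: "nat \<Rightarrow> real" where "bump_mass k = gegenbauer_mean (l + 1/2) (poly (bump k))"

text \<open>All other parts have mean zero by \<open>gegenbauer_mean_gegenbauer_op\<close>.\<close>

lemma bump_part_0: "bump_part k 0 = [:bump_mass k:]"
proof -
  have a: "l + 1/2 \<ge> 0" using l_nonneg by simp
  have z: "gegenbauer_mean (l + 1/2) (poly (bump_part k j)) = 0" if "j > 0" for j
  proof -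
    have "eigval l j > 0" using eigval_ge[of j] that by linarith
    have "0 = gegenbauer_mean (l + 1/2) (poly (smult (- eigval l j) (bump_part k j)))"
      using gegenbauer_mean_gegenbauer_op[OF l_nonneg, of "bump_part k j"] bump_part(2) by simp
    also have "\<dots> = - eigval l j * gegenbauer_mean (l + 1/2) (poly (bump_part k j))"
    proof -
      have "poly (smult (- eigval l j) (bump_part k j)) = (\<lambda>u. - eigval l j * poly (bump_part k j) u)" by (simp add: fun_eq_iff)
      then show ?thesis by (simp only: gegenbauer_mean_cmult[OF a])
    qed
    finally show ?thesis using \<open>eigval l j > 0\<close> by simp
  qed
  have "bump_mass k = gegenbauer_mean (l + 1/2) (\<lambda>u. \<Sum>j\<le>k. poly (bump_part k j) u)"
    unfolding bump_mass_def by (subst bump_part(4)) (simp add: poly_sum[abs_def])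
  also have "\<dots> = (\<Sum>j\<le>k. gegenbauer_mean (l + 1/2) (poly (bump_part k j)))"
    by (intro gegenbauer_mean_sum[OF a] continuous_real_poly)
  also have "\<dots> = gegenbauer_mean (l + 1/2) (poly (bump_part k 0))"
    using z by (subst sum.remove[of _ 0]) (auto intro: sum.neutral)
  also obtain c where c: "bump_part k 0 = [:c:]" using bump_part(1)[of k 0] degree_eq_zeroE by auto
  then have "poly (bump_part k 0) = (\<lambda>u. c)" by (simp add: fun_eq_iff)
  then have "gegenbauer_mean (l + 1/2) (poly (bump_part k 0)) = c" using a by simp
  finally show ?thesis using c by simp
qed

text \<open>The mass of the bump is of order \<open>k powr (- (l + 1/2))\<close>. Division by it removes the same
  power of \<open>k\<close> from the barriers and makes them uniform in \<open>k\<close>.\<close>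

lemma bump_mass_bounds:
  obtains c C where "0 < c" "0 < C" "\<And>k. c * (1 + real k) powr (- (l + 1/2)) \<le> bump_mass k"
    "\<And>k. bump_mass k \<le> C * (1 + real k / 2) powr (- (l + 1/2))"
proof -
  have a: "l + 1/2 \<ge> 0" using l_nonneg by simp
  obtain C where C: "C > 0" "\<And>s f. s \<ge> 0 \<Longrightarrow> continuous_on UNIV f \<Longrightarrow> (\<forall>u. \<bar>u\<bar> \<le> 1 \<longrightarrow> f u \<le> exp (- s * (1 - u))) \<Longrightarrow> gegenbauer_mean (l + 1/2) f \<le> C * (1 + s) powr (- (l + 1/2))"
    using gegenbauer_laplace_upper[OF a] by blast
  obtain c where c: "c > 0" "\<And>s f. s \<ge> 0 \<Longrightarrow> continuous_on UNIV f \<Longrightarrow> (\<forall>u. \<bar>u\<bar> \<le> 1 \<longrightarrow> 0 \<le> f u) \<Longrightarrow> (\<forall>u. 0 \<le> u \<and> u \<le> 1 \<longrightarrow> exp (- s * (1 - u)) \<le> f u) \<Longrightarrow> c * (1 + s) powr (- (l + 1/2)) \<le> gegenbauer_mean (l + 1/2) f"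
    using gegenbauer_laplace_lower[OF a] by blast
  show thesis
  proof (rule that[OF c(1) C(1)])
    fix k
    show "c * (1 + real k) powr (- (l + 1/2)) \<le> bump_mass k" unfolding bump_mass_def
      by (intro c(2) continuous_real_poly) (auto simp: poly_bump bump_lower[simplified])
    show "bump_mass k \<le> C * (1 + real k / 2) powr (- (l + 1/2))" unfolding bump_mass_def
      using bump_upper[of _ k] by (intro C(2) continuous_real_poly) (auto simp: poly_bump abs_le_iff)
  qed
qed

lemma bump_mass_pos: "bump_mass k > 0"
proof -
  obtain c C where "0 < c" "c * (1 + real k) powr (- (l + 1/2)) \<le> bump_mass k"
    using bump_mass_bounds by metis
  then show ?thesis by (smt (verit) mult_pos_pos of_nat_0_le_iff powr_gt_zero)
qed

definition ball_mass :: real where "ball_mass = ball_mean \<mu> (\<lambda>x::real^'n. 1)"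

lemma ball_mass_pos: "ball_mass > 0"
proof -
  have "ball_mean \<mu> (\<lambda>x::real^'n. 1) \<ge> 0" unfolding ball_mean_def by simp
  moreover have "ball_mean \<mu> (\<lambda>x::real^'n. 1) \<noteq> 0"
  proof
    assume "ball_mean \<mu> (\<lambda>x::real^'n. 1) = 0"
    then have "(\<lambda>x::real^'n. 1::real) = (\<lambda>x. 0)"
      by (intro weighted_inner_definite[OF mu]) (auto simp: weighted_inner_eq)
    then show False by (metis zero_neq_one)
  qed
  ultimately show ?thesis by (simp add: ball_mass_def)
qed

text \<open>Normalized to have mean one over the ball (\<open>ball_mean_approx\<close>).\<close>

definition approx :: "nat \<Rightarrow> real^'n \<Rightarrow> real^'n \<Rightarrow> real" where
  "approx k x y = zonal_poly \<mu> (bump k) x y / (bump_mass k * ball_mass)"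

definition approx_part :: "nat \<Rightarrow> nat \<Rightarrow> real^'n \<Rightarrow> real^'n \<Rightarrow> real" where
  "approx_part k j x y = zonal_poly \<mu> (bump_part k j) x y / (bump_mass k * ball_mass)"

lemma normalizer_pos: "bump_mass k * ball_mass > 0" using bump_mass_pos ball_mass_pos by simp

lemma approx_eq_sum: "approx k x y = (\<Sum>j\<le>k. approx_part k j x y)"
  unfolding approx_def approx_part_def by (subst bump_part(4)) (simp add: zonal_poly_sum sum_divide_distrib)

lemma approx_part_polys [simp, intro]: "(\<lambda>x. approx_part k j x y) \<in> polys"
  unfolding approx_part_def divide_inverse by auto

lemma approx_polys [simp, intro]: "(\<lambda>x. approx k x y) \<in> polys"
  unfolding approx_eq_sum by auto

lemma approx_part_commute: "approx_part k j x y = approx_part k j y x"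
  by (simp add: approx_part_def zonal_poly_commute)

lemma approx_part_orth_polys: "(\<lambda>x. approx_part k j x y) \<in> orth_polys \<mu> j"
proof (rule eigenfunction_in_orth_polys[OF mu _ l])
  show "(\<lambda>x. approx_part k j x y) \<in> polys_le j"
    unfolding approx_part_def divide_inverse mult.commute[of _ "inverse _"]
    by (intro polys_le_cmult zonal_poly_polys_le bump_part(1))
  show "ball_op \<mu> (\<lambda>x. approx_part k j x y) = (\<lambda>x. - eigval l j * approx_part k j x y)"
    unfolding approx_part_def divide_inverse mult.commute[of _ "inverse _"]
    by (subst ball_op_cmult) (auto simp: ball_op_zonal_poly[OF mu l] bump_part(2) zonal_poly_smult fun_eq_iff simp del: smult_minus_left)
qed

lemma approx_part_0: "approx_part k 0 x y = 1 / ball_mass"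
  using bump_mass_pos[of k] unfolding approx_part_def bump_part_0
  by (simp add: zonal_poly_def zonal_monom_def moment_0[OF mu])

lemma ball_mean_orth_polys:
  assumes "P \<in> orth_polys \<mu> j" "j > 0" shows "ball_mean \<mu> P = 0"
proof -
  have "(\<lambda>x. 1) \<in> polys_lt j" using assms(2) by (simp add: polys_lt_def)
  then have "weighted_inner \<mu> P (\<lambda>x. 1) = 0" using assms(1) unfolding orth_polys_eq[OF mu] by blast
  then show ?thesis by (simp add: weighted_inner_eq)
qed

text \<open>Parts of positive degree are orthogonal to constants, and the part of degree zero is
  constant in time.\<close>

lemma ball_mean_flow:
  "ball_mean \<mu> (\<lambda>x. \<Sum>j\<le>k. exp (- t * eigval l j) * approx_part k j x y) = 1"
proof -
  have "ball_mean \<mu> (\<lambda>x. \<Sum>j\<le>k. exp (- t * eigval l j) * approx_part k j x y) =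
     (\<Sum>j\<le>k. exp (- t * eigval l j) * ball_mean \<mu> (\<lambda>x. approx_part k j x y))"
    by (subst ball_mean_sum[OF mu]) (auto simp: ball_mean_cmult[OF mu])
  also have "\<dots> = exp (- t * eigval l 0) * ball_mean \<mu> (\<lambda>x. approx_part k 0 x y)"
    using ball_mean_orth_polys[OF approx_part_orth_polys] by (subst sum.remove[of _ 0]) (auto intro: sum.neutral)
  also have "\<dots> = ball_mean \<mu> (\<lambda>x::real^'n. (1 / ball_mass) * 1)" unfolding approx_part_0 by (simp add: eigval_def)
  also have "\<dots> = 1" unfolding ball_mean_cmult[OF mu] ball_mass_def[symmetric] using ball_mass_pos by simp
  finally show ?thesis .
qed

lemma ball_mean_approx: "ball_mean \<mu> (\<lambda>x. approx k x y) = 1"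
  using ball_mean_flow[of 0 k y] by (simp add: approx_eq_sum)

lemma AE_ball: "AE x in (ball_measure \<mu> :: (real^'n) measure). norm x < 1"
  unfolding ball_measure_eq_jacobi by (rule AE_jacobi_ball)

text \<open>The lift is at most the maximum of the bump over the arguments that occur, which is attained
  at \<open>u = 1\<close>, where the argument is \<open>1 - cos_gap x y\<close>.\<close>

lemma approx_bounds:
  assumes "norm x \<le> 1" "norm y \<le> 1"
  shows "0 \<le> approx k x y" "approx k x y \<le> (1 - cos_gap x y / 2) ^ k / (bump_mass k * ball_mass)"
proof -
  have eq: "approx k x y = zonal \<mu> (poly (bump k)) x y / (bump_mass k * ball_mass)"
    unfolding approx_def zonal_poly_eq[OF mu assms] ..
  have "zonal \<mu> (\<lambda>z. 0) x y \<le> zonal \<mu> (poly (bump k)) x y"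
    by (rule zonal_mono[OF mu assms continuous_on_const continuous_real_poly]) (auto simp: poly_bump abs_le_iff)
  then have "0 \<le> zonal \<mu> (poly (bump k)) x y" using zonal_const[OF mu, of 0 x y] by simp
  then show "0 \<le> approx k x y" unfolding eq using normalizer_pos[of k] by simp
  have "zonal \<mu> (poly (bump k)) x y \<le> gegenbauer_mean \<mu> (\<lambda>u. (1 - cos_gap x y / 2) ^ k)"
    unfolding zonal_def zonal_arg poly_bump
  proof (intro gegenbauer_mean_mono[OF mu])
    fix u :: real assume u: "\<bar>u\<bar> \<le> 1"
    have b: "bdepth x * bdepth y \<ge> 0" using assms bdepth_nonneg by (intro mult_nonneg_nonneg) auto
    have "bdepth x * bdepth y * (1 - u) \<le> bdepth x * bdepth y * 2" using b u by (intro mult_left_mono) auto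
    also have "\<dots> \<le> 2 - cos_gap x y"
    proof -
      have "1 + (x \<bullet> y - bdepth x * bdepth y) \<ge> 0"
        using cos_gap_bounds(1)[of "- x" y] assms by (simp add: cos_gap_def bdepth_def)
      then show ?thesis by (simp add: cos_gap_def bdepth_def)
    qed
    finally have "0 \<le> (1 + (1 - cos_gap x y - bdepth x * bdepth y * (1 - u))) / 2" by simp
    moreover have "bdepth x * bdepth y * (1 - u) \<ge> 0" using u by (intro mult_nonneg_nonneg[OF b]) auto
    ultimately show "((1 + (1 - cos_gap x y - bdepth x * bdepth y * (1 - u))) / 2) ^ k \<le> (1 - cos_gap x y / 2) ^ k"
      by (intro power_mono) auto
  qed (auto intro!: continuous_intros)
  then show "approx k x y \<le> (1 - cos_gap x y / 2) ^ k / (bump_mass k * ball_mass)"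
    unfolding eq using normalizer_pos[of k] mu by (intro divide_right_mono) auto
qed

lemma ball_mean_mono:
  assumes "P \<in> polys" "Q \<in> polys" "\<And>x. norm x < 1 \<Longrightarrow> P x \<le> Q x"
  shows "ball_mean \<mu> P \<le> ball_mean \<mu> (Q :: real^'n \<Rightarrow> real)"
  unfolding ball_mean_def using AE_ball
  by (intro integral_mono_AE integrable_ball_polys[OF mu] assms) (auto elim!: eventually_mono intro: assms)

text \<open>The kernel is nonnegative with mean one. Away from \<open>y\<close> it is exponentially small in \<open>k\<close>,
  which beats the power of \<open>k\<close> in the normalization.\<close>

lemma approx_identity:
  assumes Q: "Q \<in> polys" and y: "norm y < 1"
  shows "(\<lambda>k. ball_mean \<mu> (\<lambda>x. approx k x y * Q x)) \<longlonglongrightarrow> Q y"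
proof (rule LIMSEQ_I)
  fix r :: real assume r: "r > 0"
  define \<epsilon> where "\<epsilon> = r / 4"
  have \<epsilon>: "\<epsilon> > 0" using r by (simp add: \<epsilon>_def)
  have "isCont Q y" using polys_continuous[OF Q, of UNIV] by (simp add: continuous_on_eq_continuous_at)
  then obtain \<delta> where \<delta>: "\<delta> > 0" "\<And>x. norm (x - y) < \<delta> \<Longrightarrow> \<bar>Q x - Q y\<bar> < \<epsilon>"
    using \<epsilon> unfolding continuous_at_eps_delta dist_norm by auto
  obtain M where M: "\<And>x. norm x \<le> 1 \<Longrightarrow> \<bar>Q x\<bar> \<le> M"
    using continuous_bounded_on_cball[OF polys_continuous[OF Q]] by blast
  have M0: "M \<ge> 0" using M[of 0] by auto
  obtain c C where c: "0 < c" "\<And>k. c * (1 + real k) powr (- (l + 1/2)) \<le> bump_mass k"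
    using bump_mass_bounds by metis
  define \<theta> where "\<theta> = \<delta>\<^sup>2 / 4"
  have \<theta>: "\<theta> > 0" using \<delta>(1) by (simp add: \<theta>_def)
  define \<eta> where "\<eta> k = exp (- \<theta> * real k) * (1 + real k) powr (l + 1/2) / (c * ball_mass)" for k
  have far: "approx k x y \<le> \<eta> k" if x: "norm x < 1" "norm (x - y) \<ge> \<delta>" for k x
  proof -
    have "\<delta>\<^sup>2 \<le> (norm (x - y))\<^sup>2" using x \<delta>(1) by (intro power_mono) auto
    also have "\<dots> \<le> 2 * cos_gap x y" using cos_gap_eq[of x y] x y by simp
    finally have g: "1 - cos_gap x y / 2 \<le> 1 - \<theta>" by (simp add: \<theta>_def)
    also have "\<dots> \<le> exp (- \<theta>)" using exp_ge_add_one_self[of "- \<theta>"] by simp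
    finally have "1 - cos_gap x y / 2 \<le> exp (- \<theta>)" .
    then have "(1 - cos_gap x y / 2) ^ k \<le> exp (- \<theta>) ^ k"
      using cos_gap_bounds[of x y] x y by (intro power_mono) auto
    also have "\<dots> = exp (- \<theta> * real k)" by (simp add: exp_of_nat_mult[symmetric] mult.commute)
    finally have p: "(1 - cos_gap x y / 2) ^ k \<le> exp (- \<theta> * real k)" .
    have cp: "c * (1 + real k) powr (- (l + 1/2)) * ball_mass > 0" using c(1) ball_mass_pos by simp
    have "approx k x y \<le> (1 - cos_gap x y / 2) ^ k / (bump_mass k * ball_mass)"
      using approx_bounds x y by simp
    also have "\<dots> \<le> exp (- \<theta> * real k) / (bump_mass k * ball_mass)"
      using p normalizer_pos[of k] by (intro divide_right_mono) auto
    also have "\<dots> \<le> exp (- \<theta> * real k) / (c * (1 + real k) powr (- (l + 1/2)) * ball_mass)"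
      using c(2)[of k] cp ball_mass_pos normalizer_pos[of k] bump_mass_pos[of k] c(1) by (intro divide_left_mono mult_right_mono mult_pos_pos) auto
    also have "\<dots> = \<eta> k" unfolding \<eta>_def powr_minus_divide by simp
    finally show ?thesis .
  qed
  have "\<eta> \<longlonglongrightarrow> 0"
  proof -
    have "(\<lambda>k::nat. (1 + real k) powr (l + 1/2) * exp (- \<theta> * real k)) \<longlonglongrightarrow> 0"
      using \<theta> by real_asymp
    then have "(\<lambda>k. (1 + real k) powr (l + 1/2) * exp (- \<theta> * real k) / (c * ball_mass)) \<longlonglongrightarrow> 0 / (c * ball_mass)"
      by (intro tendsto_divide tendsto_const) (use c ball_mass_pos in auto)
    then show ?thesis by (simp add: \<eta>_def[abs_def] mult.commute)
  qed
  then have "(\<lambda>k. 2 * M * \<eta> k * ball_mass) \<longlonglongrightarrow> 2 * M * 0 * ball_mass" by (intro tendsto_intros)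
  then have "\<forall>\<^sub>F k in sequentially. 2 * M * \<eta> k * ball_mass < \<epsilon>" using \<epsilon> by (intro order_tendstoD(2)) auto
  then obtain k0 where k0: "\<And>k. k \<ge> k0 \<Longrightarrow> 2 * M * \<eta> k * ball_mass < \<epsilon>" by (auto simp: eventually_sequentially)
  have "norm (ball_mean \<mu> (\<lambda>x. approx k x y * Q x) - Q y) < r" if "k \<ge> k0" for k
  proof -
    have \<eta>0: "\<eta> k \<ge> 0" using c(1) ball_mass_pos by (simp add: \<eta>_def)
    \<comment> \<open>Mean one turns the difference into a mean of \<open>Q x - Q y\<close>.\<close>
    have D: "ball_mean \<mu> (\<lambda>x. approx k x y * Q x) - Q y = ball_mean \<mu> (\<lambda>x. approx k x y * (Q x - Q y))"
    proof -
      have "ball_mean \<mu> (\<lambda>x. approx k x y * (Q x - Q y)) = ball_mean \<mu> (\<lambda>x. approx k x y * Q x - Q y * approx k x y)"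
        by (simp add: algebra_simps)
      also have "\<dots> = ball_mean \<mu> (\<lambda>x. approx k x y * Q x) - Q y * 1"
        using Q by (subst ball_mean_diff[OF mu]) (auto simp: ball_mean_cmult[OF mu] ball_mean_approx)
      finally show ?thesis by simp
    qed
    \<comment> \<open>Continuity of \<open>Q\<close> near \<open>y\<close>, smallness of the kernel away from \<open>y\<close>.\<close>
    have pt: "\<bar>approx k x y * (Q x - Q y)\<bar> \<le> \<epsilon> * approx k x y + 2 * M * \<eta> k" if x: "norm x < 1" for x
    proof (cases "norm (x - y) < \<delta>")
      case True
      have "\<bar>approx k x y * (Q x - Q y)\<bar> \<le> approx k x y * \<epsilon>"
        unfolding abs_mult using approx_bounds(1)[of x y k] x y \<delta>(2)[OF True] by (intro mult_mono) auto
      then show ?thesis using M0 \<eta>0 by (simp add: mult.commute add_increasing2)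
    next
      case False
      have "\<bar>Q x - Q y\<bar> \<le> 2 * M" using M[of x] M[of y] x y by linarith
      then have "\<bar>approx k x y * (Q x - Q y)\<bar> \<le> \<eta> k * (2 * M)"
        unfolding abs_mult using approx_bounds(1)[of x y k] far[of x k] x y False \<eta>0 by (intro mult_mono) auto
      moreover have "0 \<le> \<epsilon> * approx k x y" using approx_bounds(1)[of x y k] x y \<epsilon> by simp
      ultimately show ?thesis by (simp add: mult_ac)
    qed
    have U: "ball_mean \<mu> (\<lambda>x. \<epsilon> * approx k x y + 2 * M * \<eta> k) = \<epsilon> + 2 * M * \<eta> k * ball_mass"
    proof -
      have "ball_mean \<mu> (\<lambda>x::real^'n. 2 * M * \<eta> k * 1) = 2 * M * \<eta> k * ball_mass"
        unfolding ball_mean_cmult[OF mu] ball_mass_def ..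
      moreover have "ball_mean \<mu> (\<lambda>x. \<epsilon> * approx k x y) = \<epsilon>"
        unfolding ball_mean_cmult[OF mu] ball_mean_approx by simp
      ultimately show ?thesis by (subst ball_mean_add[OF mu]) auto
    qed
    have "ball_mean \<mu> (\<lambda>x. approx k x y * (Q x - Q y)) \<le> \<epsilon> + 2 * M * \<eta> k * ball_mass"
      unfolding U[symmetric] using Q pt by (intro ball_mean_mono) (auto simp: abs_le_iff)
    moreover have "ball_mean \<mu> (\<lambda>x. (-1) * (approx k x y * (Q x - Q y))) \<le> \<epsilon> + 2 * M * \<eta> k * ball_mass"
      unfolding U[symmetric] using Q pt by (intro ball_mean_mono) (auto simp: abs_le_iff)
    ultimately have "\<bar>ball_mean \<mu> (\<lambda>x. approx k x y * (Q x - Q y))\<bar> \<le> \<epsilon> + 2 * M * \<eta> k * ball_mass"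
      unfolding ball_mean_cmult[OF mu] by (auto simp: abs_le_iff)
    also have "\<dots> < r" using k0[OF that] r by (simp add: \<epsilon>_def)
    finally show ?thesis unfolding D by simp
  qed
  then show "\<exists>no. \<forall>k\<ge>no. norm (ball_mean \<mu> (\<lambda>x. approx k x y * Q x) - Q y) < r" by blast
qed

lemma proj_kernel_polys [simp, intro]: "(\<lambda>x'::real^'n. proj_kernel \<mu> n x x') \<in> polys"
  unfolding proj_kernel_eq[OF mu] by (intro polys_sum polys_mult polys_const orth_basis_polys[OF mu])

lemma ball_mean_proj_kernel:
  fixes P :: "real^'n \<Rightarrow> real"
  assumes "P \<in> polys"
  shows "ball_mean \<mu> (\<lambda>x'. proj_kernel \<mu> n x x' * P x') = (\<Sum>Q\<in>orth_basis \<mu> n. Q x * weighted_inner \<mu> Q P)"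
proof -
  have "ball_mean \<mu> (\<lambda>x'. proj_kernel \<mu> n x x' * P x') = ball_mean \<mu> (\<lambda>x'. \<Sum>Q\<in>orth_basis \<mu> n. Q x * (Q x' * P x'))"
    by (simp add: proj_kernel_eq[OF mu] sum_distrib_right mult.assoc)
  also have "\<dots> = (\<Sum>Q\<in>orth_basis \<mu> n. Q x * weighted_inner \<mu> Q P)"
  proof -
    have "(\<lambda>x'. Q x * (Q x' * P x')) \<in> polys" if "Q \<in> orth_basis \<mu> n" for Q
      using that by (intro polys_mult polys_const assms orth_basis_polys[OF mu])
    then show ?thesis by (subst ball_mean_sum[OF mu]) (simp_all add: ball_mean_cmult[OF mu] weighted_inner_eq)
  qed
  finally show ?thesis .
qed

lemma proj_kernel_reproducing:
  fixes P :: "real^'n \<Rightarrow> real"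
  assumes P: "P \<in> orth_polys \<mu> j"
  shows "ball_mean \<mu> (\<lambda>x'. proj_kernel \<mu> n x x' * P x') = (if j = n then P x else 0)"
proof -
  have "ball_mean \<mu> (\<lambda>x'. proj_kernel \<mu> n x x' * P x') = (\<Sum>Q\<in>orth_basis \<mu> n. Q x * weighted_inner \<mu> Q P)"
    using orth_polys_polys[OF mu P] by (rule ball_mean_proj_kernel)
  also have "\<dots> = (if j = n then P x else 0)"
  proof (cases "j = n")
    case True
    then show ?thesis using orth_basis_expansion[OF mu P, of x]
      by (simp add: weighted_inner_commute[of \<mu> P] mult.commute)
  next
    case False
    then show ?thesis using orth_polys_orthogonal[OF mu orth_basis_orth_polys[OF mu] P] by auto
  qed
  finally show ?thesis .
qed

text \<open>The parts of \<open>approx\<close> lie in the spaces of orthogonal polynomials, so integrating against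
  the projection kernel of index \<open>n\<close> singles out the part of index \<open>n\<close>.\<close>

lemma approx_part_eq:
  "ball_mean \<mu> (\<lambda>x'. proj_kernel \<mu> n x x' * approx k x' y) = approx_part k n x y"
proof -
  have "ball_mean \<mu> (\<lambda>x'. proj_kernel \<mu> n x x' * approx k x' y) =
      ball_mean \<mu> (\<lambda>x'. \<Sum>j\<le>k. proj_kernel \<mu> n x x' * approx_part k j x' y)"
    by (simp add: approx_eq_sum sum_distrib_left)
  also have "\<dots> = (\<Sum>j\<le>k. if j = n then approx_part k n x y else 0)"
    using proj_kernel_reproducing[OF approx_part_orth_polys] by (subst ball_mean_sum[OF mu]) auto
  also have "\<dots> = approx_part k n x y" using bump_part(3)[of k n] by (auto simp: approx_part_def)
  finally show ?thesis .
qed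

lemma approx_part_tendsto:
  "norm y < 1 \<Longrightarrow> (\<lambda>k. approx_part k n x y) \<longlonglongrightarrow> proj_kernel \<mu> n x y"
  using approx_identity[of "\<lambda>x'. proj_kernel \<mu> n x x'" y] approx_part_eq[of n x _ y]
  by (simp add: mult.commute)

section \<open>Gaussian bounds for the flow on the ball\<close>

text \<open>The solution of the heat equation on the ball with initial value \<open>approx k\<close>.\<close>

definition flow :: "nat \<Rightarrow> real \<Rightarrow> real^'n \<Rightarrow> real^'n \<Rightarrow> real" where
  "flow k t x y = (\<Sum>j\<le>k. exp (- t * eigval l j) * approx_part k j x y)"

lemma flow_polys [simp, intro]: "(\<lambda>x. flow k t x y) \<in> polys"
  unfolding flow_def by auto

lemma flow_commute: "flow k t x y = flow k t y x"
  by (simp add: flow_def approx_part_commute[of _ _ x y])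

lemma ball_mean_flow_1: "ball_mean \<mu> (\<lambda>x. flow k t x y) = 1"
  unfolding flow_def by (rule ball_mean_flow)

abbreviation bump_flow :: "nat \<Rightarrow> real \<Rightarrow> real \<Rightarrow> real" where "bump_flow k \<equiv> heat_flow l (bump_part k) k"

lemma bump_flow_eq: "bump_flow k t z = (\<Sum>j\<le>k. exp (- t * eigval l j) * poly (bump_part k j) z)"
  by (rule heat_flow_def[OF l_nonneg bump_part(2)])

lemma bump_flow_0: "bump_flow k 0 z = ((1 + z) / 2) ^ k"
proof -
  have "bump_flow k 0 z = poly (\<Sum>j\<le>k. bump_part k j) z" by (simp add: bump_flow_eq poly_sum)
  then show ?thesis by (simp only: bump_part(4)[symmetric] poly_bump)
qed

lemma continuous_bump_flow: "continuous_on A (bump_flow k t)"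
proof -
  have "bump_flow k t = (\<lambda>z. \<Sum>j\<le>k. exp (- t * eigval l j) * poly (bump_part k j) z)" by (rule ext, rule bump_flow_eq)
  then show ?thesis by (simp only:) (intro continuous_intros)
qed

lemma flow_eq:
  assumes "norm x \<le> 1" "norm y \<le> 1"
  shows "flow k t x y = zonal \<mu> (bump_flow k t) x y / (bump_mass k * ball_mass)"
proof -
  have "bump_flow k t = poly (\<Sum>j\<le>k. smult (exp (- t * eigval l j)) (bump_part k j))"
    by (simp add: bump_flow_eq fun_eq_iff poly_sum)
  then have "zonal \<mu> (bump_flow k t) x y = (\<Sum>j\<le>k. exp (- t * eigval l j) * zonal_poly \<mu> (bump_part k j) x y)"
    by (simp only: zonal_poly_eq[OF mu assms] zonal_poly_sum zonal_poly_smult)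
  then show ?thesis by (simp add: flow_def approx_part_def sum_divide_distrib)
qed

lemma bump_ratio_upper:
  obtains B where "B > 0" "\<And>k. k \<ge> 1 \<Longrightarrow> real k powr (- (l + 1/2)) / (bump_mass k * ball_mass) \<le> B"
proof -
  obtain c where c: "0 < c" "\<And>k. c * (1 + real k) powr (- (l + 1/2)) \<le> bump_mass k"
    using bump_mass_bounds by metis
  define m where "m = l + 1/2"
  have m: "m \<ge> 0" using l_nonneg by (simp add: m_def)
  have "real k powr (- m) / (bump_mass k * ball_mass) \<le> 2 powr m / (c * ball_mass)" if k: "k \<ge> 1" for k
  proof -
    have cp: "c * (1 + real k) powr (- m) * ball_mass > 0" using c(1) ball_mass_pos by simp
    have "real k powr (- m) / (bump_mass k * ball_mass) \<le> real k powr (- m) / (c * (1 + real k) powr (- m) * ball_mass)"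
      using c(2)[of k] cp ball_mass_pos normalizer_pos[of k] bump_mass_pos[of k] c(1) unfolding m_def
      by (intro divide_left_mono mult_right_mono mult_pos_pos) auto
    also have "\<dots> = ((1 + real k) / real k) powr m / (c * ball_mass)"
      using k by (simp add: powr_minus_divide powr_divide)
    also have "\<dots> \<le> 2 powr m / (c * ball_mass)"
      using k m c(1) ball_mass_pos by (intro divide_right_mono powr_mono2) (auto simp: field_simps)
    finally show ?thesis .
  qed
  then show thesis using that[of "2 powr m / (c * ball_mass)"] c(1) ball_mass_pos unfolding m_def by simp
qed

text \<open>The one-dimensional supersolution is an exponential in \<open>z\<close>, so its lift factors by
  \<open>zonal_exp\<close>, and \<open>gegenbauer_laplace_upper\<close> turns the remaining mean into a power with exponent
  \<open>- \<mu>\<close>.\<close>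

lemma flow_upper:
  obtains A where "A > 0" "\<And>k t x y. k \<ge> 1 \<Longrightarrow> t \<ge> 0 \<Longrightarrow> norm x \<le> 1 \<Longrightarrow> norm y \<le> 1 \<Longrightarrow>
    flow k t x y \<le> gauss_super A \<mu> l t (t + 1 / k) x y"
proof -
  obtain B where B: "B > 0" "\<And>k. k \<ge> 1 \<Longrightarrow> real k powr (- (l + 1/2)) / (bump_mass k * ball_mass) \<le> B"
    using bump_ratio_upper by blast
  obtain C where C: "C > 0" "\<And>s f. s \<ge> 0 \<Longrightarrow> continuous_on UNIV f \<Longrightarrow> (\<forall>u. \<bar>u\<bar> \<le> 1 \<longrightarrow> f u \<le> exp (- s * (1 - u))) \<Longrightarrow> gegenbauer_mean \<mu> f \<le> C * (1 + s) powr (- \<mu>)"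
    using gegenbauer_laplace_upper[OF mu] by blast
  define m where "m = l + 1/2"
  define A where "A = B * C"
  have "A > 0" using B(1) C(1) by (simp add: A_def)
  moreover have "flow k t x y \<le> A * exp (m\<^sup>2 * t) * (t + 1 / k) powr (- m) * exp (- cos_gap x y / (2 * (t + 1 / k)))
      * (1 + bdepth x * bdepth y / (2 * (t + 1 / k))) powr (- \<mu>)"
    if k: "k \<ge> 1" and t: "t \<ge> 0" and xy: "norm x \<le> 1" "norm y \<le> 1" for k t and x y :: "real^'n"
  proof -
    define s where "s = t + 1 / k"
    have s: "s > 0" using k t by (simp add: s_def add_nonneg_pos)
    define K where "K = real k powr (- m) * exp (m\<^sup>2 * t) * s powr (- m)"
    have K: "K \<ge> 0" by (simp add: K_def)
    have hfu: "bump_flow k t z \<le> K * exp (- (1 / (2 * s)) * (1 - z))" if "\<bar>z\<bar> \<le> 1" for z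
    proof -
      have "bump_flow k t z \<le> real k powr (- m) * exp (m\<^sup>2 * t) * (t + 1 / k) powr (- m) * exp (- (1 - z) / (2 * (t + 1 / k)))"
        unfolding m_def using k t that
        by (intro heat_flow_upper[OF l_nonneg bump_part(2)]) (auto simp: bump_flow_0 abs_le_iff bump_upper[simplified])
      moreover have "- (1 - z) / (2 * s) = - (1 / (2 * s)) * (1 - z)" using s by (simp add: field_simps)
      ultimately show ?thesis unfolding K_def s_def by (simp only:)
    qed
    have bb: "bdepth x * bdepth y \<ge> 0" using xy by (intro mult_nonneg_nonneg bdepth_nonneg) auto
    have "zonal \<mu> (bump_flow k t) x y \<le> zonal \<mu> (\<lambda>z. K * exp (- (1 / (2 * s)) * (1 - z))) x y"
      using hfu s by (intro zonal_mono[OF mu xy continuous_bump_flow]) (auto intro!: continuous_intros)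
    also have "\<dots> = K * (exp (- (1 / (2 * s)) * cos_gap x y) * gegenbauer_mean \<mu> (\<lambda>u. exp (- ((1 / (2 * s)) * (bdepth x * bdepth y)) * (1 - u))))"
      unfolding zonal_cmult[OF mu] zonal_exp[OF mu] ..
    also have "\<dots> \<le> K * (exp (- (1 / (2 * s)) * cos_gap x y) * (C * (1 + (1 / (2 * s)) * (bdepth x * bdepth y)) powr (- \<mu>)))"
      using K s bb by (intro mult_left_mono C(2)) (auto intro!: continuous_intros)
    finally have 1: "zonal \<mu> (bump_flow k t) x y \<le> K * (exp (- cos_gap x y / (2 * s)) * (C * (1 + bdepth x * bdepth y / (2 * s)) powr (- \<mu>)))"
      by simp
    define R where "R = exp (m\<^sup>2 * t) * s powr (- m) * (exp (- cos_gap x y / (2 * s)) * (C * (1 + bdepth x * bdepth y / (2 * s)) powr (- \<mu>)))"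
    have R: "R \<ge> 0" using C(1) by (simp add: R_def)
    have "flow k t x y \<le> (K * (exp (- cos_gap x y / (2 * s)) * (C * (1 + bdepth x * bdepth y / (2 * s)) powr (- \<mu>)))) / (bump_mass k * ball_mass)"
      unfolding flow_eq[OF xy] using 1 normalizer_pos[of k] by (intro divide_right_mono) auto
    also have "\<dots> = real k powr (- m) / (bump_mass k * ball_mass) * R" by (simp add: K_def R_def)
    also have "\<dots> \<le> B * R" using B(2)[OF k] R unfolding m_def by (intro mult_right_mono)
    also have "\<dots> = A * exp (m\<^sup>2 * t) * s powr (- m) * exp (- cos_gap x y / (2 * s)) * (1 + bdepth x * bdepth y / (2 * s)) powr (- \<mu>)"
      by (simp add: A_def R_def)
    finally show ?thesis unfolding s_def .
  qed
  ultimately show thesis unfolding m_def by (rule that)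
qed

lemma bump_flow_lower:
  assumes k: "k \<ge> (1::nat)" and t: "t \<ge> 0" and z: "\<bar>z\<bar> \<le> 1"
  shows "(2 * real k) powr (- (l + 1/2)) * exp (- 3 * t) * (t + 1 / (2 * real k)) powr (- (l + 1/2)) * exp (- (2 / (t + 1 / (2 * real k))) * (1 - z))
     - exp (- 8 * real k / 3) \<le> bump_flow k t z"
proof -
  have "(2 * real k) powr (- (l + 1/2)) * exp (- 3 * t) * (t + 1 / (2 * real k)) powr (- (l + 1/2)) * exp (- 2 * (1 - z) / (t + 1 / (2 * real k)))
     - exp (- 8 * real k / 3) \<le> bump_flow k t z"
    using k t z by (intro heat_flow_lower[OF l_nonneg bump_part(2)]) (auto simp: bump_flow_0 abs_le_iff intro!: bump_lower_sqrt[simplified])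
  moreover have "- 2 * w / S = - (2 / S) * w" for S w :: real by simp
  ultimately show ?thesis by (simp only:)
qed

text \<open>The slack of \<open>bump_lower_sqrt\<close> after normalization; lower bounds for the flow hold up to
  this error, which disappears as \<open>k\<close> grows.\<close>

definition bump_error :: "nat \<Rightarrow> real" where
  "bump_error k = exp (- 8 * real k / 3) / (bump_mass k * ball_mass)"

lemma bump_error_nonneg: "bump_error k \<ge> 0"
  unfolding bump_error_def using normalizer_pos[of k] by (intro divide_nonneg_pos) auto

lemma bump_error_tendsto: "bump_error \<longlonglongrightarrow> 0"
proof -
  obtain c where c: "0 < c" "\<And>k. c * (1 + real k) powr (- (l + 1/2)) \<le> bump_mass k"
    using bump_mass_bounds by metis
  have "(\<lambda>k::nat. (1 + real k) powr (l + 1/2) * exp (- (8/3) * real k)) \<longlonglongrightarrow> 0" by real_asymp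
  then have "(\<lambda>k. (1 + real k) powr (l + 1/2) * exp (- (8/3) * real k) / (c * ball_mass)) \<longlonglongrightarrow> 0 / (c * ball_mass)"
    by (intro tendsto_divide tendsto_const) (use c ball_mass_pos in auto)
  then have lim: "(\<lambda>k. (1 + real k) powr (l + 1/2) * exp (- (8/3) * real k) / (c * ball_mass)) \<longlonglongrightarrow> 0" by simp
  show ?thesis
  proof (rule tendsto_sandwich[OF _ _ tendsto_const lim])
    show "\<forall>\<^sub>F k in sequentially. 0 \<le> bump_error k"
      by (simp add: bump_error_nonneg)
    show "\<forall>\<^sub>F k in sequentially. bump_error k \<le> (1 + real k) powr (l + 1/2) * exp (- (8/3) * real k) / (c * ball_mass)"
    proof (intro always_eventually allI)
      fix k
      have cp: "c * (1 + real k) powr (- (l + 1/2)) * ball_mass > 0" using c(1) ball_mass_pos by simp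
      have "bump_error k \<le> exp (- 8 * real k / 3) / (c * (1 + real k) powr (- (l + 1/2)) * ball_mass)"
        unfolding bump_error_def using c(2)[of k] cp ball_mass_pos normalizer_pos[of k] bump_mass_pos[of k] c(1)
        by (intro divide_left_mono mult_right_mono mult_pos_pos) auto
      also have "\<dots> = (1 + real k) powr (l + 1/2) * exp (- (8/3) * real k) / (c * ball_mass)"
        unfolding powr_minus_divide by (simp add: mult.commute)
      finally show "bump_error k \<le> (1 + real k) powr (l + 1/2) * exp (- (8/3) * real k) / (c * ball_mass)" .
    qed
  qed
qed

lemma bump_ratio_lower:
  obtains B where "B > 0" "\<And>k. k \<ge> 1 \<Longrightarrow> B \<le> (2 * real k) powr (- (l + 1/2)) / (bump_mass k * ball_mass)"
proof -
  obtain C where C: "0 < C" "\<And>k. bump_mass k \<le> C * (1 + real k / 2) powr (- (l + 1/2))"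
    using bump_mass_bounds by metis
  define m where "m = l + 1/2"
  have m: "m \<ge> 0" using l_nonneg by (simp add: m_def)
  have "(1 / 4) powr m / (C * ball_mass) \<le> (2 * real k) powr (- m) / (bump_mass k * ball_mass)" if k: "k \<ge> 1" for k
  proof -
    have "(1 / 4) powr m / (C * ball_mass) \<le> ((1 + real k / 2) / (2 * real k)) powr m / (C * ball_mass)"
      using k m C(1) ball_mass_pos by (intro divide_right_mono powr_mono2) (auto simp: field_simps)
    also have "\<dots> = (2 * real k) powr (- m) / (C * (1 + real k / 2) powr (- m) * ball_mass)"
      using k by (simp add: powr_minus_divide powr_divide)
    also have "\<dots> \<le> (2 * real k) powr (- m) / (bump_mass k * ball_mass)"
      using C(2)[of k] C(1) ball_mass_pos bump_mass_pos[of k] unfolding m_def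
      by (intro divide_left_mono mult_right_mono mult_pos_pos) auto
    finally show ?thesis .
  qed
  then show thesis using that[of "(1 / 4) powr m / (C * ball_mass)"] C(1) ball_mass_pos unfolding m_def by simp
qed

lemma flow_lower:
  obtains A where "A > 0" "\<And>k t x y. k \<ge> 1 \<Longrightarrow> t \<ge> 0 \<Longrightarrow> norm x \<le> 1 \<Longrightarrow> norm y \<le> 1 \<Longrightarrow>
    gauss_sub A \<mu> l t (t + 1 / (2 * real k)) x y - bump_error k \<le> flow k t x y"
proof -
  obtain B where B: "B > 0" "\<And>k. k \<ge> 1 \<Longrightarrow> B \<le> (2 * real k) powr (- (l + 1/2)) / (bump_mass k * ball_mass)"
    using bump_ratio_lower by blast
  obtain c where c: "c > 0" "\<And>s f. s \<ge> 0 \<Longrightarrow> continuous_on UNIV f \<Longrightarrow> (\<forall>u. \<bar>u\<bar> \<le> 1 \<longrightarrow> 0 \<le> f u) \<Longrightarrow> (\<forall>u. 0 \<le> u \<and> u \<le> 1 \<longrightarrow> exp (- s * (1 - u)) \<le> f u) \<Longrightarrow> c * (1 + s) powr (- \<mu>) \<le> gegenbauer_mean \<mu> f"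
    using gegenbauer_laplace_lower[OF mu] by blast
  define m where "m = l + 1/2"
  define A where "A = B * c"
  have "A > 0" using B(1) c(1) by (simp add: A_def)
  moreover have "A * exp (- 3 * t) * (t + 1 / (2 * real k)) powr (- m) * exp (- 2 * cos_gap x y / (t + 1 / (2 * real k)))
      * (1 + 2 * (bdepth x * bdepth y) / (t + 1 / (2 * real k))) powr (- \<mu>) - bump_error k \<le> flow k t x y"
    if k: "k \<ge> 1" and t: "t \<ge> 0" and xy: "norm x \<le> 1" "norm y \<le> 1" for k t and x y :: "real^'n"
  proof -
    define s where "s = t + 1 / (2 * real k)"
    have s: "s > 0" using k t by (simp add: s_def add_nonneg_pos)
    define K where "K = (2 * real k) powr (- m) * exp (- 3 * t) * s powr (- m)"
    have K: "K \<ge> 0" by (simp add: K_def)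
    have bb: "bdepth x * bdepth y \<ge> 0" using xy by (intro mult_nonneg_nonneg bdepth_nonneg) auto
    have hfl: "K * exp (- (2 / s) * (1 - z)) - exp (- 8 * real k / 3) \<le> bump_flow k t z" if "\<bar>z\<bar> \<le> 1" for z
      unfolding K_def s_def m_def by (rule bump_flow_lower[OF k t that])
    have "zonal \<mu> (\<lambda>z. K * exp (- (2 / s) * (1 - z)) - exp (- 8 * real k / 3)) x y \<le> zonal \<mu> (bump_flow k t) x y"
      using hfl s by (intro zonal_mono[OF mu xy _ continuous_bump_flow]) (auto intro!: continuous_intros)
    moreover have "zonal \<mu> (\<lambda>z. K * exp (- (2 / s) * (1 - z)) - exp (- 8 * real k / 3)) x y =
       K * (exp (- (2 / s) * cos_gap x y) * gegenbauer_mean \<mu> (\<lambda>u. exp (- ((2 / s) * (bdepth x * bdepth y)) * (1 - u)))) - exp (- 8 * real k / 3)"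
      by (subst zonal_diff_const[OF mu]) (auto intro!: continuous_intros simp only: zonal_cmult[OF mu] zonal_exp[OF mu])
    moreover have "K * (exp (- (2 / s) * cos_gap x y) * (c * (1 + (2 / s) * (bdepth x * bdepth y)) powr (- \<mu>)))
       \<le> K * (exp (- (2 / s) * cos_gap x y) * gegenbauer_mean \<mu> (\<lambda>u. exp (- ((2 / s) * (bdepth x * bdepth y)) * (1 - u))))"
      using K s bb by (intro mult_left_mono c(2)) (auto intro!: continuous_intros)
    ultimately have 1: "K * (exp (- 2 * cos_gap x y / s) * (c * (1 + 2 * (bdepth x * bdepth y) / s) powr (- \<mu>))) - exp (- 8 * real k / 3) \<le> zonal \<mu> (bump_flow k t) x y"
      by simp
    define R where "R = exp (- 3 * t) * s powr (- m) * (exp (- 2 * cos_gap x y / s) * (c * (1 + 2 * (bdepth x * bdepth y) / s) powr (- \<mu>)))"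
    have R: "R \<ge> 0" using c(1) by (simp add: R_def)
    have "B * R \<le> (2 * real k) powr (- m) / (bump_mass k * ball_mass) * R"
      using B(2)[OF k] R unfolding m_def by (intro mult_right_mono)
    then have "B * R - bump_error k
       \<le> (K * (exp (- 2 * cos_gap x y / s) * (c * (1 + 2 * (bdepth x * bdepth y) / s) powr (- \<mu>))) - exp (- 8 * real k / 3)) / (bump_mass k * ball_mass)"
      by (simp add: K_def R_def bump_error_def diff_divide_distrib)
    also have "\<dots> \<le> flow k t x y"
      unfolding flow_eq[OF xy] using 1 normalizer_pos[of k] by (intro divide_right_mono) auto
    finally show ?thesis unfolding s_def[symmetric] by (simp add: A_def R_def mult_ac)
  qed
  ultimately show thesis unfolding m_def by (rule that)
qed

text \<open>By Parseval's identity, the mean of \<open>flow k t\<close> times \<open>approx k\<close> is a sum over \<open>j\<close> of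
  \<open>exp (- t * eigval l j)\<close> times the squared norm of the part of \<open>approx k\<close> of index \<open>j\<close>. It is at
  most \<open>B t\<close>, because \<open>approx k\<close> has mean one. As \<open>k\<close> grows, the term of index \<open>n\<close> tends to the
  diagonal value of the projection kernel, and the diagonal controls all values. The growth in \<open>n\<close>
  obtained for a small \<open>t\<close> makes the series of the heat kernel converge at every larger time.\<close>

lemma proj_kernel_bound:
  obtains B where "\<And>t. t > 0 \<Longrightarrow> B t \<ge> 0"
    "\<And>t k x y. t > 0 \<Longrightarrow> k \<ge> 1 \<Longrightarrow> norm x \<le> 1 \<Longrightarrow> norm y \<le> 1 \<Longrightarrow> flow k t x y \<le> B t"
    "\<And>t n (x::real^'n) y. t > 0 \<Longrightarrow> norm x < 1 \<Longrightarrow> norm y < 1 \<Longrightarrow> \<bar>proj_kernel \<mu> n x y\<bar> \<le> B t * exp (t * eigval l n)"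
proof -
  obtain A where A: "A > 0" "\<And>k t x y. k \<ge> 1 \<Longrightarrow> t \<ge> 0 \<Longrightarrow> norm x \<le> 1 \<Longrightarrow> norm y \<le> 1 \<Longrightarrow>
    flow k t x y \<le> gauss_super A \<mu> l t (t + 1 / k) x y"
    using flow_upper by blast
  define m where "m = l + 1/2"
  have m: "m \<ge> 0" using l_nonneg by (simp add: m_def)
  define B where "B t = A * exp (m\<^sup>2 * t) * t powr (- m)" for t
  have B0: "B t \<ge> 0" for t using A(1) by (simp add: B_def)
  have fB: "flow k t x y \<le> B t" if t: "t > 0" and k: "k \<ge> 1" and xy: "norm x \<le> 1" "norm y \<le> 1" for t k x y
  proof -
    have s: "t + 1 / real k > 0" using t by (simp add: add_pos_nonneg)
    have bb: "bdepth x * bdepth y \<ge> 0" using xy by (intro mult_nonneg_nonneg bdepth_nonneg) auto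
    have "flow k t x y \<le> A * exp (m\<^sup>2 * t) * (t + 1 / k) powr (- m) * exp (- cos_gap x y / (2 * (t + 1 / k)))
      * (1 + bdepth x * bdepth y / (2 * (t + 1 / k))) powr (- \<mu>)"
      using A(2)[OF k less_imp_le[OF t] xy] unfolding m_def .
    also have "\<dots> \<le> A * exp (m\<^sup>2 * t) * t powr (- m) * 1 * 1"
    proof (intro mult_mono)
      show "(t + 1 / k) powr (- m) \<le> t powr (- m)" using t m by (intro powr_mono2') auto
      have "cos_gap x y / (2 * (t + 1 / k)) \<ge> 0" using s cos_gap_bounds(1)[OF xy] by (intro divide_nonneg_pos) auto
      then show "exp (- cos_gap x y / (2 * (t + 1 / k))) \<le> 1" by simp
      have "1 + bdepth x * bdepth y / (2 * (t + 1 / k)) \<ge> 1" using bb s by (simp add: divide_nonneg_pos)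
      then have "(1 + bdepth x * bdepth y / (2 * (t + 1 / k))) powr (- \<mu>) \<le> 1 powr (- \<mu>)" using mu by (intro powr_mono2') auto
      then show "(1 + bdepth x * bdepth y / (2 * (t + 1 / k))) powr (- \<mu>) \<le> 1" by simp
    qed (use A(1) in auto)
    finally show ?thesis by (simp add: B_def)
  qed
  have diag: "proj_kernel \<mu> n y y \<le> B t * exp (t * eigval l n)" if t: "t > 0" and y: "norm y < 1" for t n and y :: "real^'n"
  proof -
    have "(\<Sum>P\<in>orth_basis \<mu> n. (weighted_inner \<mu> P (\<lambda>x. approx k x y))\<^sup>2) \<le> B t * exp (t * eigval l n)"
      if k: "k \<ge> max 1 n" for k
    proof -
      \<comment> \<open>Parseval's identity for a single index.\<close>
      have part: "ball_mean \<mu> (\<lambda>x. approx_part k j x y * approx k x y) = (\<Sum>P\<in>orth_basis \<mu> j. (weighted_inner \<mu> P (\<lambda>x. approx k x y))\<^sup>2)" for j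
      proof -
        have e: "approx_part k j x y = (\<Sum>Q\<in>orth_basis \<mu> j. weighted_inner \<mu> Q (\<lambda>x. approx k x y) * Q x)" for x
          unfolding approx_part_eq[symmetric] by (subst ball_mean_proj_kernel) (simp_all add: mult.commute)
        have "ball_mean \<mu> (\<lambda>x. approx_part k j x y * approx k x y) = weighted_inner \<mu> (\<lambda>x. \<Sum>Q\<in>orth_basis \<mu> j. weighted_inner \<mu> Q (\<lambda>x. approx k x y) * Q x) (\<lambda>x. approx k x y)"
          unfolding weighted_inner_eq[of _ "\<lambda>x. \<Sum>Q\<in>orth_basis \<mu> j. _ Q * Q x"] e ..
        also have "\<dots> = (\<Sum>Q\<in>orth_basis \<mu> j. weighted_inner \<mu> Q (\<lambda>x. approx k x y) * weighted_inner \<mu> Q (\<lambda>x. approx k x y))"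
          by (intro weighted_inner_sum_left[OF mu] approx_polys orth_basis_polys[OF mu])
        finally show ?thesis by (simp add: power2_eq_square)
      qed
      have p0: "(\<Sum>P\<in>orth_basis \<mu> j. (weighted_inner \<mu> P (\<lambda>x. approx k x y))\<^sup>2) \<ge> 0" for j by (intro sum_nonneg) simp
      have "exp (- t * eigval l n) * (\<Sum>P\<in>orth_basis \<mu> n. (weighted_inner \<mu> P (\<lambda>x. approx k x y))\<^sup>2)
        \<le> (\<Sum>j\<le>k. exp (- t * eigval l j) * (\<Sum>P\<in>orth_basis \<mu> j. (weighted_inner \<mu> P (\<lambda>x. approx k x y))\<^sup>2))"
        using k p0 by (intro member_le_sum) auto
      also have "\<dots> = ball_mean \<mu> (\<lambda>x. \<Sum>j\<le>k. exp (- t * eigval l j) * (approx_part k j x y * approx k x y))"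
        unfolding part[symmetric] by (subst ball_mean_sum[OF mu]) (auto simp: ball_mean_cmult[OF mu])
      also have "\<dots> = ball_mean \<mu> (\<lambda>x. flow k t x y * approx k x y)"
        by (simp add: flow_def sum_distrib_right mult.assoc)
      also have "\<dots> \<le> ball_mean \<mu> (\<lambda>x. B t * approx k x y)"
        using approx_bounds(1)[of _ y k] y fB[OF t, of k _ y] k by (intro ball_mean_mono) (auto intro!: mult_right_mono)
      also have "\<dots> = B t" by (simp add: ball_mean_cmult[OF mu] ball_mean_approx)
      finally show ?thesis by (simp add: exp_minus field_simps)
    qed
    then have ev: "\<forall>\<^sub>F k in sequentially. (\<Sum>P\<in>orth_basis \<mu> n. (weighted_inner \<mu> P (\<lambda>x. approx k x y))\<^sup>2) \<le> B t * exp (t * eigval l n)"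
      unfolding eventually_sequentially by blast
    have lim: "(\<lambda>k. \<Sum>P\<in>orth_basis \<mu> n. (weighted_inner \<mu> P (\<lambda>x. approx k x y))\<^sup>2) \<longlonglongrightarrow> (\<Sum>P\<in>orth_basis \<mu> n. (P y)\<^sup>2)"
    proof (intro tendsto_sum tendsto_power)
      fix P :: "real^'n \<Rightarrow> real" assume P: "P \<in> orth_basis \<mu> n"
      show "(\<lambda>k. weighted_inner \<mu> P (\<lambda>x. approx k x y)) \<longlonglongrightarrow> P y"
        using approx_identity[OF orth_basis_polys[OF mu P] y] by (simp add: weighted_inner_eq mult.commute)
    qed
    have "(\<Sum>P\<in>orth_basis \<mu> n. (P y)\<^sup>2) \<le> B t * exp (t * eigval l n)"
      using tendsto_upperbound[OF lim ev] by simp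
    then show ?thesis by (simp add: proj_kernel_eq[OF mu] power2_eq_square)
  qed
  have pkb: "\<bar>proj_kernel \<mu> n x y\<bar> \<le> B t * exp (t * eigval l n)" if t: "t > 0" and xy: "norm x < 1" "norm y < 1" for t n and x y :: "real^'n"
  proof -
    have "\<bar>proj_kernel \<mu> n x y\<bar> \<le> (\<Sum>P\<in>orth_basis \<mu> n. \<bar>P x * P y\<bar>)"
      unfolding proj_kernel_eq[OF mu] by (rule sum_abs)
    also have "\<dots> \<le> (\<Sum>P\<in>orth_basis \<mu> n. (P x * P x + P y * P y) / 2)"
    proof (rule sum_mono)
      fix P :: "real^'n \<Rightarrow> real"
      show "\<bar>P x * P y\<bar> \<le> (P x * P x + P y * P y) / 2"
        using sum_squares_bound[of "\<bar>P x\<bar>" "\<bar>P y\<bar>"] by (simp add: abs_mult power2_eq_square)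
    qed
    also have "\<dots> = (proj_kernel \<mu> n x x + proj_kernel \<mu> n y y) / 2"
      unfolding proj_kernel_eq[OF mu] by (simp add: sum.distrib sum_divide_distrib[symmetric])
    also have "\<dots> \<le> B t * exp (t * eigval l n)" using diag[OF t xy(1), of n] diag[OF t xy(2), of n] by simp
    finally show ?thesis .
  qed
  show thesis by (rule that[of B, OF B0 fB pkb])
qed

section \<open>The heat kernel as the limit of the flows\<close>

lemma heat_kernel_eq: "heat_kernel \<mu> t x (y::real^'n) = (\<Sum>n. exp (- t * eigval l n) * proj_kernel \<mu> n x y)"
  unfolding heat_kernel_def Let_def l[symmetric] eigval_def by (simp add: mult.assoc)

text \<open>Each term of the eigenfunction expansion of the flow converges to the corresponding term of
  the heat kernel. The terms are dominated by a geometric series, by \<open>proj_kernel_bound\<close> at the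
  time \<open>t / 2\<close>, so the limit may be taken under the sum.\<close>

lemma flow_tendsto:
  fixes x y :: "real^'n"
  assumes t: "t > 0" and xy: "norm x < 1" "norm y < 1"
  shows "(\<lambda>k. flow k t x y) \<longlonglongrightarrow> heat_kernel \<mu> t x y"
proof -
  obtain B where B: "\<And>t. t > 0 \<Longrightarrow> B t \<ge> 0"
    "\<And>t k (x::real^'n) y. t > 0 \<Longrightarrow> k \<ge> 1 \<Longrightarrow> norm x \<le> 1 \<Longrightarrow> norm y \<le> 1 \<Longrightarrow> flow k t x y \<le> B t"
    "\<And>t n (x::real^'n) y. t > 0 \<Longrightarrow> norm x < 1 \<Longrightarrow> norm y < 1 \<Longrightarrow> \<bar>proj_kernel \<mu> n x y\<bar> \<le> B t * exp (t * eigval l n)"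
    using proj_kernel_bound by blast
  define b where "b = B (t/2)"
  have b: "b \<ge> 0" using B(1)[of "t/2"] t by (simp add: b_def)
  have pk: "\<bar>proj_kernel \<mu> n x x'\<bar> \<le> b * exp (t / 2 * eigval l n)" if "norm x' < 1" for n and x' :: "real^'n"
    unfolding b_def using t xy that by (intro B(3)) auto
  \<comment> \<open>The bound passes from the projection kernel to its means against \<open>approx\<close>, uniformly in \<open>k\<close>.\<close>
  have pb: "\<bar>approx_part k n x y\<bar> \<le> b * exp (t / 2 * eigval l n)" for k n
  proof -
    define M where "M = b * exp (t / 2 * eigval l n)"
    have pt: "\<bar>proj_kernel \<mu> n x x' * approx k x' y\<bar> \<le> M * approx k x' y" if "norm x' < 1" for x' :: "real^'n"
      unfolding abs_mult using pk[OF that, of n] approx_bounds(1)[of x' y k] that xy by (simp add: M_def mult_right_mono)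
    have M1: "ball_mean \<mu> (\<lambda>x'. M * approx k x' y) = M" by (simp add: ball_mean_cmult[OF mu] ball_mean_approx)
    have "ball_mean \<mu> (\<lambda>x'. proj_kernel \<mu> n x x' * approx k x' y) \<le> ball_mean \<mu> (\<lambda>x'. M * approx k x' y)"
      using pt by (intro ball_mean_mono) (auto simp: abs_le_iff)
    moreover have "ball_mean \<mu> (\<lambda>x'. (-1) * (proj_kernel \<mu> n x x' * approx k x' y)) \<le> ball_mean \<mu> (\<lambda>x'. M * approx k x' y)"
      using pt by (intro ball_mean_mono polys_mult) (auto simp: abs_le_iff)
    ultimately show ?thesis unfolding M1 ball_mean_cmult[OF mu] approx_part_eq by (auto simp: abs_le_iff M_def)
  qed
  define a where "a n k = exp (- t * eigval l n) * approx_part k n x y" for n k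
  have ab: "norm (a n k) \<le> b * exp (- t / 2) ^ n" for n k
  proof -
    have "norm (a n k) \<le> exp (- t * eigval l n) * (b * exp (t / 2 * eigval l n))"
      unfolding a_def norm_mult using pb[of k n] by (intro mult_mono) auto
    also have "\<dots> = b * exp (- (t / 2) * eigval l n)"
      by (simp add: exp_add[symmetric] field_simps)
    also have "\<dots> \<le> b * exp (- (t / 2) * real n)"
      using b t eigval_ge[of n] by (intro mult_left_mono) (auto intro: mult_left_mono)
    also have "\<dots> = b * exp (- t / 2) ^ n" by (simp add: exp_of_nat_mult[symmetric] mult.commute)
    finally show ?thesis .
  qed
  have "(\<lambda>k. \<Sum>n. a n k) \<longlonglongrightarrow> (\<Sum>n. exp (- t * eigval l n) * proj_kernel \<mu> n x y)"
  proof (rule tannerys_theorem[THEN conjunct2, THEN conjunct2])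
    show "(\<lambda>k. a n k) \<longlonglongrightarrow> exp (- t * eigval l n) * proj_kernel \<mu> n x y" for n
      unfolding a_def by (intro tendsto_mult tendsto_const approx_part_tendsto xy)
    show "\<forall>\<^sub>F (n, k) in at_top \<times>\<^sub>F sequentially. norm (a n k) \<le> b * exp (- t / 2) ^ n"
      using ab by (intro always_eventually) auto
    show "summable (\<lambda>n. b * exp (- t / 2) ^ n)"
      using t by (intro summable_mult summable_geometric) auto
  qed simp
  moreover have "(\<Sum>n. a n k) = flow k t x y" for k
  proof -
    have "a n k = 0" if "n \<notin> {..k}" for n using that bump_part(3)[of k n] by (simp add: a_def approx_part_def)
    then have "(\<Sum>n. a n k) = (\<Sum>n\<le>k. a n k)" by (intro suminf_finite) auto
    then show ?thesis by (simp add: flow_def a_def)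
  qed
  ultimately show ?thesis by (simp add: heat_kernel_eq)
qed

lemma heat_kernel_upper:
  obtains A where "A > 0" "\<And>t (x::real^'n) y. t > 0 \<Longrightarrow> norm x < 1 \<Longrightarrow> norm y < 1 \<Longrightarrow>
    heat_kernel \<mu> t x y \<le> gauss_super A \<mu> l t t x y"
proof -
  obtain A where A: "A > 0" "\<And>k t x y. k \<ge> 1 \<Longrightarrow> t \<ge> 0 \<Longrightarrow> norm x \<le> 1 \<Longrightarrow> norm y \<le> 1 \<Longrightarrow>
    flow k t x y \<le> gauss_super A \<mu> l t (t + 1 / k) x y"
    using flow_upper by blast
  have "heat_kernel \<mu> t x y \<le> gauss_super A \<mu> l t t x y" if t: "t > 0" and xy: "norm x < 1" "norm y < 1" for t and x y :: "real^'n"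
  proof (rule tendsto_le[OF _ _ flow_tendsto[OF t xy]])
    have s: "(\<lambda>k. t + 1 / real k) \<longlonglongrightarrow> t" by real_asymp
    have bb: "bdepth x * bdepth y \<ge> 0" using xy by (intro mult_nonneg_nonneg bdepth_nonneg) auto
    then have bt: "1 + bdepth x * bdepth y / (2 * t) \<noteq> 0" using t by (smt (verit) divide_nonneg_nonneg)
    show "(\<lambda>k. gauss_super A \<mu> l t (t + 1 / real k) x y) \<longlonglongrightarrow>
      gauss_super A \<mu> l t t x y"
      using t bt by (intro tendsto_intros s) auto
    show "\<forall>\<^sub>F k in sequentially. flow k t x y \<le> gauss_super A \<mu> l t (t + 1 / real k) x y"
      using A(2)[of _ t x y] t xy by (intro eventually_sequentiallyI[of 1]) simp
  qed simp
  then show thesis by (rule that[OF A(1)])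
qed

lemma heat_kernel_lower:
  obtains A where "A > 0" "\<And>t (x::real^'n) y. t > 0 \<Longrightarrow> norm x < 1 \<Longrightarrow> norm y < 1 \<Longrightarrow>
    gauss_sub A \<mu> l t t x y
      \<le> heat_kernel \<mu> t x y"
proof -
  obtain A where A: "A > 0" "\<And>k t x y. k \<ge> 1 \<Longrightarrow> t \<ge> 0 \<Longrightarrow> norm x \<le> 1 \<Longrightarrow> norm y \<le> 1 \<Longrightarrow>
    gauss_sub A \<mu> l t (t + 1 / (2 * real k)) x y - bump_error k \<le> flow k t x y"
    using flow_lower by blast
  have "gauss_sub A \<mu> l t t x y
      \<le> heat_kernel \<mu> t x y" if t: "t > 0" and xy: "norm x < 1" "norm y < 1" for t and x y :: "real^'n"
  proof (rule tendsto_le[OF _ flow_tendsto[OF t xy]])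
    have s: "(\<lambda>k. t + 1 / (2 * real k)) \<longlonglongrightarrow> t" by real_asymp
    have bb: "bdepth x * bdepth y \<ge> 0" using xy by (intro mult_nonneg_nonneg bdepth_nonneg) auto
    then have bt: "1 + 2 * (bdepth x * bdepth y) / t \<noteq> 0" using t by (smt (verit) divide_nonneg_nonneg)
    have "(\<lambda>k. gauss_sub A \<mu> l t (t + 1 / (2 * real k)) x y - bump_error k) \<longlonglongrightarrow>
      gauss_sub A \<mu> l t t x y - 0"
      using t bt by (intro tendsto_intros s bump_error_tendsto) auto
    then show "(\<lambda>k. gauss_sub A \<mu> l t (t + 1 / (2 * real k)) x y - bump_error k) \<longlonglongrightarrow>
      gauss_sub A \<mu> l t t x y"
      by simp
    show "\<forall>\<^sub>F k in sequentially. gauss_sub A \<mu> l t (t + 1 / (2 * real k)) x y - bump_error k \<le> flow k t x y"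
      using A(2)[of _ t x y] t xy by (intro eventually_sequentiallyI[of 1]) simp
  qed simp
  then show thesis by (rule that[OF A(1)])
qed

text \<open>The factors \<open>exp (m\<^sup>2 t)\<close> and \<open>exp (- 3 t)\<close> spoil the barriers for large times. Instead, the
  bounds by constants that they give at time one are propagated by the minimum principle, applied
  to the flow and to its negative.\<close>

lemma heat_kernel_long_time:
  obtains c C where "c > 0" "C > 0" "\<And>t (x::real^'n) y. t \<ge> 1 \<Longrightarrow> norm x < 1 \<Longrightarrow> norm y < 1 \<Longrightarrow>
    c \<le> heat_kernel \<mu> t x y \<and> heat_kernel \<mu> t x y \<le> C"
proof -
  define m where "m = l + 1/2"
  have m: "m \<ge> 0" using l_nonneg by (simp add: m_def)
  obtain B where B: "B > 0" "\<And>k. k \<ge> 1 \<Longrightarrow> B \<le> (2 * real k) powr (- (l + 1/2)) / (bump_mass k * ball_mass)"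
    using bump_ratio_lower by blast
  obtain b where b: "b > 0" "\<And>k. k \<ge> 1 \<Longrightarrow> real k powr (- (l + 1/2)) / (bump_mass k * ball_mass) \<le> b"
    using bump_ratio_upper by blast
  define c where "c = B * (exp (- 3) * 2 powr (- m) * exp (- 4))"
  define C where "C = b * exp (m\<^sup>2)"
  have c0: "c > 0" using B by (simp add: c_def)
  have C0: "C > 0" using b(1) by (simp add: C_def)
  have lower: "c - bump_error k \<le> flow k t x y"
    if k: "k \<ge> 1" and t: "t \<ge> 1" and xy: "norm x \<le> 1" "norm y \<le> 1" for k t and x y :: "real^'n"
  proof -
    define K where "K = (2 * real k) powr (- m) * (exp (- 3) * 2 powr (- m) * exp (- 4))"
    have "K - exp (- 8 * real k / 3) \<le> bump_flow k 1 z" if z: "z \<in> {-1..1}" for z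
    proof -
      define s where "s = 1 + 1 / (2 * real k)"
      have s: "1 \<le> s" "s \<le> 2" using k by (auto simp: s_def field_simps)
      have "2 powr (- m) \<le> s powr (- m)" using s m by (intro powr_mono2') auto
      moreover have "exp (- 4) \<le> exp (- (2 / s) * (1 - z))"
      proof -
        have "(2 / s) * (1 - z) \<le> 2 * 2" using s z by (intro mult_mono) (auto simp: field_simps)
        then show ?thesis by simp
      qed
      ultimately have "(2 * real k) powr (- m) * (exp (- 3) * 2 powr (- m) * exp (- 4)) \<le> (2 * real k) powr (- m) * (exp (- 3) * s powr (- m) * exp (- (2 / s) * (1 - z)))"
        by (intro mult_left_mono mult_mono) auto
      also have "\<dots> - exp (- 8 * real k / 3) \<le> bump_flow k 1 z"
        using bump_flow_lower[OF k, of 1 z] z unfolding s_def m_def by (simp add: mult.assoc abs_le_iff)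
      finally show ?thesis unfolding K_def by simp
    qed
    then have hk: "K - exp (- 8 * real k / 3) \<le> bump_flow k t z" if "\<bar>z\<bar> \<le> 1" for z
      using that t by (rule_tac heat_flow_ge_const[OF l_nonneg bump_part(2), where ?t0.0 = 1]) (auto simp: abs_le_iff)
    have "K - exp (- 8 * real k / 3) = zonal \<mu> (\<lambda>z. K - exp (- 8 * real k / 3)) x y" using zonal_const[OF mu] by metis
    also have "\<dots> \<le> zonal \<mu> (bump_flow k t) x y" using hk by (intro zonal_mono[OF mu xy _ continuous_bump_flow]) auto
    finally have "(K - exp (- 8 * real k / 3)) / (bump_mass k * ball_mass) \<le> flow k t x y"
      unfolding flow_eq[OF xy] using normalizer_pos[of k] by (intro divide_right_mono) auto
    moreover have "c \<le> K / (bump_mass k * ball_mass)"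
    proof -
      have "B * (exp (- 3) * 2 powr (- m) * exp (- 4)) \<le> (2 * real k) powr (- m) / (bump_mass k * ball_mass) * (exp (- 3) * 2 powr (- m) * exp (- 4))"
        using B(2)[OF k] unfolding m_def by (intro mult_right_mono) auto
      then show ?thesis by (simp add: c_def K_def)
    qed
    ultimately show ?thesis by (simp add: bump_error_def diff_divide_distrib)
  qed
  have upper: "flow k t x y \<le> C"
    if k: "k \<ge> 1" and t: "t \<ge> 1" and xy: "norm x \<le> 1" "norm y \<le> 1" for k t and x y :: "real^'n"
  proof -
    define K where "K = real k powr (- m) * exp (m\<^sup>2)"
    have u1: "bump_flow k 1 z \<le> K" if z: "z \<in> {-1..1}" for z
    proof -
      have "bump_flow k 1 z \<le> real k powr (- m) * exp (m\<^sup>2 * 1) * (1 + 1 / k) powr (- m) * exp (- (1 - z) / (2 * (1 + 1 / k)))"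
        unfolding m_def using k z
        by (intro heat_flow_upper[OF l_nonneg bump_part(2)]) (auto simp: bump_flow_0 bump_upper[simplified])
      also have "\<dots> \<le> real k powr (- m) * exp (m\<^sup>2 * 1) * 1 * 1"
      proof (intro mult_mono)
        have "(1 + 1 / real k) powr (- m) \<le> 1 powr (- m)" using m by (intro powr_mono2') auto
        then show "(1 + 1 / real k) powr (- m) \<le> 1" by simp
        have "(1 - z) / (2 * (1 + 1 / real k)) \<ge> 0" using z by (intro divide_nonneg_nonneg) auto
        then have "- (1 - z) / (2 * (1 + 1 / real k)) \<le> 0" by (simp only: minus_divide_left[symmetric] neg_le_0_iff_le)
        then show "exp (- (1 - z) / (2 * (1 + 1 / real k))) \<le> 1" by (simp only: exp_le_one_iff)
      qed auto
      finally show ?thesis by (simp add: K_def)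
    qed
    \<comment> \<open>The parts of the negative of the flow, to which the minimum principle is applied.\<close>
    define e' where "e' j = - bump_part k j" for j
    have e': "gegenbauer_op l (e' j) = smult (- eigval l j) (e' j)" for j
    proof -
      have "gegenbauer_op l (- p) = - gegenbauer_op l p" for p
        by (simp add: gegenbauer_op_def pderiv_minus algebra_simps)
      then show ?thesis by (simp add: e'_def bump_part(2))
    qed
    have neg: "heat_flow l e' k t z = - bump_flow k t z" for t z
      unfolding heat_flow_def[OF l_nonneg e'] bump_flow_eq by (simp add: e'_def sum_negf)
    have hk: "bump_flow k t z \<le> K" if "\<bar>z\<bar> \<le> 1" for z
    proof -
      have "- K \<le> heat_flow l e' k t z"
        using that t u1 by (rule_tac heat_flow_ge_const[OF l_nonneg e', where ?t0.0 = 1]) (auto simp: abs_le_iff neg)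
      then show ?thesis by (simp add: neg)
    qed
    have "zonal \<mu> (bump_flow k t) x y \<le> zonal \<mu> (\<lambda>z. K) x y" using hk by (intro zonal_mono[OF mu xy continuous_bump_flow]) auto
    also have "\<dots> = K" by (rule zonal_const[OF mu])
    finally have "flow k t x y \<le> K / (bump_mass k * ball_mass)"
      unfolding flow_eq[OF xy] using normalizer_pos[of k] by (intro divide_right_mono) auto
    also have "\<dots> \<le> C"
    proof -
      have "real k powr (- m) / (bump_mass k * ball_mass) * exp (m\<^sup>2) \<le> b * exp (m\<^sup>2)"
        using b(2)[OF k] unfolding m_def by (intro mult_right_mono) auto
      then show ?thesis by (simp add: K_def C_def)
    qed
    finally show ?thesis .
  qed
  have "c \<le> heat_kernel \<mu> t x y \<and> heat_kernel \<mu> t x y \<le> C"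
    if t: "t \<ge> 1" and xy: "norm x < 1" "norm y < 1" for t and x y :: "real^'n"
  proof
    have t0: "t > 0" using t by simp
    have "(\<lambda>k. c - bump_error k) \<longlonglongrightarrow> c - 0"
      by (intro tendsto_diff tendsto_const bump_error_tendsto)
    then have lim: "(\<lambda>k. c - bump_error k) \<longlonglongrightarrow> c" by simp
    show "c \<le> heat_kernel \<mu> t x y"
      by (rule tendsto_le[OF _ flow_tendsto[OF t0 xy] lim], simp)
        (use lower[OF _ t, of _ x y] xy in \<open>auto intro!: eventually_sequentiallyI[of 1]\<close>)
    show "heat_kernel \<mu> t x y \<le> C"
      by (rule tendsto_upperbound[OF flow_tendsto[OF t0 xy]])
        (use upper[OF _ t, of _ x y] xy in \<open>auto intro!: eventually_sequentiallyI[of 1]\<close>)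
  qed
  then show thesis by (rule that[OF c0 C0])
qed

text \<open>The flow has mean one in \<open>x\<close>, hence in \<open>y\<close> by symmetry, and is bounded uniformly in \<open>k\<close> at
  each fixed time, so the means converge. The indicator restricts to the set on which the flows
  are known to converge.\<close>

lemma heat_kernel_mass:
  fixes x :: "real^'n"
  assumes t: "t > 0" and x: "norm x < 1"
  shows "integrable (ball_measure \<mu>) (\<lambda>y. indicator (ball 0 1) y * heat_kernel \<mu> t x y)"
    and "(\<integral>y. indicator (ball 0 1) y * heat_kernel \<mu> t x y \<partial>ball_measure \<mu>) = 1"
proof -
  obtain B where B: "\<And>t. t > 0 \<Longrightarrow> B t \<ge> 0" "\<And>t k (x::real^'n) y. t > 0 \<Longrightarrow> k \<ge> 1 \<Longrightarrow> norm x \<le> 1 \<Longrightarrow> norm y \<le> 1 \<Longrightarrow> flow k t x y \<le> B t"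
    "\<And>t n (x::real^'n) y. t > 0 \<Longrightarrow> norm x < 1 \<Longrightarrow> norm y < 1 \<Longrightarrow> \<bar>proj_kernel \<mu> n x y\<bar> \<le> B t * exp (t * eigval l n)"
    using proj_kernel_bound by blast
  obtain A where A: "A > 0" "\<And>k t x y. k \<ge> 1 \<Longrightarrow> t \<ge> 0 \<Longrightarrow> norm x \<le> 1 \<Longrightarrow> norm y \<le> 1 \<Longrightarrow>
    gauss_sub A \<mu> l t (t + 1 / (2 * real k)) x y - bump_error k \<le> flow k t x y"
    using flow_lower by blast
  obtain E where E: "\<And>k. bump_error k \<le> E"
  proof -
    have "Bseq bump_error"
      using bump_error_tendsto by (intro convergent_imp_Bseq) (auto simp: convergent_def)
    then obtain K where "\<And>k. norm (bump_error k) \<le> K" unfolding Bseq_def by blast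
    then have "bump_error k \<le> K" for k
      by (metis abs_le_D1 real_norm_def)
    then show thesis by (rule that)
  qed
  have fm: "(\<lambda>y. indicator (ball 0 1) y * flow (Suc k) t x y) \<in> borel_measurable (ball_measure \<mu>)" for k
  proof -
    have "(\<lambda>y. flow (Suc k) t x y) \<in> borel_measurable borel"
      by (subst flow_commute, intro borel_measurable_continuous_onI polys_continuous flow_polys)
    then have "(\<lambda>y. indicator (ball 0 1) y * flow (Suc k) t x y) \<in> borel_measurable borel" by measurable
    then show ?thesis unfolding ball_measure_eq_jacobi by (simp add: measurable_cong_sets[OF sets_jacobi refl])
  qed
  have lim: "(\<lambda>k. indicator (ball 0 1) y * flow (Suc k) t x y) \<longlonglongrightarrow> indicator (ball 0 1) y * heat_kernel \<mu> t x y" for y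
    using flow_tendsto[OF t x, of y] by (cases "norm y < 1") (auto intro!: tendsto_mult dest: LIMSEQ_Suc)
  have Hm: "(\<lambda>y. indicator (ball 0 1) y * heat_kernel \<mu> t x y) \<in> borel_measurable (ball_measure \<mu>)"
    by (rule borel_measurable_LIMSEQ_real[OF lim fm])
  have cint: "integrable (ball_measure \<mu>) (\<lambda>y::real^'n. B t + E)"
    by (rule integrable_ball_polys[OF mu]) simp
  have bound: "AE y in ball_measure \<mu>. norm (indicator (ball 0 1) y * flow (Suc k) t x y) \<le> B t + E" for k
  proof (rule AE_I2)
    fix y :: "real^'n"
    have E0: "E \<ge> 0" using bump_error_nonneg E by (rule order_trans)
    show "norm (indicator (ball 0 1) y * flow (Suc k) t x y) \<le> B t + E"
    proof (cases "norm y < 1")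
      case True
      have bb: "bdepth x * bdepth y \<ge> 0" using x True by (intro mult_nonneg_nonneg bdepth_nonneg) auto
      define X where "X = gauss_sub A \<mu> l t (t + 1 / (2 * real (Suc k))) x y"
      have "X \<ge> 0" unfolding X_def using A(1) by (intro mult_nonneg_nonneg) auto
      moreover have "X - bump_error (Suc k) \<le> flow (Suc k) t x y"
        unfolding X_def using t x True by (intro A(2)) auto
      ultimately have "- E \<le> flow (Suc k) t x y" using E[of "Suc k"] by linarith
      moreover have "flow (Suc k) t x y \<le> B t" using t x True by (intro B(2)) auto
      ultimately have "\<bar>flow (Suc k) t x y\<bar> \<le> B t + E" using E0 B(1)[OF t] by linarith
      then show ?thesis using True by simp
    qed (use E0 B(1)[OF t] in simp)
  qed
  show "integrable (ball_measure \<mu>) (\<lambda>y. indicator (ball 0 1) y * heat_kernel \<mu> t x y)"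
    by (rule integrable_dominated_convergence[OF Hm fm cint AE_I2 bound]) (rule lim)
  have "(\<lambda>k. \<integral>y. indicator (ball 0 1) y * flow (Suc k) t x y \<partial>ball_measure \<mu>) \<longlonglongrightarrow> (\<integral>y. indicator (ball 0 1) y * heat_kernel \<mu> t x y \<partial>ball_measure \<mu>)"
    by (rule integral_dominated_convergence[OF Hm fm cint AE_I2 bound]) (rule lim)
  moreover have "(\<integral>y. indicator (ball 0 1) y * flow (Suc k) t x y \<partial>ball_measure \<mu>) = 1" for k
  proof -
    have "(\<integral>y. indicator (ball 0 1) y * flow (Suc k) t x y \<partial>ball_measure \<mu>) = (\<integral>y. flow (Suc k) t y x \<partial>ball_measure \<mu>)"
    proof (rule integral_cong_AE[OF fm])
      show "(\<lambda>y. flow (Suc k) t y x) \<in> borel_measurable (ball_measure \<mu>)"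
        by (rule borel_measurable_integrable, rule integrable_ball_polys[OF mu]) auto
      show "AE y in ball_measure \<mu>. indicator (ball 0 1) y * flow (Suc k) t x y = flow (Suc k) t y x"
        using AE_ball by eventually_elim (simp add: flow_commute[of _ _ x])
    qed
    also have "\<dots> = 1" using ball_mean_flow_1[of "Suc k" t x] by (simp add: ball_mean_def)
    finally show ?thesis .
  qed
  ultimately show "(\<integral>y. indicator (ball 0 1) y * heat_kernel \<mu> t x y \<partial>ball_measure \<mu>) = 1"
    by (simp add: LIMSEQ_const_iff)
qed

end

section \<open>Distance, depth and the volume of balls\<close>

lemma ball_dist_eq: "ball_dist x y = arccos (1 - cos_gap x y)"
  by (simp add: ball_dist_def cos_gap_def)

lemma ball_dist_range:
  assumes "norm x \<le> 1" "norm y \<le> 1"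
  shows "0 \<le> ball_dist x y" "ball_dist x y \<le> pi" "cos (ball_dist x y) = 1 - cos_gap x y"
  unfolding ball_dist_eq using cos_gap_bounds[OF assms] by (auto intro: arccos_lbound arccos_ubound)

lemma half_le_sin:
  assumes "0 \<le> x" "x \<le> pi / 2" shows "x / 2 \<le> sin x"
proof (cases "x \<le> pi / 3")
  case True
  have "sin 0 - 0 / 2 \<le> sin x - x / 2"
  proof (rule DERIV_nonneg_imp_nondecreasing[OF assms(1)])
    fix y assume y: "0 \<le> y" "y \<le> x"
    have "cos (pi / 3) \<le> cos y" using y True by (intro cos_monotone_0_pi_le) auto
    then have "0 \<le> cos y - 1 / 2" by (simp add: cos_60)
    moreover have "((\<lambda>x. sin x - x / 2) has_real_derivative cos y - 1 / 2) (at y)"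
      by (auto intro!: derivative_eq_intros)
    ultimately show "\<exists>d. ((\<lambda>x. sin x - x / 2) has_real_derivative d) (at y) \<and> 0 \<le> d" by blast
  qed
  then show ?thesis by simp
next
  case False
  have "pi / 2 / 2 \<le> sqrt 3 / 2"
  proof -
    have "pi / 2 \<le> 8 / 5" using pi_approx by simp
    moreover have "8 / 5 \<le> sqrt 3" by (rule real_le_rsqrt) (simp add: power2_eq_square)
    ultimately show ?thesis by simp
  qed
  also have "\<dots> = sin (pi / 3)" by (simp add: sin_60)
  also have "\<dots> \<le> sin x" using False assms by (intro sin_monotone_2pi_le) auto
  finally show ?thesis using assms by simp
qed

text \<open>The half-angle formula \<open>1 - cos d = 2 (sin (d/2))\<^sup>2\<close> together with \<open>d/4 \<le> sin (d/2) \<le> d/2\<close>.\<close>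

lemma cos_gap_dist:
  assumes "norm x \<le> 1" "norm y \<le> 1"
  shows "cos_gap x y \<le> (ball_dist x y)\<^sup>2 / 2" "(ball_dist x y)\<^sup>2 / 8 \<le> cos_gap x y"
proof -
  define d where "d = ball_dist x y"
  have d: "0 \<le> d" "d \<le> pi" unfolding d_def using ball_dist_range[OF assms] by auto
  have "cos (2 * (d / 2)) = 1 - 2 * (sin (d / 2))\<^sup>2" by (rule cos_double_sin)
  then have g: "cos_gap x y = 2 * (sin (d / 2))\<^sup>2" using ball_dist_range(3)[OF assms] by (simp add: d_def)
  have s0: "0 \<le> sin (d / 2)" using d by (intro sin_ge_zero) auto
  have "sin (d / 2) \<le> d / 2" using d by (intro sin_x_le_x) auto
  then have "(sin (d / 2))\<^sup>2 \<le> (d / 2)\<^sup>2" using s0 by (intro power_mono) auto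
  then show "cos_gap x y \<le> (ball_dist x y)\<^sup>2 / 2" unfolding g d_def[symmetric] by (simp add: power_divide)
  have "(d / 2) / 2 \<le> sin (d / 2)" using d by (intro half_le_sin) auto
  then have "(d / 2 / 2)\<^sup>2 \<le> (sin (d / 2))\<^sup>2" using d by (intro power_mono) auto
  then show "(ball_dist x y)\<^sup>2 / 8 \<le> cos_gap x y" unfolding g d_def[symmetric] by (simp add: power_divide)
qed

text \<open>The kernel bounds contain \<open>t + bdepth x * bdepth y\<close>, the volumes \<open>(sqrt t + bdepth x)\<^sup>2\<close>.
  The two differ by a factor of at most order \<open>1 + cos_gap x y / t\<close>, because the difference of the
  depths has square at most \<open>2 * cos_gap x y\<close>; such a factor can be absorbed by a Gaussian.\<close>

lemma depth_comparison:
  assumes xy: "norm x \<le> 1" "norm y \<le> 1" and t: "t > 0"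
  shows "(sqrt t + bdepth x)\<^sup>2 \<le> 4 * (t + bdepth x * bdepth y) * (1 + cos_gap x y / t)"
    and "(sqrt t + bdepth x) * (sqrt t + bdepth y) \<le> 4 * (t + bdepth x * bdepth y) * (1 + cos_gap x y / t)"
    and "t + bdepth x * bdepth y \<le> (sqrt t + bdepth x) * (sqrt t + bdepth y)"
proof -
  have *: "(sqrt t + bdepth x)\<^sup>2 \<le> 4 * (t + bdepth x * bdepth y) * (1 + cos_gap x y / t)"
    if xy: "norm x \<le> 1" "norm y \<le> 1" for x y :: "real^'n"
  proof -
    have b: "0 \<le> bdepth x" "0 \<le> bdepth y" using xy by (auto intro: bdepth_nonneg)
    have "(bdepth x - bdepth y)\<^sup>2 \<le> 2 * cos_gap x y" using cos_gap_eq[OF xy] by simp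
    moreover have "(bdepth x - bdepth y)\<^sup>2 = (bdepth x)\<^sup>2 - 2 * (bdepth x * bdepth y) + (bdepth y)\<^sup>2"
      by (simp add: power2_eq_square algebra_simps)
    moreover have "(bdepth y)\<^sup>2 \<ge> 0" by simp
    ultimately have 1: "(bdepth x)\<^sup>2 \<le> 2 * (bdepth x * bdepth y) + 2 * cos_gap x y" by linarith
    have "(sqrt t + bdepth x)\<^sup>2 + (sqrt t - bdepth x)\<^sup>2 = 2 * t + 2 * (bdepth x)\<^sup>2"
    proof -
      have "sqrt t * sqrt t = t" using t by simp
      then show ?thesis by (simp add: power2_eq_square algebra_simps)
    qed
    moreover have "(sqrt t - bdepth x)\<^sup>2 \<ge> 0" by simp
    ultimately have "(sqrt t + bdepth x)\<^sup>2 \<le> 2 * t + 2 * (bdepth x)\<^sup>2" by linarith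
    also have "\<dots> \<le> 4 * t + 4 * (bdepth x * bdepth y) + 4 * cos_gap x y" using 1 t by linarith
    also have "\<dots> = 4 * (t + bdepth x * bdepth y) + 4 * cos_gap x y" by simp
    also have "\<dots> \<le> 4 * (t + bdepth x * bdepth y) * (1 + cos_gap x y / t)"
    proof -
      have "0 \<le> bdepth x * bdepth y * cos_gap x y / t" using b t cos_gap_bounds(1)[OF xy] by simp
      moreover have "4 * (t + bdepth x * bdepth y) * (1 + cos_gap x y / t) =
         4 * (t + bdepth x * bdepth y) + 4 * cos_gap x y + 4 * (bdepth x * bdepth y * cos_gap x y / t)"
        using t by (simp add: field_simps)
      ultimately show ?thesis by simp
    qed
    finally show ?thesis .
  qed
  show 1: "(sqrt t + bdepth x)\<^sup>2 \<le> 4 * (t + bdepth x * bdepth y) * (1 + cos_gap x y / t)" using *[OF xy] .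
  have c: "cos_gap y x = cos_gap x y" by (simp add: cos_gap_def inner_commute mult.commute)
  have 2: "(sqrt t + bdepth y)\<^sup>2 \<le> 4 * (t + bdepth x * bdepth y) * (1 + cos_gap x y / t)"
    using *[OF xy(2,1)] unfolding c by (simp add: mult.commute)
  define R where "R = 4 * (t + bdepth x * bdepth y) * (1 + cos_gap x y / t)"
  have "2 * ((sqrt t + bdepth x) * (sqrt t + bdepth y)) \<le> (sqrt t + bdepth x)\<^sup>2 + (sqrt t + bdepth y)\<^sup>2"
    using sum_squares_bound[of "sqrt t + bdepth x" "sqrt t + bdepth y"] by (simp only: mult.assoc)
  then show "(sqrt t + bdepth x) * (sqrt t + bdepth y) \<le> 4 * (t + bdepth x * bdepth y) * (1 + cos_gap x y / t)"
    using 1 2 unfolding R_def[symmetric] by linarith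
  have b: "0 \<le> bdepth x" "0 \<le> bdepth y" using xy by (auto intro: bdepth_nonneg)
  have "(sqrt t + bdepth x) * (sqrt t + bdepth y) = t + bdepth x * bdepth y + sqrt t * bdepth y + bdepth x * sqrt t"
    using t by (simp add: algebra_simps)
  moreover have "0 \<le> sqrt t * bdepth y" "0 \<le> bdepth x * sqrt t" using b t by auto
  ultimately show "t + bdepth x * bdepth y \<le> (sqrt t + bdepth x) * (sqrt t + bdepth y)" by linarith
qed

lemma open_dist_ball:
  assumes "norm x \<le> 1" shows "open (dist_ball x r)"
proof -
  have "continuous_on (ball 0 1) (\<lambda>y. ball_dist x y)"
    unfolding ball_dist_eq
  proof (rule continuous_on_compose2[OF continuous_on_arccos'])
    show "continuous_on (ball 0 1) (\<lambda>y. 1 - cos_gap x y)"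
      unfolding cos_gap_def by (intro continuous_intros)
    show "(\<lambda>y. 1 - cos_gap x y) ` ball 0 1 \<subseteq> {- 1..1}"
      using cos_gap_bounds[OF assms] by (force simp: less_imp_le)
  qed
  then have "open (ball 0 1 \<inter> (\<lambda>y. ball_dist x y) -` {..<r})"
    by (rule continuous_open_preimage) auto
  moreover have "dist_ball x r = ball 0 1 \<inter> (\<lambda>y. ball_dist x y) -` {..<r}"
    by (auto simp: dist_ball_def)
  ultimately show ?thesis by simp
qed

context
  fixes \<mu> l :: real
  assumes mu: "\<mu> \<ge> 0" and l: "l = \<mu> + (real CARD('n::finite) - 1) / 2"
begin

text \<open>The factor that the upper and the lower bound of the heat kernel for \<open>t \<le> 1\<close> have in common.\<close>

definition gauss_prefactor :: "real \<Rightarrow> real^'n \<Rightarrow> real^'n \<Rightarrow> real" where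
  "gauss_prefactor t x y = t powr (- (real CARD('n) / 2)) * (t + bdepth x * bdepth y) powr (- \<mu>)"

text \<open>The order of magnitude of \<open>ball_volume \<mu> x (sqrt t)\<close> for \<open>t \<le> 1\<close>: a Euclidean ball of radius
  \<open>sqrt t\<close> in the hemisphere, weighted with the power \<open>2 \<mu>\<close> of the height.\<close>

definition vol_model :: "real \<Rightarrow> real^'n \<Rightarrow> real" where
  "vol_model t x = t powr (real CARD('n) / 2) * (sqrt t + bdepth x) powr (2 * \<mu>)"

lemma prefactor_pos: "t > 0 \<Longrightarrow> norm x \<le> 1 \<Longrightarrow> norm y \<le> 1 \<Longrightarrow> gauss_prefactor t x y > 0"
  unfolding gauss_prefactor_def
  using mult_nonneg_nonneg[OF bdepth_nonneg bdepth_nonneg, of x y] by (intro mult_pos_pos) (auto simp: add_pos_nonneg)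

lemma vol_model_pos: "t > 0 \<Longrightarrow> norm x \<le> 1 \<Longrightarrow> vol_model t x > 0"
proof -
  assume "t > 0" "norm x \<le> 1"
  then have "sqrt t + bdepth x > 0" by (intro add_pos_nonneg bdepth_nonneg) auto
  then show ?thesis unfolding vol_model_def using \<open>t > 0\<close> by simp
qed

lemma powr_split: "t > 0 \<Longrightarrow> t powr (- (l + 1/2)) * t powr \<mu> = t powr (- (real CARD('n) / 2))"
  unfolding powr_add[symmetric] l by (intro arg_cong[where f = "\<lambda>e. t powr e"]) (simp add: field_simps)

lemma short_time_upper:
  obtains C where "C > 0" "\<And>t (x::real^'n) y. 0 < t \<Longrightarrow> t \<le> 1 \<Longrightarrow> norm x < 1 \<Longrightarrow> norm y < 1 \<Longrightarrow>
    heat_kernel \<mu> t x y \<le> C * gauss_prefactor t x y * exp (- cos_gap x y / (2 * t))"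
proof -
  obtain A where A: "A > 0" "\<And>t (x::real^'n) y. t > 0 \<Longrightarrow> norm x < 1 \<Longrightarrow> norm y < 1 \<Longrightarrow>
    heat_kernel \<mu> t x y \<le> gauss_super A \<mu> l t t x y"
    using heat_kernel_upper[OF mu l] by blast
  define C where "C = A * exp ((l + 1/2)\<^sup>2) * 2 powr \<mu>"
  have C: "C > 0" using A(1) by (simp add: C_def)
  have "heat_kernel \<mu> t x y \<le> C * gauss_prefactor t x y * exp (- cos_gap x y / (2 * t))"
    if t: "0 < t" "t \<le> 1" and xy: "norm x < 1" "norm y < 1" for t and x y :: "real^'n"
  proof -
    have bb: "bdepth x * bdepth y \<ge> 0" using xy by (intro mult_nonneg_nonneg bdepth_nonneg) auto
    have "(1 + bdepth x * bdepth y / (2 * t)) powr (- \<mu>) \<le> ((t + bdepth x * bdepth y) / (2 * t)) powr (- \<mu>)"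
      using bb t mu by (intro powr_mono2') (auto simp: field_simps add_pos_nonneg)
    also have "\<dots> = t powr \<mu> * (2 powr \<mu> * (t + bdepth x * bdepth y) powr (- \<mu>))"
    proof -
      define q where "q = t + bdepth x * bdepth y"
      have "q > 0" using bb t by (simp add: q_def)
      then show ?thesis unfolding q_def[symmetric] using t by (simp add: powr_divide powr_mult powr_minus_divide)
    qed
    finally have 1: "(1 + bdepth x * bdepth y / (2 * t)) powr (- \<mu>) \<le> t powr \<mu> * (2 powr \<mu> * (t + bdepth x * bdepth y) powr (- \<mu>))" .
    have "(l + 1/2)\<^sup>2 * t \<le> (l + 1/2)\<^sup>2 * 1" using t by (intro mult_left_mono) auto
    then have 2: "exp ((l + 1/2)\<^sup>2 * t) \<le> exp ((l + 1/2)\<^sup>2)" by simp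
    have "heat_kernel \<mu> t x y \<le> gauss_super A \<mu> l t t x y" by (rule A(2)) (use t xy in auto)
    also have "\<dots> \<le> A * exp ((l + 1/2)\<^sup>2) * t powr (- (l + 1/2)) * exp (- cos_gap x y / (2 * t))
      * (t powr \<mu> * (2 powr \<mu> * (t + bdepth x * bdepth y) powr (- \<mu>)))"
      using 1 2 A(1) by (intro mult_mono) auto
    also have "\<dots> = C * ((t powr (- (l + 1/2)) * t powr \<mu>) * (t + bdepth x * bdepth y) powr (- \<mu>)) * exp (- cos_gap x y / (2 * t))"
      by (simp add: C_def)
    also have "\<dots> = C * gauss_prefactor t x y * exp (- cos_gap x y / (2 * t))"
      unfolding powr_split[OF t(1)] gauss_prefactor_def ..
    finally show ?thesis .
  qed
  then show thesis by (rule that[OF C])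
qed

lemma short_time_lower:
  obtains c where "c > 0" "\<And>t (x::real^'n) y. 0 < t \<Longrightarrow> t \<le> 1 \<Longrightarrow> norm x < 1 \<Longrightarrow> norm y < 1 \<Longrightarrow>
    c * gauss_prefactor t x y * exp (- 2 * cos_gap x y / t) \<le> heat_kernel \<mu> t x y"
proof -
  obtain A where A: "A > 0" "\<And>t (x::real^'n) y. t > 0 \<Longrightarrow> norm x < 1 \<Longrightarrow> norm y < 1 \<Longrightarrow>
    gauss_sub A \<mu> l t t x y
      \<le> heat_kernel \<mu> t x y"
    using heat_kernel_lower[OF mu l] by blast
  define c where "c = A * exp (- 3) * 2 powr (- \<mu>)"
  have c: "c > 0" using A(1) by (simp add: c_def)
  have "c * gauss_prefactor t x y * exp (- 2 * cos_gap x y / t) \<le> heat_kernel \<mu> t x y"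
    if t: "0 < t" "t \<le> 1" and xy: "norm x < 1" "norm y < 1" for t and x y :: "real^'n"
  proof -
    have bb: "bdepth x * bdepth y \<ge> 0" using xy by (intro mult_nonneg_nonneg bdepth_nonneg) auto
    have "t powr \<mu> * (2 powr (- \<mu>) * (t + bdepth x * bdepth y) powr (- \<mu>)) = (2 * (t + bdepth x * bdepth y) / t) powr (- \<mu>)"
    proof -
      define q where "q = t + bdepth x * bdepth y"
      have "q > 0" using bb t by (simp add: q_def)
      then show ?thesis unfolding q_def[symmetric] using t by (simp add: powr_divide powr_mult powr_minus_divide)
    qed
    also have "\<dots> \<le> (1 + 2 * (bdepth x * bdepth y) / t) powr (- \<mu>)"
      using bb t mu by (intro powr_mono2') (auto simp: field_simps add_pos_nonneg)
    finally have 1: "t powr \<mu> * (2 powr (- \<mu>) * (t + bdepth x * bdepth y) powr (- \<mu>)) \<le> (1 + 2 * (bdepth x * bdepth y) / t) powr (- \<mu>)" .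
    have 2: "exp (- 3) \<le> exp (- 3 * t)" using t by simp
    have "c * gauss_prefactor t x y * exp (- 2 * cos_gap x y / t) =
      c * ((t powr (- (l + 1/2)) * t powr \<mu>) * (t + bdepth x * bdepth y) powr (- \<mu>)) * exp (- 2 * cos_gap x y / t)"
      unfolding powr_split[OF t(1)] gauss_prefactor_def ..
    also have "\<dots> = A * exp (- 3) * t powr (- (l + 1/2)) * exp (- 2 * cos_gap x y / t) * (t powr \<mu> * (2 powr (- \<mu>) * (t + bdepth x * bdepth y) powr (- \<mu>)))"
      by (simp add: c_def)
    also have "\<dots> \<le> gauss_sub A \<mu> l t t x y"
      using 1 2 A(1) by (intro mult_mono) auto
    also have "\<dots> \<le> heat_kernel \<mu> t x y" by (rule A(2)) (use t xy in auto)
    finally show ?thesis .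
  qed
  then show thesis by (rule that[OF c])
qed

lemma ball_finite_measure: "finite_measure (ball_measure \<mu> :: (real^'n) measure)"
  unfolding ball_measure_eq_jacobi using mu by (intro finite_measure_jacobi) simp

lemma dist_ball_sets [simp]: "norm x \<le> 1 \<Longrightarrow> dist_ball x r \<in> sets (ball_measure \<mu>)"
  by (simp add: ball_measure_eq_jacobi borel_open[OF open_dist_ball])

lemma integral_dist_ball:
  fixes x :: "real^'n"
  assumes "norm x \<le> 1"
  shows "integrable (ball_measure \<mu>) (\<lambda>y. indicator (dist_ball x r) y * (c::real))"
    "(\<integral>y. indicator (dist_ball x r) y * c \<partial>ball_measure \<mu>) = c * ball_volume \<mu> x r"
proof -
  interpret finite_measure "ball_measure \<mu> :: (real^'n) measure" by (rule ball_finite_measure)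
  show "integrable (ball_measure \<mu>) (\<lambda>y. indicator (dist_ball x r) y * c)"
    using assms emeasure_finite by (intro integrable_mult_left integrable_real_indicator) (auto simp: less_top[symmetric])
  show "(\<integral>y. indicator (dist_ball x r) y * c \<partial>ball_measure \<mu>) = c * ball_volume \<mu> x r"
    using assms by (simp add: ball_volume_def)
qed

text \<open>On the ball of radius \<open>sqrt t\<close> around \<open>x\<close> the heat kernel is at least a constant divided by
  \<open>vol_model t x\<close>, while its total mass is one.\<close>

lemma volume_upper:
  obtains C where "C > 0" "\<And>t (x::real^'n). 0 < t \<Longrightarrow> t \<le> 1 \<Longrightarrow> norm x < 1 \<Longrightarrow> ball_volume \<mu> x (sqrt t) \<le> C * vol_model t x"
proof -
  obtain c where c: "c > 0" "\<And>t (x::real^'n) y. 0 < t \<Longrightarrow> t \<le> 1 \<Longrightarrow> norm x < 1 \<Longrightarrow> norm y < 1 \<Longrightarrow>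
    c * gauss_prefactor t x y * exp (- 2 * cos_gap x y / t) \<le> heat_kernel \<mu> t x y"
    using short_time_lower by blast
  define a where "a = c * 2 powr (- \<mu>) * exp (- 1)"
  have a: "a > 0" using c by (simp add: a_def)
  have "ball_volume \<mu> x (sqrt t) \<le> (1 / a) * vol_model t x" if t: "0 < t" "t \<le> 1" and x: "norm x < 1" for t and x :: "real^'n"
  proof -
    have W: "vol_model t x > 0" using t x by (intro vol_model_pos) auto
    have bx: "0 \<le> bdepth x" using x by (auto intro: bdepth_nonneg)
    have pt: "indicator (dist_ball x (sqrt t)) y * (a / vol_model t x) \<le> indicator (ball 0 1) y * heat_kernel \<mu> t x y" for y
    proof (cases "norm y < 1")
      case y: True
      have low: "c * gauss_prefactor t x y * exp (- 2 * cos_gap x y / t) \<le> heat_kernel \<mu> t x y" by (rule c(2)[OF t x y])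
      have pf: "gauss_prefactor t x y > 0" using t x y by (intro prefactor_pos) auto
      show ?thesis
      proof (cases "y \<in> dist_ball x (sqrt t)")
        case True
        have by': "0 \<le> bdepth y" using y by (auto intro: bdepth_nonneg)
        have d: "ball_dist x y < sqrt t" "0 \<le> ball_dist x y" using True ball_dist_range[of x y] x y by (auto simp: dist_ball_def)
        have "(ball_dist x y)\<^sup>2 \<le> (sqrt t)\<^sup>2" using d by (intro power_mono) auto
        then have g: "cos_gap x y \<le> t / 2" using cos_gap_dist(1)[of x y] x y t by simp
        have e: "exp (- 1) \<le> exp (- 2 * cos_gap x y / t)" using g t by (simp add: field_simps)
        have "(bdepth x - bdepth y)\<^sup>2 \<le> 2 * cos_gap x y" using cos_gap_eq[of x y] x y by simp
        also have "\<dots> \<le> (sqrt t)\<^sup>2" using g t by simp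
        finally have "\<bar>bdepth x - bdepth y\<bar> \<le> \<bar>sqrt t\<bar>" by (rule iffD2[OF abs_le_square_iff])
        then have "bdepth y \<le> bdepth x + sqrt t" using t by (simp add: abs_le_iff)
        then have "sqrt t + bdepth y \<le> 2 * sqrt t + 2 * bdepth x" using bx by linarith
        then have "sqrt t + bdepth y \<le> 2 * (sqrt t + bdepth x)" by (simp only: distrib_left)
        then have "(sqrt t + bdepth x) * (sqrt t + bdepth y) \<le> (sqrt t + bdepth x) * (2 * (sqrt t + bdepth x))"
          using bx t by (intro mult_left_mono) auto
        then have q: "t + bdepth x * bdepth y \<le> 2 * (sqrt t + bdepth x)\<^sup>2"
        proof -
          have "(sqrt t + bdepth x) * (2 * (sqrt t + bdepth x)) = 2 * (sqrt t + bdepth x)\<^sup>2"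
            by (simp only: power2_eq_square mult.left_commute)
          moreover have "t + bdepth x * bdepth y \<le> (sqrt t + bdepth x) * (sqrt t + bdepth y)"
            using x y t by (intro depth_comparison(3)) auto
          ultimately show ?thesis
            using \<open>(sqrt t + bdepth x) * (sqrt t + bdepth y) \<le> (sqrt t + bdepth x) * (2 * (sqrt t + bdepth x))\<close> by linarith
        qed
        have q0: "t + bdepth x * bdepth y > 0" using t bx by' by (simp add: add_pos_nonneg)
        have "(2 * (sqrt t + bdepth x)\<^sup>2) powr (- \<mu>) \<le> (t + bdepth x * bdepth y) powr (- \<mu>)"
          using q q0 mu by (intro powr_mono2') auto
        moreover have "(2 * (sqrt t + bdepth x)\<^sup>2) powr (- \<mu>) = 2 powr (- \<mu>) / (sqrt t + bdepth x) powr (2 * \<mu>)"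
        proof -
          have "(sqrt t + bdepth x)\<^sup>2 powr (- \<mu>) = (sqrt t + bdepth x) powr (- (2 * \<mu>))"
            using t bx by (simp add: powr_powr flip: powr_numeral)
          then show ?thesis by (simp add: powr_mult powr_minus_divide)
        qed
        ultimately have "t powr (- (real CARD('n) / 2)) * (2 powr (- \<mu>) / (sqrt t + bdepth x) powr (2 * \<mu>)) \<le> gauss_prefactor t x y"
          unfolding gauss_prefactor_def by (intro mult_left_mono) auto
        moreover have "t powr (- (real CARD('n) / 2)) * (2 powr (- \<mu>) / (sqrt t + bdepth x) powr (2 * \<mu>)) = 2 powr (- \<mu>) / vol_model t x"
          unfolding vol_model_def powr_minus_divide by simp
        ultimately have "c * (2 powr (- \<mu>) / vol_model t x) * exp (- 1) \<le> c * gauss_prefactor t x y * exp (- 2 * cos_gap x y / t)"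
          using c(1) e pf W by (intro mult_mono mult_nonneg_nonneg) auto
        then show ?thesis using low True y by (simp add: a_def)
      next
        case False
        have "0 \<le> c * gauss_prefactor t x y * exp (- 2 * cos_gap x y / t)" using c(1) pf by simp
        then show ?thesis using low False y by simp
      qed
    next
      case False
      then have "y \<notin> dist_ball x (sqrt t)" by (simp add: dist_ball_def)
      then show ?thesis using False by simp
    qed
    have "(a / vol_model t x) * ball_volume \<mu> x (sqrt t) = (\<integral>y. indicator (dist_ball x (sqrt t)) y * (a / vol_model t x) \<partial>ball_measure \<mu>)"
      by (rule integral_dist_ball(2)[symmetric]) (use x in simp)
    also have "\<dots> \<le> (\<integral>y. indicator (ball 0 1) y * heat_kernel \<mu> t x y \<partial>ball_measure \<mu>)"
      using pt x by (intro Bochner_Integration.integral_mono integral_dist_ball(1) heat_kernel_mass(1)[OF mu l t(1) x]) auto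
    also have "\<dots> = 1" by (rule heat_kernel_mass(2)[OF mu l t(1) x])
    finally show ?thesis using W a by (simp add: field_simps)
  qed
  then show thesis using a by (intro that[of "1 / a"]) auto
qed

text \<open>Outside the ball of radius \<open>K * sqrt t\<close> the kernel at time \<open>t\<close> is at most half the kernel at
  time \<open>8 t\<close>: with \<open>g = cos_gap x y\<close>, the upper bound decays like \<open>exp (- g / (2 t))\<close>, the lower
  bound at time \<open>8 t\<close> only like \<open>exp (- g / (4 t))\<close>, and their quotient is small for large \<open>K\<close>. As
  both kernels have mass one, half of the mass at time \<open>t\<close> lies in that ball, where the kernel is
  at most a constant divided by \<open>vol_model t x\<close>. Replacing \<open>t\<close> by \<open>t / K\<^sup>2\<close> changes the radius to
  \<open>sqrt t\<close> at the expense of a constant.\<close>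

lemma volume_lower:
  obtains c where "c > 0" "\<And>t (x::real^'n). 0 < t \<Longrightarrow> t \<le> 1 \<Longrightarrow> norm x < 1 \<Longrightarrow> c * vol_model t x \<le> ball_volume \<mu> x (sqrt t)"
proof -
  define d where "d = real CARD('n)"
  define m where "m = d / 2 + \<mu>"
  have m: "m \<ge> 0" using mu by (simp add: m_def d_def)
  obtain c where c: "c > 0" "\<And>t (x::real^'n) y. 0 < t \<Longrightarrow> t \<le> 1 \<Longrightarrow> norm x < 1 \<Longrightarrow> norm y < 1 \<Longrightarrow>
    c * gauss_prefactor t x y * exp (- 2 * cos_gap x y / t) \<le> heat_kernel \<mu> t x y"
    using short_time_lower by blast
  obtain C where C: "C > 0" "\<And>t (x::real^'n) y. 0 < t \<Longrightarrow> t \<le> 1 \<Longrightarrow> norm x < 1 \<Longrightarrow> norm y < 1 \<Longrightarrow>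
    heat_kernel \<mu> t x y \<le> C * gauss_prefactor t x y * exp (- cos_gap x y / (2 * t))"
    using short_time_upper by blast
  have "(\<lambda>k::nat. (C * 8 powr m / c) * exp (- ((real k)\<^sup>2 / 32))) \<longlonglongrightarrow> (C * 8 powr m / c) * 0"
    by (intro tendsto_mult tendsto_const) real_asymp
  then have "\<forall>\<^sub>F k::nat in sequentially. (C * 8 powr m / c) * exp (- ((real k)\<^sup>2 / 32)) < 1 / 2"
    by (intro order_tendstoD(2)) auto
  \<comment> \<open>With \<open>K \<ge> 3\<close> the time \<open>8 * (t / K\<^sup>2)\<close> stays below one.\<close>
  moreover have "\<forall>\<^sub>F k::nat in sequentially. k \<ge> 3" by (rule eventually_ge_at_top)
  ultimately have "\<forall>\<^sub>F k::nat in sequentially. (C * 8 powr m / c) * exp (- ((real k)\<^sup>2 / 32)) < 1 / 2 \<and> k \<ge> 3"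
    by (rule eventually_conj)
  then obtain k :: nat where k: "(C * 8 powr m / c) * exp (- ((real k)\<^sup>2 / 32)) < 1 / 2" "k \<ge> 3"
    by (auto simp: eventually_sequentially)
  define K where "K = real k"
  have K: "K \<ge> 3" "(C * 8 powr m / c) * exp (- (K\<^sup>2 / 32)) \<le> 1 / 2" using k by (auto simp: K_def)
  have K8: "K\<^sup>2 \<ge> 8" using power_mono[of 3 K 2] K(1) by simp
  define b where "b = C * (4 * (1 + K\<^sup>2 / 2)) powr \<mu>"
  have p4: "4 * (1 + K\<^sup>2 / 2) > 0" by (simp add: add_pos_nonneg)
  then have "(4 * (1 + K\<^sup>2 / 2)) powr \<mu> > 0" by (simp only: powr_gt_zero less_imp_neq[THEN not_sym] not_False_eq_True)
  then have b: "b > 0" unfolding b_def using C(1) by (rule mult_pos_pos[rotated])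
  have main: "vol_model t x / (2 * b) \<le> ball_volume \<mu> x (K * sqrt t)"
    if t: "0 < t" "8 * t \<le> 1" and x: "norm x < 1" for t and x :: "real^'n"
  proof -
    have t1: "t \<le> 1" using t by simp
    have W: "vol_model t x > 0" using t x by (intro vol_model_pos) auto
    have bx: "0 \<le> bdepth x" using x by (auto intro: bdepth_nonneg)
    have pt: "indicator (ball 0 1) y * heat_kernel \<mu> t x y \<le>
        (1 / 2) * (indicator (ball 0 1) y * heat_kernel \<mu> (8 * t) x y) + indicator (dist_ball x (K * sqrt t)) y * (b / vol_model t x)" for y
    proof (cases "norm y < 1")
      case y: True
      have by': "0 \<le> bdepth y" using y by (auto intro: bdepth_nonneg)
      have up: "heat_kernel \<mu> t x y \<le> C * gauss_prefactor t x y * exp (- cos_gap x y / (2 * t))" by (rule C(2)[OF t(1) t1 x y])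
      have low: "c * gauss_prefactor (8 * t) x y * exp (- 2 * cos_gap x y / (8 * t)) \<le> heat_kernel \<mu> (8 * t) x y"
        by (rule c(2)) (use t x y in auto)
      have pf: "gauss_prefactor t x y > 0" "gauss_prefactor (8 * t) x y > 0" using t x y by (auto intro!: prefactor_pos)
      have g0: "cos_gap x y \<ge> 0" using cos_gap_bounds(1)[of x y] x y by simp
      have q0: "t + bdepth x * bdepth y > 0" using t bx by' by (simp add: add_pos_nonneg)
      have h8: "0 \<le> heat_kernel \<mu> (8 * t) x y"
      proof -
        have "0 \<le> c * gauss_prefactor (8 * t) x y * exp (- 2 * cos_gap x y / (8 * t))" using c(1) pf by simp
        then show ?thesis using low by linarith
      qed
      show ?thesis
      proof (cases "y \<in> dist_ball x (K * sqrt t)")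
        case True
        have d: "ball_dist x y < K * sqrt t" "0 \<le> ball_dist x y" using True ball_dist_range[of x y] x y by (auto simp: dist_ball_def)
        have "(ball_dist x y)\<^sup>2 \<le> (K * sqrt t)\<^sup>2" using d by (intro power_mono) auto
        also have "\<dots> = K\<^sup>2 * t" using t by (simp add: power_mult_distrib)
        finally have "cos_gap x y \<le> K\<^sup>2 * t / 2" using cos_gap_dist(1)[of x y] x y by simp
        then have "1 + cos_gap x y / t \<le> 1 + K\<^sup>2 / 2" using t by (simp add: field_simps)
        then have "4 * (t + bdepth x * bdepth y) * (1 + cos_gap x y / t) \<le> 4 * (t + bdepth x * bdepth y) * (1 + K\<^sup>2 / 2)"
          using q0 by (intro mult_left_mono) auto
        moreover have "(sqrt t + bdepth x)\<^sup>2 \<le> 4 * (t + bdepth x * bdepth y) * (1 + cos_gap x y / t)"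
          using x y t by (intro depth_comparison(1)) auto
        ultimately have "(sqrt t + bdepth x)\<^sup>2 \<le> 4 * (t + bdepth x * bdepth y) * (1 + K\<^sup>2 / 2)" by linarith
        moreover have "4 * (t + bdepth x * bdepth y) * (1 + K\<^sup>2 / 2) = (t + bdepth x * bdepth y) * (4 * (1 + K\<^sup>2 / 2))"
          by (simp only: mult_ac)
        ultimately have q: "(sqrt t + bdepth x)\<^sup>2 / (4 * (1 + K\<^sup>2 / 2)) \<le> t + bdepth x * bdepth y"
          using p4 by (simp only: pos_divide_le_eq)
        have sb: "(sqrt t + bdepth x)\<^sup>2 > 0" using t bx by (intro zero_less_power add_pos_nonneg) auto
        have "(t + bdepth x * bdepth y) powr (- \<mu>) \<le> ((sqrt t + bdepth x)\<^sup>2 / (4 * (1 + K\<^sup>2 / 2))) powr (- \<mu>)"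
          using mu by (intro powr_mono2' divide_pos_pos sb p4 q) auto
        also have "\<dots> = (4 * (1 + K\<^sup>2 / 2)) powr \<mu> / (sqrt t + bdepth x) powr (2 * \<mu>)"
        proof -
          have "(sqrt t + bdepth x)\<^sup>2 powr \<mu> = (sqrt t + bdepth x) powr (2 * \<mu>)"
            using t bx by (simp add: powr_powr flip: powr_numeral)
          then show ?thesis using p4 by (simp add: powr_divide powr_minus_divide)
        qed
        finally have "gauss_prefactor t x y \<le> t powr (- (d / 2)) * ((4 * (1 + K\<^sup>2 / 2)) powr \<mu> / (sqrt t + bdepth x) powr (2 * \<mu>))"
          unfolding gauss_prefactor_def d_def by (intro mult_left_mono) auto
        also have "\<dots> = (4 * (1 + K\<^sup>2 / 2)) powr \<mu> / vol_model t x"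
          unfolding vol_model_def powr_minus_divide d_def by simp
        finally have "C * gauss_prefactor t x y * exp (- cos_gap x y / (2 * t)) \<le> C * ((4 * (1 + K\<^sup>2 / 2)) powr \<mu> / vol_model t x) * 1"
          using C(1) pf g0 t W by (intro mult_mono) auto
        then have "heat_kernel \<mu> t x y \<le> b / vol_model t x" using up by (simp add: b_def)
        then show ?thesis using True y h8 by simp
      next
        case False
        then have "K * sqrt t \<le> ball_dist x y" using y by (auto simp: dist_ball_def)
        then have "(K * sqrt t)\<^sup>2 \<le> (ball_dist x y)\<^sup>2" using K t by (intro power_mono) auto
        moreover have "(K * sqrt t)\<^sup>2 = K\<^sup>2 * t" using t by (simp add: power_mult_distrib)
        ultimately have "K\<^sup>2 * t / 8 \<le> cos_gap x y" using cos_gap_dist(2)[of x y] x y by simp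
        then have "K\<^sup>2 / 32 \<le> cos_gap x y / (4 * t)" using t by (simp add: field_simps)
        then have e: "exp (- (cos_gap x y / (4 * t))) \<le> exp (- (K\<^sup>2 / 32))" by simp
        \<comment> \<open>Half of the exponent pays for the comparison of the constants, the other half is that
          of the time \<open>8 t\<close>.\<close>
        have ee: "exp (- cos_gap x y / (2 * t)) = exp (- (cos_gap x y / (4 * t))) * exp (- 2 * cos_gap x y / (8 * t))"
          using t by (simp add: exp_add[symmetric] field_simps)
        have N8: "gauss_prefactor t x y \<le> 8 powr m * gauss_prefactor (8 * t) x y"
        proof -
          have "(8 * (t + bdepth x * bdepth y)) powr (- \<mu>) \<le> (8 * t + bdepth x * bdepth y) powr (- \<mu>)"
            using q0 t bx by' mu by (intro powr_mono2') (auto simp: add_pos_nonneg)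
          then have "8 powr m * ((8 * t) powr (- (d / 2)) * (8 * (t + bdepth x * bdepth y)) powr (- \<mu>)) \<le> 8 powr m * gauss_prefactor (8 * t) x y"
            unfolding gauss_prefactor_def d_def by (intro mult_left_mono) auto
          moreover have "8 powr m * ((8 * t) powr (- (d / 2)) * (8 * (t + bdepth x * bdepth y)) powr (- \<mu>)) = gauss_prefactor t x y"
          proof -
            have "(8::real) powr m * (8 powr (- (d / 2)) * 8 powr (- \<mu>)) = 1"
              by (simp add: m_def powr_add[symmetric])
            moreover define q where "q = t + bdepth x * bdepth y"
            ultimately show ?thesis using q0 t unfolding gauss_prefactor_def d_def[symmetric] q_def[symmetric]
              by (simp add: powr_mult mult_ac)
          qed
          ultimately show ?thesis by (simp only:)
        qed
        have "heat_kernel \<mu> t x y \<le> C * gauss_prefactor t x y * (exp (- (cos_gap x y / (4 * t))) * exp (- 2 * cos_gap x y / (8 * t)))"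
          using up unfolding ee .
        also have "\<dots> \<le> C * (8 powr m * gauss_prefactor (8 * t) x y) * (exp (- (K\<^sup>2 / 32)) * exp (- 2 * cos_gap x y / (8 * t)))"
          using C(1) N8 e pf by (intro mult_mono mult_nonneg_nonneg) auto
        also have "\<dots> = ((C * 8 powr m / c) * exp (- (K\<^sup>2 / 32))) * (c * gauss_prefactor (8 * t) x y * exp (- 2 * cos_gap x y / (8 * t)))"
          using c(1) by simp
        also have "\<dots> \<le> (1 / 2) * heat_kernel \<mu> (8 * t) x y"
          using K(2) low c(1) pf by (intro mult_mono) auto
        finally show ?thesis using False y by simp
      qed
    next
      case False
      then have "y \<notin> dist_ball x (K * sqrt t)" by (simp add: dist_ball_def)
      then show ?thesis using False by simp
    qed
    have t8: "8 * t > 0" using t by simp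
    have i1: "integrable (ball_measure \<mu>) (\<lambda>y. (1 / 2) * (indicator (ball 0 1) y * heat_kernel \<mu> (8 * t) x y))"
      by (intro integrable_mult_right heat_kernel_mass(1)[OF mu l t8 x])
    have i2: "integrable (ball_measure \<mu>) (\<lambda>y. indicator (dist_ball x (K * sqrt t)) y * (b / vol_model t x))"
      by (rule integral_dist_ball(1)) (use x in simp)
    have "1 = (\<integral>y. indicator (ball 0 1) y * heat_kernel \<mu> t x y \<partial>ball_measure \<mu>)"
      by (rule heat_kernel_mass(2)[OF mu l t(1) x, symmetric])
    also have "\<dots> \<le> (\<integral>y. (1 / 2) * (indicator (ball 0 1) y * heat_kernel \<mu> (8 * t) x y) + indicator (dist_ball x (K * sqrt t)) y * (b / vol_model t x) \<partial>ball_measure \<mu>)"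
      using pt by (intro Bochner_Integration.integral_mono Bochner_Integration.integrable_add i1 i2 heat_kernel_mass(1)[OF mu l t(1) x]) auto
    also have "\<dots> = (1 / 2) * 1 + (b / vol_model t x) * ball_volume \<mu> x (K * sqrt t)"
    proof -
      have "norm x \<le> 1" using x by simp
      then show ?thesis
        unfolding Bochner_Integration.integral_add[OF i1 i2] integral_mult_right_zero heat_kernel_mass(2)[OF mu l t8 x]
        by (simp only: integral_dist_ball(2))
    qed
    finally have "1 / 2 \<le> (b / vol_model t x) * ball_volume \<mu> x (K * sqrt t)" by linarith
    then show ?thesis using W b by (simp add: field_simps)
  qed
  define a where "a = K powr (- (d + 2 * \<mu>)) / (2 * b)"
  have a: "a > 0" using K b by (simp add: a_def)
  have "a * vol_model t x \<le> ball_volume \<mu> x (sqrt t)" if t: "0 < t" "t \<le> 1" and x: "norm x < 1" for t and x :: "real^'n"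
  proof -
    define s where "s = t / K\<^sup>2"
    have K0: "K > 0" using K by simp
    have K2: "K\<^sup>2 > 0" using K0 by simp
    have s: "s > 0" using t K2 unfolding s_def by (intro divide_pos_pos) auto
    have s8: "8 * s \<le> 1" using t K8 K2 unfolding s_def by (simp add: pos_divide_le_eq)
    have sq: "sqrt s = sqrt t / K" using K0 by (simp add: s_def real_sqrt_divide)
    have bx: "0 \<le> bdepth x" using x by (auto intro: bdepth_nonneg)
    have "(sqrt t + bdepth x) / K \<le> sqrt s + bdepth x"
    proof -
      have "bdepth x / K \<le> bdepth x / 1" using bx K by (intro divide_left_mono) auto
      then show ?thesis by (simp add: sq add_divide_distrib)
    qed
    then have "((sqrt t + bdepth x) / K) powr (2 * \<mu>) \<le> (sqrt s + bdepth x) powr (2 * \<mu>)"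
      using mu bx t K0 by (intro powr_mono2) (auto intro!: divide_nonneg_pos)
    then have "s powr (d / 2) * ((sqrt t + bdepth x) / K) powr (2 * \<mu>) \<le> vol_model s x"
      unfolding vol_model_def d_def by (intro mult_left_mono) auto
    moreover have "s powr (d / 2) * ((sqrt t + bdepth x) / K) powr (2 * \<mu>) = K powr (- (d + 2 * \<mu>)) * vol_model t x"
    proof -
      have "(K\<^sup>2) powr (d / 2) = K powr d" using K0 by (simp add: powr_powr flip: powr_numeral)
      then have "s powr (d / 2) = t powr (d / 2) / K powr d" using t by (simp add: s_def powr_divide)
      moreover have "K powr (- (d + 2 * \<mu>)) = 1 / (K powr d * K powr (2 * \<mu>))" by (simp only: powr_minus_divide powr_add)
      ultimately show ?thesis using bx t K0 unfolding vol_model_def d_def[symmetric]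
        by (simp add: powr_divide)
    qed
    ultimately have "a * vol_model t x \<le> vol_model s x / (2 * b)"
      using b by (simp add: a_def divide_right_mono)
    also have "\<dots> \<le> ball_volume \<mu> x (K * sqrt s)" by (rule main[OF s s8 x])
    also have "K * sqrt s = sqrt t" using K0 by (simp add: sq)
    finally show ?thesis .
  qed
  then show thesis by (rule that[OF a])
qed

lemma ball_volume_mono: "r \<le> r' \<Longrightarrow> norm (x::real^'n) \<le> 1 \<Longrightarrow> ball_volume \<mu> x r \<le> ball_volume \<mu> x r'"
proof -
  interpret finite_measure "ball_measure \<mu> :: (real^'n) measure" by (rule ball_finite_measure)
  show "r \<le> r' \<Longrightarrow> norm (x::real^'n) \<le> 1 \<Longrightarrow> ball_volume \<mu> x r \<le> ball_volume \<mu> x r'"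
    unfolding ball_volume_def by (intro finite_measure_mono dist_ball_sets) (auto simp: dist_ball_def)
qed

lemma ball_volume_le_total: "ball_volume \<mu> (x::real^'n) r \<le> measure (ball_measure \<mu>) (UNIV :: (real^'n) set)"
proof -
  interpret finite_measure "ball_measure \<mu> :: (real^'n) measure" by (rule ball_finite_measure)
  have "space (ball_measure \<mu> :: (real^'n) measure) = UNIV" by (simp add: ball_measure_eq_jacobi)
  then show ?thesis unfolding ball_volume_def using bounded_measure[of "dist_ball x r"] by simp
qed

section \<open>Two-sided Gaussian bounds\<close>

lemma sqrt_vol_model:
  assumes "t > 0" "norm x \<le> 1" "norm y \<le> 1"
  shows "sqrt (vol_model t x * vol_model t y) = t powr (real CARD('n) / 2) * ((sqrt t + bdepth x) * (sqrt t + bdepth y)) powr \<mu>"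
proof -
  have b: "0 < sqrt t + bdepth x" "0 < sqrt t + bdepth y" using assms by (auto intro!: add_pos_nonneg bdepth_nonneg)
  define p where "p = (sqrt t + bdepth x) * (sqrt t + bdepth y)"
  have p: "p > 0" using b by (simp add: p_def)
  have "vol_model t x * vol_model t y = (t powr (real CARD('n) / 2))\<^sup>2 * p powr (2 * \<mu>)"
    using b by (simp add: vol_model_def p_def powr_mult power2_eq_square)
  also have "p powr (2 * \<mu>) = (p powr \<mu>)\<^sup>2" using p by (simp add: powr_powr mult.commute flip: powr_numeral)
  finally show ?thesis unfolding p_def[symmetric] by (simp add: real_sqrt_mult)
qed

text \<open>Both volumes are replaced by their models, whose geometric mean is a power of \<open>t\<close> times
  \<open>p powr \<mu>\<close> with \<open>p = (sqrt t + bdepth x) * (sqrt t + bdepth y)\<close>. The kernel bounds contain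
  \<open>q = t + bdepth x * bdepth y\<close> instead. As \<open>q \<le> p\<close>, the lower bound follows. For the upper bound,
  \<open>q\<close> may be smaller than \<open>p\<close> by a factor of order \<open>1 + z\<close>, \<open>z = cos_gap x y / t\<close>; its power \<open>\<mu>\<close>
  is bounded by a multiple of \<open>exp (z / 4)\<close>, which uses up half of the Gaussian.\<close>

lemma heat_kernel_gaussian_short:
  obtains c C where "c > 0" "C > 0" "\<And>t (x::real^'n) y. 0 < t \<Longrightarrow> t \<le> 1 \<Longrightarrow> norm x < 1 \<Longrightarrow> norm y < 1 \<Longrightarrow>
    c * exp (- (ball_dist x y)\<^sup>2 / (1 * t)) / sqrt (ball_volume \<mu> x (sqrt t) * ball_volume \<mu> y (sqrt t)) \<le> heat_kernel \<mu> t x y \<and>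
    heat_kernel \<mu> t x y \<le> C * exp (- (ball_dist x y)\<^sup>2 / (32 * t)) / sqrt (ball_volume \<mu> x (sqrt t) * ball_volume \<mu> y (sqrt t))"
proof -
  obtain c where c: "c > 0" "\<And>t (x::real^'n) y. 0 < t \<Longrightarrow> t \<le> 1 \<Longrightarrow> norm x < 1 \<Longrightarrow> norm y < 1 \<Longrightarrow>
    c * gauss_prefactor t x y * exp (- 2 * cos_gap x y / t) \<le> heat_kernel \<mu> t x y"
    using short_time_lower by blast
  obtain C where C: "C > 0" "\<And>t (x::real^'n) y. 0 < t \<Longrightarrow> t \<le> 1 \<Longrightarrow> norm x < 1 \<Longrightarrow> norm y < 1 \<Longrightarrow>
    heat_kernel \<mu> t x y \<le> C * gauss_prefactor t x y * exp (- cos_gap x y / (2 * t))"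
    using short_time_upper by blast
  obtain v where v: "v > 0" "\<And>t (x::real^'n). 0 < t \<Longrightarrow> t \<le> 1 \<Longrightarrow> norm x < 1 \<Longrightarrow> v * vol_model t x \<le> ball_volume \<mu> x (sqrt t)"
    using volume_lower by blast
  obtain V where V: "V > 0" "\<And>t (x::real^'n). 0 < t \<Longrightarrow> t \<le> 1 \<Longrightarrow> norm x < 1 \<Longrightarrow> ball_volume \<mu> x (sqrt t) \<le> V * vol_model t x"
    using volume_upper by blast
  define k where "k = (\<mu> + 1) powr (\<mu> + 1) * 4 powr \<mu>"
  have k: "k > 0" using mu by (simp add: k_def)
  define c1 where "c1 = c * v"
  define C1 where "C1 = C * (4 powr \<mu> * k) * V"
  have c1: "c1 > 0" and C1: "C1 > 0" using c(1) v(1) C(1) V(1) k by (simp_all add: c1_def C1_def)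
  have "c1 * exp (- (ball_dist x y)\<^sup>2 / (1 * t)) / sqrt (ball_volume \<mu> x (sqrt t) * ball_volume \<mu> y (sqrt t)) \<le> heat_kernel \<mu> t x y \<and>
    heat_kernel \<mu> t x y \<le> C1 * exp (- (ball_dist x y)\<^sup>2 / (32 * t)) / sqrt (ball_volume \<mu> x (sqrt t) * ball_volume \<mu> y (sqrt t))"
    if t: "0 < t" "t \<le> 1" and xy: "norm x < 1" "norm y < 1" for t and x y :: "real^'n"
  proof -
    have xy': "norm x \<le> 1" "norm y \<le> 1" using xy by auto
    have b: "0 < sqrt t + bdepth x" "0 < sqrt t + bdepth y" using t xy by (auto intro!: add_pos_nonneg bdepth_nonneg)
    define g where "g = cos_gap x y"
    have g0: "g \<ge> 0" unfolding g_def using cos_gap_bounds(1)[OF xy'] .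
    define q where "q = t + bdepth x * bdepth y"
    have q0: "q > 0" unfolding q_def using t xy' by (intro add_pos_nonneg mult_nonneg_nonneg bdepth_nonneg) auto
    define p where "p = (sqrt t + bdepth x) * (sqrt t + bdepth y)"
    have p: "p > 0" using b by (simp add: p_def)
    define S where "S = t powr (real CARD('n) / 2) * p powr \<mu>"
    have S: "S > 0" using t p by (simp add: S_def)
    have Sq: "sqrt (vol_model t x * vol_model t y) = S" unfolding S_def p_def by (rule sqrt_vol_model[OF t(1) xy'])
    define Q where "Q = sqrt (ball_volume \<mu> x (sqrt t) * ball_volume \<mu> y (sqrt t))"
    have wx: "vol_model t x > 0" "vol_model t y > 0" using t xy' by (auto intro: vol_model_pos)
    have Qv: "v * S \<le> Q"
    proof -
      have "(v * vol_model t x) * (v * vol_model t y) \<le> ball_volume \<mu> x (sqrt t) * ball_volume \<mu> y (sqrt t)"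
        using v wx t xy by (intro mult_mono) (auto simp: ball_volume_def)
      then have "sqrt (v\<^sup>2 * (vol_model t x * vol_model t y)) \<le> Q"
        unfolding Q_def by (intro real_sqrt_le_mono) (simp add: power2_eq_square mult_ac)
      moreover have "sqrt (v\<^sup>2 * X) = v * sqrt X" for X using v(1) by (simp add: real_sqrt_mult)
      ultimately show ?thesis by (simp only: Sq)
    qed
    have QV: "Q \<le> V * S"
    proof -
      have "ball_volume \<mu> x (sqrt t) * ball_volume \<mu> y (sqrt t) \<le> (V * vol_model t x) * (V * vol_model t y)"
        using V wx t xy by (intro mult_mono) (auto simp: ball_volume_def)
      then have "Q \<le> sqrt (V\<^sup>2 * (vol_model t x * vol_model t y))"
        unfolding Q_def by (intro real_sqrt_le_mono) (simp add: power2_eq_square mult_ac)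
      moreover have "sqrt (V\<^sup>2 * X) = V * sqrt X" for X using V(1) by (simp add: real_sqrt_mult)
      ultimately show ?thesis by (simp only: Sq)
    qed
    have vS: "v * S > 0" using v S by simp
    then have Q0: "Q > 0" using Qv by linarith
    have pf: "gauss_prefactor t x y = t powr (- (real CARD('n) / 2)) * q powr (- \<mu>)"
      by (simp add: gauss_prefactor_def q_def)
    have "c1 * exp (- (ball_dist x y)\<^sup>2 / (1 * t)) / Q \<le> heat_kernel \<mu> t x y"
    proof -
      have "p powr (- \<mu>) \<le> q powr (- \<mu>)"
        using depth_comparison(3)[OF xy' t(1)] q0 mu unfolding p_def q_def by (intro powr_mono2') auto
      then have "t powr (- (real CARD('n) / 2)) * p powr (- \<mu>) \<le> gauss_prefactor t x y"
        unfolding pf by (intro mult_left_mono) auto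
      then have N: "1 / S \<le> gauss_prefactor t x y" by (simp add: S_def powr_minus_divide)
      have e: "exp (- (ball_dist x y)\<^sup>2 / (1 * t)) \<le> exp (- 2 * g / t)"
        using cos_gap_dist(1)[OF xy'] t unfolding g_def by (simp add: divide_right_mono)
      have "c1 * exp (- (ball_dist x y)\<^sup>2 / (1 * t)) / Q \<le> c1 * exp (- (ball_dist x y)\<^sup>2 / (1 * t)) / (v * S)"
        using Qv Q0 vS c1 by (intro divide_left_mono) auto
      also have "\<dots> = c * (1 / S) * exp (- (ball_dist x y)\<^sup>2 / (1 * t))" using v(1) by (simp add: c1_def)
      also have "\<dots> \<le> c * gauss_prefactor t x y * exp (- 2 * g / t)"
        using N e c(1) S prefactor_pos[OF t(1) xy'] by (intro mult_mono) auto
      also have "\<dots> \<le> heat_kernel \<mu> t x y" unfolding g_def by (rule c(2)[OF t xy])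
      finally show ?thesis .
    qed
    moreover have "heat_kernel \<mu> t x y \<le> C1 * exp (- (ball_dist x y)\<^sup>2 / (32 * t)) / Q"
    proof -
      define z where "z = g / t"
      have z: "z \<ge> 0" using g0 t by (simp add: z_def)
      have z1: "4 * (1 + z) > 0" using z by simp
      have "p / (4 * (1 + z)) \<le> q"
      proof -
        have "p \<le> 4 * q * (1 + z)"
          using depth_comparison(2)[OF xy' t(1)] unfolding p_def q_def z_def g_def .
        moreover have "4 * q * (1 + z) = q * (4 * (1 + z))" by (simp only: mult_ac)
        ultimately show ?thesis using z1 by (simp only: pos_divide_le_eq)
      qed
      then have "q powr (- \<mu>) \<le> (p / (4 * (1 + z))) powr (- \<mu>)"
        using p z1 mu by (intro powr_mono2') auto
      also have "\<dots> = (4 powr \<mu> * (1 + z) powr \<mu>) * p powr (- \<mu>)"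
      proof -
        define r where "r = 1 + z"
        have "r > 0" using z by (simp add: r_def)
        then show ?thesis unfolding r_def[symmetric] using p by (simp add: powr_divide powr_mult powr_minus_divide)
      qed
      finally have "gauss_prefactor t x y \<le> t powr (- (real CARD('n) / 2)) * ((4 powr \<mu> * (1 + z) powr \<mu>) * p powr (- \<mu>))"
        unfolding pf by (intro mult_left_mono) auto
      also have "\<dots> = 4 powr \<mu> * (1 + z) powr \<mu> / S" by (simp add: S_def powr_minus_divide)
      finally have N: "gauss_prefactor t x y \<le> 4 powr \<mu> * (1 + z) powr \<mu> / S" .
      have "(1 + z) powr \<mu> \<le> k * exp (z / 4)"
      proof -
        have "(1 + z) powr \<mu> \<le> (4 * (1 + z / 4)) powr \<mu>" using z mu by (intro powr_mono2) auto
        also have "\<dots> = 4 powr \<mu> * (1 + z / 4) powr \<mu>" by (rule powr_mult)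
        also have "\<dots> \<le> 4 powr \<mu> * (1 + z / 4) powr (\<mu> + 1)" using z by (intro mult_left_mono powr_mono) auto
        also have "\<dots> \<le> 4 powr \<mu> * ((\<mu> + 1) powr (\<mu> + 1) * exp (z / 4))"
          using z mu by (intro mult_left_mono one_plus_powr_le_exp) auto
        finally show ?thesis by (simp add: k_def mult_ac)
      qed
      then have "4 powr \<mu> * (1 + z) powr \<mu> / S \<le> 4 powr \<mu> * (k * exp (z / 4)) / S"
        using S by (intro divide_right_mono mult_left_mono) auto
      with N have N': "gauss_prefactor t x y \<le> 4 powr \<mu> * (k * exp (z / 4)) / S" by linarith
      have e: "exp (z / 4) * exp (- g / (2 * t)) \<le> exp (- (ball_dist x y)\<^sup>2 / (32 * t))"
      proof -
        have "exp (z / 4) * exp (- g / (2 * t)) = exp (- (g / (4 * t)))"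
          using t by (simp add: z_def exp_add[symmetric] field_simps)
        moreover have "(ball_dist x y)\<^sup>2 / (32 * t) \<le> g / (4 * t)"
          using cos_gap_dist(2)[OF xy'] t unfolding g_def by (simp add: field_simps)
        ultimately show ?thesis by simp
      qed
      have "heat_kernel \<mu> t x y \<le> C * gauss_prefactor t x y * exp (- g / (2 * t))" unfolding g_def by (rule C(2)[OF t xy])
      also have "\<dots> \<le> C * (4 powr \<mu> * (k * exp (z / 4)) / S) * exp (- g / (2 * t))"
        using N' C(1) by (intro mult_right_mono mult_left_mono) auto
      also have "\<dots> = C * (4 powr \<mu> * k) / S * (exp (z / 4) * exp (- g / (2 * t)))" by simp
      also have "\<dots> \<le> C * (4 powr \<mu> * k) / S * exp (- (ball_dist x y)\<^sup>2 / (32 * t))"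
        using e C(1) k S by (intro mult_left_mono) auto
      also have "\<dots> = C1 * exp (- (ball_dist x y)\<^sup>2 / (32 * t)) / (V * S)" using V(1) by (simp add: C1_def)
      also have "\<dots> \<le> C1 * exp (- (ball_dist x y)\<^sup>2 / (32 * t)) / Q"
        using QV Q0 C1 V(1) S by (intro divide_left_mono) auto
      finally show ?thesis .
    qed
    ultimately show ?thesis unfolding Q_def by blast
  qed
  then show thesis by (rule that[OF c1 C1])
qed

text \<open>For \<open>t \<ge> 1\<close> the kernel, the volumes and the Gaussian factor all lie between positive
  constants, the last because \<open>ball_dist\<close> is at most \<open>pi < 4\<close>.\<close>

lemma heat_kernel_gaussian_long:
  obtains c C where "c > 0" "C > 0" "\<And>t (x::real^'n) y. 1 \<le> t \<Longrightarrow> norm x < 1 \<Longrightarrow> norm y < 1 \<Longrightarrow>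
    c * exp (- (ball_dist x y)\<^sup>2 / (1 * t)) / sqrt (ball_volume \<mu> x (sqrt t) * ball_volume \<mu> y (sqrt t)) \<le> heat_kernel \<mu> t x y \<and>
    heat_kernel \<mu> t x y \<le> C * exp (- (ball_dist x y)\<^sup>2 / (32 * t)) / sqrt (ball_volume \<mu> x (sqrt t) * ball_volume \<mu> y (sqrt t))"
proof -
  obtain h H where h: "h > 0" "H > 0" "\<And>t (x::real^'n) y. t \<ge> 1 \<Longrightarrow> norm x < 1 \<Longrightarrow> norm y < 1 \<Longrightarrow>
    h \<le> heat_kernel \<mu> t x y \<and> heat_kernel \<mu> t x y \<le> H"
    using heat_kernel_long_time[OF mu l] by blast
  obtain v where v: "v > 0" "\<And>t (x::real^'n). 0 < t \<Longrightarrow> t \<le> 1 \<Longrightarrow> norm x < 1 \<Longrightarrow> v * vol_model t x \<le> ball_volume \<mu> x (sqrt t)"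
    using volume_lower by blast
  define w where "w = measure (ball_measure \<mu>) (UNIV :: (real^'n) set)"
  have vol: "v \<le> ball_volume \<mu> x (sqrt t)" "ball_volume \<mu> x (sqrt t) \<le> w" if "1 \<le> t" "norm x < 1" for t and x :: "real^'n"
  proof -
    have "1 powr (2 * \<mu>) \<le> (sqrt 1 + bdepth x) powr (2 * \<mu>)" using that mu bdepth_nonneg[of x] by (intro powr_mono2) auto
    then have "v * 1 \<le> v * vol_model 1 x" using v(1) by (intro mult_left_mono) (auto simp: vol_model_def)
    also have "\<dots> \<le> ball_volume \<mu> x (sqrt 1)" using that by (intro v(2)) auto
    also have "\<dots> \<le> ball_volume \<mu> x (sqrt t)" using that by (intro ball_volume_mono) auto
    finally show "v \<le> ball_volume \<mu> x (sqrt t)" by simp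
    show "ball_volume \<mu> x (sqrt t) \<le> w" unfolding w_def by (rule ball_volume_le_total)
  qed
  have w: "w > 0" using vol[of 1 0] v(1) by simp
  define c where "c = h * v"
  define C where "C = H * w * exp 1"
  have c0: "c > 0" and C0: "C > 0" using h v w by (simp_all add: c_def C_def)
  have "c * exp (- (ball_dist x y)\<^sup>2 / (1 * t)) / sqrt (ball_volume \<mu> x (sqrt t) * ball_volume \<mu> y (sqrt t)) \<le> heat_kernel \<mu> t x y \<and>
    heat_kernel \<mu> t x y \<le> C * exp (- (ball_dist x y)\<^sup>2 / (32 * t)) / sqrt (ball_volume \<mu> x (sqrt t) * ball_volume \<mu> y (sqrt t))"
    if t: "1 \<le> t" and xy: "norm x < 1" "norm y < 1" for t and x y :: "real^'n"
  proof -
    define Q where "Q = sqrt (ball_volume \<mu> x (sqrt t) * ball_volume \<mu> y (sqrt t))"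
    have "v * v \<le> ball_volume \<mu> x (sqrt t) * ball_volume \<mu> y (sqrt t)"
      using vol t xy v(1) by (intro mult_mono) (auto simp: ball_volume_def)
    then have "sqrt (v * v) \<le> Q" unfolding Q_def by (rule real_sqrt_le_mono)
    then have Qv: "v \<le> Q" using v(1) by simp
    have "ball_volume \<mu> x (sqrt t) * ball_volume \<mu> y (sqrt t) \<le> w * w"
      using vol t xy w by (intro mult_mono) (auto simp: ball_volume_def)
    then have "Q \<le> sqrt (w * w)" unfolding Q_def by (rule real_sqrt_le_mono)
    then have Qw: "Q \<le> w" using w by simp
    have Q0: "Q > 0" using Qv v(1) by linarith
    have "c * exp (- (ball_dist x y)\<^sup>2 / (1 * t)) / Q \<le> c * 1 / v"
      using Qv v(1) c0 Q0 t by (intro frac_le mult_left_mono) (auto simp: divide_nonneg_pos)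
    also have "\<dots> = h" using v(1) by (simp add: c_def)
    also have "\<dots> \<le> heat_kernel \<mu> t x y" using h(3)[OF t xy] by simp
    finally have 1: "c * exp (- (ball_dist x y)\<^sup>2 / (1 * t)) / Q \<le> heat_kernel \<mu> t x y" .
    have "(ball_dist x y)\<^sup>2 / (32 * t) \<le> 1"
    proof -
      have "ball_dist x y \<le> 4" using ball_dist_range(2)[of x y] xy pi_less_4 by simp
      then have "(ball_dist x y)\<^sup>2 \<le> 4\<^sup>2" using ball_dist_range(1)[of x y] xy by (intro power_mono) auto
      then show ?thesis using t by (simp add: divide_le_eq)
    qed
    then have e: "1 \<le> exp 1 * exp (- (ball_dist x y)\<^sup>2 / (32 * t))" unfolding exp_add[symmetric] by simp
    have "heat_kernel \<mu> t x y \<le> H * 1" using h(3)[OF t xy] by simp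
    also have "\<dots> \<le> H * (exp 1 * exp (- (ball_dist x y)\<^sup>2 / (32 * t)))" using e h(2) by (intro mult_left_mono) auto
    also have "\<dots> = C * exp (- (ball_dist x y)\<^sup>2 / (32 * t)) / w" using w by (simp add: C_def)
    also have "\<dots> \<le> C * exp (- (ball_dist x y)\<^sup>2 / (32 * t)) / Q" using Qw Q0 C0 w by (intro divide_left_mono) auto
    finally show ?thesis using 1 unfolding Q_def by blast
  qed
  then show thesis by (rule that[OF c0 C0])
qed

end

theorem theorem1p1:
  fixes \<mu> :: real
  assumes "\<mu> \<ge> 0"
  shows "\<exists>c1>0. \<exists>c2>0. \<exists>c3>0. \<exists>c4>0.
    \<forall>x \<in> ball (0 :: real ^ 'n) 1. \<forall>y \<in> ball (0 :: real ^ 'n) 1. \<forall>t>0.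
      c1 * exp (- (ball_dist x y)\<^sup>2 / (c2 * t))
          / sqrt (ball_volume \<mu> x (sqrt t) * ball_volume \<mu> y (sqrt t)) \<le> heat_kernel \<mu> t x y \<and>
      heat_kernel \<mu> t x y \<le> c3 * exp (- (ball_dist x y)\<^sup>2 / (c4 * t))
          / sqrt (ball_volume \<mu> x (sqrt t) * ball_volume \<mu> y (sqrt t))"
proof -
  define E where "E k t x y = exp (- (ball_dist x y)\<^sup>2 / (k * t)) / sqrt (ball_volume \<mu> x (sqrt t) * ball_volume \<mu> y (sqrt t))"
    for k t and x y :: "real^'n"
  have E0: "E k t x y \<ge> 0" for k t x y unfolding E_def ball_volume_def by simp
  obtain c C where s: "c > 0" "C > 0" "\<And>t (x::real^'n) y. 0 < t \<Longrightarrow> t \<le> 1 \<Longrightarrow> norm x < 1 \<Longrightarrow> norm y < 1 \<Longrightarrow>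
    c * E 1 t x y \<le> heat_kernel \<mu> t x y \<and> heat_kernel \<mu> t x y \<le> C * E 32 t x y"
    using heat_kernel_gaussian_short[OF assms refl, where ?'n = 'n] unfolding E_def times_divide_eq_right by blast
  obtain h H where g: "h > 0" "H > 0" "\<And>t (x::real^'n) y. 1 \<le> t \<Longrightarrow> norm x < 1 \<Longrightarrow> norm y < 1 \<Longrightarrow>
    h * E 1 t x y \<le> heat_kernel \<mu> t x y \<and> heat_kernel \<mu> t x y \<le> H * E 32 t x y"
    using heat_kernel_gaussian_long[OF assms refl, where ?'n = 'n] unfolding E_def times_divide_eq_right by blast
  have "min c h * E 1 t x y \<le> heat_kernel \<mu> t x y \<and> heat_kernel \<mu> t x y \<le> max C H * E 32 t x y"
    if "norm x < 1" "norm y < 1" "t > 0" for t and x y :: "real^'n"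
  proof -
    have "min c h * E 1 t x y \<le> c * E 1 t x y" "min c h * E 1 t x y \<le> h * E 1 t x y"
      "C * E 32 t x y \<le> max C H * E 32 t x y" "H * E 32 t x y \<le> max C H * E 32 t x y"
      using E0 by (auto intro!: mult_right_mono)
    then show ?thesis using s(3)[of t x y] g(3)[of t x y] that by (cases "t \<le> 1") force+
  qed
  then show ?thesis
    using s(1,2) g(1,2) unfolding E_def times_divide_eq_right
    by (intro exI[of _ "min c h"] exI[of _ "1::real"] exI[of _ "max C H"] exI[of _ "32::real"] conjI ballI allI impI) auto
qed

end
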